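(* Let $M^m$ be a complete $m$-dimensional Riemannian manifold with Ricci curvature bounded from below, and let $f:M\to\mathbb R$ be a function of class $C^2$ such that $\inf_M f>-\infty$ and $\sup_M\|\operatorname{Hess} f\|<\infty$. Then every minimizing sequence of $f$ admits a good shadow; that is, for every sequence $(p_n)$ in $M$ with $f(p_n)\to\inf_M f$ there exists a sequence $(q_n)$ in $M$ such that $f(q_n)\to\inf_M f$, $\lim_{n\to\infty} d(p_n,q_n)=0$, $\lim_{n\to\infty}\|\nabla f(q_n)\|=0$ and $\liminf_{n\to\infty}\Delta f(q_n)\ge 0$.
   Context: "Complete manifold" means complete (connected, boundaryless) Riemannian manifold, and $d$ denotes the Riemannian distance. $\nabla f$ is the Riemannian gradient, $\Delta f=\operatorname{div}\nabla f$ is the Laplace–Beltrami operator (so $\Delta f$ is the trace of $\operatorname{Hess} f$), and $\|\operatorname{Hess} f\|$ is the pointwise operator norm of the Hessian $v\mapsto\nabla_v\nabla f$. A minimizing sequence of $f$ is a sequence $(p_n)$ in $M$ with $f(p_n)\to\inf_M f$. A minimizing sequence $(p_n)$ of $f$ admits a good shadow if there is a minimizing sequence $(q_n)$ of $f$ with $\lim d(p_n,q_n)=0$, $\lim\|\nabla f(q_n)\|=0$ and $\liminf\Delta f(q_n)\ge 0$. *)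

theory Defs
  imports "HOL-Analysis.Analysis"
begin

text \<open>
  The manifold is the whole type \<open>'a\<close>, its topology the one of the type. A chart is a pair
  of a domain and a coordinate map into \<open>real ^ 'm\<close>; since it has to map onto an open
  set, manifolds have no boundary. A tensor field is given by its components in
  every chart of the atlas, as functions of the coordinates, subject to the usual
  transformation law; objects at a point are read in some chart around it.
\<close>

type_synonym ('a, 'm) chart = "'a set \<times> ('a \<Rightarrow> real ^ 'm)"

type_synonym 'm coord_metric = "real ^ 'm \<Rightarrow> real ^ 'm ^ 'm"

primrec Ck_on :: "nat \<Rightarrow> ('a::euclidean_space \<Rightarrow> 'b::real_normed_vector) \<Rightarrow> 'a set \<Rightarrow> bool" where
  "Ck_on 0 h S \<longleftrightarrow> continuous_on S h"
| "Ck_on (Suc k) h S \<longleftrightarrow>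
     (\<forall>x\<in>S. h differentiable (at x)) \<and> (\<forall>v. Ck_on k (\<lambda>x. frechet_derivative h (at x) v) S)"

definition smooth_on :: "('a::euclidean_space \<Rightarrow> 'b::real_normed_vector) \<Rightarrow> 'a set \<Rightarrow> bool" where
  "smooth_on h S \<longleftrightarrow> (\<forall>k. Ck_on k h S)"


section \<open>Calculus in coordinates\<close>

text \<open>Throughout this section the metric is \<open>G\<close>, on an open set of \<open>real ^ 'm\<close>.\<close>

definition metric_ip :: "'m::finite coord_metric \<Rightarrow> real ^ 'm \<Rightarrow> real ^ 'm \<Rightarrow> real ^ 'm \<Rightarrow> real" where
  "metric_ip G x v w = v \<bullet> (G x *v w)"

definition metric_norm :: "'m::finite coord_metric \<Rightarrow> real ^ 'm \<Rightarrow> real ^ 'm \<Rightarrow> real" where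
  "metric_norm G x v = sqrt (metric_ip G x v v)"

definition partial :: "'m::finite \<Rightarrow> (real ^ 'm \<Rightarrow> real) \<Rightarrow> real ^ 'm \<Rightarrow> real" where
  "partial i h x = frechet_derivative h (at x) (axis i 1)"

text \<open>\<open>christoffel G x k i j\<close> is the symbol with upper index \<open>k\<close> and lower indices \<open>i\<close>, \<open>j\<close>.\<close>

definition christoffel :: "'m::finite coord_metric \<Rightarrow> real ^ 'm \<Rightarrow> 'm \<Rightarrow> 'm \<Rightarrow> 'm \<Rightarrow> real" where
  "christoffel G x k i j =
     (1/2) * (\<Sum>l\<in>UNIV. matrix_inv (G x) $ k $ l *
       (partial i (\<lambda>y. G y $ j $ l) x + partial j (\<lambda>y. G y $ i $ l) x
         - partial l (\<lambda>y. G y $ i $ j) x))"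

text \<open>The Levi-Civita covariant derivative at \<open>x\<close> of the vector field \<open>X\<close> in direction \<open>v\<close>.\<close>

definition cov_deriv ::
    "'m::finite coord_metric \<Rightarrow> (real ^ 'm \<Rightarrow> real ^ 'm) \<Rightarrow> real ^ 'm \<Rightarrow> real ^ 'm \<Rightarrow> real ^ 'm" where
  "cov_deriv G X x v =
     frechet_derivative X (at x) v
       + (\<chi> k. \<Sum>i\<in>UNIV. \<Sum>j\<in>UNIV. christoffel G x k i j * v $ i * X x $ j)"

text \<open>
  The curvature \<open>R(u,v)w = \<nabla>\<^sub>u\<nabla>\<^sub>v w - \<nabla>\<^sub>v\<nabla>\<^sub>u w - \<nabla>\<^bsub>[u,v]\<^esub> w\<close>, where the vectors are extended
  to fields with constant components, so that the bracket vanishes. The Ricci tensor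
  is the trace of \<open>u \<mapsto> R(u,v)w\<close>, hence positive on round spheres.
\<close>

definition curvature ::
    "'m::finite coord_metric \<Rightarrow> real ^ 'm \<Rightarrow> real ^ 'm \<Rightarrow> real ^ 'm \<Rightarrow> real ^ 'm \<Rightarrow> real ^ 'm" where
  "curvature G x u v w =
     cov_deriv G (\<lambda>y. cov_deriv G (\<lambda>_. w) y v) x u
       - cov_deriv G (\<lambda>y. cov_deriv G (\<lambda>_. w) y u) x v"

definition ricci :: "'m::finite coord_metric \<Rightarrow> real ^ 'm \<Rightarrow> real ^ 'm \<Rightarrow> real ^ 'm \<Rightarrow> real" where
  "ricci G x v w = trace (matrix (\<lambda>u. curvature G x u v w))"

definition coord_grad ::
    "'m::finite coord_metric \<Rightarrow> (real ^ 'm \<Rightarrow> real) \<Rightarrow> real ^ 'm \<Rightarrow> real ^ 'm" where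
  "coord_grad G h x = matrix_inv (G x) *v (\<chi> i. partial i h x)"

definition coord_div ::
    "'m::finite coord_metric \<Rightarrow> (real ^ 'm \<Rightarrow> real ^ 'm) \<Rightarrow> real ^ 'm \<Rightarrow> real" where
  "coord_div G X x = trace (matrix (cov_deriv G X x))"

definition coord_hess ::
    "'m::finite coord_metric \<Rightarrow> (real ^ 'm \<Rightarrow> real) \<Rightarrow> real ^ 'm \<Rightarrow> real ^ 'm \<Rightarrow> real ^ 'm" where
  "coord_hess G h x v = cov_deriv G (coord_grad G h) x v"

definition metric_op_norm ::
    "'m::finite coord_metric \<Rightarrow> real ^ 'm \<Rightarrow> (real ^ 'm \<Rightarrow> real ^ 'm) \<Rightarrow> real" where
  "metric_op_norm G x L = Sup {metric_norm G x (L v) | v. metric_norm G x v = 1}"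


section \<open>Riemannian manifolds\<close>

definition coord_expr :: "('a, 'm) chart \<Rightarrow> ('a \<Rightarrow> 'b) \<Rightarrow> real ^ 'm \<Rightarrow> 'b" where
  "coord_expr c h = h \<circ> inv_into (fst c) (snd c)"

locale smooth_atlas =
  fixes A :: "('a::{t2_space, second_countable_topology}, 'm::finite) chart set"
  assumes covers: "(\<Union>c\<in>A. fst c) = UNIV"
    and open_domain: "c \<in> A \<Longrightarrow> open (fst c)"
    and open_range: "c \<in> A \<Longrightarrow> open (snd c ` fst c)"
    and chart_homeo:
      "c \<in> A \<Longrightarrow> homeomorphism (fst c) (snd c ` fst c) (snd c) (inv_into (fst c) (snd c))"
    and transition_smooth:
      "c \<in> A \<Longrightarrow> c' \<in> A \<Longrightarrow> smooth_on (coord_expr c (snd c')) (snd c ` (fst c \<inter> fst c'))"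

locale riemannian_manifold = smooth_atlas A
  for A :: "('a::{t2_space, second_countable_topology}, 'm::finite) chart set" +
  fixes g :: "('a, 'm) chart \<Rightarrow> 'm coord_metric"
  assumes connected: "connected (UNIV :: 'a set)"
    and metric_smooth: "c \<in> A \<Longrightarrow> smooth_on (g c) (snd c ` fst c)"
    and metric_sym:
      "c \<in> A \<Longrightarrow> x \<in> snd c ` fst c \<Longrightarrow> metric_ip (g c) x v w = metric_ip (g c) x w v"
    and metric_pos:
      "c \<in> A \<Longrightarrow> x \<in> snd c ` fst c \<Longrightarrow> v \<noteq> 0 \<Longrightarrow> metric_ip (g c) x v v > 0"
    and metric_transform:
      "c \<in> A \<Longrightarrow> c' \<in> A \<Longrightarrow> p \<in> fst c \<inter> fst c' \<Longrightarrow>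
         J = frechet_derivative (coord_expr c (snd c')) (at (snd c p)) \<Longrightarrow>
         metric_ip (g c) (snd c p) v w = metric_ip (g c') (snd c' p) (J v) (J w)"

text \<open>The quantities read below in \<open>chart_at A p\<close> do not depend on the choice of the chart.\<close>

definition chart_at :: "('a, 'm) chart set \<Rightarrow> 'a \<Rightarrow> ('a, 'm) chart" where
  "chart_at A p = (SOME c. c \<in> A \<and> p \<in> fst c)"

definition C2_fun :: "('a, 'm::finite) chart set \<Rightarrow> ('a \<Rightarrow> real) \<Rightarrow> bool" where
  "C2_fun A f \<longleftrightarrow> (\<forall>c\<in>A. Ck_on 2 (coord_expr c f) (snd c ` fst c))"

definition grad_norm ::
    "('a, 'm::finite) chart set \<Rightarrow> (('a, 'm) chart \<Rightarrow> 'm coord_metric) \<Rightarrow> ('a \<Rightarrow> real) \<Rightarrow> 'a \<Rightarrow> real" where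
  "grad_norm A g f p =
     (let c = chart_at A p; x = snd c p
      in metric_norm (g c) x (coord_grad (g c) (coord_expr c f) x))"

definition hess_norm ::
    "('a, 'm::finite) chart set \<Rightarrow> (('a, 'm) chart \<Rightarrow> 'm coord_metric) \<Rightarrow> ('a \<Rightarrow> real) \<Rightarrow> 'a \<Rightarrow> real" where
  "hess_norm A g f p =
     (let c = chart_at A p; x = snd c p
      in metric_op_norm (g c) x (coord_hess (g c) (coord_expr c f) x))"

definition laplacian ::
    "('a, 'm::finite) chart set \<Rightarrow> (('a, 'm) chart \<Rightarrow> 'm coord_metric) \<Rightarrow> ('a \<Rightarrow> real) \<Rightarrow> 'a \<Rightarrow> real" where
  "laplacian A g f p =
     (let c = chart_at A p
      in coord_div (g c) (coord_grad (g c) (coord_expr c f)) (snd c p))"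

definition ricci_bounded_below ::
    "('a, 'm::finite) chart set \<Rightarrow> (('a, 'm) chart \<Rightarrow> 'm coord_metric) \<Rightarrow> bool" where
  "ricci_bounded_below A g \<longleftrightarrow>
     (\<exists>K. \<forall>c\<in>A. \<forall>x\<in>snd c ` fst c. \<forall>v. ricci (g c) x v v \<ge> K * metric_ip (g c) x v v)"

text \<open>
  Regularity of a curve on \<open>{a..b}\<close> is one-sided at the end points. The library notion
  \<open>piecewise_C1_differentiable_on\<close> puts no condition on the derivative near the break
  points, so it allows curves of infinite length, on which \<open>integral\<close> would return \<open>0\<close>.
\<close>

definition C1_curve_on ::
    "('a::topological_space, 'm::finite) chart set \<Rightarrow> real \<Rightarrow> real \<Rightarrow> (real \<Rightarrow> 'a) \<Rightarrow> bool" where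
  "C1_curve_on A a b \<gamma> \<longleftrightarrow>
     continuous_on {a..b} \<gamma> \<and>
     (\<forall>c\<in>A. \<exists>D.
        (\<forall>t\<in>{t\<in>{a..b}. \<gamma> t \<in> fst c}.
           ((snd c \<circ> \<gamma>) has_vector_derivative D t) (at t within {a..b})) \<and>
        continuous_on {t\<in>{a..b}. \<gamma> t \<in> fst c} D)"

definition piecewise_C1_curve ::
    "('a::topological_space, 'm::finite) chart set \<Rightarrow> (real \<Rightarrow> 'a) \<Rightarrow> bool" where
  "piecewise_C1_curve A \<gamma> \<longleftrightarrow>
     (\<exists>S. finite S \<and>
        (\<forall>a b. 0 \<le> a \<longrightarrow> a < b \<longrightarrow> b \<le> 1 \<longrightarrow> {a<..<b} \<inter> S = {} \<longrightarrow> C1_curve_on A a b \<gamma>))"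

definition speed ::
    "('a, 'm::finite) chart set \<Rightarrow> (('a, 'm) chart \<Rightarrow> 'm coord_metric) \<Rightarrow> (real \<Rightarrow> 'a) \<Rightarrow> real \<Rightarrow> real" where
  "speed A g \<gamma> t =
     (let c = chart_at A (\<gamma> t)
      in metric_norm (g c) (snd c (\<gamma> t)) (vector_derivative (snd c \<circ> \<gamma>) (at t)))"

definition curve_length ::
    "('a, 'm::finite) chart set \<Rightarrow> (('a, 'm) chart \<Rightarrow> 'm coord_metric) \<Rightarrow> (real \<Rightarrow> 'a) \<Rightarrow> real" where
  "curve_length A g \<gamma> = integral {0..1} (speed A g \<gamma>)"

definition riem_dist ::
    "('a::topological_space, 'm::finite) chart set \<Rightarrow> (('a, 'm) chart \<Rightarrow> 'm coord_metric) \<Rightarrow> 'a \<Rightarrow> 'a \<Rightarrow> real" where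
  "riem_dist A g p q =
     Inf {curve_length A g \<gamma> | \<gamma>. piecewise_C1_curve A \<gamma> \<and> \<gamma> 0 = p \<and> \<gamma> 1 = q}"

definition complete_riemannian_manifold ::
    "('a::{t2_space, second_countable_topology}, 'm::finite) chart set \<Rightarrow>
       (('a, 'm) chart \<Rightarrow> 'm coord_metric) \<Rightarrow> bool" where
  "complete_riemannian_manifold A g \<longleftrightarrow>
     riemannian_manifold A g \<and> Metric_space.mcomplete UNIV (riem_dist A g)"


section \<open>Minimizing sequences and good shadows\<close>

definition minimizing_seq :: "('a \<Rightarrow> real) \<Rightarrow> (nat \<Rightarrow> 'a) \<Rightarrow> bool" where
  "minimizing_seq f p \<longleftrightarrow> (\<lambda>n. f (p n)) \<longlonglongrightarrow> (INF x. f x)"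

definition admits_good_shadow ::
    "('a::topological_space, 'm::finite) chart set \<Rightarrow> (('a, 'm) chart \<Rightarrow> 'm coord_metric) \<Rightarrow>
       ('a \<Rightarrow> real) \<Rightarrow> (nat \<Rightarrow> 'a) \<Rightarrow> bool" where
  "admits_good_shadow A g f p \<longleftrightarrow>
     (\<exists>q. minimizing_seq f q \<and>
        (\<lambda>n. riem_dist A g (p n) (q n)) \<longlonglongrightarrow> 0 \<and>
        (\<lambda>n. grad_norm A g f (q n)) \<longlonglongrightarrow> 0 \<and>
        liminf (\<lambda>n. ereal (laplacian A g f (q n))) \<ge> 0)"

end

theory Submission
  imports Defs
begin

text \<open>Let \<open>q\<^sub>n\<close> minimize \<open>F x = f x + d(x, p\<^sub>n)\<^sup>2 / (2 t\<^sub>n)\<close>, which is possible because closed balls are compact,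
  with \<open>t\<^sub>n\<close> tending to infinity so slowly that \<open>t\<^sub>n (f p\<^sub>n - inf f)\<close> still tends to \<open>0\<close>. Comparing with \<open>F p\<^sub>n\<close>
  gives \<open>f q\<^sub>n \<le> f p\<^sub>n\<close> and \<open>L\<^sub>n = d(q\<^sub>n, p\<^sub>n) \<longlonglongrightarrow> 0\<close>; minimality to first order gives
  \<open>|\<nabla>f(q\<^sub>n)| \<le> L\<^sub>n / t\<^sub>n\<close>, and to second order it bounds \<open>\<Delta>f(q\<^sub>n)\<close> from below by
  \<open>-1/(2 t\<^sub>n)\<close> times the Laplacian, in the barrier sense, of the squared distance to \<open>p\<^sub>n\<close>.

  That Laplacian is bounded without geodesics, parallel transport or cut loci. A minimizing chain of
  \<open>N\<close> short links joins \<open>q\<^sub>n\<close> to \<open>p\<^sub>n\<close>. On each link, in one chart, an almost parallel frame, scaled by a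
  factor that decreases linearly from \<open>1\<close> to \<open>0\<close> along the chain, generates maps whose pulled-back metrics
  satisfy a second variation formula; summing over the frame turns the curvature term into the Ricci
  curvature. Since all maps are applied to one and the same short curve, the metric comparison passes to distances, and
  the Cauchy-Schwarz inequality along the chain yields the bound for the sum of the second differences of the squared distance.\<close>

section \<open>Functions of class \<open>C\<^sup>k\<close>\<close>

text \<open>The squared distance need not be differentiable, and no minimizing geodesic is at hand
  as a smooth curve. Hence every estimate is an upper bound for a sum of values at \<open>s\<close>
  and \<open>- s\<close>: first order terms cancel, any competing curve yields such a bound, and the
  path along which a point moves matters only up to o(s^2). So explicit quadratic paths can replace
  geodesics, and passing from one chart to the next costs nothing in the limit.

  The scaling factor has derivative 1/L on a chain of length L and contributes dim/L^2; the
  curvature contributes the Ricci constant K. Multiplied by L^2 this is of order dim + K L^2, which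
  does not vanish as L tends to 0; only the division by 2 t makes it small, which is why t has to
  grow. At L = 0, where 1/L has no meaning, the squared distance is estimated directly.

  An almost parallel frame loses orthonormality, so the local estimates are stated for almost
  orthonormal frames, with tolerances found by compactness; the number of links is chosen
  afterwards.\<close>

lemma Ck_on_cong:
  assumes "open S" "\<And>x. x \<in> S \<Longrightarrow> f x = g x" "Ck_on k f S"
  shows "Ck_on k g S"
  using assms(2,3)
proof (induction k arbitrary: f g)
  case 0
  then show ?case using continuous_on_cong[of S S f g] by simp
next
  case (Suc k)
  have fd: "frechet_derivative f (at x) = frechet_derivative g (at x) \<and> g differentiable (at x)"
    if "x \<in> S" for x
  proof
    have "f differentiable (at x)" using Suc.prems that by simp
    then show "frechet_derivative f (at x) = frechet_derivative g (at x)"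
      by (rule frechet_derivative_transform_within_open[OF _ assms(1) that Suc.prems(1)])
    obtain D where D: "(f has_derivative D) (at x)"
      using \<open>f differentiable (at x)\<close> unfolding differentiable_def by blast
    have "(g has_derivative D) (at x)"
      by (rule has_derivative_transform_within_open[OF D assms(1) that]) (rule Suc.prems(1))
    then show "g differentiable (at x)"
      unfolding differentiable_def by blast
  qed
  have "Ck_on k (\<lambda>x. frechet_derivative g (at x) v) S" for v
    using Suc.IH[of "\<lambda>x. frechet_derivative f (at x) v" "\<lambda>x. frechet_derivative g (at x) v"]
      Suc.prems fd by simp
  then show ?case using fd by simp
qed

lemma has_vector_derivative_chain:
  assumes "(X has_vector_derivative X') (at t within T)" "(h has_derivative h') (at (X t))"
  shows "((\<lambda>t. h (X t)) has_vector_derivative h' X') (at t within T)"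
  using vector_derivative_diff_chain_within[OF assms(1) has_derivative_at_withinI[OF assms(2)]]
  by (simp add: o_def)

text \<open>\<open>frechet_derivative\<close> is a choice; this rule lets an explicit derivative
  stand in for it. Most closure rules below are inductions on \<open>k\<close> through it.\<close>

lemma Ck_on_SucI:
  assumes "open S" "\<And>x. x \<in> S \<Longrightarrow> (h has_derivative h' x) (at x)"
    "\<And>v. Ck_on k (\<lambda>x. h' x v) S"
  shows "Ck_on (Suc k) h S"
proof -
  have "Ck_on k (\<lambda>x. frechet_derivative h (at x) v) S" for v
    by (rule Ck_on_cong[OF assms(1) _ assms(3)[of v]]) (metis assms(2) frechet_derivative_at)
  then show ?thesis using assms(2) differentiable_def by (metis Ck_on.simps(2))
qed

lemma Ck_on_SucD:
  assumes "Ck_on (Suc k) h S"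
  shows "x \<in> S \<Longrightarrow> (h has_derivative frechet_derivative h (at x)) (at x)"
    and "Ck_on k (\<lambda>x. frechet_derivative h (at x) v) S"
  using assms frechet_derivative_works by auto

lemma Ck_on_Suc_imp: "Ck_on (Suc k) h S \<Longrightarrow> Ck_on k h S"
proof (induction k arbitrary: h)
  case 0
  then show ?case
    by (auto intro!: continuous_at_imp_continuous_on differentiable_imp_continuous_within)
next
  case (Suc k)
  then show ?case by (metis Ck_on.simps(2))
qed

lemma Ck_on_imp_continuous_on: "Ck_on k h S \<Longrightarrow> continuous_on S h"
  by (induction k) (auto dest: Ck_on_Suc_imp simp del: Ck_on.simps(2))

lemma Ck_on_const: "open S \<Longrightarrow> Ck_on k (\<lambda>x. c) S"
proof (induction k arbitrary: c)
  case (Suc k)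
  show ?case by (rule Ck_on_SucI[OF Suc.prems has_derivative_const]) (rule Suc.IH[OF Suc.prems])
qed simp

lemma Ck_on_add:
  assumes "open S" "Ck_on k f S" "Ck_on k g S"
  shows "Ck_on k (\<lambda>x. f x + g x) S"
  using assms(2,3)
proof (induction k arbitrary: f g)
  case 0
  then show ?case by (simp add: continuous_on_add)
next
  case (Suc k)
  show ?case
    by (rule Ck_on_SucI[OF assms(1) has_derivative_add[OF Ck_on_SucD(1)[OF Suc.prems(1)] Ck_on_SucD(1)[OF Suc.prems(2)]]])
       (assumption+, rule Suc.IH, (rule Ck_on_SucD(2), rule Suc.prems)+)
qed

lemma Ck_on_sum:
  assumes "open S" "\<And>i. i \<in> I \<Longrightarrow> Ck_on k (f i) S"
  shows "Ck_on k (\<lambda>x. \<Sum>i\<in>I. f i x) S"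
  using assms(2)
proof (induction I rule: infinite_finite_induct)
  case (insert i I)
  have "Ck_on k (\<lambda>x. f i x + (\<Sum>j\<in>I. f j x)) S"
    by (rule Ck_on_add[OF assms(1)]) (use insert in auto)
  then show ?case using insert by simp
qed (simp_all add: Ck_on_const assms(1))

lemma Ck_on_mult:
  fixes f g :: "'a::euclidean_space \<Rightarrow> real"
  assumes "open S" "Ck_on k f S" "Ck_on k g S"
  shows "Ck_on k (\<lambda>x. f x * g x) S"
  using assms(2,3)
proof (induction k arbitrary: f g)
  case 0
  then show ?case by (simp add: continuous_on_mult)
next
  case (Suc k)
  show ?case
    by (rule Ck_on_SucI[OF assms(1) has_derivative_mult[OF Ck_on_SucD(1)[OF Suc.prems(1)] Ck_on_SucD(1)[OF Suc.prems(2)]]])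
       (assumption+, rule Ck_on_add[OF assms(1)], (rule Suc.IH, (rule Ck_on_Suc_imp Ck_on_SucD(2), rule Suc.prems)+)+)
qed

lemma Ck_on_prod:
  fixes f :: "'i \<Rightarrow> 'a::euclidean_space \<Rightarrow> real"
  assumes "open S" "\<And>i. i \<in> I \<Longrightarrow> Ck_on k (f i) S"
  shows "Ck_on k (\<lambda>x. \<Prod>i\<in>I. f i x) S"
  using assms(2)
proof (induction I rule: infinite_finite_induct)
  case (insert i I)
  have "Ck_on k (\<lambda>x. f i x * (\<Prod>j\<in>I. f j x)) S"
    by (rule Ck_on_mult[OF assms(1)]) (use insert in auto)
  then show ?case using insert by simp
qed (simp_all add: Ck_on_const assms(1))

text \<open>The derivative is a product of the same reciprocal with the derivative of
  \<open>f\<close>, so the induction hypothesis applies to it once \<open>f\<close> is regarded as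
  one order less regular.\<close>

lemma Ck_on_inverse:
  fixes f :: "'a::euclidean_space \<Rightarrow> real"
  assumes "open S" "Ck_on k f S" "\<And>x. x \<in> S \<Longrightarrow> f x \<noteq> 0"
  shows "Ck_on k (\<lambda>x. inverse (f x)) S"
  using assms(2)
proof (induction k)
  case 0
  then show ?case by (simp add: continuous_on_inverse assms(3))
next
  case (Suc k)
  have *: "Ck_on k (\<lambda>x. inverse (f x)) S" by (rule Suc.IH[OF Ck_on_Suc_imp[OF Suc.prems]])
  have "((\<lambda>x. inverse (f x)) has_derivative
      (\<lambda>v. (- 1) * (inverse (f x) * frechet_derivative f (at x) v * inverse (f x)))) (at x)" if "x \<in> S" for x
    using Deriv.has_derivative_inverse[OF assms(3)[OF that] Ck_on_SucD(1)[OF Suc.prems that]] by simp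
  then show ?case
  proof (rule Ck_on_SucI[OF assms(1)])
    show "Ck_on k (\<lambda>x. (- 1) * (inverse (f x) * frechet_derivative f (at x) v * inverse (f x))) S" for v
      by (rule Ck_on_mult[OF assms(1) Ck_on_const[OF assms(1)] Ck_on_mult[OF assms(1)
            Ck_on_mult[OF assms(1) * Ck_on_SucD(2)[OF Suc.prems]] *]])
  qed
qed

lemma Ck_on_linear:
  assumes "open S" "bounded_linear L" "Ck_on k f S"
  shows "Ck_on k (\<lambda>x. L (f x)) S"
  using assms(3)
proof (induction k arbitrary: f)
  case 0
  then show ?case by (simp add: bounded_linear.continuous_on[OF assms(2)])
next
  case (Suc k)
  show ?case
    by (rule Ck_on_SucI[OF assms(1) bounded_linear.has_derivative[OF assms(2) Ck_on_SucD(1)[OF Suc.prems]]])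
       (simp, rule Suc.IH[OF Ck_on_SucD(2)[OF Suc.prems]])
qed

text \<open>A vector is the sum of its coordinates embedded by bounded linear maps. Used repeatedly,
  this also covers nested vectors such as the Christoffel tensor.\<close>

lemma Ck_on_vec:
  fixes f :: "'a::euclidean_space \<Rightarrow> 'b::real_normed_vector ^ 'n::finite"
  assumes "open S" "\<And>i. Ck_on k (\<lambda>x. f x $ i) S"
  shows "Ck_on k f S"
proof -
  have bl: "bounded_linear (\<lambda>y::'b. (\<chi> j. if j = i then y else 0) :: 'b ^ 'n)" for i
  proof (rule bounded_linear_intro[where K=1])
    show "norm ((\<chi> j. if j = i then y else 0) :: 'b ^ 'n) \<le> norm y * 1" for y :: 'b
      using L2_set_le_sum[of UNIV "\<lambda>j. norm (if j = i then y else 0)"]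
      by (simp add: norm_vec_def if_distrib[where f=norm] cong: if_cong)
  qed (auto simp: vec_eq_iff)
  have eq: "f x = (\<Sum>i\<in>UNIV. (\<chi> j. if j = i then f x $ i else 0))" for x
    by (simp add: vec_eq_iff)
  have "Ck_on k (\<lambda>x. \<Sum>i\<in>UNIV. ((\<chi> j. if j = i then f x $ i else 0) :: 'b ^ 'n)) S"
    by (intro Ck_on_sum assms(1) Ck_on_linear[OF assms(1) bl assms(2)])
  then show ?thesis unfolding eq[symmetric] .
qed

section \<open>Regularity of determinants and inverse matrices\<close>

lemma Ck_on_det:
  fixes F :: "'a::euclidean_space \<Rightarrow> real ^ 'n ^ 'n"
  assumes "open S" "\<And>i j. Ck_on k (\<lambda>x. F x $ i $ j) S"
  shows "Ck_on k (\<lambda>x. det (F x)) S"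
  unfolding det_def by (intro Ck_on_sum Ck_on_mult Ck_on_prod Ck_on_const assms)

text \<open>Cramer's rule with right-hand side \<open>axis l 1\<close>, whose solution is column
  \<open>l\<close> of the inverse. Each entry thus becomes a rational expression in the entries of
  \<open>A\<close>, to which the closure rules apply.\<close>

lemma matrix_inv_cramer:
  fixes A :: "real ^ 'n ^ 'n"
  assumes "det A \<noteq> 0"
  shows "matrix_inv A $ k $ l = det (\<chi> i j. if j = k then axis l 1 $ i else A $ i $ j) * inverse (det A)"
proof -
  have "invertible A" using assms by (simp add: invertible_det_nz)
  then have "A ** matrix_inv A = mat 1"
    using someI_ex[of "\<lambda>B. A ** B = mat 1 \<and> B ** A = mat 1"] unfolding invertible_def matrix_inv_def by blast
  then have "A *v (matrix_inv A *v axis l 1) = axis l 1"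
    by (simp add: matrix_vector_mul_assoc)
  then have "matrix_inv A *v axis l 1 = (\<chi> k. det (\<chi> i j. if j = k then axis l 1 $ i else A $ i $ j) / det A)"
    using cramer[OF assms] by blast
  moreover have "(matrix_inv A *v axis l 1) $ k = matrix_inv A $ k $ l"
    by (simp add: matrix_vector_mult_def axis_def if_distrib cong: if_cong)
  ultimately show ?thesis by (simp add: divide_inverse)
qed

lemma Ck_on_matrix_inv:
  fixes F :: "'a::euclidean_space \<Rightarrow> real ^ 'n ^ 'n"
  assumes "open S" "\<And>i j. Ck_on k (\<lambda>x. F x $ i $ j) S" "\<And>x. x \<in> S \<Longrightarrow> det (F x) \<noteq> 0"
  shows "Ck_on k (\<lambda>x. matrix_inv (F x) $ a $ b) S"
proof -
  have entry: "Ck_on k (\<lambda>x. (\<chi> i j. if j = a then axis b 1 $ i else F x $ i $ j) $ i $ j) S" for i j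
    by (cases "j = a") (simp_all add: assms Ck_on_const)
  have "Ck_on k (\<lambda>x. det (\<chi> i j. if j = a then axis b 1 $ i else F x $ i $ j) * inverse (det (F x))) S"
    by (intro Ck_on_mult assms(1,3) Ck_on_inverse Ck_on_det assms(2) entry)
  then show ?thesis by (rule Ck_on_cong[OF assms(1), rotated]) (simp add: matrix_inv_cramer assms(3))
qed

text \<open>Both mixed derivatives are limits of the same second difference quotient.\<close>

lemma mixed_derivative_mvt:
  fixes h :: "'a::euclidean_space \<Rightarrow> real"
  assumes S: "open S" and C: "Ck_on 2 h S" and x: "x \<in> S" and e: "e > 0"
  shows "\<exists>d>0. \<forall>s. 0 < s \<and> s < d \<longrightarrow>
    \<bar>(h (x + s *\<^sub>R u + s *\<^sub>R v) - h (x + s *\<^sub>R u) - h (x + s *\<^sub>R v) + h x) / s\<^sup>2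
      - frechet_derivative (\<lambda>y. frechet_derivative h (at y) u) (at x) v\<bar> < e"
proof -
  define D where "D = (\<lambda>y. frechet_derivative h (at y) u)"
  define D2 where "D2 = (\<lambda>y. frechet_derivative D (at y) v)"
  have C': "Ck_on (Suc (Suc 0)) h S" using C by (simp add: numeral_2_eq_2)
  have h': "(h has_derivative frechet_derivative h (at y)) (at y)" if "y \<in> S" for y
    by (rule Ck_on_SucD(1)[OF C' that])
  have CD: "Ck_on (Suc 0) D S" unfolding D_def by (rule Ck_on_SucD(2)[OF C'])
  have D': "(D has_derivative frechet_derivative D (at y)) (at y)" if "y \<in> S" for y
    by (rule Ck_on_SucD(1)[OF CD that])
  have cD2: "continuous_on S D2" unfolding D2_def using Ck_on_SucD(2)[OF CD] by simp
  obtain r0 where r0: "r0 > 0" "cball x r0 \<subseteq> S" using S x open_contains_cball by blast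
  have "isCont D2 x" using cD2 S x continuous_on_eq_continuous_at by blast
  then obtain r1 where r1: "r1 > 0" "\<And>y. dist y x < r1 \<Longrightarrow> \<bar>D2 y - D2 x\<bar> < e"
    using e by (auto simp: continuous_at_eps_delta dist_real_def)
  define r where "r = min r0 r1"
  have r: "r > 0" using r0 r1 r_def by simp
  define d where "d = r / (norm u + norm v + 1)"
  have nz: "norm u + norm v + 1 > 0" using norm_ge_zero[of u] norm_ge_zero[of v] by linarith
  have d: "d > 0" using r nz d_def by simp
  have close: "norm (a *\<^sub>R u + b *\<^sub>R v) < r" if "0 \<le> a" "a \<le> s" "0 \<le> b" "b \<le> s" "0 < s" "s < d" for a b s
  proof -
    have "norm (a *\<^sub>R u + b *\<^sub>R v) \<le> a * norm u + b * norm v"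
      using norm_triangle_ineq[of "a *\<^sub>R u" "b *\<^sub>R v"] that by simp
    also have "\<dots> \<le> s * norm u + s * norm v"
      using that by (intro add_mono mult_right_mono) auto
    also have "\<dots> < s * (norm u + norm v + 1)" using that by (simp add: algebra_simps)
    also have "\<dots> < d * (norm u + norm v + 1)" using that nz by simp
    finally show ?thesis using nz d_def by simp
  qed
  have inS: "x + a *\<^sub>R u + b *\<^sub>R v \<in> S" if "0 \<le> a" "a \<le> s" "0 \<le> b" "b \<le> s" "0 < s" "s < d" for a b s
  proof -
    have "dist x (x + a *\<^sub>R u + b *\<^sub>R v) = norm (a *\<^sub>R u + b *\<^sub>R v)"
      by (metis add.assoc add_diff_cancel_left' dist_commute dist_norm)
    then show ?thesis using close[OF that] r0 r_def by (auto simp: subset_iff)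
  qed
  have "\<bar>(h (x + s *\<^sub>R u + s *\<^sub>R v) - h (x + s *\<^sub>R u) - h (x + s *\<^sub>R v) + h x) / s\<^sup>2 - D2 x\<bar> < e"
    if s: "0 < s" "s < d" for s
  proof -
    \<comment> \<open>The increment in direction \<open>v\<close>. The mean value theorem is applied
      to it along \<open>u\<close>, and then to the resulting increment of \<open>D\<close> along
      \<open>v\<close>.\<close>
    define \<phi> where "\<phi> = (\<lambda>a. h (x + a *\<^sub>R u + s *\<^sub>R v) - h (x + a *\<^sub>R u))"
    have ph: "(\<phi> has_real_derivative D (x + a *\<^sub>R u + s *\<^sub>R v) - D (x + a *\<^sub>R u)) (at a)" if "0 \<le> a" "a \<le> s" for a
    proof -
      have i1: "x + a *\<^sub>R u + s *\<^sub>R v \<in> S" using inS[of a s s] that s by simp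
      have i2: "x + a *\<^sub>R u \<in> S" using inS[of a s 0] that s by simp
      have "((\<lambda>a. h (x + a *\<^sub>R u + s *\<^sub>R v)) has_vector_derivative D (x + a *\<^sub>R u + s *\<^sub>R v)) (at a)"
        unfolding D_def by (rule has_vector_derivative_chain[where X="\<lambda>a. x + a *\<^sub>R u + s *\<^sub>R v", OF _ h'[OF i1]]) (auto intro!: derivative_eq_intros simp: has_vector_derivative_def)
      moreover have "((\<lambda>a. h (x + a *\<^sub>R u)) has_vector_derivative D (x + a *\<^sub>R u)) (at a)"
        unfolding D_def by (rule has_vector_derivative_chain[where X="\<lambda>a. x + a *\<^sub>R u", OF _ h'[OF i2]]) (auto intro!: derivative_eq_intros simp: has_vector_derivative_def)
      ultimately show ?thesis
        unfolding \<phi>_def has_real_derivative_iff_has_vector_derivative by (rule has_vector_derivative_diff)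
    qed
    obtain a where a: "0 < a" "a < s" "\<phi> s - \<phi> 0 = (s - 0) * (D (x + a *\<^sub>R u + s *\<^sub>R v) - D (x + a *\<^sub>R u))"
      using MVT2[of 0 s \<phi> "\<lambda>a. D (x + a *\<^sub>R u + s *\<^sub>R v) - D (x + a *\<^sub>R u)"] ph s by auto
    have pd: "((\<lambda>b. D (x + a *\<^sub>R u + b *\<^sub>R v)) has_real_derivative D2 (x + a *\<^sub>R u + b *\<^sub>R v)) (at b)" if "0 \<le> b" "b \<le> s" for b
    proof -
      have i1: "x + a *\<^sub>R u + b *\<^sub>R v \<in> S" using inS[of a s b] that s a by simp
      show ?thesis unfolding D2_def has_real_derivative_iff_has_vector_derivative
        by (rule has_vector_derivative_chain[where X="\<lambda>b. x + a *\<^sub>R u + b *\<^sub>R v", OF _ D'[OF i1]]) (auto intro!: derivative_eq_intros simp: has_vector_derivative_def)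
    qed
    obtain b where b: "0 < b" "b < s" "D (x + a *\<^sub>R u + s *\<^sub>R v) - D (x + a *\<^sub>R u + 0 *\<^sub>R v) = (s - 0) * D2 (x + a *\<^sub>R u + b *\<^sub>R v)"
      using MVT2[of 0 s "\<lambda>b. D (x + a *\<^sub>R u + b *\<^sub>R v)" "\<lambda>b. D2 (x + a *\<^sub>R u + b *\<^sub>R v)"] pd s by auto
    have "h (x + s *\<^sub>R u + s *\<^sub>R v) - h (x + s *\<^sub>R u) - h (x + s *\<^sub>R v) + h x = s\<^sup>2 * D2 (x + a *\<^sub>R u + b *\<^sub>R v)"
      using a(3) b(3) by (simp add: \<phi>_def power2_eq_square)
    then have *: "(h (x + s *\<^sub>R u + s *\<^sub>R v) - h (x + s *\<^sub>R u) - h (x + s *\<^sub>R v) + h x) / s\<^sup>2 = D2 (x + a *\<^sub>R u + b *\<^sub>R v)"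
      using s by simp
    have "dist (x + a *\<^sub>R u + b *\<^sub>R v) x < r1"
      using close[of a s b] a b s r_def by (simp add: dist_norm add.assoc)
    then show ?thesis using r1(2) * by simp
  qed
  then show ?thesis using d unfolding D_def D2_def by blast
qed

lemma mixed_derivative_commute:
  fixes h :: "'a::euclidean_space \<Rightarrow> real"
  assumes S: "open S" and C: "Ck_on 2 h S" and x: "x \<in> S"
  shows "frechet_derivative (\<lambda>y. frechet_derivative h (at y) u) (at x) v
    = frechet_derivative (\<lambda>y. frechet_derivative h (at y) v) (at x) u" (is "?A = ?B")
proof (rule ccontr)
  define a b where "a = ?A" and "b = ?B"
  assume "?A \<noteq> ?B"
  then have e: "\<bar>?A - ?B\<bar> / 2 > 0" by simp
  define q where "q = (\<lambda>s. (h (x + s *\<^sub>R u + s *\<^sub>R v) - h (x + s *\<^sub>R u) - h (x + s *\<^sub>R v) + h x) / s\<^sup>2)"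
  obtain d1 where d1: "d1 > 0" "\<And>s. 0 < s \<Longrightarrow> s < d1 \<Longrightarrow> \<bar>q s - ?A\<bar> < \<bar>?A - ?B\<bar> / 2"
    using mixed_derivative_mvt[OF S C x e, of u v] unfolding q_def by blast
  have q': "q = (\<lambda>s. (h (x + s *\<^sub>R v + s *\<^sub>R u) - h (x + s *\<^sub>R v) - h (x + s *\<^sub>R u) + h x) / s\<^sup>2)"
    unfolding q_def by (intro ext) (simp add: algebra_simps)
  obtain d2 where d2: "d2 > 0" "\<And>s. 0 < s \<Longrightarrow> s < d2 \<Longrightarrow> \<bar>q s - ?B\<bar> < \<bar>?A - ?B\<bar> / 2"
    using mixed_derivative_mvt[OF S C x e, of v u] unfolding q' by blast
  define s where "s = min d1 d2 / 2"
  have "0 < s" "s < d1" "s < d2" using d1(1) d2(1) by (auto simp: s_def)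
  then have "\<bar>q s - ?A\<bar> < \<bar>?A - ?B\<bar> / 2" "\<bar>q s - ?B\<bar> < \<bar>?A - ?B\<bar> / 2"
    using d1(2) d2(2) by auto
  then have "\<bar>q s - a\<bar> < \<bar>a - b\<bar> / 2" "\<bar>q s - b\<bar> < \<bar>a - b\<bar> / 2"
    by (simp_all only: a_def b_def)
  then show False using abs_triangle_ineq4[of "q s - b" "q s - a"] by simp
qed

section \<open>The Levi-Civita connection and its curvature in a chart\<close>

text \<open>Contraction of a tensor in its last index; contracting once more gives
  \<open>trilin\<close>. Splitting into two bounded bilinear maps makes the product rule and
  continuity available when tensor and vectors all depend on a point.\<close>

definition slices :: "real ^ 'm ^ 'm ^ 'm \<Rightarrow> real ^ 'm \<Rightarrow> real ^ 'm ^ 'm::finite" where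
  "slices T w = (\<chi> k. T $ k *v w)"

definition trilin :: "real ^ 'm ^ 'm ^ 'm \<Rightarrow> real ^ 'm \<Rightarrow> real ^ 'm \<Rightarrow> real ^ 'm::finite" where
  "trilin T v w = slices T w *v v"

interpretation matrix_vector: bounded_bilinear "(*v) :: real ^ 'm::finite ^ 'n::finite \<Rightarrow> real ^ 'm \<Rightarrow> real ^ 'n"
  unfolding bilinear_conv_bounded_bilinear[symmetric] bilinear_def
  by (auto intro!: linearI simp: vec_eq_iff matrix_vector_mult_def sum.distrib sum_distrib_left algebra_simps)

interpretation slices: bounded_bilinear "slices :: real ^ 'm::finite ^ 'm ^ 'm \<Rightarrow> _"
  unfolding bilinear_conv_bounded_bilinear[symmetric] bilinear_def slices_def
  by (auto intro!: linearI simp: vec_eq_iff matrix_vector_mult_def sum.distrib sum_distrib_left algebra_simps)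

lemma trilin_has_derivative:
  fixes T :: "'x::real_normed_vector \<Rightarrow> real ^ 'm::finite ^ 'm ^ 'm"
  assumes "(T has_derivative T') (at x within S)" "(V has_derivative V') (at x within S)"
    "(W has_derivative W') (at x within S)"
  shows "((\<lambda>x. trilin (T x) (V x) (W x)) has_derivative
    (\<lambda>u. trilin (T' u) (V x) (W x) + trilin (T x) (V' u) (W x) + trilin (T x) (V x) (W' u))) (at x within S)"
  unfolding trilin_def
  by (rule has_derivative_eq_rhs[OF matrix_vector.FDERIV[OF slices.FDERIV[OF assms(1,3)] assms(2)]])
     (auto simp: matrix_vector.add_left add_ac)

lemma continuous_on_trilin:
  assumes "continuous_on S T" "continuous_on S V" "continuous_on S W"
  shows "continuous_on S (\<lambda>x. trilin (T x) (V x) (W x))"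
  unfolding trilin_def by (intro matrix_vector.continuous_on slices.continuous_on assms)

lemma trilin_algebra:
  "trilin T (u + v) w = trilin T u w + trilin T v w"
  "trilin T v (u + w) = trilin T v u + trilin T v w"
  "trilin T (u - v) w = trilin T u w - trilin T v w"
  "trilin T v (u - w) = trilin T v u - trilin T v w"
  "trilin T (c *\<^sub>R v) w = c *\<^sub>R trilin T v w"
  "trilin T v (c *\<^sub>R w) = c *\<^sub>R trilin T v w"
  "trilin T 0 w = 0" "trilin T v 0 = 0"
  "trilin T (- v) w = - trilin T v w" "trilin T v (- w) = - trilin T v w"
  unfolding trilin_def
  by (simp_all add: matrix_vector.add_right slices.add_right matrix_vector.add_left
      matrix_vector.diff_right slices.diff_right matrix_vector.diff_left
      matrix_vector.scaleR_right slices.scaleR_right matrix_vector.scaleR_left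
      matrix_vector.zero_right slices.zero_right matrix_vector.zero_left
      matrix_vector.minus_right slices.minus_right matrix_vector.minus_left)

lemma trilin_tensor_algebra:
  "trilin (T + T') v w = trilin T v w + trilin T' v w"
  "trilin (c *\<^sub>R T) v w = c *\<^sub>R trilin T v w"
  "trilin 0 v w = 0"
  unfolding trilin_def
  by (simp_all add: matrix_vector.add_left slices.add_left matrix_vector.scaleR_left slices.scaleR_left
      matrix_vector.zero_left slices.zero_left)

definition chris_tensor :: "'m::finite coord_metric \<Rightarrow> real ^ 'm \<Rightarrow> real ^ 'm ^ 'm ^ 'm" where
  "chris_tensor G x = (\<chi> k i j. christoffel G x k i j)"

definition Gam :: "'m::finite coord_metric \<Rightarrow> real ^ 'm \<Rightarrow> real ^ 'm \<Rightarrow> real ^ 'm \<Rightarrow> real ^ 'm" where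
  "Gam G x v w = trilin (chris_tensor G x) v w"

text \<open>The directional derivative of the Christoffel symbols with \<open>v\<close> and
  \<open>w\<close> held constant. It is not a tensor by itself; combinations such as the one in
  \<open>curvature_eq\<close> are.\<close>

definition dGam :: "'m::finite coord_metric \<Rightarrow> real ^ 'm \<Rightarrow> real ^ 'm \<Rightarrow> real ^ 'm \<Rightarrow> real ^ 'm \<Rightarrow> real ^ 'm" where
  "dGam G x u v w = trilin (frechet_derivative (chris_tensor G) (at x) u) v w"

lemma trilin_component: "trilin T v w $ k = (\<Sum>i\<in>UNIV. \<Sum>j\<in>UNIV. T $ k $ i $ j * v $ i * w $ j)"
  by (simp add: trilin_def slices_def matrix_vector_mult_def sum_distrib_right sum_distrib_left mult_ac)

lemma Gam_component: "Gam G x v w $ k = (\<Sum>i\<in>UNIV. \<Sum>j\<in>UNIV. christoffel G x k i j * v $ i * w $ j)"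
  by (simp add: Gam_def trilin_component chris_tensor_def)

lemma cov_deriv_Gam: "cov_deriv G X x v = frechet_derivative X (at x) v + Gam G x v (X x)"
  unfolding cov_deriv_def by (simp add: vec_eq_iff Gam_component)

lemmas Gam_algebra = trilin_algebra[of "chris_tensor G x" for G x, folded Gam_def]

lemma metric_ip_linear:
  "metric_ip G x (u + v) w = metric_ip G x u w + metric_ip G x v w"
  "metric_ip G x v (u + w) = metric_ip G x v u + metric_ip G x v w"
  "metric_ip G x (u - v) w = metric_ip G x u w - metric_ip G x v w"
  "metric_ip G x v (u - w) = metric_ip G x v u - metric_ip G x v w"
  "metric_ip G x (c *\<^sub>R v) w = c * metric_ip G x v w"
  "metric_ip G x v (c *\<^sub>R w) = c * metric_ip G x v w"
  "metric_ip G x 0 w = 0" "metric_ip G x v 0 = 0"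
  "metric_ip G x (- v) w = - metric_ip G x v w" "metric_ip G x v (- w) = - metric_ip G x v w"
  unfolding metric_ip_def
  by (simp_all add: matrix_vector.add_right matrix_vector.diff_right matrix_vector.scaleR_right
      matrix_vector.zero_right matrix_vector.minus_right inner_add inner_diff)

lemma metric_ip_sum:
  "metric_ip G x (\<Sum>i\<in>I. f i) w = (\<Sum>i\<in>I. metric_ip G x (f i) w)"
  "metric_ip G x v (\<Sum>i\<in>I. f i) = (\<Sum>i\<in>I. metric_ip G x v (f i))"
  by (induction I rule: infinite_finite_induct) (auto simp: metric_ip_linear)

text \<open>A Riemannian metric on one coordinate domain. The local theory is developed here once
  and instantiated at every chart through \<open>local_metric_chart\<close>.\<close>

locale local_metric =
  fixes U :: "(real ^ 'm::finite) set" and G :: "'m coord_metric"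
  assumes open_U: "open U" and smooth_G: "smooth_on G U"
    and ip_sym: "x \<in> U \<Longrightarrow> metric_ip G x v w = metric_ip G x w v"
    and ip_pos: "x \<in> U \<Longrightarrow> v \<noteq> 0 \<Longrightarrow> metric_ip G x v v > 0"
begin

lemma ip_nonneg: "x \<in> U \<Longrightarrow> metric_ip G x v v \<ge> 0"
  using ip_pos[of x v] by (cases "v = 0") (auto simp: metric_ip_linear)

lemma G_has_derivative: "x \<in> U \<Longrightarrow> (G has_derivative frechet_derivative G (at x)) (at x)"
  using smooth_G Ck_on_SucD(1)[of 0 G U] unfolding smooth_on_def by blast

lemma G_entry_Ck: "Ck_on k (\<lambda>x. G x $ i $ j) U"
proof -
  have "bounded_linear (\<lambda>A :: real ^ 'm ^ 'm. A $ i $ j)"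
    by (rule bounded_linear_compose[OF bounded_linear_vec_nth bounded_linear_vec_nth])
  then show ?thesis using Ck_on_linear[OF open_U] smooth_G unfolding smooth_on_def by blast
qed

lemma partial_entry:
  assumes "x \<in> U"
  shows "partial i (\<lambda>y. G y $ j $ l) x = frechet_derivative G (at x) (axis i 1) $ j $ l"
proof -
  have "bounded_linear (\<lambda>A :: real ^ 'm ^ 'm. A $ j $ l)"
    by (rule bounded_linear_compose[OF bounded_linear_vec_nth bounded_linear_vec_nth])
  from bounded_linear.has_derivative[OF this G_has_derivative[OF assms]]
  show ?thesis unfolding partial_def by (metis frechet_derivative_at)
qed

lemma partial_Ck: "Ck_on k (partial i (\<lambda>y. G y $ j $ l)) U"
  using Ck_on_SucD(2)[OF G_entry_Ck[of "Suc k" j l], of "axis i 1"] unfolding partial_def[abs_def] .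

lemma G_transpose:
  assumes "x \<in> U" shows "G x $ i $ j = G x $ j $ i"
proof -
  have *: "metric_ip G x (axis i 1) (axis j 1) = G x $ i $ j" for i j
    by (simp add: metric_ip_def inner_axis' matrix_vector_mult_basis column_def)
  show ?thesis using ip_sym[OF assms, of "axis i 1" "axis j 1"] by (simp add: *)
qed

lemma partial_sym:
  assumes "x \<in> U" shows "partial l (\<lambda>y. G y $ i $ j) x = partial l (\<lambda>y. G y $ j $ i) x"
proof -
  have "(\<lambda>y. G y $ i $ j) differentiable (at x)" using G_entry_Ck[of "Suc 0"] assms by auto
  then show ?thesis unfolding partial_def
    by (subst frechet_derivative_transform_within_open[OF _ open_U assms, where g="\<lambda>y. G y $ j $ i"])
       (auto simp: G_transpose)
qed

lemma det_G: assumes "x \<in> U" shows "det (G x) \<noteq> 0"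
proof -
  have "\<forall>v. G x *v v = 0 \<longrightarrow> v = 0"
    using ip_pos[OF assms] unfolding metric_ip_def by (metis inner_zero_right less_irrefl)
  then have "invertible (G x)" by (simp add: invertible_left_inverse matrix_left_invertible_ker)
  then show ?thesis by (simp add: invertible_det_nz)
qed

lemma inv_G: assumes "x \<in> U" shows "G x *v (matrix_inv (G x) *v b) = b"
proof -
  have "invertible (G x)" using det_G[OF assms] by (simp add: invertible_det_nz)
  then have "G x ** matrix_inv (G x) = mat 1"
    using someI_ex[of "\<lambda>B. G x ** B = mat 1 \<and> B ** G x = mat 1"] unfolding invertible_def matrix_inv_def by blast
  then show ?thesis by (simp add: matrix_vector_mul_assoc)
qed

lemma chris_Ck: "Ck_on k (chris_tensor G) U"
proof -
  have "Ck_on k (\<lambda>x. christoffel G x a i j) U" for a i j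
  proof -
    have *: "christoffel G x a i j = (1/2) * (\<Sum>l\<in>UNIV. matrix_inv (G x) $ a $ l *
       (partial i (\<lambda>y. G y $ j $ l) x + (partial j (\<lambda>y. G y $ i $ l) x
         + (-1) * partial l (\<lambda>y. G y $ i $ j) x)))" for x
      by (simp add: christoffel_def algebra_simps)
    show ?thesis unfolding *
      by (intro Ck_on_mult Ck_on_const Ck_on_sum Ck_on_add Ck_on_matrix_inv G_entry_Ck open_U det_G partial_Ck)
  qed
  then show ?thesis by (intro Ck_on_vec open_U) (simp add: chris_tensor_def)
qed

lemma chris_has_derivative:
  "x \<in> U \<Longrightarrow> (chris_tensor G has_derivative frechet_derivative (chris_tensor G) (at x)) (at x)"
  using chris_Ck[of "Suc 0"] Ck_on_SucD(1) by blast

text \<open>Torsion-freeness: the defining formula is symmetric in its lower indices because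
  \<open>G\<close> is symmetric.\<close>

lemma Gam_sym: assumes "x \<in> U" shows "Gam G x v w = Gam G x w v"
proof -
  have "christoffel G x k i j = christoffel G x k j i" for k i j
    unfolding christoffel_def using partial_sym[OF assms, of _ i j] by (simp add: add.commute)
  then have "Gam G x v w $ k = Gam G x w v $ k" for k
    unfolding Gam_component by (subst sum.swap) (simp add: mult_ac)
  then show ?thesis by (simp add: vec_eq_iff)
qed

lemma ip_deriv_expand:
  assumes "x \<in> U"
  shows "v \<bullet> (frechet_derivative G (at x) u *v w)
    = (\<Sum>i\<in>UNIV. \<Sum>j\<in>UNIV. \<Sum>l\<in>UNIV. partial i (\<lambda>y. G y $ j $ l) x * u $ i * v $ j * w $ l)"
proof -
  have l: "linear (frechet_derivative G (at x))"
    using G_has_derivative[OF assms] has_derivative_linear by blast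
  have "frechet_derivative G (at x) u = frechet_derivative G (at x) (\<Sum>i\<in>UNIV. u $ i *\<^sub>R axis i 1)"
    by (simp add: basis_expansion[of u, unfolded scalar_mult_eq_scaleR])
  also have "\<dots> = (\<Sum>i\<in>UNIV. u $ i *\<^sub>R frechet_derivative G (at x) (axis i 1))"
    by (simp add: linear_sum[OF l] linear_scale[OF l])
  finally have *: "frechet_derivative G (at x) u $ j $ l = (\<Sum>i\<in>UNIV. u $ i * partial i (\<lambda>y. G y $ j $ l) x)" for j l
    by (simp add: partial_entry[OF assms])
  have "v \<bullet> (frechet_derivative G (at x) u *v w) =
    (\<Sum>j\<in>UNIV. \<Sum>l\<in>UNIV. \<Sum>i\<in>UNIV. partial i (\<lambda>y. G y $ j $ l) x * u $ i * v $ j * w $ l)"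
    unfolding inner_vec_def matrix_vector_mult_def
    by (simp add: * sum_distrib_left sum_distrib_right mult_ac)
  also have "\<dots> = (\<Sum>j\<in>UNIV. \<Sum>i\<in>UNIV. \<Sum>l\<in>UNIV. partial i (\<lambda>y. G y $ j $ l) x * u $ i * v $ j * w $ l)"
    by (intro sum.cong refl sum.swap)
  also have "\<dots> = (\<Sum>i\<in>UNIV. \<Sum>j\<in>UNIV. \<Sum>l\<in>UNIV. partial i (\<lambda>y. G y $ j $ l) x * u $ i * v $ j * w $ l)"
    by (rule sum.swap)
  finally show ?thesis .
qed

text \<open>Koszul's formula. Multiplication by \<open>G\<close> removes the inverse metric from the
  Christoffel symbols and leaves half the combination of partial derivatives, named
  \<open>b\<close>; the rest is a renaming of summation indices, done in \<open>s1\<close> and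
  \<open>s2\<close>.\<close>

lemma koszul:
  assumes x: "x \<in> U"
  shows "2 * metric_ip G x w (Gam G x u v) =
    v \<bullet> (frechet_derivative G (at x) u *v w) + u \<bullet> (frechet_derivative G (at x) v *v w)
    - u \<bullet> (frechet_derivative G (at x) w *v v)"
proof -
  define b where "b = (\<chi> l. (1/2) * (\<Sum>i\<in>UNIV. \<Sum>j\<in>UNIV. (partial i (\<lambda>y. G y $ j $ l) x + partial j (\<lambda>y. G y $ i $ l) x
         - partial l (\<lambda>y. G y $ i $ j) x) * u $ i * v $ j))"
  have "Gam G x u v = matrix_inv (G x) *v b"
  proof (simp only: vec_eq_iff, rule allI)
    fix k
    have "Gam G x u v $ k = (\<Sum>i\<in>UNIV. \<Sum>j\<in>UNIV. \<Sum>l\<in>UNIV. matrix_inv (G x) $ k $ l * ((1/2) * ((partial i (\<lambda>y. G y $ j $ l) x + partial j (\<lambda>y. G y $ i $ l) x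
         - partial l (\<lambda>y. G y $ i $ j) x) * u $ i * v $ j)))"
      unfolding Gam_component christoffel_def by (simp add: sum_distrib_left sum_distrib_right mult_ac)
    also have "\<dots> = (\<Sum>i\<in>UNIV. \<Sum>l\<in>UNIV. \<Sum>j\<in>UNIV. matrix_inv (G x) $ k $ l * ((1/2) * ((partial i (\<lambda>y. G y $ j $ l) x + partial j (\<lambda>y. G y $ i $ l) x
         - partial l (\<lambda>y. G y $ i $ j) x) * u $ i * v $ j)))"
      by (intro sum.cong refl sum.swap)
    also have "\<dots> = (\<Sum>l\<in>UNIV. \<Sum>i\<in>UNIV. \<Sum>j\<in>UNIV. matrix_inv (G x) $ k $ l * ((1/2) * ((partial i (\<lambda>y. G y $ j $ l) x + partial j (\<lambda>y. G y $ i $ l) x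
         - partial l (\<lambda>y. G y $ i $ j) x) * u $ i * v $ j)))"
      by (rule sum.swap)
    also have "\<dots> = (matrix_inv (G x) *v b) $ k"
      unfolding matrix_vector_mult_def b_def by (simp add: sum_distrib_left)
    finally show "Gam G x u v $ k = (matrix_inv (G x) *v b) $ k" .
  qed
  then have Gb: "G x *v Gam G x u v = b" using inv_G[OF x] by simp
  have s1: "(\<Sum>i\<in>UNIV. \<Sum>j\<in>UNIV. \<Sum>l\<in>UNIV. partial i (\<lambda>y. G y $ j $ l) x * v $ i * u $ j * w $ l)
    = (\<Sum>i\<in>UNIV. \<Sum>j\<in>UNIV. \<Sum>l\<in>UNIV. partial j (\<lambda>y. G y $ i $ l) x * u $ i * v $ j * w $ l)"
    by (subst sum.swap) (simp add: mult_ac)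
  have s2: "(\<Sum>i\<in>UNIV. \<Sum>j\<in>UNIV. \<Sum>l\<in>UNIV. partial i (\<lambda>y. G y $ j $ l) x * w $ i * u $ j * v $ l)
    = (\<Sum>i\<in>UNIV. \<Sum>j\<in>UNIV. \<Sum>l\<in>UNIV. partial l (\<lambda>y. G y $ i $ j) x * u $ i * v $ j * w $ l)"
  proof -
    have "(\<Sum>i\<in>UNIV. \<Sum>j\<in>UNIV. \<Sum>l\<in>UNIV. partial i (\<lambda>y. G y $ j $ l) x * w $ i * u $ j * v $ l)
      = (\<Sum>j\<in>UNIV. \<Sum>i\<in>UNIV. \<Sum>l\<in>UNIV. partial i (\<lambda>y. G y $ j $ l) x * w $ i * u $ j * v $ l)"
      by (rule sum.swap)
    also have "\<dots> = (\<Sum>j\<in>UNIV. \<Sum>l\<in>UNIV. \<Sum>i\<in>UNIV. partial i (\<lambda>y. G y $ j $ l) x * w $ i * u $ j * v $ l)"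
      by (intro sum.cong refl sum.swap)
    finally show ?thesis by (simp add: mult_ac)
  qed
  have "2 * metric_ip G x w (Gam G x u v) = 2 * (\<Sum>l\<in>UNIV. w $ l * b $ l)"
    by (simp add: metric_ip_def Gb inner_vec_def)
  also have "\<dots> = (\<Sum>l\<in>UNIV. w $ l * (\<Sum>i\<in>UNIV. \<Sum>j\<in>UNIV. (partial i (\<lambda>y. G y $ j $ l) x + partial j (\<lambda>y. G y $ i $ l) x
         - partial l (\<lambda>y. G y $ i $ j) x) * u $ i * v $ j))"
    by (subst sum_distrib_left, intro sum.cong refl) (simp add: b_def)
  also have "\<dots> = (\<Sum>l\<in>UNIV. \<Sum>i\<in>UNIV. \<Sum>j\<in>UNIV. (partial i (\<lambda>y. G y $ j $ l) x + partial j (\<lambda>y. G y $ i $ l) x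
         - partial l (\<lambda>y. G y $ i $ j) x) * u $ i * v $ j * w $ l)"
    by (simp add: sum_distrib_left mult_ac)
  also have "\<dots> = (\<Sum>i\<in>UNIV. \<Sum>l\<in>UNIV. \<Sum>j\<in>UNIV. (partial i (\<lambda>y. G y $ j $ l) x + partial j (\<lambda>y. G y $ i $ l) x
         - partial l (\<lambda>y. G y $ i $ j) x) * u $ i * v $ j * w $ l)"
    by (rule sum.swap)
  also have "\<dots> = (\<Sum>i\<in>UNIV. \<Sum>j\<in>UNIV. \<Sum>l\<in>UNIV. (partial i (\<lambda>y. G y $ j $ l) x + partial j (\<lambda>y. G y $ i $ l) x
         - partial l (\<lambda>y. G y $ i $ j) x) * u $ i * v $ j * w $ l)"
    by (intro sum.cong refl sum.swap)
  finally show ?thesis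
    unfolding ip_deriv_expand[OF x] s1 s2
    by (simp add: sum.distrib sum_subtractf algebra_simps)
qed

text \<open>Compatibility with the metric. In the sum of Koszul's formula for (w, u, v) and for (v,
  u, w) the terms differentiated along \<open>v\<close> and \<open>w\<close> cancel.\<close>

lemma compat:
  assumes x: "x \<in> U"
  shows "v \<bullet> (frechet_derivative G (at x) u *v w) = metric_ip G x (Gam G x u v) w + metric_ip G x v (Gam G x u w)"
proof -
  have sy: "v \<bullet> (frechet_derivative G (at x) u *v w) = w \<bullet> (frechet_derivative G (at x) u *v v)" for u v w
  proof -
    have "(\<Sum>j\<in>UNIV. \<Sum>l\<in>UNIV. partial i (\<lambda>y. G y $ j $ l) x * u $ i * v $ j * w $ l)
      = (\<Sum>j\<in>UNIV. \<Sum>l\<in>UNIV. partial i (\<lambda>y. G y $ j $ l) x * u $ i * w $ j * v $ l)" for i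
      by (subst sum.swap) (simp add: mult_ac partial_sym[OF x])
    then show ?thesis unfolding ip_deriv_expand[OF x] by simp
  qed
  show ?thesis
    using koszul[OF x, of w u v] koszul[OF x, of v u w] ip_sym[OF x, of "Gam G x u v" w]
      sy[of v u w] sy[of u v w] sy[of u w v] sy[of v w u] sy[of w v u]
    by linarith
qed

text \<open>The product rule for covariant derivatives along a curve:
  \<open>V' + Gam G (P s) P' (V s)\<close> is the covariant derivative of \<open>V\<close>.
  Derivatives of inner products along curves are computed through it.\<close>

lemma metric_ip_has_derivative:
  assumes "(P has_vector_derivative P') (at s within S)" "(V has_vector_derivative V') (at s within S)"
    "(W has_vector_derivative W') (at s within S)" and PU: "P s \<in> U"
  shows "((\<lambda>s. metric_ip G (P s) (V s) (W s)) has_real_derivative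
    metric_ip G (P s) (V' + Gam G (P s) P' (V s)) (W s) + metric_ip G (P s) (V s) (W' + Gam G (P s) P' (W s))) (at s within S)"
proof -
  have GP: "((\<lambda>s. G (P s)) has_vector_derivative frechet_derivative G (at (P s)) P') (at s within S)"
    by (rule has_vector_derivative_chain[OF assms(1) G_has_derivative[OF PU]])
  have "((\<lambda>s. V s \<bullet> (G (P s) *v W s)) has_vector_derivative
     V s \<bullet> (G (P s) *v W' + frechet_derivative G (at (P s)) P' *v W s) + V' \<bullet> (G (P s) *v W s)) (at s within S)"
    by (intro bounded_bilinear.has_vector_derivative[OF bounded_bilinear_inner]
        matrix_vector.has_vector_derivative GP assms)
  then show ?thesis
    unfolding has_real_derivative_iff_has_vector_derivative metric_ip_def
    by (rule has_vector_derivative_eq_rhs)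
       (use compat[OF PU, of "V s" P' "W s"] in \<open>simp add: inner_add_right metric_ip_def[symmetric] metric_ip_linear\<close>)
qed

lemma Gam_has_derivative:
  assumes "(P has_vector_derivative P') (at s within S)" "(V has_vector_derivative V') (at s within S)"
    "(W has_vector_derivative W') (at s within S)" and PU: "P s \<in> U"
  shows "((\<lambda>s. Gam G (P s) (V s) (W s)) has_vector_derivative
    dGam G (P s) P' (V s) (W s) + Gam G (P s) V' (W s) + Gam G (P s) (V s) W') (at s within S)"
proof -
  have GP: "((\<lambda>s. chris_tensor G (P s)) has_vector_derivative frechet_derivative (chris_tensor G) (at (P s)) P') (at s within S)"
    by (rule has_vector_derivative_chain[OF assms(1) chris_has_derivative[OF PU]])
  show ?thesis unfolding Gam_def dGam_def has_vector_derivative_def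
    by (rule has_derivative_eq_rhs[OF trilin_has_derivative[OF
          GP[unfolded has_vector_derivative_def] assms(2,3)[unfolded has_vector_derivative_def]]])
       (auto simp: trilin_algebra trilin_tensor_algebra algebra_simps)
qed

lemma dGam_algebra:
  assumes "x \<in> U"
  shows "dGam G x (u + u') v w = dGam G x u v w + dGam G x u' v w"
    "dGam G x (c *\<^sub>R u) v w = c *\<^sub>R dGam G x u v w"
    "dGam G x u (v + v') w = dGam G x u v w + dGam G x u v' w"
    "dGam G x u v (w + w') = dGam G x u v w + dGam G x u v w'"
    "dGam G x u (c *\<^sub>R v) w = c *\<^sub>R dGam G x u v w"
    "dGam G x u v (c *\<^sub>R w) = c *\<^sub>R dGam G x u v w"
proof -
  have l: "linear (frechet_derivative (chris_tensor G) (at x))"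
    using chris_has_derivative[OF assms] has_derivative_linear by blast
  show "dGam G x (u + u') v w = dGam G x u v w + dGam G x u' v w"
    "dGam G x (c *\<^sub>R u) v w = c *\<^sub>R dGam G x u v w"
    by (simp_all add: dGam_def linear_add[OF l] linear_scale[OF l] trilin_tensor_algebra)
  show "dGam G x u (v + v') w = dGam G x u v w + dGam G x u v' w"
    "dGam G x u v (w + w') = dGam G x u v w + dGam G x u v w'"
    "dGam G x u (c *\<^sub>R v) w = c *\<^sub>R dGam G x u v w"
    "dGam G x u v (c *\<^sub>R w) = c *\<^sub>R dGam G x u v w"
    by (simp_all add: dGam_def trilin_algebra)
qed

lemma dGam_sym: assumes "x \<in> U" shows "dGam G x u v w = dGam G x u w v"
proof -
  define X where "X = (\<lambda>s::real. x + s *\<^sub>R u)"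
  have X: "(X has_vector_derivative u) (at 0)" "X 0 = x" unfolding X_def
    by (auto intro!: derivative_eq_intros simp: has_vector_derivative_def)
  have "((\<lambda>s. Gam G (X s) v w) has_vector_derivative dGam G x u v w) (at 0)" for v w
    using Gam_has_derivative[OF X(1) has_vector_derivative_const[of v] has_vector_derivative_const[of w]]
      X(2) assms by (simp add: Gam_algebra)
  moreover have "((\<lambda>s. Gam G (X s) v w) has_vector_derivative dGam G x u w v) (at 0)"
  proof (rule has_vector_derivative_transform_within_open)
    show "((\<lambda>s. Gam G (X s) w v) has_vector_derivative dGam G x u w v) (at 0)" by fact
    have "continuous_on UNIV X" unfolding X_def by (intro continuous_intros)
    then show "open (X -` U)" using open_U by (simp add: open_vimage)
    show "0 \<in> X -` U" using X(2) assms by simp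
  qed (auto simp: Gam_sym)
  ultimately show ?thesis using vector_derivative_unique_at by blast
qed

lemma cov_deriv_const: "cov_deriv G (\<lambda>_. w) y v = Gam G y v w"
  by (simp add: cov_deriv_Gam)

lemma curvature_eq:
  assumes "x \<in> U"
  shows "curvature G x u v w = dGam G x u v w + Gam G x u (Gam G x v w)
    - dGam G x v u w - Gam G x v (Gam G x u w)"
proof -
  have d: "frechet_derivative (\<lambda>y. Gam G y v w) (at x) = (\<lambda>u. dGam G x u v w)" for v w
  proof -
    have "((\<lambda>y. Gam G y v w) has_derivative (\<lambda>u. dGam G x u v w)) (at x)"
      unfolding Gam_def dGam_def
      by (rule has_derivative_eq_rhs[OF trilin_has_derivative[OF chris_has_derivative[OF assms] has_derivative_const has_derivative_const]])
         (simp add: trilin_algebra)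
    then show ?thesis by (metis frechet_derivative_at)
  qed
  show ?thesis unfolding curvature_def cov_deriv_const by (simp add: cov_deriv_Gam d)
qed

lemma ricci_eq: "ricci G x v w = trace (matrix (\<lambda>u. curvature G x u v w))"
  by (simp add: ricci_def)

text \<open>For \<open>a\<close> with constant components, the commutator of the second derivatives
  of |a|^2 in directions \<open>u\<close> and \<open>v\<close> is, up to sign, 2 <R(u,v)a, a>. It
  vanishes because mixed derivatives commute.\<close>

lemma curvature_skew:
  assumes x: "x \<in> U"
  shows "metric_ip G x (curvature G x u v a) a = 0"
proof -
  define h where "h = (\<lambda>y. metric_ip G y a a)"
  have h_eq: "h = (\<lambda>y. \<Sum>i\<in>UNIV. \<Sum>j\<in>UNIV. (a $ i * a $ j) * G y $ i $ j)"
    unfolding h_def metric_ip_def inner_vec_def matrix_vector_mult_def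
    by (simp add: sum_distrib_left mult_ac)
  have C: "Ck_on 2 h U" unfolding h_eq
    by (intro Ck_on_sum Ck_on_mult Ck_on_const G_entry_Ck open_U)
  have line: "((\<lambda>s. y + s *\<^sub>R b) has_vector_derivative b) (at 0)" for y b :: "real ^ 'm"
    by (auto intro!: derivative_eq_intros simp: has_vector_derivative_def)
  \<comment> \<open>Derivatives in a fixed direction are computed along lines, where the covariant
    product rule applies.\<close>
  have fr: "frechet_derivative F (at y) b = D"
    if "y \<in> U" "Ck_on (Suc 0) F U" "((\<lambda>s. F (y + s *\<^sub>R b)) has_real_derivative D) (at 0)"
    for F :: "real ^ 'm \<Rightarrow> real" and y b D
  proof -
    have "((\<lambda>s. F (y + s *\<^sub>R b)) has_vector_derivative frechet_derivative F (at y) b) (at 0)"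
      using has_vector_derivative_chain[OF line, of F _ y b] Ck_on_SucD(1)[OF that(2,1)] by simp
    then show ?thesis using that(3) vector_derivative_unique_at
      unfolding has_real_derivative_iff_has_vector_derivative by blast
  qed
  have D1: "frechet_derivative h (at y) b = 2 * metric_ip G y (Gam G y b a) a" if "y \<in> U" for y b
  proof (rule fr[OF that])
    show "Ck_on (Suc 0) h U" using C unfolding numeral_2_eq_2 by (rule Ck_on_Suc_imp)
    show "((\<lambda>s. h (y + s *\<^sub>R b)) has_real_derivative 2 * metric_ip G y (Gam G y b a) a) (at 0)"
      unfolding h_def
      using metric_ip_has_derivative[OF line[of y b] has_vector_derivative_const[of a] has_vector_derivative_const[of a]] that
      by (simp add: ip_sym[OF that, of a])
  qed
  have D2: "frechet_derivative (\<lambda>y. frechet_derivative h (at y) b) (at x) c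
      = 2 * (metric_ip G x (dGam G x c b a + Gam G x c (Gam G x b a)) a + metric_ip G x (Gam G x b a) (Gam G x c a))" for b c
  proof (rule fr[OF x])
    show "Ck_on (Suc 0) (\<lambda>y. frechet_derivative h (at y) b) U"
      using C by (intro Ck_on_SucD(2)) (simp only: numeral_2_eq_2)
    have "((\<lambda>s. 2 * metric_ip G (x + s *\<^sub>R c) (Gam G (x + s *\<^sub>R c) b a) a) has_real_derivative
       2 * (metric_ip G x (dGam G x c b a + Gam G x c (Gam G x b a)) a + metric_ip G x (Gam G x b a) (Gam G x c a))) (at 0)"
      using x by (auto intro!: derivative_eq_intros
        metric_ip_has_derivative[THEN DERIV_cong] line Gam_has_derivative[OF line has_vector_derivative_const has_vector_derivative_const] simp: Gam_algebra)
    then show "((\<lambda>s. frechet_derivative h (at (x + s *\<^sub>R c)) b) has_real_derivative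
       2 * (metric_ip G x (dGam G x c b a + Gam G x c (Gam G x b a)) a + metric_ip G x (Gam G x b a) (Gam G x c a))) (at 0)"
    proof (rule has_field_derivative_transform_within_open)
      have "continuous_on UNIV (\<lambda>s. x + s *\<^sub>R c)" by (intro continuous_intros)
      then show "open ((\<lambda>s. x + s *\<^sub>R c) -` U)" using open_U by (simp add: open_vimage)
    qed (use x D1 in auto)
  qed
  show ?thesis
    using mixed_derivative_commute[OF open_U C x, of u v]
    unfolding D2 curvature_eq[OF x]
    using ip_sym[OF x, of "Gam G x u a" "Gam G x v a"]
    by (simp add: metric_ip_linear)
qed

text \<open>Polarization of \<open>curvature_skew\<close> at \<open>a + b\<close>.\<close>

lemma curvature_antisym:
  assumes x: "x \<in> U"
  shows "metric_ip G x (curvature G x u v a) b = - metric_ip G x (curvature G x u v b) a"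
proof -
  have "curvature G x u v (a + b) = curvature G x u v a + curvature G x u v b"
    by (simp add: curvature_eq[OF x] dGam_algebra[OF x] Gam_algebra)
  then show ?thesis
    using curvature_skew[OF x, of u v "a + b"] curvature_skew[OF x, of u v a] curvature_skew[OF x, of u v b]
    by (simp add: metric_ip_linear)
qed

section \<open>Second variation of a pulled-back metric\<close>

text \<open>With \<open>P = x + sW - s\<^sup>2A/2\<close> and \<open>T = v + sV\<^sub>1 - s\<^sup>2V\<^sub>2/2\<close> this is the second derivative of
  \<open>s \<mapsto> |T|\<^sup>2\<close>, written with \<open>\<nabla>\<^sub>s T\<close>.\<close>

definition pull1 where
  "pull1 x W A v V1 V2 s =
    V1 - s *\<^sub>R V2 + Gam G (x + s *\<^sub>R W - (s\<^sup>2/2) *\<^sub>R A) (W - s *\<^sub>R A) (v + s *\<^sub>R V1 - (s\<^sup>2/2) *\<^sub>R V2)"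

definition pull2 where
  "pull2 x W A v V1 V2 s =
    (let P = x + s *\<^sub>R W - (s\<^sup>2/2) *\<^sub>R A; P' = W - s *\<^sub>R A; T = v + s *\<^sub>R V1 - (s\<^sup>2/2) *\<^sub>R V2; T' = V1 - s *\<^sub>R V2;
         N = pull1 x W A v V1 V2 s
     in 2 * (metric_ip G P (- V2 + (dGam G P P' P' T + Gam G P (- A) T + Gam G P P' T') + Gam G P P' N) T + metric_ip G P N N))"

text \<open>\<open>pull1\<close> is the covariant derivative of \<open>T\<close> along
  \<open>P\<close>. It appears after the first differentiation and is itself differentiated by
  \<open>Gam_has_derivative\<close>.\<close>

lemma pull_derivative:
  assumes PU: "x + s *\<^sub>R W - (s\<^sup>2/2) *\<^sub>R A \<in> U"
  shows "((\<lambda>s. metric_ip G (x + s *\<^sub>R W - (s\<^sup>2/2) *\<^sub>R A) (v + s *\<^sub>R V1 - (s\<^sup>2/2) *\<^sub>R V2) (v + s *\<^sub>R V1 - (s\<^sup>2/2) *\<^sub>R V2))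
     has_real_derivative 2 * metric_ip G (x + s *\<^sub>R W - (s\<^sup>2/2) *\<^sub>R A) (pull1 x W A v V1 V2 s) (v + s *\<^sub>R V1 - (s\<^sup>2/2) *\<^sub>R V2)) (at s)"
    "((\<lambda>s. 2 * metric_ip G (x + s *\<^sub>R W - (s\<^sup>2/2) *\<^sub>R A) (pull1 x W A v V1 V2 s) (v + s *\<^sub>R V1 - (s\<^sup>2/2) *\<^sub>R V2))
     has_real_derivative pull2 x W A v V1 V2 s) (at s)"
proof -
  have P: "((\<lambda>s. a + s *\<^sub>R b - (s\<^sup>2/2) *\<^sub>R c) has_vector_derivative b - s *\<^sub>R c) (at s)" for a b c :: "real ^ 'm"
    by (auto intro!: derivative_eq_intros simp: has_vector_derivative_def algebra_simps)
  have P': "((\<lambda>s. b - s *\<^sub>R c) has_vector_derivative - c) (at s)" for b c :: "real ^ 'm"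
    by (auto intro!: derivative_eq_intros simp: has_vector_derivative_def algebra_simps)
  show "((\<lambda>s. metric_ip G (x + s *\<^sub>R W - (s\<^sup>2/2) *\<^sub>R A) (v + s *\<^sub>R V1 - (s\<^sup>2/2) *\<^sub>R V2) (v + s *\<^sub>R V1 - (s\<^sup>2/2) *\<^sub>R V2))
     has_real_derivative 2 * metric_ip G (x + s *\<^sub>R W - (s\<^sup>2/2) *\<^sub>R A) (pull1 x W A v V1 V2 s) (v + s *\<^sub>R V1 - (s\<^sup>2/2) *\<^sub>R V2)) (at s)"
    unfolding pull1_def
    by (rule DERIV_cong[OF metric_ip_has_derivative[OF P P P PU]])
       (simp add: ip_sym[OF PU, of "v + s *\<^sub>R V1 - (s\<^sup>2/2) *\<^sub>R V2"])
  have N: "(pull1 x W A v V1 V2 has_vector_derivative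
      - V2 + (dGam G (x + s *\<^sub>R W - (s\<^sup>2/2) *\<^sub>R A) (W - s *\<^sub>R A) (W - s *\<^sub>R A) (v + s *\<^sub>R V1 - (s\<^sup>2/2) *\<^sub>R V2)
       + Gam G (x + s *\<^sub>R W - (s\<^sup>2/2) *\<^sub>R A) (- A) (v + s *\<^sub>R V1 - (s\<^sup>2/2) *\<^sub>R V2)
       + Gam G (x + s *\<^sub>R W - (s\<^sup>2/2) *\<^sub>R A) (W - s *\<^sub>R A) (V1 - s *\<^sub>R V2))) (at s)"
    unfolding pull1_def[abs_def]
    by (rule has_vector_derivative_add[OF P' Gam_has_derivative[OF P P' P PU]])
  show "((\<lambda>s. 2 * metric_ip G (x + s *\<^sub>R W - (s\<^sup>2/2) *\<^sub>R A) (pull1 x W A v V1 V2 s) (v + s *\<^sub>R V1 - (s\<^sup>2/2) *\<^sub>R V2))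
     has_real_derivative pull2 x W A v V1 V2 s) (at s)"
    unfolding pull2_def Let_def
    by (rule DERIV_cong[OF DERIV_cmult[OF metric_ip_has_derivative[OF P N P PU]]])
       (simp add: pull1_def)
qed

text \<open>The second variation formula. Taking \<open>Gam G x W W\<close> for \<open>A\<close>
  makes the acceleration of the path vanish at 0, and the vector in place of \<open>V2\<close> is
  the derivative of that \<open>A\<close> in direction \<open>v\<close> when \<open>W\<close> is a
  field with derivative \<open>V1\<close>. With these choices the non-tensorial terms combine into
  the curvature.\<close>

lemma pull2_zero:
  assumes x: "x \<in> U"
  shows "pull2 x W (Gam G x W W) v V1 (dGam G x v W W + 2 *\<^sub>R Gam G x V1 W) 0
    = 2 * (metric_ip G x (V1 + Gam G x v W) (V1 + Gam G x v W) + metric_ip G x (curvature G x W v W) v)"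
proof -
  have "pull2 x W (Gam G x W W) v V1 (dGam G x v W W + 2 *\<^sub>R Gam G x V1 W) 0
    = 2 * (metric_ip G x (V1 + Gam G x W v) (V1 + Gam G x W v) + metric_ip G x (curvature G x W v W) v)"
    unfolding pull2_def Let_def pull1_def curvature_eq[OF x]
    using Gam_sym[OF x, of "Gam G x W W" v] Gam_sym[OF x, of v W] Gam_sym[OF x, of V1 W]
      dGam_sym[OF x, of W W v]
    by (simp add: Gam_algebra metric_ip_linear algebra_simps scaleR_2)
  then show ?thesis by (simp add: Gam_sym[OF x, of W v])
qed

end

text \<open>The mean value theorem for the symmetrized function \<open>\<psi>\<close> yields a
  difference of \<open>\<theta>1\<close> at opposite points \<open>r\<close> and \<open>- r\<close>;
  applied to that difference it yields \<open>\<theta>2\<close> at one point. The factor 2 is the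
  length 2 r of the inner interval.\<close>

lemma second_difference_bound:
  fixes \<theta> :: "real \<Rightarrow> real"
  assumes s: "0 \<le> s"
    and d1: "\<And>r. \<bar>r\<bar> \<le> s \<Longrightarrow> (\<theta> has_real_derivative \<theta>1 r) (at r)"
    and d2: "\<And>r. \<bar>r\<bar> \<le> s \<Longrightarrow> (\<theta>1 has_real_derivative \<theta>2 r) (at r)"
    and b: "\<And>r. \<bar>r\<bar> \<le> s \<Longrightarrow> \<bar>\<theta>2 r - c\<bar> \<le> e"
  shows "\<bar>\<theta> s + \<theta> (- s) - 2 * \<theta> 0 - s\<^sup>2 * c\<bar> \<le> 2 * e * s\<^sup>2"
proof (cases "s = 0")
  case False
  then have s: "0 < s" using s by simp
  define \<psi> where "\<psi> = (\<lambda>r. \<theta> r + \<theta> (- r) - 2 * \<theta> 0 - r\<^sup>2 * c)"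
  have d: "(\<psi> has_real_derivative \<theta>1 r - \<theta>1 (- r) - 2 * r * c) (at r)" if "\<bar>r\<bar> \<le> s" for r
  proof -
    have "((\<lambda>r. \<theta> (- r)) has_real_derivative \<theta>1 (- r) * (- 1)) (at r)"
      by (rule DERIV_chain2[OF d1]) (use that in \<open>auto intro!: derivative_eq_intros\<close>)
    then show ?thesis unfolding \<psi>_def
      by (auto intro!: derivative_eq_intros d1 that simp: power2_eq_square)
  qed
  obtain r where r: "0 < r" "r < s" "\<psi> s - \<psi> 0 = (s - 0) * (\<theta>1 r - \<theta>1 (- r) - 2 * r * c)"
    using MVT2[of 0 s \<psi> "\<lambda>r. \<theta>1 r - \<theta>1 (- r) - 2 * r * c"] d s by auto
  obtain q where q: "- r < q" "q < r" "\<theta>1 r - \<theta>1 (- r) = (r - - r) * \<theta>2 q"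
    using MVT2[of "- r" r \<theta>1 \<theta>2] d2 r by auto
  have "\<bar>\<psi> s\<bar> = \<bar>s * (2 * r * (\<theta>2 q - c))\<bar>"
    using r(3) q(3) by (simp add: \<psi>_def algebra_simps)
  also have "\<dots> = s * (2 * r * \<bar>\<theta>2 q - c\<bar>)" using s r by (simp add: abs_mult)
  also have "\<dots> \<le> s * (2 * s * e)"
    using s r q b[of q] by (intro mult_left_mono mult_mono) auto
  finally show ?thesis by (simp add: \<psi>_def power2_eq_square mult_ac)
qed simp

section \<open>Continuity and uniform estimates on compact sets\<close>

lemma norm_matrix_vector_bound:
  "\<exists>B>0. \<forall>(A :: real ^ 'm::finite ^ 'm) v. norm (A *v v) \<le> norm A * norm v * B"
  using matrix_vector.pos_bounded by auto

lemma norm_trilin_bound: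
  "\<exists>B>0. \<forall>(T :: real ^ 'm::finite ^ 'm ^ 'm) v w. norm (trilin T v w) \<le> B * norm T * norm v * norm w"
proof -
  obtain B1 where B1: "B1 > 0" "\<And>(A :: real ^ 'm ^ 'm) v. norm (A *v v) \<le> norm A * norm v * B1"
    using norm_matrix_vector_bound by blast
  obtain B2 where B2: "B2 > 0" "\<And>(T :: real ^ 'm ^ 'm ^ 'm) w. norm (slices T w) \<le> norm T * norm w * B2"
    using slices.pos_bounded by blast
  have "norm (trilin T v w) \<le> (B1 * B2) * norm T * norm v * norm w" for T :: "real ^ 'm ^ 'm ^ 'm" and v w
  proof -
    have "norm (trilin T v w) \<le> norm (slices T w) * norm v * B1" unfolding trilin_def by (rule B1)
    also have "\<dots> \<le> (norm T * norm w * B2) * norm v * B1" using B1 B2 by (intro mult_right_mono) auto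
    finally show ?thesis by (simp add: mult_ac)
  qed
  then show ?thesis using B1(1) B2(1) by (intro exI[of _ "B1 * B2"]) auto
qed

context local_metric
begin

lemma continuous_on_G: "continuous_on U G"
  using smooth_G Ck_on_imp_continuous_on unfolding smooth_on_def by blast

lemma continuous_on_metric_ip:
  assumes "continuous_on S X" "continuous_on S V" "continuous_on S W" "X ` S \<subseteq> U"
  shows "continuous_on S (\<lambda>p. metric_ip G (X p) (V p) (W p))"
  unfolding metric_ip_def
  by (intro continuous_on_inner matrix_vector.continuous_on assms continuous_on_compose2[OF continuous_on_G])

lemma continuous_on_Gam:
  assumes "continuous_on S X" "continuous_on S V" "continuous_on S W" "X ` S \<subseteq> U"
  shows "continuous_on S (\<lambda>p. Gam G (X p) (V p) (W p))"
  unfolding Gam_def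
  by (intro continuous_on_trilin assms continuous_on_compose2[OF Ck_on_imp_continuous_on[OF chris_Ck[of 0]]])

text \<open>\<open>Ck_on\<close> controls a derivative only in each fixed direction. Expanding the
  direction along the axes gives continuity jointly in point and direction, which
  \<open>continuous_on_dGam\<close> rests on.\<close>

lemma chris_derivative_expand:
  assumes "x \<in> U"
  shows "frechet_derivative (chris_tensor G) (at x) u = (\<Sum>i\<in>UNIV. u $ i *\<^sub>R frechet_derivative (chris_tensor G) (at x) (axis i 1))"
proof -
  have l: "linear (frechet_derivative (chris_tensor G) (at x))"
    using chris_has_derivative[OF assms] has_derivative_linear by blast
  have "frechet_derivative (chris_tensor G) (at x) u = frechet_derivative (chris_tensor G) (at x) (\<Sum>i\<in>UNIV. u $ i *\<^sub>R axis i 1)"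
    by (simp add: basis_expansion[of u, unfolded scalar_mult_eq_scaleR])
  then show ?thesis by (simp add: linear_sum[OF l] linear_scale[OF l])
qed

lemma chris_derivative_continuous:
  "continuous_on U (\<lambda>x. frechet_derivative (chris_tensor G) (at x) u)"
  using Ck_on_SucD(2)[OF chris_Ck[of "Suc 0"]] by simp

lemma continuous_on_dGam:
  assumes "continuous_on S X" "continuous_on S D" "continuous_on S V" "continuous_on S W" "X ` S \<subseteq> U"
  shows "continuous_on S (\<lambda>p. dGam G (X p) (D p) (V p) (W p))"
proof -
  have "continuous_on S (\<lambda>p. trilin (\<Sum>i\<in>UNIV. D p $ i *\<^sub>R frechet_derivative (chris_tensor G) (at (X p)) (axis i 1)) (V p) (W p))"
    by (intro continuous_on_trilin assms continuous_intros continuous_on_compose2[OF chris_derivative_continuous])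
  then show ?thesis
    by (rule continuous_on_eq)
       (use assms(5) in \<open>auto simp: dGam_def chris_derivative_expand[symmetric] image_subset_iff\<close>)
qed

text \<open>The error of the second difference is governed by the variation of the second derivative
  \<open>H\<close> between 0 and \<open>s\<close>. This variation is uniformly small over the
  compact set \<open>K\<close>: counterexamples with \<open>s\<close> tending to 0 would accumulate
  at some point of \<open>K\<close> with \<open>s = 0\<close>, where the variation is 0.\<close>

lemma pull_second_difference:
  fixes X W A v V1 V2 :: "'z::metric_space \<Rightarrow> real ^ 'm"
  assumes K: "compact K" and c: "continuous_on K X" "continuous_on K W" "continuous_on K A"
      "continuous_on K v" "continuous_on K V1" "continuous_on K V2"
    and XU: "X ` K \<subseteq> U" and e: "e > 0"
  shows "\<exists>r>0. \<forall>z\<in>K. \<forall>s. \<bar>s\<bar> < r \<longrightarrow>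
     X z + s *\<^sub>R W z - (s\<^sup>2/2) *\<^sub>R A z \<in> U \<and>
     (let \<theta> = (\<lambda>s. metric_ip G (X z + s *\<^sub>R W z - (s\<^sup>2/2) *\<^sub>R A z) (v z + s *\<^sub>R V1 z - (s\<^sup>2/2) *\<^sub>R V2 z)
           (v z + s *\<^sub>R V1 z - (s\<^sup>2/2) *\<^sub>R V2 z))
      in \<bar>\<theta> s + \<theta> (- s) - 2 * \<theta> 0 - s\<^sup>2 * pull2 (X z) (W z) (A z) (v z) (V1 z) (V2 z) 0\<bar> \<le> e * s\<^sup>2)"
proof -
  define P where "P = (\<lambda>z s. X z + s *\<^sub>R W z - (s\<^sup>2/2) *\<^sub>R A z)"
  define H where "H = (\<lambda>z s. pull2 (X z) (W z) (A z) (v z) (V1 z) (V2 z) s)"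
  define good where "good = (\<lambda>z s. P z s \<in> U \<and> \<bar>H z s - H z 0\<bar> \<le> e / 2)"
  have "\<exists>r>0. \<forall>z\<in>K. \<forall>s. \<bar>s\<bar> < r \<longrightarrow> good z s"
  proof (rule ccontr)
    assume "\<not> ?thesis"
    then have "\<exists>z\<in>K. \<exists>s. \<bar>s\<bar> < 1 / real (Suc n) \<and> \<not> good z s" for n
      by (meson of_nat_0_less_iff zero_less_Suc zero_less_divide_1_iff)
    then obtain z s where zs: "\<And>n. z n \<in> K" "\<And>n. \<bar>s n\<bar> < 1 / real (Suc n)" "\<And>n. \<not> good (z n) (s n)"
      by metis
    have "s \<longlonglongrightarrow> 0" by (rule LIMSEQ_norm_0) (use zs(2) in simp)
    obtain l r where lr: "l \<in> K" "strict_mono r" "(z \<circ> r) \<longlonglongrightarrow> l"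
      using K zs(1) unfolding compact_def by blast
    have zr: "(\<lambda>n. (z (r n), s (r n))) \<longlonglongrightarrow> (l, 0)"
      using lr \<open>s \<longlonglongrightarrow> 0\<close> LIMSEQ_subseq_LIMSEQ[of s 0 r] by (auto intro!: tendsto_Pair simp: o_def)
    have f: "continuous_on (T) (\<lambda>p. F (fst p))" if "continuous_on K F" "fst ` T \<subseteq> K" for F :: "'z \<Rightarrow> real ^ 'm" and T :: "('z \<times> real) set"
      by (rule continuous_on_compose2[OF that(1) continuous_on_fst[OF continuous_on_id] that(2)])
    note fc = f[OF c(1)] f[OF c(2)] f[OF c(3)] f[OF c(4)] f[OF c(5)] f[OF c(6)]
    have cP: "continuous_on (K \<times> UNIV) (\<lambda>p. P (fst p) (snd p))"
      unfolding P_def by (intro continuous_intros fc) auto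
    have "(\<lambda>n. P (z (r n)) (s (r n))) \<longlonglongrightarrow> P l 0"
      using continuous_on_tendsto_compose[OF cP zr] lr zs(1) by simp
    moreover have "P l 0 \<in> U" using XU lr by (auto simp: P_def)
    ultimately have ev1: "\<forall>\<^sub>F n in sequentially. P (z (r n)) (s (r n)) \<in> U"
      using open_U topological_tendstoD by blast
    \<comment> \<open>The path may leave \<open>U\<close>, where nothing is known of
      \<open>G\<close>; joint continuity of \<open>H\<close> is therefore claimed only on this part
      of the parameter set.\<close>
    define T where "T = {p \<in> K \<times> UNIV. P (fst p) (snd p) \<in> U}"
    have TK: "fst ` T \<subseteq> K" "\<And>p. p \<in> T \<Longrightarrow> P (fst p) (snd p) \<in> U" unfolding T_def by auto
    have cT: "continuous_on T (\<lambda>p. P (fst p) (snd p))"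
      by (rule continuous_on_subset[OF cP]) (auto simp: T_def)
    have cN: "continuous_on T (\<lambda>p. pull1 (X (fst p)) (W (fst p)) (A (fst p)) (v (fst p)) (V1 (fst p)) (V2 (fst p)) (snd p))"
      unfolding pull1_def
      by (intro continuous_intros continuous_on_Gam fc TK(1) cT[unfolded P_def]) (use TK(2) in \<open>auto simp: P_def\<close>)
    have "continuous_on T (\<lambda>p. H (fst p) (snd p))"
      unfolding H_def pull2_def Let_def
      by (intro continuous_intros continuous_on_metric_ip continuous_on_Gam continuous_on_dGam fc TK(1) cT[unfolded P_def] cN)
         (use TK(2) in \<open>auto simp: P_def\<close>)
    moreover have "continuous_on T (\<lambda>p. H (fst p) 0)"
      unfolding H_def pull2_def Let_def pull1_def
      by (intro continuous_intros continuous_on_metric_ip continuous_on_Gam continuous_on_dGam fc TK(1))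
         (use XU TK(1) in auto)
    ultimately have cH: "continuous_on T (\<lambda>p. H (fst p) (snd p) - H (fst p) 0)" by (rule continuous_on_diff)
    have "(\<lambda>n. H (z (r n)) (s (r n)) - H (z (r n)) 0) \<longlonglongrightarrow> H l 0 - H l 0"
      using continuous_on_tendsto_compose[OF cH zr] lr zs(1) ev1 \<open>P l 0 \<in> U\<close> by (simp add: T_def)
    then have "\<forall>\<^sub>F n in sequentially. \<bar>H (z (r n)) (s (r n)) - H (z (r n)) 0\<bar> < e / 2"
      using e order_tendstoD(2)[OF tendsto_rabs, of "\<lambda>n. H (z (r n)) (s (r n)) - H (z (r n)) 0" "H l 0 - H l 0" sequentially "e/2"]
      by simp
    with ev1 have "\<forall>\<^sub>F n in sequentially. False"
    proof eventually_elim
      case (elim n)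
      then show ?case using zs(3)[of "r n"] unfolding good_def by (meson less_imp_le)
    qed
    then show False by simp
  qed
  then obtain r where r: "r > 0" "\<And>z s. z \<in> K \<Longrightarrow> \<bar>s\<bar> < r \<Longrightarrow> good z s" by blast
  show ?thesis
  proof (intro exI[of _ r] conjI ballI allI impI)
    show "r > 0" by fact
    fix z s assume z: "z \<in> K" and s: "\<bar>s\<bar> < r"
    then show "X z + s *\<^sub>R W z - (s\<^sup>2/2) *\<^sub>R A z \<in> U" using r(2) unfolding good_def P_def by blast
    define \<theta> where "\<theta> = (\<lambda>s. metric_ip G (X z + s *\<^sub>R W z - (s\<^sup>2/2) *\<^sub>R A z) (v z + s *\<^sub>R V1 z - (s\<^sup>2/2) *\<^sub>R V2 z)
           (v z + s *\<^sub>R V1 z - (s\<^sup>2/2) *\<^sub>R V2 z))"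
    \<comment> \<open>\<open>second_difference_bound\<close> is stated for a nonnegative step; both
      sides are even in \<open>s\<close>.\<close>
    have "\<bar>\<theta> \<bar>s\<bar> + \<theta> (- \<bar>s\<bar>) - 2 * \<theta> 0 - \<bar>s\<bar>\<^sup>2 * H z 0\<bar> \<le> 2 * (e/2) * \<bar>s\<bar>\<^sup>2"
    proof (rule second_difference_bound)
      fix q assume "\<bar>q\<bar> \<le> \<bar>s\<bar>"
      then have g: "good z q" using r(2)[OF z, of q] s by simp
      then have PU: "X z + q *\<^sub>R W z - (q\<^sup>2/2) *\<^sub>R A z \<in> U" by (simp add: good_def P_def)
      from pull_derivative[OF PU]
      show "(\<theta> has_real_derivative 2 * metric_ip G (X z + q *\<^sub>R W z - (q\<^sup>2/2) *\<^sub>R A z) (pull1 (X z) (W z) (A z) (v z) (V1 z) (V2 z) q) (v z + q *\<^sub>R V1 z - (q\<^sup>2/2) *\<^sub>R V2 z)) (at q)"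
        "((\<lambda>q. 2 * metric_ip G (X z + q *\<^sub>R W z - (q\<^sup>2/2) *\<^sub>R A z) (pull1 (X z) (W z) (A z) (v z) (V1 z) (V2 z) q) (v z + q *\<^sub>R V1 z - (q\<^sup>2/2) *\<^sub>R V2 z))
         has_real_derivative H z q) (at q)"
        unfolding \<theta>_def H_def .
      show "\<bar>H z q - H z 0\<bar> \<le> e / 2" using g by (simp add: good_def)
    qed simp
    moreover have "\<theta> \<bar>s\<bar> + \<theta> (- \<bar>s\<bar>) = \<theta> s + \<theta> (- s)" by (cases "s \<ge> 0") auto
    ultimately show "let \<theta> = (\<lambda>s. metric_ip G (X z + s *\<^sub>R W z - (s\<^sup>2/2) *\<^sub>R A z) (v z + s *\<^sub>R V1 z - (s\<^sup>2/2) *\<^sub>R V2 z)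
           (v z + s *\<^sub>R V1 z - (s\<^sup>2/2) *\<^sub>R V2 z))
      in \<bar>\<theta> s + \<theta> (- s) - 2 * \<theta> 0 - s\<^sup>2 * pull2 (X z) (W z) (A z) (v z) (V1 z) (V2 z) 0\<bar> \<le> e * s\<^sup>2"
      unfolding Let_def \<theta>_def[symmetric] by (simp add: H_def)
  qed
qed

lemma metric_norm_sq: "x \<in> U \<Longrightarrow> (metric_norm G x v)\<^sup>2 = metric_ip G x v v"
  by (simp add: metric_norm_def ip_nonneg)

lemma metric_norm_scaleR: "metric_norm G x (c *\<^sub>R v) = \<bar>c\<bar> * metric_norm G x v"
  by (simp add: metric_norm_def metric_ip_linear real_sqrt_mult flip: power2_eq_square mult.assoc)

lemma metric_norm_nonneg: "x \<in> U \<Longrightarrow> metric_norm G x v \<ge> 0"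
  by (simp add: metric_norm_def ip_nonneg)

lemma continuous_on_metric_norm:
  assumes "continuous_on S X" "continuous_on S V" "X ` S \<subseteq> U"
  shows "continuous_on S (\<lambda>p. metric_norm G (X p) (V p))"
  unfolding metric_norm_def by (intro continuous_on_real_sqrt continuous_on_metric_ip assms)

text \<open>Extremal values on the compact bundle of Euclidean unit vectors over \<open>K\<close>,
  extended by homogeneity.\<close>

lemma metric_norm_bounds:
  assumes K: "compact K" "K \<subseteq> U"
  shows "\<exists>a b. 0 < a \<and> 0 < b \<and> (\<forall>x\<in>K. \<forall>v. a * norm v \<le> metric_norm G x v \<and> metric_norm G x v \<le> b * norm v)"
proof (cases "K = {}")
  case True then show ?thesis using zero_less_one by blast
next
  case False
  define S where "S = K \<times> sphere (0 :: real ^ 'm) 1"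
  have S: "compact S" unfolding S_def by (intro compact_Times K compact_sphere)
  have "axis undefined 1 \<in> sphere (0 :: real ^ 'm) 1" by simp
  then have ne: "S \<noteq> {}" using False unfolding S_def by blast
  have c: "continuous_on S (\<lambda>p. metric_norm G (fst p) (snd p))"
    by (intro continuous_on_metric_norm continuous_intros) (use K S_def in auto)
  obtain p where p: "p \<in> S" "\<And>q. q \<in> S \<Longrightarrow> metric_norm G (fst p) (snd p) \<le> metric_norm G (fst q) (snd q)"
    using continuous_attains_inf[OF S ne c] by blast
  obtain p' where p': "p' \<in> S" "\<And>q. q \<in> S \<Longrightarrow> metric_norm G (fst q) (snd q) \<le> metric_norm G (fst p') (snd p')"
    using continuous_attains_sup[OF S ne c] by blast
  define a b where "a = metric_norm G (fst p) (snd p)" and "b = metric_norm G (fst p') (snd p')"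
  have "snd p \<noteq> 0" "fst p \<in> U" using p(1) K unfolding S_def by auto
  then have a: "a > 0" unfolding a_def metric_norm_def by (simp add: ip_pos)
  have b: "b > 0" using a p(2)[OF p'(1)] unfolding a_def b_def by simp
  have "a * norm v \<le> metric_norm G x v \<and> metric_norm G x v \<le> b * norm v" if x: "x \<in> K" for x v
  proof (cases "v = 0")
    case True then show ?thesis by (simp add: metric_norm_def metric_ip_linear)
  next
    case False
    define w where "w = (1 / norm v) *\<^sub>R v"
    have "(x, w) \<in> S" using False x by (simp add: S_def w_def)
    then have "a \<le> metric_norm G x w" "metric_norm G x w \<le> b"
      using p(2) p'(2) unfolding a_def b_def by force+
    moreover have "v = norm v *\<^sub>R w" using False by (simp add: w_def)
    then have "metric_norm G x v = norm v * metric_norm G x w" using metric_norm_scaleR by (metis abs_norm_cancel)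
    ultimately show ?thesis
      by (simp add: mult.commute[of _ "norm v"] mult_left_mono)
  qed
  then show ?thesis using a b by blast
qed

lemma metric_ip_bound:
  assumes K: "compact K" "K \<subseteq> U"
  shows "\<exists>b>0. \<forall>x\<in>K. \<forall>v w. \<bar>metric_ip G x v w\<bar> \<le> b * norm v * norm w"
proof -
  obtain B where B: "B > 0" "\<And>(A :: real ^ 'm ^ 'm) v. norm (A *v v) \<le> norm A * norm v * B"
    using norm_matrix_vector_bound by blast
  have "bounded (G ` K)"
    using compact_continuous_image[OF continuous_on_subset[OF continuous_on_G K(2)] K(1)] compact_imp_bounded by blast
  then obtain M where M: "M > 0" "\<And>x. x \<in> K \<Longrightarrow> norm (G x) \<le> M" unfolding bounded_pos by auto
  have "\<bar>metric_ip G x v w\<bar> \<le> (M * B) * norm v * norm w" if "x \<in> K" for x v w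
  proof -
    have "\<bar>metric_ip G x v w\<bar> \<le> norm v * norm (G x *v w)"
      unfolding metric_ip_def by (rule Cauchy_Schwarz_ineq2)
    also have "\<dots> \<le> norm v * (norm (G x) * norm w * B)" by (intro mult_left_mono B(2)) simp
    also have "\<dots> \<le> norm v * (M * norm w * B)" using M(2)[OF that] B(1) by (intro mult_left_mono mult_right_mono) auto
    finally show ?thesis by (simp add: mult_ac)
  qed
  then show ?thesis using M B by (intro exI[of _ "M * B"]) auto
qed

section \<open>Frames and the Ricci trace\<close>

definition orthonormal :: "real ^ 'm \<Rightarrow> ('m \<Rightarrow> real ^ 'm) \<Rightarrow> bool" where
  "orthonormal x e \<longleftrightarrow> (\<forall>i j. metric_ip G x (e i) (e j) = (if i = j then 1 else 0))"

text \<open>Gram-Schmidt as an induction over the set of indices already treated: fewer than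
  \<open>CARD('m)\<close> vectors do not span, so some \<open>v\<close> lies outside their span and
  its orthogonal remainder \<open>u\<close> is nonzero.\<close>

lemma orthonormal_exists:
  assumes x: "x \<in> U" shows "\<exists>e. orthonormal x e"
proof -
  have "\<exists>e :: 'm \<Rightarrow> real ^ 'm. \<forall>i\<in>S. \<forall>j\<in>S. metric_ip G x (e i) (e j) = (if i = j then 1 else 0)" for S :: "'m set"
  proof (induction S rule: infinite_finite_induct)
    case (insert k S)
    then obtain e :: "'m \<Rightarrow> real ^ 'm" where e: "\<And>i j. i \<in> S \<Longrightarrow> j \<in> S \<Longrightarrow> metric_ip G x (e i) (e j) = (if i = j then 1 else 0)"
      by blast
    have "dim (e ` S) \<le> card (e ` S)" by (rule dim_le_card') (use insert in simp)
    also have "\<dots> \<le> card S" by (rule card_image_le) (use insert in simp)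
    also have "\<dots> < CARD('m)" using insert psubset_card_mono[of UNIV S] by auto
    finally have "span (e ` S) \<noteq> UNIV" using dim_eq_full[of "e ` S"] by simp
    then obtain v where v: "v \<notin> span (e ` S)" by blast
    define u where "u = v - (\<Sum>i\<in>S. metric_ip G x v (e i) *\<^sub>R e i)"
    have "u \<noteq> 0"
    proof
      assume "u = 0"
      then have "v = (\<Sum>i\<in>S. metric_ip G x v (e i) *\<^sub>R e i)" by (simp add: u_def)
      also have "\<dots> \<in> span (e ` S)" by (intro span_sum span_scale span_base) auto
      finally show False using v by simp
    qed
    then have pos: "metric_ip G x u u > 0" using ip_pos[OF x] by simp
    have orth: "metric_ip G x u (e j) = 0" if "j \<in> S" for j
    proof -
      have "(\<Sum>i\<in>S. metric_ip G x v (e i) * metric_ip G x (e i) (e j)) = (\<Sum>i\<in>S. if i = j then metric_ip G x v (e i) else 0)"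
        by (intro sum.cong refl) (simp add: e that)
      then show ?thesis using that insert.hyps by (simp add: u_def metric_ip_linear metric_ip_sum)
    qed
    then have orth': "metric_ip G x (e j) u = 0" if "j \<in> S" for j
      using that ip_sym[OF x, of u "e j"] by simp
    define c where "c = 1 / sqrt (metric_ip G x u u)"
    have c: "c * (c * metric_ip G x u u) = 1"
      using pos by (simp add: c_def field_simps)
    have "\<forall>i\<in>insert k S. \<forall>j\<in>insert k S. metric_ip G x ((e(k := c *\<^sub>R u)) i) ((e(k := c *\<^sub>R u)) j) = (if i = j then 1 else 0)"
      using insert.hyps e orth c orth' by (auto simp: metric_ip_linear)
    then show ?case by blast
  qed auto
  from this[of UNIV] show ?thesis unfolding orthonormal_def by simp
qed

text \<open>With the \<open>e i\<close> as columns of \<open>E\<close> and their duals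
  \<open>G x *v e i\<close> as rows of \<open>F\<close>, orthonormality reads
  \<open>F ** E = mat 1\<close>. Then also \<open>E ** F = mat 1\<close>, and cyclicity of the trace
  gives the sum.\<close>

lemma trace_orthonormal:
  assumes x: "x \<in> U" and e: "orthonormal x e" and L: "linear L"
  shows "trace (matrix L) = (\<Sum>i\<in>UNIV. metric_ip G x (L (e i)) (e i))"
proof -
  define M where "M = matrix L"
  have M: "M *v v = L v" for v unfolding M_def using matrix_works[of L v] L by (simp add: linear_matrix_vector_mul_eq)
  define E where "E = (\<chi> a i. e i $ a)"
  define F where "F = (\<chi> i a. (G x *v e i) $ a)"
  have "(F ** E) $ i $ j = metric_ip G x (e j) (e i)" for i j
    by (simp add: F_def E_def matrix_matrix_mult_def metric_ip_def inner_vec_def mult.commute)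
  then have "F ** E = mat 1"
    using e by (auto simp: vec_eq_iff mat_def orthonormal_def)
  then have EF: "E ** F = mat 1" using matrix_left_right_inverse by blast
  have "trace M = trace (M ** (E ** F))" by (simp add: EF)
  also have "\<dots> = trace ((M ** E) ** F)" by (simp add: matrix_mul_assoc)
  also have "\<dots> = trace (F ** (M ** E))" by (rule trace_mul_sym)
  also have "\<dots> = (\<Sum>i\<in>UNIV. metric_ip G x (L (e i)) (e i))"
    unfolding trace_def
  proof (intro sum.cong refl)
    fix i
    have "(M ** E) $ a $ i = L (e i) $ a" for a
      by (simp add: M[symmetric] E_def matrix_matrix_mult_def matrix_vector_mult_def)
    then show "(F ** (M ** E)) $ i $ i = metric_ip G x (L (e i)) (e i)"
      unfolding matrix_matrix_mult_def[of F] by (simp add: F_def metric_ip_def inner_vec_def mult.commute)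
  qed
  finally show ?thesis by (simp add: M_def)
qed

lemma curvature_linear: assumes x: "x \<in> U" shows "linear (\<lambda>u. curvature G x u v w)"
  by (rule linearI) (simp_all add: curvature_eq[OF x] dGam_algebra[OF x] Gam_algebra algebra_simps)

text \<open>The trace of the curvature term of the second variation over the frame. The sign comes
  from \<open>curvature_antisym\<close>, which exchanges the last two vectors.\<close>

lemma ricci_orthonormal:
  assumes x: "x \<in> U" and e: "orthonormal x e"
  shows "(\<Sum>i\<in>UNIV. metric_ip G x (curvature G x (e i) v (e i)) v) = - ricci G x v v"
proof -
  have "ricci G x v v = (\<Sum>i\<in>UNIV. metric_ip G x (curvature G x (e i) v v) (e i))"
    unfolding ricci_eq by (rule trace_orthonormal[OF x e curvature_linear[OF x]])
  also have "\<dots> = (\<Sum>i\<in>UNIV. - metric_ip G x (curvature G x (e i) v (e i)) v)"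
    by (rule sum.cong[OF refl curvature_antisym[OF x]])
  finally show ?thesis by (simp add: sum_negf)
qed

lemma continuous_on_curvature:
  assumes "continuous_on S X" "continuous_on S A" "continuous_on S V" "continuous_on S W" "X ` S \<subseteq> U"
  shows "continuous_on S (\<lambda>p. curvature G (X p) (A p) (V p) (W p))"
proof -
  have "continuous_on S (\<lambda>p. dGam G (X p) (A p) (V p) (W p) + Gam G (X p) (A p) (Gam G (X p) (V p) (W p))
    - dGam G (X p) (V p) (A p) (W p) - Gam G (X p) (V p) (Gam G (X p) (A p) (W p)))"
    by (intro continuous_intros continuous_on_Gam continuous_on_dGam assms)
  then show ?thesis
    by (rule continuous_on_eq) (use assms(5) in \<open>auto simp: curvature_eq image_subset_iff\<close>)
qed

lemma curvature_scaleR: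
  assumes x: "x \<in> U"
  shows "curvature G x (a *\<^sub>R u) (b *\<^sub>R v) (c *\<^sub>R w) = (a * b * c) *\<^sub>R curvature G x u v w"
  by (simp add: curvature_eq[OF x] dGam_algebra[OF x] Gam_algebra algebra_simps)

section \<open>Drift of an almost parallel frame\<close>

lemma chris_lipschitz:
  assumes r: "cball x0 r \<subseteq> U"
  shows "\<exists>B>0. \<forall>x\<in>cball x0 r. \<forall>y\<in>cball x0 r. norm (chris_tensor G x - chris_tensor G y) \<le> B * norm (x - y)"
proof -
  define D where "D = (\<lambda>i x. frechet_derivative (chris_tensor G) (at x) (axis i 1))"
  have "bounded ((\<lambda>x. \<Sum>i\<in>UNIV. norm (D i x)) ` cball x0 r)"
    unfolding D_def
    by (intro compact_imp_bounded compact_continuous_image continuous_intros compact_cball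
        continuous_on_subset[OF chris_derivative_continuous r])
  then obtain B where B0: "B > 0" "\<forall>x\<in>cball x0 r. norm (\<Sum>i\<in>UNIV. norm (D i x)) \<le> B"
    unfolding bounded_pos by blast
  have B: "B > 0" "(\<Sum>i\<in>UNIV. norm (D i x)) \<le> B" if "x \<in> cball x0 r" for x
    using B0 that by (auto dest!: bspec abs_le_D1)
  have "norm (chris_tensor G x - chris_tensor G y) \<le> B * norm (x - y)" if "x \<in> cball x0 r" "y \<in> cball x0 r" for x y
  proof (rule differentiable_bound[OF convex_cball[of x0 r] _ _ that])
    fix z assume z: "z \<in> cball x0 r"
    then have zU: "z \<in> U" using r by blast
    show "(chris_tensor G has_derivative frechet_derivative (chris_tensor G) (at z)) (at z within cball x0 r)"
      by (rule has_derivative_at_withinI[OF chris_has_derivative[OF zU]])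
    show "onorm (frechet_derivative (chris_tensor G) (at z)) \<le> B"
    proof (rule onorm_le)
      fix u
      have "norm (frechet_derivative (chris_tensor G) (at z) u) \<le> (\<Sum>i\<in>UNIV. norm (u $ i *\<^sub>R D i z))"
        unfolding chris_derivative_expand[OF zU, of u] D_def by (rule norm_sum)
      also have "\<dots> \<le> (\<Sum>i\<in>UNIV. norm u * norm (D i z))"
        by (intro sum_mono) (simp add: mult_right_mono component_le_norm_cart)
      also have "\<dots> = norm u * (\<Sum>i\<in>UNIV. norm (D i z))" by (simp add: sum_distrib_left)
      also have "\<dots> \<le> norm u * B" by (intro mult_left_mono B(2)[OF z]) simp
      finally show "norm (frechet_derivative (chris_tensor G) (at z) u) \<le> B * norm u" by (simp add: mult.commute)
    qed
  qed
  then show ?thesis using B0(1) by blast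
qed

text \<open>Along the segment from \<open>y\<close> to \<open>z\<close> the extended vectors have
  covariant derivative of size O(|z - y|^2): one factor is the velocity, the other arises because
  the covariant derivative of the field vanishes at \<open>y\<close> and the Christoffel symbols are
  Lipschitz. Inner products are thus preserved to second order, the accuracy that a chain of many
  links requires.\<close>

lemma frame_drift:
  assumes r: "cball x0 r \<subseteq> U" and M: "M \<ge> 0"
  shows "\<exists>C>0. \<forall>y\<in>cball x0 r. \<forall>z\<in>cball x0 r. \<forall>e f. norm e \<le> M \<longrightarrow> norm f \<le> M \<longrightarrow>
    \<bar>metric_ip G z (e - Gam G y (z - y) e) (f - Gam G y (z - y) f) - metric_ip G y e f\<bar> \<le> C * (norm (z - y))\<^sup>2"
proof -
  obtain B where B: "B > 0" "\<And>x y. x \<in> cball x0 r \<Longrightarrow> y \<in> cball x0 r \<Longrightarrow> norm (chris_tensor G x - chris_tensor G y) \<le> B * norm (x - y)"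
    using chris_lipschitz[OF r] by blast
  obtain Q where Q: "Q > 0" "\<And>(T :: real ^ 'm ^ 'm ^ 'm) v w. norm (trilin T v w) \<le> Q * norm T * norm v * norm w"
    using norm_trilin_bound by blast
  have "bounded (chris_tensor G ` cball x0 r)"
    by (intro compact_imp_bounded compact_continuous_image compact_cball
        continuous_on_subset[OF Ck_on_imp_continuous_on[OF chris_Ck[of 0]] r])
  then obtain N where N: "N > 0" "\<And>x. x \<in> cball x0 r \<Longrightarrow> norm (chris_tensor G x) \<le> N"
    unfolding bounded_pos by auto
  obtain b where b: "b > 0" "\<And>x v w. x \<in> cball x0 r \<Longrightarrow> \<bar>metric_ip G x v w\<bar> \<le> b * norm v * norm w"
    using metric_ip_bound[OF compact_cball r] by blast
  define M' where "M' = M + Q * N * (2 * \<bar>r\<bar>) * M"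
  define C1 where "C1 = Q * B * M' + Q * N * (Q * N * M)"
  have M': "M' \<ge> 0" using Q N M by (simp add: M'_def)
  have C1: "C1 \<ge> 0" using Q N M B M' by (simp add: C1_def)
  have main: "\<bar>metric_ip G z (e - Gam G y (z - y) e) (f - Gam G y (z - y) f) - metric_ip G y e f\<bar> \<le> (2 * b * C1 * M') * (norm (z - y))\<^sup>2"
    if y: "y \<in> cball x0 r" and z: "z \<in> cball x0 r" and eM: "norm e \<le> M" and fM: "norm f \<le> M" for y z e f
  proof -
    define w where "w = z - y"
    define X where "X = (\<lambda>t::real. y + t *\<^sub>R w)"
    define V where "V = (\<lambda>e (t::real). e - t *\<^sub>R Gam G y w e)"
    have X: "X t \<in> cball x0 r" if "0 \<le> t" "t \<le> 1" for t
    proof -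
      have "X t = (1 - t) *\<^sub>R y + t *\<^sub>R z" by (simp add: X_def w_def algebra_simps)
      then show ?thesis using convexD_alt[OF convex_cball y z that] by simp
    qed
    have w2: "norm w \<le> 2 * \<bar>r\<bar>"
      using y z dist_triangle2[of z y x0] by (auto simp: w_def dist_norm norm_minus_commute)
    have G1: "norm (Gam G y w h) \<le> Q * N * norm w * M" if "norm h \<le> M" for h
    proof -
      have "norm (Gam G y w h) \<le> Q * norm (chris_tensor G y) * norm w * norm h" unfolding Gam_def by (rule Q(2))
      also have "\<dots> \<le> Q * N * norm w * M" using Q(1) N(1) N(2)[OF y] that M by (intro mult_mono) auto
      finally show ?thesis .
    qed
    have Vb: "norm (V h t) \<le> M'" if "0 \<le> t" "t \<le> 1" "norm h \<le> M" for h t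
    proof -
      have "norm (V h t) \<le> norm h + t * norm (Gam G y w h)"
        unfolding V_def using norm_triangle_ineq4[of h "t *\<^sub>R Gam G y w h"] that by simp
      also have "\<dots> \<le> M + 1 * (Q * N * norm w * M)"
        using that G1[OF that(3)] by (intro add_mono mult_mono) auto
      also have "\<dots> \<le> M'" unfolding M'_def mult_1 using w2 Q(1) N(1) M by (intro add_left_mono mult_right_mono mult_left_mono) auto
      finally show ?thesis .
    qed
    \<comment> \<open>The covariant derivative of \<open>V h\<close> along the segment. It splits
      into the change of the Christoffel symbols between \<open>y\<close> and \<open>X t\<close> and
      a term quadratic in them.\<close>
    have Bb: "norm (- Gam G y w h + Gam G (X t) w (V h t)) \<le> C1 * (norm w)\<^sup>2" if t: "0 \<le> t" "t \<le> 1" "norm h \<le> M" for h t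
    proof -
      have "- Gam G y w h + Gam G (X t) w (V h t) = trilin (chris_tensor G (X t) - chris_tensor G y) w (V h t) - t *\<^sub>R Gam G y w (Gam G y w h)"
        using trilin_tensor_algebra(1)[of "chris_tensor G (X t) - chris_tensor G y" "chris_tensor G y" w "V h t"]
        by (simp add: Gam_def V_def trilin_algebra)
      also have "norm \<dots> \<le> norm (trilin (chris_tensor G (X t) - chris_tensor G y) w (V h t)) + t * norm (Gam G y w (Gam G y w h))"
        using norm_triangle_ineq4[of "trilin (chris_tensor G (X t) - chris_tensor G y) w (V h t)" "t *\<^sub>R Gam G y w (Gam G y w h)"] t by simp
      also have "\<dots> \<le> Q * (B * norm w) * norm w * M' + 1 * (Q * N * norm w * (Q * N * norm w * M))"
      proof (intro add_mono mult_mono)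
        have "norm (chris_tensor G (X t) - chris_tensor G y) \<le> B * norm (X t - y)" by (rule B(2)[OF X[OF t(1,2)] y])
        also have "\<dots> \<le> B * norm w" using t B(1) by (simp add: X_def mult_left_le_one_le)
        finally have *: "norm (chris_tensor G (X t) - chris_tensor G y) \<le> B * norm w" .
        have "norm (trilin (chris_tensor G (X t) - chris_tensor G y) w (V h t)) \<le> Q * norm (chris_tensor G (X t) - chris_tensor G y) * norm w * norm (V h t)"
          by (rule Q(2))
        also have "\<dots> \<le> Q * (B * norm w) * norm w * M'" using * Vb[OF t] Q(1) B(1) by (intro mult_mono) auto
        finally show "norm (trilin (chris_tensor G (X t) - chris_tensor G y) w (V h t)) \<le> Q * (B * norm w) * norm w * M'" .
        have "norm (Gam G y w (Gam G y w h)) \<le> Q * norm (chris_tensor G y) * norm w * norm (Gam G y w h)" unfolding Gam_def[of G y w "Gam G y w h"] by (rule Q(2))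
        also have "\<dots> \<le> Q * N * norm w * (Q * N * norm w * M)" using N(2)[OF y] N(1) Q(1) G1[OF t(3)] by (intro mult_mono) auto
        finally show "norm (Gam G y w (Gam G y w h)) \<le> Q * N * norm w * (Q * N * norm w * M)" .
      qed (use t in auto)
      finally show ?thesis by (simp add: C1_def algebra_simps power2_eq_square)
    qed
    define \<phi> where "\<phi> = (\<lambda>t. metric_ip G (X t) (V e t) (V f t))"
    define \<phi>' where "\<phi>' = (\<lambda>t. metric_ip G (X t) (- Gam G y w e + Gam G (X t) w (V e t)) (V f t) + metric_ip G (X t) (V e t) (- Gam G y w f + Gam G (X t) w (V f t)))"
    have d: "(\<phi> has_real_derivative \<phi>' t) (at t)" if "0 \<le> t" "t \<le> 1" for t
      unfolding \<phi>_def \<phi>'_def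
      by (rule metric_ip_has_derivative)
         (use X[OF that] r in \<open>auto simp: X_def V_def intro!: derivative_eq_intros simp: has_vector_derivative_def\<close>)
    obtain t where t: "0 < t" "t < 1" "\<phi> 1 - \<phi> 0 = (1 - 0) * \<phi>' t"
      using MVT2[of 0 1 \<phi> \<phi>'] d by auto
    have t': "0 \<le> t" "t \<le> 1" using t by auto
    have "\<bar>\<phi>' t\<bar> \<le> \<bar>metric_ip G (X t) (- Gam G y w e + Gam G (X t) w (V e t)) (V f t)\<bar> + \<bar>metric_ip G (X t) (V e t) (- Gam G y w f + Gam G (X t) w (V f t))\<bar>"
      unfolding \<phi>'_def by (rule abs_triangle_ineq)
    also have "\<dots> \<le> b * (C1 * (norm w)\<^sup>2) * M' + b * M' * (C1 * (norm w)\<^sup>2)"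
    proof -
      have "\<bar>metric_ip G (X t) g h\<bar> \<le> b * p * q" if "norm g \<le> p" "norm h \<le> q" for g h p q
      proof -
        have "0 \<le> p" using that(1) norm_ge_zero order_trans by blast
        then have "b * norm g * norm h \<le> b * p * q"
          using that b(1) by (intro mult_mono) auto
        then show ?thesis using b(2)[OF X[OF t'], of g h] by simp
      qed
      then show ?thesis using Bb[OF t' eM] Bb[OF t' fM] Vb[OF t' eM] Vb[OF t' fM] by (intro add_mono) auto
    qed
    finally have "\<bar>\<phi> 1 - \<phi> 0\<bar> \<le> (2 * b * C1 * M') * (norm w)\<^sup>2" using t(3) by (simp add: algebra_simps)
    then show ?thesis by (simp add: \<phi>_def X_def V_def w_def)
  qed
  \<comment> \<open>\<open>M\<close> may be 0, and then so is the product; adding 1 makes the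
    constant positive.\<close>
  have "0 < 2 * b * C1 * M' + 1" using b(1) C1 M' by (simp add: add_nonneg_pos)
  moreover have "(2 * b * C1 * M') * q\<^sup>2 \<le> (2 * b * C1 * M' + 1) * q\<^sup>2" for q :: real by (simp add: algebra_simps)
  ultimately show ?thesis using main order_trans by blast
qed

text \<open>If every \<open>\<kappa>\<close> failed, a limit of counterexamples would violate the estimate at \<open>x = y = x\<^sub>0\<close> for an
  exactly orthonormal frame, where it is the Ricci bound.\<close>

lemma frame_estimate_unit:
  fixes \<Lambda> \<epsilon> Kr :: real
  assumes x0: "x0 \<in> U" and Kr: "Kr \<ge> 0" "\<And>v. ricci G x0 v v \<ge> - Kr * metric_ip G x0 v v"
    and \<Lambda>: "\<Lambda> \<ge> 0" and \<epsilon>: "\<epsilon> > 0"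
  shows "\<exists>\<kappa>::real. \<kappa> > 0 \<and> cball x0 \<kappa> \<subseteq> U \<and> (\<forall>x\<in>cball x0 \<kappa>. \<forall>y\<in>cball x0 \<kappa>. \<forall>(e :: 'm \<Rightarrow> real ^ 'm) l (a::real) v.
     (\<forall>i j. \<bar>metric_ip G y (e i) (e j) - (if i = j then 1 else 0)\<bar> \<le> \<kappa>) \<longrightarrow>
     (\<forall>u. \<bar>l \<bullet> u\<bar> \<le> (\<Lambda> + \<kappa>) * metric_norm G y u) \<longrightarrow> \<bar>a\<bar> \<le> 1 + \<kappa> \<longrightarrow> norm v = 1 \<longrightarrow>
     (let E = (\<lambda>i. e i - Gam G y (x - y) (e i)); N = (\<lambda>i. (l \<bullet> v) *\<^sub>R E i + a *\<^sub>R (Gam G x v (E i) - Gam G y v (e i)))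
      in (\<Sum>i\<in>UNIV. metric_ip G x (N i) (N i) + a\<^sup>2 * metric_ip G x (curvature G x (E i) v (E i)) v)
         \<le> (real CARD('m) * \<Lambda>\<^sup>2 + Kr + \<epsilon>) * metric_ip G x v v))"
proof (rule ccontr)
  assume neg: "\<not> ?thesis"
  obtain k0 where k0: "k0 > 0" "cball x0 k0 \<subseteq> U" using open_U x0 open_contains_cball by blast
  obtain a0 b0 where ab: "0 < a0" "0 < b0" "\<And>x v. x \<in> cball x0 k0 \<Longrightarrow> a0 * norm v \<le> metric_norm G x v"
    "\<And>x v. x \<in> cball x0 k0 \<Longrightarrow> metric_norm G x v \<le> b0 * norm v"
    using metric_norm_bounds[OF compact_cball k0(2)] by blast
  define \<Phi> where "\<Phi> = (\<lambda>(x, y, e :: real ^ 'm ^ 'm, l, a :: real, v).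
      (\<Sum>i\<in>UNIV. metric_ip G x ((l \<bullet> v) *\<^sub>R (e $ i - Gam G y (x - y) (e $ i)) + a *\<^sub>R (Gam G x v (e $ i - Gam G y (x - y) (e $ i)) - Gam G y v (e $ i)))
          ((l \<bullet> v) *\<^sub>R (e $ i - Gam G y (x - y) (e $ i)) + a *\<^sub>R (Gam G x v (e $ i - Gam G y (x - y) (e $ i)) - Gam G y v (e $ i)))
        + a\<^sup>2 * metric_ip G x (curvature G x (e $ i - Gam G y (x - y) (e $ i)) v (e $ i - Gam G y (x - y) (e $ i))) v)
       - (real CARD('m) * \<Lambda>\<^sup>2 + Kr + \<epsilon>) * metric_ip G x v v)"
  define bad where "bad = (\<lambda>(\<kappa>::real) (x, y, e :: real ^ 'm ^ 'm, l, a, v). x \<in> cball x0 \<kappa> \<and> y \<in> cball x0 \<kappa> \<and>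
     (\<forall>i j. \<bar>metric_ip G y (e $ i) (e $ j) - (if i = j then 1 else 0)\<bar> \<le> \<kappa>) \<and>
     (\<forall>u. \<bar>l \<bullet> u\<bar> \<le> (\<Lambda> + \<kappa>) * metric_norm G y u) \<and> \<bar>a\<bar> \<le> 1 + \<kappa> \<and> norm v = 1 \<and>
     \<Phi> (x, y, e, l, a, v) > 0)"
  have ex: "\<exists>p. bad \<kappa> p" if \<kappa>: "0 < \<kappa>" "\<kappa> \<le> k0" for \<kappa> :: real
  proof -
    have "cball x0 \<kappa> \<subseteq> U" using k0(2) \<kappa> by auto
    with neg \<kappa>(1) obtain x y and e :: "'m \<Rightarrow> real ^ 'm" and l and a :: real and v where
      "x \<in> cball x0 \<kappa>" "y \<in> cball x0 \<kappa>"
      "(\<forall>i j. \<bar>metric_ip G y (e i) (e j) - (if i = j then 1 else 0)\<bar> \<le> \<kappa>)"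
      "(\<forall>u. \<bar>l \<bullet> u\<bar> \<le> (\<Lambda> + \<kappa>) * metric_norm G y u)" "\<bar>a\<bar> \<le> 1 + \<kappa>" "norm v = 1"
      "\<not> (let E = (\<lambda>i. e i - Gam G y (x - y) (e i)); N = (\<lambda>i. (l \<bullet> v) *\<^sub>R E i + a *\<^sub>R (Gam G x v (E i) - Gam G y v (e i)))
      in (\<Sum>i\<in>UNIV. metric_ip G x (N i) (N i) + a\<^sup>2 * metric_ip G x (curvature G x (E i) v (E i)) v)
         \<le> (real CARD('m) * \<Lambda>\<^sup>2 + Kr + \<epsilon>) * metric_ip G x v v)"
      by blast
    then have "bad \<kappa> (x, y, \<chi> i. e i, l, a, v)" unfolding bad_def \<Phi>_def Let_def by simp
    then show ?thesis by blast
  qed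
  \<comment> \<open>Strictly below 1 / Suc n, as \<open>LIMSEQ_norm_0\<close> demands, and at most
    \<open>k0\<close>, so that all base points stay in one compact ball inside
    \<open>U\<close>.\<close>
  define \<kappa> where "\<kappa> = (\<lambda>n. min k0 (1 / real (Suc (Suc n))))"
  have \<kappa>: "0 < \<kappa> n" "\<kappa> n \<le> k0" "\<kappa> n \<le> 1" for n using k0(1) by (auto simp: \<kappa>_def min_le_iff_disj)
  have \<kappa>0: "\<kappa> \<longlonglongrightarrow> 0"
  proof (rule LIMSEQ_norm_0)
    have "\<kappa> n \<le> 1 / real (Suc (Suc n))" for n by (simp add: \<kappa>_def)
    moreover have "1 / real (Suc (Suc n)) < 1 / real (Suc n)" for n by (simp add: field_simps)
    ultimately show "norm (\<kappa> n) < 1 / real (Suc n)" for n using \<kappa>(1)[of n] le_less_trans by fastforce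
  qed
  have "\<exists>p. bad (\<kappa> n) p" for n using ex[OF \<kappa>(1,2)] .
  then obtain p where p: "\<And>n. bad (\<kappa> n) (p n)" by metis
  define x y e l a v where "x = (\<lambda>n. fst (p n))" and "y = (\<lambda>n. fst (snd (p n)))" and "e = (\<lambda>n. fst (snd (snd (p n))))"
    and "l = (\<lambda>n. fst (snd (snd (snd (p n)))))" and "a = (\<lambda>n. fst (snd (snd (snd (snd (p n))))))"
    and "v = (\<lambda>n. snd (snd (snd (snd (snd (p n))))))"
  have pe: "p n = (x n, y n, e n, l n, a n, v n)" for n
    by (simp add: x_def y_def e_def l_def a_def v_def)
  note P = p[unfolded pe bad_def prod.case]
  have xk: "x n \<in> cball x0 k0" "y n \<in> cball x0 k0" for n using P[of n] \<kappa>(2)[of n] by auto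
  \<comment> \<open>Near-orthonormality with tolerance at most 1 bounds the squared metric length of
    each vector by 2; the bound on the form \<open>l\<close>, tested on \<open>l\<close> itself,
    bounds \<open>l\<close>. So all counterexamples lie in the compact set \<open>T\<close>.\<close>
  have eb: "norm (e n $ i) \<le> sqrt 2 / a0" for n i
  proof -
    have "\<bar>metric_ip G (y n) (e n $ i) (e n $ i) - 1\<bar> \<le> \<kappa> n" using P[of n] by metis
    then have "metric_norm G (y n) (e n $ i) \<le> sqrt 2"
      unfolding metric_norm_def using \<kappa>(3)[of n] by (intro real_sqrt_le_mono) simp
    then have "a0 * norm (e n $ i) \<le> sqrt 2" using ab(3)[OF xk(2)] order_trans by blast
    then show ?thesis using ab(1) by (simp add: field_simps)
  qed
  have ebb: "norm (e n) \<le> real CARD('m) * (sqrt 2 / a0)" for n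
  proof -
    have "norm (e n) \<le> (\<Sum>i\<in>UNIV. norm (e n $ i))"
      unfolding norm_vec_def by (rule L2_set_le_sum) simp
    also have "\<dots> \<le> (\<Sum>i\<in>(UNIV::'m set). sqrt 2 / a0)" by (rule sum_mono) (rule eb)
    finally show ?thesis by simp
  qed
  have lb: "norm (l n) \<le> (\<Lambda> + 1) * b0" for n
  proof (cases "l n = 0")
    case False
    have "(norm (l n))\<^sup>2 \<le> (\<Lambda> + \<kappa> n) * metric_norm G (y n) (l n)"
      using P[of n] by (metis abs_of_nonneg inner_ge_zero power2_norm_eq_inner)
    also have "\<dots> \<le> (\<Lambda> + 1) * (b0 * norm (l n))"
      using \<kappa>[of n] \<Lambda> ab(4)[OF xk(2)] xk(2) k0 by (intro mult_mono) (auto intro!: metric_norm_nonneg)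
    finally show ?thesis using False by (simp add: power2_eq_square)
  qed (use \<Lambda> ab in simp)
  define T where "T = cball x0 k0 \<times> cball x0 k0 \<times> cball (0 :: real ^ 'm ^ 'm) (real CARD('m) * (sqrt 2 / a0))
     \<times> cball (0 :: real ^ 'm) ((\<Lambda> + 1) * b0) \<times> cball (0::real) 2 \<times> sphere (0 :: real ^ 'm) 1"
  have T: "compact T" unfolding T_def by (intro compact_Times compact_cball compact_sphere)
  have pT: "p n \<in> T" for n
    using xk[of n] ebb[of n] lb[of n] P[of n] \<kappa>(3)[of n] unfolding pe T_def by (auto simp: dist_norm)
  obtain p0 r where pr: "p0 \<in> T" "strict_mono r" "(p \<circ> r) \<longlonglongrightarrow> p0"
    using T pT unfolding compact_def by blast
  obtain x' y' e' l' a' v' where p0: "p0 = (x', y', e', l', a', v')" by (metis prod_cases6)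
  have lim: "(\<lambda>n. x (r n)) \<longlonglongrightarrow> x'" "(\<lambda>n. y (r n)) \<longlonglongrightarrow> y'" "(\<lambda>n. e (r n)) \<longlonglongrightarrow> e'" "(\<lambda>n. l (r n)) \<longlonglongrightarrow> l'"
     "(\<lambda>n. a (r n)) \<longlonglongrightarrow> a'" "(\<lambda>n. v (r n)) \<longlonglongrightarrow> v'"
  proof -
    have q: "(\<lambda>n. p (r n)) \<longlonglongrightarrow> p0" using pr(3) by (simp add: o_def)
    note q1 = tendsto_snd[OF q] note q2 = tendsto_snd[OF q1] note q3 = tendsto_snd[OF q2] note q4 = tendsto_snd[OF q3]
    show "(\<lambda>n. x (r n)) \<longlonglongrightarrow> x'" "(\<lambda>n. y (r n)) \<longlonglongrightarrow> y'" "(\<lambda>n. e (r n)) \<longlonglongrightarrow> e'" "(\<lambda>n. l (r n)) \<longlonglongrightarrow> l'"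
     "(\<lambda>n. a (r n)) \<longlonglongrightarrow> a'" "(\<lambda>n. v (r n)) \<longlonglongrightarrow> v'"
      using tendsto_fst[OF q] tendsto_fst[OF q1] tendsto_fst[OF q2] tendsto_fst[OF q3] tendsto_fst[OF q4] tendsto_snd[OF q4]
      by (simp_all add: pe p0)
  qed
  have \<kappa>r: "(\<lambda>n. \<kappa> (r n)) \<longlonglongrightarrow> 0" using LIMSEQ_subseq_LIMSEQ[OF \<kappa>0 pr(2)] by (simp add: o_def)
  have x': "x' = x0" and y': "y' = x0"
  proof -
    have *: "z' = x0" if "\<And>n. z n \<in> cball x0 (\<kappa> n)" "(\<lambda>n. z (r n)) \<longlonglongrightarrow> z'" for z z'
    proof -
      have "(\<lambda>n. dist x0 (z (r n))) \<longlonglongrightarrow> 0"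
        by (rule tendsto_sandwich[OF _ _ tendsto_const \<kappa>r]) (use that(1) in \<open>auto intro!: always_eventually\<close>)
      moreover have "(\<lambda>n. dist x0 (z (r n))) \<longlonglongrightarrow> dist x0 z'" by (intro tendsto_intros that)
      ultimately show ?thesis using LIMSEQ_unique by fastforce
    qed
    show "x' = x0" "y' = x0" using *[OF _ lim(1)] *[OF _ lim(2)] P by blast+
  qed
  have cip: "continuous_on (cball x0 k0 \<times> UNIV) (\<lambda>p. metric_ip G (fst p) (fst (snd p)) (snd (snd p)))"
    by (intro continuous_on_metric_ip continuous_intros) (use k0 in auto)
  have ipl: "(\<lambda>n. metric_ip G (y (r n)) (V n) (W n)) \<longlonglongrightarrow> metric_ip G x0 V' W'" if "V \<longlonglongrightarrow> V'" "W \<longlonglongrightarrow> W'" for V W V' W'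
    using continuous_on_tendsto_compose[OF cip tendsto_Pair[OF lim(2) tendsto_Pair[OF that]]] xk y' k0(1) by simp
  have on: "orthonormal x0 (\<lambda>i. e' $ i)"
    unfolding orthonormal_def
  proof (intro allI)
    fix i j
    have "(\<lambda>n. \<bar>metric_ip G (y (r n)) (e (r n) $ i) (e (r n) $ j) - (if i = j then 1 else 0)\<bar>) \<longlonglongrightarrow> \<bar>metric_ip G x0 (e' $ i) (e' $ j) - (if i = j then 1 else 0)\<bar>"
      by (intro tendsto_intros ipl lim)
    moreover have "(\<lambda>n. \<bar>metric_ip G (y (r n)) (e (r n) $ i) (e (r n) $ j) - (if i = j then 1 else 0)\<bar>) \<longlonglongrightarrow> 0"
      by (rule tendsto_sandwich[OF _ _ tendsto_const \<kappa>r]) (use P in \<open>auto intro!: always_eventually\<close>)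
    ultimately show "metric_ip G x0 (e' $ i) (e' $ j) = (if i = j then 1 else 0)" using LIMSEQ_unique by fastforce
  qed
  have lv: "\<bar>l' \<bullet> v'\<bar> \<le> \<Lambda> * metric_norm G x0 v'"
  proof (rule LIMSEQ_le)
    show "(\<lambda>n. \<bar>l (r n) \<bullet> v'\<bar>) \<longlonglongrightarrow> \<bar>l' \<bullet> v'\<bar>" by (intro tendsto_intros lim)
    have "(\<lambda>n. (\<Lambda> + \<kappa> (r n)) * metric_norm G (y (r n)) v') \<longlonglongrightarrow> (\<Lambda> + 0) * metric_norm G x0 v'"
      unfolding metric_norm_def by (intro tendsto_intros ipl \<kappa>r)
    then show "(\<lambda>n. (\<Lambda> + \<kappa> (r n)) * metric_norm G (y (r n)) v') \<longlonglongrightarrow> \<Lambda> * metric_norm G x0 v'" by simp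
  qed (use P in auto)
  have a': "\<bar>a'\<bar> \<le> 1"
  proof (rule LIMSEQ_le)
    show "(\<lambda>n. \<bar>a (r n)\<bar>) \<longlonglongrightarrow> \<bar>a'\<bar>" by (intro tendsto_intros lim)
    show "(\<lambda>n. 1 + \<kappa> (r n)) \<longlonglongrightarrow> 1" using tendsto_add[OF tendsto_const[of 1] \<kappa>r] by simp
  qed (use P in auto)
  have v': "norm v' = 1" using pr(1) unfolding p0 T_def by simp
  have c\<Phi>: "continuous_on T \<Phi>"
    unfolding \<Phi>_def split_beta
    by (intro continuous_intros continuous_on_metric_ip continuous_on_Gam continuous_on_curvature) (use k0 in \<open>auto simp: T_def\<close>)
  have "\<Phi> p0 \<ge> 0"
  proof (rule LIMSEQ_le_const)
    show "(\<lambda>n. \<Phi> (p (r n))) \<longlonglongrightarrow> \<Phi> p0"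
      by (rule continuous_on_tendsto_compose[OF c\<Phi>]) (use pr pT in \<open>simp_all add: o_def\<close>)
    show "\<exists>N. \<forall>n\<ge>N. 0 \<le> \<Phi> (p (r n))" using P unfolding pe by (auto intro!: less_imp_le)
  qed
  moreover have "\<Phi> p0 < 0"
  proof -
    have vp: "metric_ip G x0 v' v' > 0" using ip_pos[OF x0, of v'] v' by force
    have l2: "(l' \<bullet> v')\<^sup>2 \<le> \<Lambda>\<^sup>2 * metric_ip G x0 v' v'"
    proof -
      have "\<bar>l' \<bullet> v'\<bar>\<^sup>2 \<le> (\<Lambda> * metric_norm G x0 v')\<^sup>2" using lv by (intro power_mono) auto
      then show ?thesis by (simp add: power_mult_distrib metric_norm_sq[OF x0])
    qed
    have a2: "a'\<^sup>2 \<le> 1" using a' by (simp add: abs_square_le_1)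
    have "a'\<^sup>2 * - ricci G x0 v' v' \<le> a'\<^sup>2 * (Kr * metric_ip G x0 v' v')"
      using Kr(2)[of v'] by (intro mult_left_mono) auto
    also have "\<dots> \<le> 1 * (Kr * metric_ip G x0 v' v')" using a2 Kr(1) vp by (intro mult_right_mono) auto
    finally have ric: "a'\<^sup>2 * - ricci G x0 v' v' \<le> Kr * metric_ip G x0 v' v'" by simp
    have on1: "metric_ip G x0 (e' $ i) (e' $ i) = 1" for i using on by (simp add: orthonormal_def)
    \<comment> \<open>Both base points are now \<open>x0\<close>, so the two Christoffel terms in
      \<open>N\<close> cancel and only a multiple of the frame vector remains; its squared length is
      the square of that multiple because the limit frame is orthonormal.\<close>
    have "\<Phi> p0 = (\<Sum>i\<in>(UNIV::'m set). (l' \<bullet> v')\<^sup>2) + a'\<^sup>2 * (\<Sum>i\<in>UNIV. metric_ip G x0 (curvature G x0 (e' $ i) v' (e' $ i)) v')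
       - (real CARD('m) * \<Lambda>\<^sup>2 + Kr + \<epsilon>) * metric_ip G x0 v' v'"
      unfolding \<Phi>_def p0 prod.case x' y'
      by (simp add: Gam_algebra metric_ip_linear on1 sum.distrib sum_distrib_left power2_eq_square)
    also have "\<dots> = CARD('m) * (l' \<bullet> v')\<^sup>2 + a'\<^sup>2 * - ricci G x0 v' v' - (real CARD('m) * \<Lambda>\<^sup>2 + Kr + \<epsilon>) * metric_ip G x0 v' v'"
      unfolding ricci_orthonormal[OF x0 on] by simp
    also have "\<dots> \<le> CARD('m) * (\<Lambda>\<^sup>2 * metric_ip G x0 v' v') + Kr * metric_ip G x0 v' v' - (real CARD('m) * \<Lambda>\<^sup>2 + Kr + \<epsilon>) * metric_ip G x0 v' v'"
      using l2 ric by (intro diff_right_mono add_mono mult_left_mono) auto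
    also have "\<dots> = - \<epsilon> * metric_ip G x0 v' v'" by (simp add: algebra_simps)
    also have "\<dots> < 0" using \<epsilon> vp by simp
    finally show ?thesis .
  qed
  ultimately show False by simp
qed

text \<open>Both sides are quadratic in \<open>v\<close>. The restriction to unit vectors served the
  compactness argument and is removed by scaling.\<close>

lemma frame_estimate:
  fixes \<Lambda> \<epsilon> Kr :: real
  assumes x0: "x0 \<in> U" and Kr: "Kr \<ge> 0" "\<And>v. ricci G x0 v v \<ge> - Kr * metric_ip G x0 v v"
    and \<Lambda>: "\<Lambda> \<ge> 0" and \<epsilon>: "\<epsilon> > 0"
  shows "\<exists>\<kappa>::real. \<kappa> > 0 \<and> cball x0 \<kappa> \<subseteq> U \<and> (\<forall>x\<in>cball x0 \<kappa>. \<forall>y\<in>cball x0 \<kappa>. \<forall>(e :: 'm \<Rightarrow> real ^ 'm) l (a::real) v.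
     (\<forall>i j. \<bar>metric_ip G y (e i) (e j) - (if i = j then 1 else 0)\<bar> \<le> \<kappa>) \<longrightarrow>
     (\<forall>u. \<bar>l \<bullet> u\<bar> \<le> (\<Lambda> + \<kappa>) * metric_norm G y u) \<longrightarrow> \<bar>a\<bar> \<le> 1 + \<kappa> \<longrightarrow>
     (let E = (\<lambda>i. e i - Gam G y (x - y) (e i)); N = (\<lambda>i. (l \<bullet> v) *\<^sub>R E i + a *\<^sub>R (Gam G x v (E i) - Gam G y v (e i)))
      in (\<Sum>i\<in>UNIV. metric_ip G x (N i) (N i) + a\<^sup>2 * metric_ip G x (curvature G x (E i) v (E i)) v)
         \<le> (real CARD('m) * \<Lambda>\<^sup>2 + Kr + \<epsilon>) * metric_ip G x v v))"
proof -
  obtain \<kappa> :: real where \<kappa>: "\<kappa> > 0" "cball x0 \<kappa> \<subseteq> U" and est: "\<And>x y (e :: 'm \<Rightarrow> real ^ 'm) l (a::real) v.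
     x \<in> cball x0 \<kappa> \<Longrightarrow> y \<in> cball x0 \<kappa> \<Longrightarrow>
     (\<forall>i j. \<bar>metric_ip G y (e i) (e j) - (if i = j then 1 else 0)\<bar> \<le> \<kappa>) \<Longrightarrow>
     (\<forall>u. \<bar>l \<bullet> u\<bar> \<le> (\<Lambda> + \<kappa>) * metric_norm G y u) \<Longrightarrow> \<bar>a\<bar> \<le> 1 + \<kappa> \<Longrightarrow> norm v = 1 \<Longrightarrow>
     (let E = (\<lambda>i. e i - Gam G y (x - y) (e i)); N = (\<lambda>i. (l \<bullet> v) *\<^sub>R E i + a *\<^sub>R (Gam G x v (E i) - Gam G y v (e i)))
      in (\<Sum>i\<in>UNIV. metric_ip G x (N i) (N i) + a\<^sup>2 * metric_ip G x (curvature G x (E i) v (E i)) v)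
         \<le> (real CARD('m) * \<Lambda>\<^sup>2 + Kr + \<epsilon>) * metric_ip G x v v)"
    using frame_estimate_unit[OF x0 Kr \<Lambda> \<epsilon>] by blast
  show ?thesis
  proof (intro exI[of _ \<kappa>] conjI \<kappa> ballI allI impI)
    fix x y v l and e :: "'m \<Rightarrow> real ^ 'm" and a :: real
    assume xy: "x \<in> cball x0 \<kappa>" "y \<in> cball x0 \<kappa>"
      and h: "\<forall>i j. \<bar>metric_ip G y (e i) (e j) - (if i = j then 1 else 0)\<bar> \<le> \<kappa>"
        "\<forall>u. \<bar>l \<bullet> u\<bar> \<le> (\<Lambda> + \<kappa>) * metric_norm G y u" "\<bar>a\<bar> \<le> 1 + \<kappa>"
    have xU: "x \<in> U" using xy \<kappa> by blast
    define E where "E = (\<lambda>i. e i - Gam G y (x - y) (e i))"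
    define N where "N = (\<lambda>v i. (l \<bullet> v) *\<^sub>R E i + a *\<^sub>R (Gam G x v (E i) - Gam G y v (e i)))"
    obtain w0 :: "real ^ 'm" where w0: "norm w0 = 1" using vector_choose_size[of 1] by auto
    define w where "w = (if v = 0 then w0 else (1 / norm v) *\<^sub>R v)"
    have w: "norm w = 1" "v = norm v *\<^sub>R w" unfolding w_def using w0 by auto
    have N: "N (c *\<^sub>R w) i = c *\<^sub>R N w i" for c i
      by (simp add: N_def Gam_algebra algebra_simps)
    have C: "curvature G x (E i) (c *\<^sub>R w) (E i) = c *\<^sub>R curvature G x (E i) w (E i)" for c i
      using curvature_scaleR[OF xU, of 1 _ c _ 1] by simp
    have "(\<Sum>i\<in>UNIV. metric_ip G x (N w i) (N w i) + a\<^sup>2 * metric_ip G x (curvature G x (E i) w (E i)) w)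
         \<le> (real CARD('m) * \<Lambda>\<^sup>2 + Kr + \<epsilon>) * metric_ip G x w w" (is "?S w \<le> _")
      using est[OF xy h w(1)] unfolding Let_def E_def N_def .
    then have "(norm v)\<^sup>2 * ?S w \<le> (norm v)\<^sup>2 * ((real CARD('m) * \<Lambda>\<^sup>2 + Kr + \<epsilon>) * metric_ip G x w w)"
      by (intro mult_left_mono) auto
    moreover have "?S (norm v *\<^sub>R w) = (norm v)\<^sup>2 * ?S w"
      unfolding N C by (simp add: metric_ip_linear sum_distrib_left power2_eq_square algebra_simps)
    moreover have "metric_ip G x (norm v *\<^sub>R w) (norm v *\<^sub>R w) = (norm v)\<^sup>2 * metric_ip G x w w"
      by (simp add: metric_ip_linear power2_eq_square)
    ultimately have "?S v \<le> (real CARD('m) * \<Lambda>\<^sup>2 + Kr + \<epsilon>) * metric_ip G x v v"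
      using w(2) by (simp add: mult_ac)
    then show "let E = (\<lambda>i. e i - Gam G y (x - y) (e i)); N = (\<lambda>i. (l \<bullet> v) *\<^sub>R E i + a *\<^sub>R (Gam G x v (E i) - Gam G y v (e i)))
      in (\<Sum>i\<in>UNIV. metric_ip G x (N i) (N i) + a\<^sup>2 * metric_ip G x (curvature G x (E i) v (E i)) v)
         \<le> (real CARD('m) * \<Lambda>\<^sup>2 + Kr + \<epsilon>) * metric_ip G x v v"
      unfolding Let_def E_def N_def .
  qed
qed

end

section \<open>Curves, length and distance\<close>

text \<open>Induction on the number of break points strictly inside the interval; an interval
  containing one is cut there.\<close>

lemma interval_split_induct [consumes 2, case_names base join]:
  fixes P :: "real \<Rightarrow> real \<Rightarrow> bool"
  assumes "finite S" "a < b"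
    and base: "\<And>u v. a \<le> u \<Longrightarrow> u < v \<Longrightarrow> v \<le> b \<Longrightarrow> {u<..<v} \<inter> S = {} \<Longrightarrow> P u v"
    and join: "\<And>u v w. a \<le> u \<Longrightarrow> u < v \<Longrightarrow> v < w \<Longrightarrow> w \<le> b \<Longrightarrow> P u v \<Longrightarrow> P v w \<Longrightarrow> P u w"
  shows "P a b"
proof -
  have "P u w" if "card (S \<inter> {u<..<w}) = n" "a \<le> u" "u < w" "w \<le> b" for n u w
    using that
  proof (induction n arbitrary: u w rule: less_induct)
    case (less n)
    show ?case
    proof (cases "S \<inter> {u<..<w} = {}")
      case True then show ?thesis using base less.prems by (simp add: inf_commute)
    next
      case False
      then obtain v where v: "v \<in> S" "u < v" "v < w" by auto
      have "card (S \<inter> {u<..<v}) < card (S \<inter> {u<..<w})" "card (S \<inter> {v<..<w}) < card (S \<inter> {u<..<w})"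
        using v assms(1) by (intro psubset_card_mono; auto)+
      then have "P u v" "P v w" using less v by auto
      then show ?thesis using join less.prems v by blast
    qed
  qed
  then show ?thesis using assms(2) by blast
qed

text \<open>As for the Christoffel tensor, expansion in a basis turns continuity for fixed
  directions into continuity along a moving direction.\<close>

lemma frechet_derivative_continuous:
  fixes h :: "'a::euclidean_space \<Rightarrow> 'b::real_normed_vector"
  assumes C: "Ck_on (Suc 0) h S" and c: "continuous_on N X" "continuous_on N D" "X ` N \<subseteq> S"
  shows "continuous_on N (\<lambda>t. frechet_derivative h (at (X t)) (D t))"
proof -
  have "continuous_on N (\<lambda>t. \<Sum>i\<in>Basis. (D t \<bullet> i) *\<^sub>R frechet_derivative h (at (X t)) i)"
    using Ck_on_SucD(2)[OF C] by (intro continuous_intros c continuous_on_compose2[OF _ c(1,3)]) auto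
  then show ?thesis
  proof (rule continuous_on_eq)
    fix t assume "t \<in> N"
    then have l: "linear (frechet_derivative h (at (X t)))"
      using Ck_on_SucD(1)[OF C] c(3) has_derivative_linear by blast
    have "frechet_derivative h (at (X t)) (D t) = frechet_derivative h (at (X t)) (\<Sum>i\<in>Basis. (D t \<bullet> i) *\<^sub>R i)"
      by (simp add: euclidean_representation)
    then show "(\<Sum>i\<in>Basis. (D t \<bullet> i) *\<^sub>R frechet_derivative h (at (X t)) i) = frechet_derivative h (at (X t)) (D t)"
      by (simp add: linear_sum[OF l] linear_scale[OF l])
  qed
qed

abbreviation chart_range :: "('a, 'm) chart \<Rightarrow> (real ^ 'm) set" where
  "chart_range c \<equiv> snd c ` fst c"

definition chart_pt :: "('a, 'm) chart \<Rightarrow> real ^ 'm \<Rightarrow> 'a" where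
  "chart_pt c = inv_into (fst c) (snd c)"

definition chart_trans :: "('a, 'm) chart \<Rightarrow> ('a, 'm) chart \<Rightarrow> real ^ 'm \<Rightarrow> real ^ 'm" where
  "chart_trans c c' = coord_expr c (snd c')"

text \<open>\<open>piecewise_C1_curve\<close> on an arbitrary interval, so that curves can be cut
  and joined without rescaling to [0,1] each time.\<close>

definition piecewise_C1_on :: "('a::topological_space, 'm::finite) chart set \<Rightarrow> real \<Rightarrow> real \<Rightarrow> (real \<Rightarrow> 'a) \<Rightarrow> bool" where
  "piecewise_C1_on A a b \<gamma> \<longleftrightarrow> (\<exists>S. finite S \<and>
     (\<forall>u v. a \<le> u \<longrightarrow> u < v \<longrightarrow> v \<le> b \<longrightarrow> {u<..<v} \<inter> S = {} \<longrightarrow> C1_curve_on A u v \<gamma>))"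

section \<open>Restriction, joining and affine reparametrization of curves\<close>

lemma piecewise_C1_curve_iff: "piecewise_C1_curve A \<gamma> \<longleftrightarrow> piecewise_C1_on A 0 1 \<gamma>"
  unfolding piecewise_C1_curve_def piecewise_C1_on_def by blast

lemma C1_curve_on_cong:
  assumes "C1_curve_on A a b \<gamma>" "\<And>t. a \<le> t \<Longrightarrow> t \<le> b \<Longrightarrow> \<gamma> t = \<gamma>' t"
  shows "C1_curve_on A a b \<gamma>'"
  unfolding C1_curve_on_def
proof (intro conjI ballI)
  show "continuous_on {a..b} \<gamma>'"
    using assms continuous_on_cong[of "{a..b}" "{a..b}" \<gamma> \<gamma>'] unfolding C1_curve_on_def by simp
  fix c assume "c \<in> A"
  then obtain D where D: "\<forall>t\<in>{t\<in>{a..b}. \<gamma> t \<in> fst c}. ((snd c \<circ> \<gamma>) has_vector_derivative D t) (at t within {a..b})"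
     "continuous_on {t\<in>{a..b}. \<gamma> t \<in> fst c} D"
    using assms(1) unfolding C1_curve_on_def by blast
  have eq: "{t\<in>{a..b}. \<gamma>' t \<in> fst c} = {t\<in>{a..b}. \<gamma> t \<in> fst c}" using assms(2) by auto
  have "((snd c \<circ> \<gamma>') has_vector_derivative D t) (at t within {a..b})" if "t \<in> {t\<in>{a..b}. \<gamma> t \<in> fst c}" for t
    by (rule has_vector_derivative_transform[of t "{a..b}" _ "snd c \<circ> \<gamma>"]) (use D that assms(2) in auto)
  then show "\<exists>D. (\<forall>t\<in>{t\<in>{a..b}. \<gamma>' t \<in> fst c}. ((snd c \<circ> \<gamma>') has_vector_derivative D t) (at t within {a..b})) \<and>
      continuous_on {t\<in>{a..b}. \<gamma>' t \<in> fst c} D"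
    unfolding eq using D(2) by blast
qed

lemma C1_curve_on_affine:
  assumes "C1_curve_on A a b \<gamma>" "\<And>t. u \<le> t \<Longrightarrow> t \<le> v \<Longrightarrow> a \<le> m * t + k \<and> m * t + k \<le> b"
  shows "C1_curve_on A u v (\<lambda>t. \<gamma> (m * t + k))"
  unfolding C1_curve_on_def
proof (intro conjI ballI)
  define \<phi> where "\<phi> = (\<lambda>t. m * t + k)"
  have im: "\<phi> ` {u..v} \<subseteq> {a..b}" using assms(2) by (auto simp: \<phi>_def)
  have c\<phi>: "continuous_on T \<phi>" for T unfolding \<phi>_def by (intro continuous_intros)
  have "continuous_on {a..b} \<gamma>" using assms(1) unfolding C1_curve_on_def by blast
  from continuous_on_compose2[OF this c\<phi> im]
  show "continuous_on {u..v} (\<lambda>t. \<gamma> (m * t + k))" unfolding \<phi>_def .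
  fix c assume "c \<in> A"
  then obtain D where D: "\<forall>t\<in>{t\<in>{a..b}. \<gamma> t \<in> fst c}. ((snd c \<circ> \<gamma>) has_vector_derivative D t) (at t within {a..b})"
     "continuous_on {t\<in>{a..b}. \<gamma> t \<in> fst c} D"
    using assms(1) unfolding C1_curve_on_def by blast
  have "((snd c \<circ> (\<lambda>t. \<gamma> (m * t + k))) has_vector_derivative m *\<^sub>R D (\<phi> t)) (at t within {u..v})"
    if t: "t \<in> {u..v}" "\<gamma> (m * t + k) \<in> fst c" for t
  proof -
    have 1: "(\<phi> has_vector_derivative m) (at t within {u..v})"
      unfolding \<phi>_def by (auto intro!: derivative_eq_intros simp: has_vector_derivative_def)
    have "\<phi> t \<in> {t\<in>{a..b}. \<gamma> t \<in> fst c}" using t im by (auto simp: \<phi>_def image_subset_iff)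
    then have 2: "((snd c \<circ> \<gamma>) has_vector_derivative D (\<phi> t)) (at (\<phi> t) within \<phi> ` {u..v})"
      using D(1) has_vector_derivative_within_subset[OF _ im] by blast
    show ?thesis using vector_diff_chain_within[OF 1 2] by (simp add: o_def \<phi>_def)
  qed
  moreover have "continuous_on {t\<in>{u..v}. \<gamma> (m * t + k) \<in> fst c} (\<lambda>t. m *\<^sub>R D (\<phi> t))"
    by (intro continuous_intros continuous_on_compose2[OF D(2) c\<phi>]) (use im in \<open>auto simp: \<phi>_def image_subset_iff\<close>)
  ultimately show "\<exists>D. (\<forall>t\<in>{t\<in>{u..v}. \<gamma> (m * t + k) \<in> fst c}. ((snd c \<circ> (\<lambda>t. \<gamma> (m * t + k))) has_vector_derivative D t) (at t within {u..v})) \<and>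
      continuous_on {t\<in>{u..v}. \<gamma> (m * t + k) \<in> fst c} D"
    by (intro exI[of _ "\<lambda>t. m *\<^sub>R D (\<phi> t)"] conjI ballI) simp_all
qed

lemma piecewise_C1_on_subinterval: "piecewise_C1_on A a b \<gamma> \<Longrightarrow> a \<le> u \<Longrightarrow> v \<le> b \<Longrightarrow> piecewise_C1_on A u v \<gamma>"
  unfolding piecewise_C1_on_def by (meson order_trans)

lemma piecewise_C1_on_join:
  assumes "piecewise_C1_on A a b \<gamma>" "piecewise_C1_on A b c \<gamma>"
  shows "piecewise_C1_on A a c \<gamma>"
proof -
  obtain S T where S: "finite S" "\<And>u v. a \<le> u \<Longrightarrow> u < v \<Longrightarrow> v \<le> b \<Longrightarrow> {u<..<v} \<inter> S = {} \<Longrightarrow> C1_curve_on A u v \<gamma>"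
    and T: "finite T" "\<And>u v. b \<le> u \<Longrightarrow> u < v \<Longrightarrow> v \<le> c \<Longrightarrow> {u<..<v} \<inter> T = {} \<Longrightarrow> C1_curve_on A u v \<gamma>"
    using assms unfolding piecewise_C1_on_def by meson
  show ?thesis unfolding piecewise_C1_on_def
  proof (intro exI[of _ "insert b (S \<union> T)"] conjI allI impI)
    fix u v assume h: "a \<le> u" "u < v" "v \<le> c" "{u<..<v} \<inter> insert b (S \<union> T) = {}"
    then have "v \<le> b \<or> b \<le> u" by auto
    then show "C1_curve_on A u v \<gamma>"
    proof
      assume "v \<le> b"
      show ?thesis by (rule S(2)) (use h \<open>v \<le> b\<close> in auto)
    next
      assume "b \<le> u"
      show ?thesis by (rule T(2)) (use h \<open>b \<le> u\<close> in auto)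
    qed
  qed (use S T in auto)
qed

lemma piecewise_C1_on_cong:
  assumes "piecewise_C1_on A a b \<gamma>" "\<And>t. a \<le> t \<Longrightarrow> t \<le> b \<Longrightarrow> \<gamma> t = \<gamma>' t"
  shows "piecewise_C1_on A a b \<gamma>'"
proof -
  obtain S where S: "finite S" "\<And>u v. a \<le> u \<Longrightarrow> u < v \<Longrightarrow> v \<le> b \<Longrightarrow> {u<..<v} \<inter> S = {} \<Longrightarrow> C1_curve_on A u v \<gamma>"
    using assms(1) unfolding piecewise_C1_on_def by meson
  have "C1_curve_on A u v \<gamma>'" if "a \<le> u" "u < v" "v \<le> b" "{u<..<v} \<inter> S = {}" for u v
    by (rule C1_curve_on_cong[OF S(2)[OF that]]) (use that assms(2) in auto)
  then show ?thesis unfolding piecewise_C1_on_def using S(1) by (intro exI[of _ S]) simp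
qed

lemma piecewise_C1_on_affine:
  assumes "piecewise_C1_on A a b \<gamma>" "m \<noteq> 0" "\<And>t. u \<le> t \<Longrightarrow> t \<le> v \<Longrightarrow> a \<le> m * t + k \<and> m * t + k \<le> b"
  shows "piecewise_C1_on A u v (\<lambda>t. \<gamma> (m * t + k))"
proof -
  obtain S where S: "finite S" "\<And>u v. a \<le> u \<Longrightarrow> u < v \<Longrightarrow> v \<le> b \<Longrightarrow> {u<..<v} \<inter> S = {} \<Longrightarrow> C1_curve_on A u v \<gamma>"
    using assms(1) unfolding piecewise_C1_on_def by meson
  define S' where "S' = (\<lambda>t. m * t + k) -` S"
  have "finite S'" unfolding S'_def by (rule finite_vimageI[OF S(1)]) (use assms(2) in \<open>auto simp: inj_on_def\<close>)
  moreover have "C1_curve_on A p q (\<lambda>t. \<gamma> (m * t + k))"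
    if h: "u \<le> p" "p < q" "q \<le> v" "{p<..<q} \<inter> S' = {}" for p q
  proof -
    \<comment> \<open>\<open>m\<close> may be negative, as for a reversed curve; the image interval
      is then traversed backwards.\<close>
    define lo hi where "lo = min (m * p + k) (m * q + k)" and "hi = max (m * p + k) (m * q + k)"
    have "m * p \<noteq> m * q" using h assms(2) by simp
    then have lh: "lo < hi" unfolding lo_def hi_def by linarith
    have lo: "a \<le> lo" "hi \<le> b" using assms(3)[of p] assms(3)[of q] h by (auto simp: lo_def hi_def)
    have "s \<notin> S" if s: "lo < s" "s < hi" for s
    proof
      assume "s \<in> S"
      then have 1: "(s - k) / m \<in> S'" using assms(2) by (simp add: S'_def)
      have "p < (s - k) / m \<and> (s - k) / m < q"
      proof (cases "m > 0")
        case True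
        then have "m * p < m * q" using h by simp
        then have "m * p + k < s" "s < m * q + k" using s by (auto simp: lo_def hi_def)
        then show ?thesis using True by (simp add: field_simps)
      next
        case False
        then have m: "m < 0" using assms(2) by simp
        then have "m * q < m * p" using h by simp
        then have "m * q + k < s" "s < m * p + k" using s by (auto simp: lo_def hi_def)
        then show ?thesis using m by (simp add: field_simps)
      qed
      then show False using 1 h(4) by auto
    qed
    then have "{lo<..<hi} \<inter> S = {}" by (metis disjoint_iff greaterThanLessThan_iff)
    then have "C1_curve_on A lo hi \<gamma>" by (rule S(2)[OF lo(1) lh lo(2)])
    then show ?thesis
    proof (rule C1_curve_on_affine)
      fix t assume t: "p \<le> t" "t \<le> q"
      show "lo \<le> m * t + k \<and> m * t + k \<le> hi"
      proof (cases "m \<ge> 0")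
        case True
        then have "m * p \<le> m * t" "m * t \<le> m * q" using t by (auto intro: mult_left_mono)
        then show ?thesis by (auto simp: lo_def hi_def)
      next
        case False
        then have "m * t \<le> m * p" "m * q \<le> m * t" using t by (auto intro: mult_left_mono_neg)
        then show ?thesis by (auto simp: lo_def hi_def)
      qed
    qed
  qed
  ultimately show ?thesis unfolding piecewise_C1_on_def by blast
qed

lemma (in smooth_atlas) chart_at: "chart_at A p \<in> A" "p \<in> fst (chart_at A p)"
proof -
  have "\<exists>c. c \<in> A \<and> p \<in> fst c" using covers by blast
  from someI_ex[OF this] show "chart_at A p \<in> A" "p \<in> fst (chart_at A p)" unfolding chart_at_def by auto
qed

section \<open>Speed and length independently of charts\<close>

context riemannian_manifold
begin

lemma chart_inj: "c \<in> A \<Longrightarrow> inj_on (snd c) (fst c)"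
  using chart_homeo[of c] unfolding homeomorphism_def by (metis inj_on_inverseI)

lemma chart_pt_inv [simp]: "c \<in> A \<Longrightarrow> p \<in> fst c \<Longrightarrow> chart_pt c (snd c p) = p"
  unfolding chart_pt_def by (simp add: chart_inj)

lemma chart_pt: "c \<in> A \<Longrightarrow> x \<in> chart_range c \<Longrightarrow> chart_pt c x \<in> fst c \<and> snd c (chart_pt c x) = x"
  by auto

lemma continuous_on_chart: "c \<in> A \<Longrightarrow> continuous_on (fst c) (snd c)"
  and continuous_on_chart_pt: "c \<in> A \<Longrightarrow> continuous_on (chart_range c) (chart_pt c)"
  using chart_homeo[of c] unfolding homeomorphism_def chart_pt_def by auto

lemma local_metric_chart: "c \<in> A \<Longrightarrow> local_metric (chart_range c) (g c)"
  using open_range metric_smooth metric_sym metric_pos by unfold_locales auto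

lemma open_chart_image:
  assumes "c \<in> A" "open W" "W \<subseteq> fst c" shows "open (snd c ` W)"
proof -
  have "snd c ` W = chart_range c \<inter> chart_pt c -` W"
    using assms by (auto simp: image_iff)
  then show ?thesis
    using continuous_open_preimage[OF continuous_on_chart_pt[OF assms(1)] open_range[OF assms(1)] assms(2)] by simp
qed

lemma open_chart_pt_image:
  assumes "c \<in> A" "open V" "V \<subseteq> chart_range c" shows "open (chart_pt c ` V)"
proof -
  have "chart_pt c ` V = fst c \<inter> snd c -` V"
    using assms by (auto simp: image_iff subset_iff) (metis chart_pt_inv)
  then show ?thesis
    using continuous_open_preimage[OF continuous_on_chart[OF assms(1)] open_domain[OF assms(1)] assms(2)] by simp
qed

lemma chart_trans_eq: "c \<in> A \<Longrightarrow> p \<in> fst c \<Longrightarrow> chart_trans c c' (snd c p) = snd c' p"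
  by (simp add: chart_trans_def coord_expr_def chart_pt_def[symmetric])

lemma chart_trans_Ck:
  "c \<in> A \<Longrightarrow> c' \<in> A \<Longrightarrow> Ck_on k (chart_trans c c') (snd c ` (fst c \<inter> fst c'))"
  using transition_smooth unfolding smooth_on_def chart_trans_def by blast

lemma chart_trans_has_derivative:
  assumes "c \<in> A" "c' \<in> A" "p \<in> fst c" "p \<in> fst c'"
  shows "(chart_trans c c' has_derivative frechet_derivative (chart_trans c c') (at (snd c p))) (at (snd c p))"
  by (rule Ck_on_SucD(1)[OF chart_trans_Ck[OF assms(1,2)]]) (use assms in auto)

lemma metric_ip_trans:
  assumes "c \<in> A" "c' \<in> A" "p \<in> fst c" "p \<in> fst c'"
  shows "metric_ip (g c') (snd c' p) (frechet_derivative (chart_trans c c') (at (snd c p)) v) (frechet_derivative (chart_trans c c') (at (snd c p)) w)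
     = metric_ip (g c) (snd c p) v w"
  using metric_transform[OF assms(1,2) _ refl] assms unfolding chart_trans_def by simp

lemma metric_norm_trans:
  assumes "c \<in> A" "c' \<in> A" "p \<in> fst c" "p \<in> fst c'"
  shows "metric_norm (g c') (snd c' p) (frechet_derivative (chart_trans c c') (at (snd c p)) v) = metric_norm (g c) (snd c p) v"
  unfolding metric_norm_def metric_ip_trans[OF assms] ..

text \<open>Near \<open>t\<close> the curve stays in the domain of \<open>c\<close>, so its two
  coordinate representations differ there by the transition map. The set \<open>S\<close> allows for
  one-sided derivatives.\<close>

lemma chart_change:
  assumes cc: "c \<in> A" "c' \<in> A" "\<gamma> t \<in> fst c" "\<gamma> t \<in> fst c'"
    and t: "t \<in> S" and cont: "continuous (at t within S) \<gamma>"
    and D: "((snd c \<circ> \<gamma>) has_vector_derivative D) (at t within S)"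
  shows "((snd c' \<circ> \<gamma>) has_vector_derivative frechet_derivative (chart_trans c c') (at (snd c (\<gamma> t))) D) (at t within S)"
proof -
  have 1: "((\<lambda>s. chart_trans c c' ((snd c \<circ> \<gamma>) s)) has_vector_derivative frechet_derivative (chart_trans c c') (at (snd c (\<gamma> t))) D) (at t within S)"
    using has_vector_derivative_chain[OF D, of "chart_trans c c'"] chart_trans_has_derivative[OF cc] by simp
  have "\<forall>\<^sub>F s in at t within S. \<gamma> s \<in> fst c"
    using cont open_domain[OF cc(1)] cc(3) unfolding continuous_within by (rule topological_tendstoD)
  then obtain d where d: "d > 0" "\<And>s. s \<in> S \<Longrightarrow> s \<noteq> t \<Longrightarrow> dist s t < d \<Longrightarrow> \<gamma> s \<in> fst c"
    unfolding eventually_at by blast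
  show ?thesis
  proof (rule has_vector_derivative_transform_within[OF 1 d(1) t])
    fix s assume "s \<in> S" "dist s t < d"
    then have "\<gamma> s \<in> fst c" using d(2) cc(3) by blast
    then show "chart_trans c c' ((snd c \<circ> \<gamma>) s) = (snd c' \<circ> \<gamma>) s" by (simp add: chart_trans_eq cc(1))
  qed
qed

text \<open>The chart in the definition of \<open>speed\<close> is an arbitrary choice; since
  transition maps are isometries, the speed can be read in any chart around the point.\<close>

lemma speed_chart:
  assumes c: "c \<in> A" "\<gamma> t \<in> fst c" and cont: "isCont \<gamma> t"
    and D: "((snd c \<circ> \<gamma>) has_vector_derivative D) (at t)"
  shows "speed A g \<gamma> t = metric_norm (g c) (snd c (\<gamma> t)) D"
proof -
  note ca = chart_at[of "\<gamma> t"]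
  have "((snd (chart_at A (\<gamma> t)) \<circ> \<gamma>) has_vector_derivative frechet_derivative (chart_trans c (chart_at A (\<gamma> t))) (at (snd c (\<gamma> t))) D) (at t)"
    by (rule chart_change[OF c(1) ca(1) c(2) ca(2) UNIV_I cont D])
  from vector_derivative_at[OF this] show ?thesis
    unfolding speed_def Let_def by (simp add: metric_norm_trans[OF c(1) ca(1) c(2) ca(2)])
qed

lemma speed_nonneg: "speed A g \<gamma> t \<ge> 0"
proof -
  interpret local_metric "chart_range (chart_at A (\<gamma> t))" "g (chart_at A (\<gamma> t))"
    by (rule local_metric_chart[OF chart_at(1)])
  show ?thesis unfolding speed_def Let_def by (rule metric_norm_nonneg) (use chart_at(2) in auto)
qed

text \<open>\<open>speed\<close> uses a two-sided derivative, whose value at the end points carries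
  no information about the curve on \<open>{a..b}\<close>. The function \<open>\<sigma>\<close> is
  formed with the derivative within the interval; it is continuous up to the ends and agrees with
  the speed inside.\<close>

lemma C1_curve_speed:
  assumes C: "C1_curve_on A a b \<gamma>" and ab: "a < b"
  shows "\<exists>\<sigma>. continuous_on {a..b} \<sigma> \<and> (\<forall>t\<in>{a<..<b}. speed A g \<gamma> t = \<sigma> t)"
proof -
  have cg: "continuous_on {a..b} \<gamma>" using C unfolding C1_curve_on_def by blast
  have cw: "continuous (at t within {a..b}) \<gamma>" if "t \<in> {a..b}" for t
    using cg that by (simp add: continuous_on_eq_continuous_within)
  define \<sigma> where "\<sigma> t = (let c = chart_at A (\<gamma> t) in metric_norm (g c) (snd c (\<gamma> t)) (vector_derivative (snd c \<circ> \<gamma>) (at t within {a..b})))" for t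
  have \<sigma>_chart: "\<sigma> t = metric_norm (g c) (snd c (\<gamma> t)) D"
    if c: "c \<in> A" "\<gamma> t \<in> fst c" and t: "t \<in> {a..b}" and D: "((snd c \<circ> \<gamma>) has_vector_derivative D) (at t within {a..b})" for c t D
  proof -
    note ca = chart_at[of "\<gamma> t"]
    have "((snd (chart_at A (\<gamma> t)) \<circ> \<gamma>) has_vector_derivative frechet_derivative (chart_trans c (chart_at A (\<gamma> t))) (at (snd c (\<gamma> t))) D) (at t within {a..b})"
      by (rule chart_change[OF c(1) ca(1) c(2) ca(2) t cw[OF t] D])
    then have "vector_derivative (snd (chart_at A (\<gamma> t)) \<circ> \<gamma>) (at t within {a..b}) = frechet_derivative (chart_trans c (chart_at A (\<gamma> t))) (at (snd c (\<gamma> t))) D"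
      using vector_derivative_within_cbox[OF ab, of t] t by simp
    then show ?thesis
      unfolding \<sigma>_def Let_def by (simp add: metric_norm_trans[OF c(1) ca(1) c(2) ca(2)])
  qed
  have "continuous (at t within {a..b}) \<sigma>" if t: "t \<in> {a..b}" for t
  proof -
    define c where "c = chart_at A (\<gamma> t)"
    have c: "c \<in> A" "\<gamma> t \<in> fst c" using chart_at unfolding c_def by auto
    interpret local_metric "chart_range c" "g c" by (rule local_metric_chart[OF c(1)])
    define N where "N = {t\<in>{a..b}. \<gamma> t \<in> fst c}"
    obtain D where D: "\<forall>t\<in>N. ((snd c \<circ> \<gamma>) has_vector_derivative D t) (at t within {a..b})" "continuous_on N D"
      using C c(1) unfolding C1_curve_on_def N_def by blast
    have "continuous_on N (\<lambda>t. metric_norm (g c) (snd c (\<gamma> t)) (D t))"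
      by (intro continuous_on_metric_norm D(2) continuous_on_compose2[OF continuous_on_chart[OF c(1)] continuous_on_subset[OF cg]])
         (auto simp: N_def)
    then have "continuous_on N \<sigma>"
      by (rule continuous_on_eq) (use \<sigma>_chart[OF c(1)] D(1) in \<open>auto simp: N_def\<close>)
    moreover have tN: "t \<in> N" using t c by (simp add: N_def)
    ultimately have "continuous (at t within N) \<sigma>" by (simp add: continuous_on_eq_continuous_within)
    \<comment> \<open>\<open>N\<close> is relatively open in the interval, so limits at
      \<open>t\<close> within either set agree.\<close>
    moreover have "at t within N = at t within {a..b}"
    proof -
      have "openin (top_of_set {a..b}) ({a..b} \<inter> \<gamma> -` fst c)"
        by (rule continuous_openin_preimage_gen[OF cg open_domain[OF c(1)]])
      moreover have "{a..b} \<inter> \<gamma> -` fst c = N" by (auto simp: N_def)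
      ultimately obtain O' where O': "open O'" "N = {a..b} \<inter> O'" by (auto simp: openin_open)
      show ?thesis by (rule at_within_nhd[OF _ O'(1)]) (use O' tN in auto)
    qed
    ultimately show ?thesis by metis
  qed
  then have "\<forall>t\<in>{a..b}. continuous (at t within {a..b}) \<sigma>" by (rule ballI)
  then have "continuous_on {a..b} \<sigma>" by (rule continuous_on_eq_continuous_within[THEN iffD2])
  moreover have "speed A g \<gamma> t = \<sigma> t" if "t \<in> {a<..<b}" for t
  proof -
    have "at t within {a..b} = at t" by (rule at_within_interior) (use that in simp)
    then show ?thesis unfolding speed_def \<sigma>_def by simp
  qed
  ultimately show ?thesis by (intro exI[of _ \<sigma>] conjI ballI)
qed

lemma piecewise_C1_on_speed_integrable:
  assumes "piecewise_C1_on A a b \<gamma>" shows "speed A g \<gamma> integrable_on {a..b}"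
proof (cases "a < b")
  case True
  obtain S where S: "finite S" "\<And>u v. a \<le> u \<Longrightarrow> u < v \<Longrightarrow> v \<le> b \<Longrightarrow> {u<..<v} \<inter> S = {} \<Longrightarrow> C1_curve_on A u v \<gamma>"
    using assms unfolding piecewise_C1_on_def by meson
  show ?thesis using S(1) True
  proof (induction rule: interval_split_induct)
    case (base u v)
    obtain \<sigma> where \<sigma>: "continuous_on {u..v} \<sigma>" "\<And>t. t \<in> {u<..<v} \<Longrightarrow> speed A g \<gamma> t = \<sigma> t"
      using C1_curve_speed[OF S(2)[OF base] base(2)] by blast
    show ?case
      by (rule integrable_spike_finite[of "{u, v}" _ _ \<sigma>])
         (use \<sigma> integrable_continuous_real in auto)
  next
    case (join u v w)
    then show ?case
      using Henstock_Kurzweil_Integration.integrable_combine[of u v w "speed A g \<gamma>"] by simp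
  qed
next
  case False
  then show ?thesis
    using integrable_on_refl[of "speed A g \<gamma>" b] by (cases "a = b") (auto simp: integrable_on_empty)
qed

lemma piecewise_C1_on_continuous:
  assumes "piecewise_C1_on A a b \<gamma>" "a < b" shows "continuous_on {a..b} \<gamma>"
proof -
  obtain S where S: "finite S" "\<And>u v. a \<le> u \<Longrightarrow> u < v \<Longrightarrow> v \<le> b \<Longrightarrow> {u<..<v} \<inter> S = {} \<Longrightarrow> C1_curve_on A u v \<gamma>"
    using assms unfolding piecewise_C1_on_def by meson
  show ?thesis using S(1) assms(2)
  proof (induction rule: interval_split_induct)
    case (base u v) then show ?case using S(2) unfolding C1_curve_on_def by blast
  next
    case (join u v w)
    have "{u..w} = {u..v} \<union> {v..w}" using join by auto
    then show ?case using continuous_on_closed_Un[OF _ _ join(5,6)] by simp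
  qed
qed

text \<open>The form in which integral estimates use the regularity of a curve: a finite exceptional
  set is negligible, and elsewhere the speed is the length of an honest velocity in every chart
  around the point.\<close>

lemma piecewise_C1_on_derivative:
  assumes "piecewise_C1_on A a b \<gamma>"
  shows "\<exists>S. finite S \<and> (\<forall>t\<in>{a<..<b} - S. isCont \<gamma> t \<and>
     (\<forall>c\<in>A. \<gamma> t \<in> fst c \<longrightarrow> (\<exists>D. ((snd c \<circ> \<gamma>) has_vector_derivative D) (at t) \<and> speed A g \<gamma> t = metric_norm (g c) (snd c (\<gamma> t)) D)))"
proof -
  obtain S where S: "finite S" "\<And>u v. a \<le> u \<Longrightarrow> u < v \<Longrightarrow> v \<le> b \<Longrightarrow> {u<..<v} \<inter> S = {} \<Longrightarrow> C1_curve_on A u v \<gamma>"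
    using assms unfolding piecewise_C1_on_def by meson
  have "isCont \<gamma> t \<and> (\<forall>c\<in>A. \<gamma> t \<in> fst c \<longrightarrow> (\<exists>D. ((snd c \<circ> \<gamma>) has_vector_derivative D) (at t) \<and> speed A g \<gamma> t = metric_norm (g c) (snd c (\<gamma> t)) D))"
    if t: "t \<in> {a<..<b} - S" for t
  proof -
    have "open ({a<..<b} - S)" using S(1) by (simp add: finite_imp_closed open_Diff)
    then obtain e where e: "e > 0" "cball t e \<subseteq> {a<..<b} - S" using t open_contains_cball by blast
    define u v where "u = t - e" and "v = t + e"
    have uv: "{u..v} \<subseteq> {a<..<b} - S" using e(2) by (simp add: u_def v_def cball_eq_atLeastAtMost)
    have "u \<in> {u..v}" "v \<in> {u..v}" "t \<in> {u<..<v}" using e(1) by (auto simp: u_def v_def)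
    moreover have "{u<..<v} \<inter> S = {}" using uv by (auto simp: subset_iff)
    ultimately have C: "C1_curve_on A u v \<gamma>" using S(2)[of u v] uv by fastforce
    have at: "at t within {u..v} = at t" by (rule at_within_interior) (use e(1) in \<open>simp add: u_def v_def\<close>)
    have "continuous (at t within {u..v}) \<gamma>"
      using C e(1) unfolding C1_curve_on_def continuous_on_eq_continuous_within by (auto simp: u_def v_def)
    then have cont: "isCont \<gamma> t" unfolding at .
    have "\<exists>D. ((snd c \<circ> \<gamma>) has_vector_derivative D) (at t) \<and> speed A g \<gamma> t = metric_norm (g c) (snd c (\<gamma> t)) D"
      if c: "c \<in> A" "\<gamma> t \<in> fst c" for c
    proof -
      obtain D where D: "\<forall>t\<in>{t\<in>{u..v}. \<gamma> t \<in> fst c}. ((snd c \<circ> \<gamma>) has_vector_derivative D t) (at t within {u..v})"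
        using C c(1) unfolding C1_curve_on_def by blast
      have "((snd c \<circ> \<gamma>) has_vector_derivative D t) (at t)"
        using D c(2) e(1) unfolding at[symmetric] by (auto simp: u_def v_def)
      then show ?thesis using speed_chart[OF c cont] by blast
    qed
    then show ?thesis using cont by blast
  qed
  then show ?thesis using S(1) by blast
qed

text \<open>The interval is described as an image under the inverse affine map because
  \<open>has_integral_affinity\<close> delivers it in this form.\<close>

lemma piecewise_C1_on_affine_length:
  assumes p: "piecewise_C1_on A a b \<gamma>" and m: "m \<noteq> 0" and ab: "a < b"
    and uv: "{u..v} = (\<lambda>t. (1 / m) * t + - ((1 / m) * k)) ` {a..b}"
  shows "integral {u..v} (speed A g (\<lambda>t. \<gamma> (m * t + k))) = integral {a..b} (speed A g \<gamma>)"
proof -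
  obtain S where S: "finite S" "\<And>t. t \<in> {a<..<b} - S \<Longrightarrow> isCont \<gamma> t \<and>
     (\<forall>c\<in>A. \<gamma> t \<in> fst c \<longrightarrow> (\<exists>D. ((snd c \<circ> \<gamma>) has_vector_derivative D) (at t) \<and> speed A g \<gamma> t = metric_norm (g c) (snd c (\<gamma> t)) D))"
    using piecewise_C1_on_derivative[OF p] by blast
  define S' where "S' = (\<lambda>t. m * t + k) -` (S \<union> {a, b})"
  have fS: "finite S'" unfolding S'_def by (rule finite_vimageI) (use m S in \<open>auto simp: inj_on_def\<close>)
  have sp: "speed A g (\<lambda>t. \<gamma> (m * t + k)) t = \<bar>m\<bar> * speed A g \<gamma> (m * t + k)" if t: "t \<in> {u..v} - S'" for t
  proof -
    have "m * t + k \<in> {a..b}" using t m uv by (auto simp: right_diff_distrib)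
    then have h: "m * t + k \<in> {a<..<b} - S" using t by (auto simp: S'_def less_le)
    define c where "c = chart_at A (\<gamma> (m * t + k))"
    have c: "c \<in> A" "\<gamma> (m * t + k) \<in> fst c" unfolding c_def by (rule chart_at)+
    obtain D where D: "((snd c \<circ> \<gamma>) has_vector_derivative D) (at (m * t + k))" "speed A g \<gamma> (m * t + k) = metric_norm (g c) (snd c (\<gamma> (m * t + k))) D"
      and cont: "isCont \<gamma> (m * t + k)"
      using S(2)[OF h] c by blast
    have f: "((\<lambda>t. m * t + k) has_vector_derivative m) (at t)"
      by (auto intro!: derivative_eq_intros simp: has_vector_derivative_def)
    have 1: "((snd c \<circ> (\<lambda>t. \<gamma> (m * t + k))) has_vector_derivative m *\<^sub>R D) (at t)"
      using vector_diff_chain_at[OF f D(1)] by (simp add: o_def)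
    have 2: "isCont (\<lambda>t. \<gamma> (m * t + k)) t"
      using cont by (intro continuous_at_compose[unfolded o_def, of _ "\<lambda>t. m * t + k" \<gamma>]) (auto intro: continuous_intros)
    interpret local_metric "chart_range c" "g c" by (rule local_metric_chart[OF c(1)])
    show ?thesis using speed_chart[OF c(1) _ 2 1] c(2) D(2) by (simp add: metric_norm_scaleR)
  qed
  have "(speed A g \<gamma> has_integral integral {a..b} (speed A g \<gamma>)) (cbox a b)"
    using piecewise_C1_on_speed_integrable[OF p] by (simp add: integrable_integral)
  from has_integral_affinity[OF this m, of k]
  have "((\<lambda>t. speed A g \<gamma> (m * t + k)) has_integral (1 / \<bar>m\<bar>) * integral {a..b} (speed A g \<gamma>)) {u..v}"
    unfolding uv by simp
  from has_integral_mult_right[OF this, of "\<bar>m\<bar>"]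
  have "((\<lambda>t. \<bar>m\<bar> * speed A g \<gamma> (m * t + k)) has_integral integral {a..b} (speed A g \<gamma>)) {u..v}"
    using m by simp
  then have "(speed A g (\<lambda>t. \<gamma> (m * t + k)) has_integral integral {a..b} (speed A g \<gamma>)) {u..v}"
    by (rule has_integral_spike_finite[OF fS, rotated]) (use sp in auto)
  then show ?thesis by (rule integral_unique)
qed

text \<open>Holds for every curve: the integral of a function that is not integrable is 0.\<close>

lemma piecewise_C1_on_length_nonneg: "integral S (speed A g \<gamma>) \<ge> 0"
  by (cases "speed A g \<gamma> integrable_on S") (auto intro!: integral_nonneg speed_nonneg simp: not_integrable_integral)

text \<open>\<open>riem_dist\<close> is an infimum over curves on [0,1]; another parameter interval
  is reduced to it by an affine change, which preserves length.\<close>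

lemma riem_dist_le_length:
  assumes p: "piecewise_C1_on A a b \<gamma>" and ab: "a < b"
  shows "riem_dist A g (\<gamma> a) (\<gamma> b) \<le> integral {a..b} (speed A g \<gamma>)"
proof -
  define \<gamma>' where "\<gamma>' = (\<lambda>t. \<gamma> ((b - a) * t + a))"
  have "piecewise_C1_on A 0 1 \<gamma>'" unfolding \<gamma>'_def
  proof (rule piecewise_C1_on_affine[OF p])
    fix t :: real assume "0 \<le> t" "t \<le> 1"
    then have "0 \<le> (b - a) * t" "(b - a) * t \<le> (b - a) * 1" using ab by (auto intro!: mult_left_mono simp del: mult_1_right)
    then show "a \<le> (b - a) * t + a \<and> (b - a) * t + a \<le> b" by simp
  qed (use ab in simp)
  moreover have "integral {0..1} (speed A g \<gamma>') = integral {a..b} (speed A g \<gamma>)"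
    unfolding \<gamma>'_def
  proof (rule piecewise_C1_on_affine_length[OF p _ ab])
    have "x \<in> (\<lambda>t. 1 / (b - a) * t + - (1 / (b - a) * a)) ` {a..b}" if x: "0 \<le> x" "x \<le> 1" for x
    proof (rule image_eqI)
      have "1 / q * (q * x + a) + - (1 / q * a) = x" if "q \<noteq> 0" for q using that by (simp add: field_simps)
      then show "x = 1 / (b - a) * ((b - a) * x + a) + - (1 / (b - a) * a)" using ab by simp
      have "(b - a) * x \<le> b - a" by (rule mult_left_le) (use x ab in auto)
      moreover have "0 \<le> (b - a) * x" using x ab by simp
      ultimately have "a \<le> (b - a) * x + a" "(b - a) * x + a \<le> b" by linarith+
      then show "(b - a) * x + a \<in> {a..b}" by (simp only: atLeastAtMost_iff)
    qed
    moreover have "0 \<le> 1 / (b - a) * t + - (1 / (b - a) * a) \<and> 1 / (b - a) * t + - (1 / (b - a) * a) \<le> 1"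
      if "t \<in> {a..b}" for t
      using ab that by (auto simp: diff_divide_distrib[symmetric])
    ultimately show "{0..1} = (\<lambda>t. 1 / (b - a) * t + - (1 / (b - a) * a)) ` {a..b}" by force
  qed (use ab in simp)
  moreover have "\<gamma>' 0 = \<gamma> a" "\<gamma>' 1 = \<gamma> b" by (auto simp: \<gamma>'_def)
  ultimately have "integral {a..b} (speed A g \<gamma>) \<in> {curve_length A g \<gamma>' | \<gamma>'. piecewise_C1_curve A \<gamma>' \<and> \<gamma>' 0 = \<gamma> a \<and> \<gamma>' 1 = \<gamma> b}"
    unfolding curve_length_def piecewise_C1_curve_iff by (intro CollectI exI[of _ \<gamma>'] conjI) simp_all
  moreover have "bdd_below {curve_length A g \<gamma>' | \<gamma>'. piecewise_C1_curve A \<gamma>' \<and> \<gamma>' 0 = \<gamma> a \<and> \<gamma>' 1 = \<gamma> b}"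
    unfolding curve_length_def by (rule bdd_belowI[of _ 0]) (auto intro: piecewise_C1_on_length_nonneg)
  ultimately show ?thesis unfolding riem_dist_def by (rule cInf_lower)
qed

end

lemma segment_in_cball:
  fixes x y z :: "'n::real_normed_vector"
  shows "x \<in> cball z r \<Longrightarrow> y \<in> cball z r \<Longrightarrow> 0 \<le> t \<Longrightarrow> t \<le> 1 \<Longrightarrow> x + t *\<^sub>R (y - x) \<in> cball z r"
  using convexD_alt[OF convex_cball, of x z r y t] by (simp add: algebra_simps)

section \<open>Curves written in a chart\<close>

context riemannian_manifold
begin

text \<open>Regularity is given in one chart; in any other chart \<open>c'\<close> the velocity is
  the image of \<open>D\<close> under the differential of the transition map.\<close>

lemma C1_chart_curve:
  assumes c: "c \<in> A" and D: "\<And>t. t \<in> {a..b} \<Longrightarrow> (X has_vector_derivative D t) (at t within {a..b})"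
    and cD: "continuous_on {a..b} D" and X: "\<And>t. t \<in> {a..b} \<Longrightarrow> X t \<in> chart_range c"
  shows "C1_curve_on A a b (\<lambda>t. chart_pt c (X t))"
  unfolding C1_curve_on_def
proof (intro conjI ballI)
  have cX: "continuous_on {a..b} X"
    unfolding continuous_on_eq_continuous_within using D has_vector_derivative_continuous by blast
  define \<gamma> where "\<gamma> = (\<lambda>t. chart_pt c (X t))"
  have c\<gamma>: "continuous_on {a..b} \<gamma>" unfolding \<gamma>_def
    by (rule continuous_on_compose2[OF continuous_on_chart_pt[OF c] cX]) (use X in auto)
  then show "continuous_on {a..b} (\<lambda>t. chart_pt c (X t))" unfolding \<gamma>_def .
  have \<gamma>c: "\<gamma> t \<in> fst c" "snd c (\<gamma> t) = X t" if "t \<in> {a..b}" for t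
    using chart_pt[OF c X[OF that]] by (auto simp: \<gamma>_def)
  fix c' assume c': "c' \<in> A"
  define N where "N = {t \<in> {a..b}. \<gamma> t \<in> fst c'}"
  have "((snd c' \<circ> \<gamma>) has_vector_derivative frechet_derivative (chart_trans c c') (at (X t)) (D t)) (at t within {a..b})"
    if t: "t \<in> N" for t
  proof -
    have tab: "t \<in> {a..b}" and tc': "\<gamma> t \<in> fst c'" using t by (auto simp: N_def)
    have "((snd c \<circ> \<gamma>) has_vector_derivative D t) (at t within {a..b})"
      by (rule has_vector_derivative_transform[OF tab _ D[OF tab]]) (simp add: \<gamma>c)
    moreover have "continuous (at t within {a..b}) \<gamma>" using c\<gamma> tab continuous_on_eq_continuous_within by blast
    ultimately show ?thesis using chart_change[where \<gamma>=\<gamma> and t=t and S="{a..b}", OF c c' \<gamma>c(1)[OF tab] tc' tab] \<gamma>c(2)[OF tab] by simp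
  qed
  moreover have "continuous_on N (\<lambda>t. frechet_derivative (chart_trans c c') (at (X t)) (D t))"
  proof (rule frechet_derivative_continuous[OF chart_trans_Ck[OF c c']])
    show "continuous_on N X" "continuous_on N D" using cX cD by (auto simp: N_def intro: continuous_on_subset)
    show "X ` N \<subseteq> snd c ` (fst c \<inter> fst c')"
    proof
      fix x assume "x \<in> X ` N"
      then obtain t where "t \<in> {a..b}" "\<gamma> t \<in> fst c'" "x = X t" by (auto simp: N_def)
      then show "x \<in> snd c ` (fst c \<inter> fst c')" using \<gamma>c[of t] by (metis IntI image_eqI)
    qed
  qed
  moreover have N_eq: "{t \<in> {a..b}. chart_pt c (X t) \<in> fst c'} = N" by (simp add: N_def \<gamma>_def)
  ultimately show "\<exists>D. (\<forall>t\<in>{t \<in> {a..b}. chart_pt c (X t) \<in> fst c'}. ((snd c' \<circ> (\<lambda>t. chart_pt c (X t))) has_vector_derivative D t) (at t within {a..b})) \<and>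
     continuous_on {t \<in> {a..b}. chart_pt c (X t) \<in> fst c'} D"
    unfolding N_eq \<gamma>_def[symmetric]
    by (intro exI[of _ "\<lambda>t. frechet_derivative (chart_trans c c') (at (X t)) (D t)"] conjI ballI)
qed

lemma piecewise_C1_on_chart_map:
  assumes c: "c \<in> A" and p: "piecewise_C1_on A a b \<gamma>" and W: "W \<subseteq> chart_range c"
    and \<gamma>W: "\<And>t. a \<le> t \<Longrightarrow> t \<le> b \<Longrightarrow> \<gamma> t \<in> chart_pt c ` W"
    and \<psi>: "Ck_on (Suc 0) \<psi> W" "\<psi> ` W \<subseteq> chart_range c"
  shows "piecewise_C1_on A a b (\<lambda>t. chart_pt c (\<psi> (snd c (\<gamma> t))))"
proof -
  obtain S where S: "finite S" "\<And>u v. a \<le> u \<Longrightarrow> u < v \<Longrightarrow> v \<le> b \<Longrightarrow> {u<..<v} \<inter> S = {} \<Longrightarrow> C1_curve_on A u v \<gamma>"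
    using p unfolding piecewise_C1_on_def by meson
  have \<gamma>c: "\<gamma> t \<in> fst c" "snd c (\<gamma> t) \<in> W" if tab: "a \<le> t" "t \<le> b" for t
  proof -
    obtain x where x: "x \<in> W" "\<gamma> t = chart_pt c x" using \<gamma>W[OF tab] by blast
    then show "\<gamma> t \<in> fst c" "snd c (\<gamma> t) \<in> W" using chart_pt[OF c, of x] W by auto
  qed
  have "C1_curve_on A u v (\<lambda>t. chart_pt c (\<psi> (snd c (\<gamma> t))))"
    if uv: "a \<le> u" "u < v" "v \<le> b" "{u<..<v} \<inter> S = {}" for u v
  proof -
    have C: "C1_curve_on A u v \<gamma>" by (rule S(2)[OF uv])
    have eq: "{t\<in>{u..v}. \<gamma> t \<in> fst c} = {u..v}" using \<gamma>c uv by auto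
    obtain D where D': "\<forall>t\<in>{t\<in>{u..v}. \<gamma> t \<in> fst c}. ((snd c \<circ> \<gamma>) has_vector_derivative D t) (at t within {u..v})"
        "continuous_on {t\<in>{u..v}. \<gamma> t \<in> fst c} D"
      using C c unfolding C1_curve_on_def by blast
    note D = D'[unfolded eq]
    have cx: "continuous_on {u..v} (snd c \<circ> \<gamma>)"
      unfolding continuous_on_eq_continuous_within using D has_vector_derivative_continuous by blast
    show ?thesis
    proof (rule C1_chart_curve[OF c])
      fix t assume t: "t \<in> {u..v}"
      show "((\<lambda>t. \<psi> (snd c (\<gamma> t))) has_vector_derivative frechet_derivative \<psi> (at (snd c (\<gamma> t))) (D t)) (at t within {u..v})"
        using has_vector_derivative_chain[OF bspec[OF D(1) t], of \<psi>] Ck_on_SucD(1)[OF \<psi>(1)] \<gamma>c(2)[of t] t uv by simp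
      show "\<psi> (snd c (\<gamma> t)) \<in> chart_range c" using \<psi>(2) \<gamma>c(2)[of t] t uv by auto
    next
      show "continuous_on {u..v} (\<lambda>t. frechet_derivative \<psi> (at (snd c (\<gamma> t))) (D t))"
        by (rule frechet_derivative_continuous[OF \<psi>(1) cx[unfolded o_def] D(2)]) (use \<gamma>c uv in auto)
    qed
  qed
  then show ?thesis unfolding piecewise_C1_on_def using S(1) by (intro exI[of _ S]) simp
qed

text \<open>A single velocity \<open>D\<close> serves all maps \<open>\<psi> j\<close> at once.
  \<open>contraction\<close> depends on this, since its hypothesis bounds the sum over
  \<open>j\<close> of squared lengths for one and the same vector.\<close>

lemma piecewise_C1_on_chart_map_speed:
  assumes c: "c \<in> A" and p: "piecewise_C1_on A a b \<gamma>" and W: "W \<subseteq> chart_range c"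
    and \<gamma>W: "\<And>t. a \<le> t \<Longrightarrow> t \<le> b \<Longrightarrow> \<gamma> t \<in> chart_pt c ` W"
    and \<psi>: "\<And>j. j \<in> J \<Longrightarrow> Ck_on (Suc 0) (\<psi> j) W" "\<And>j. j \<in> J \<Longrightarrow> \<psi> j ` W \<subseteq> chart_range c"
  shows "\<exists>S. finite S \<and> (\<forall>t\<in>{a<..<b} - S. \<exists>D. speed A g \<gamma> t = metric_norm (g c) (snd c (\<gamma> t)) D \<and>
    (\<forall>j\<in>J. speed A g (\<lambda>t. chart_pt c (\<psi> j (snd c (\<gamma> t)))) t
      = metric_norm (g c) (\<psi> j (snd c (\<gamma> t))) (frechet_derivative (\<psi> j) (at (snd c (\<gamma> t))) D)))"
proof -
  obtain S where S: "finite S" "\<And>t. t \<in> {a<..<b} - S \<Longrightarrow> isCont \<gamma> t \<and>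
     (\<forall>c\<in>A. \<gamma> t \<in> fst c \<longrightarrow> (\<exists>D. ((snd c \<circ> \<gamma>) has_vector_derivative D) (at t) \<and> speed A g \<gamma> t = metric_norm (g c) (snd c (\<gamma> t)) D))"
    using piecewise_C1_on_derivative[OF p] by blast
  have \<gamma>c: "\<gamma> t \<in> fst c" "snd c (\<gamma> t) \<in> W" if tab: "a \<le> t" "t \<le> b" for t
  proof -
    obtain x where x: "x \<in> W" "\<gamma> t = chart_pt c x" using \<gamma>W[OF tab] by blast
    then show "\<gamma> t \<in> fst c" "snd c (\<gamma> t) \<in> W" using chart_pt[OF c, of x] W by auto
  qed
  have "\<exists>D. speed A g \<gamma> t = metric_norm (g c) (snd c (\<gamma> t)) D \<and>
    (\<forall>j\<in>J. speed A g (\<lambda>t. chart_pt c (\<psi> j (snd c (\<gamma> t)))) t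
      = metric_norm (g c) (\<psi> j (snd c (\<gamma> t))) (frechet_derivative (\<psi> j) (at (snd c (\<gamma> t))) D))"
    if t: "t \<in> {a<..<b} - S" for t
  proof -
    have tab: "a \<le> t" "t \<le> b" using t by auto
    obtain D where D: "((snd c \<circ> \<gamma>) has_vector_derivative D) (at t)" "speed A g \<gamma> t = metric_norm (g c) (snd c (\<gamma> t)) D"
      using S(2)[OF t] c \<gamma>c(1)[OF tab] by blast
    have "speed A g (\<lambda>t. chart_pt c (\<psi> j (snd c (\<gamma> t)))) t
      = metric_norm (g c) (\<psi> j (snd c (\<gamma> t))) (frechet_derivative (\<psi> j) (at (snd c (\<gamma> t))) D)" if j: "j \<in> J" for j
    proof -
      define \<gamma>' where "\<gamma>' = (\<lambda>t. chart_pt c (\<psi> j (snd c (\<gamma> t))))"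
      have r: "\<psi> j (snd c (\<gamma> s)) \<in> chart_range c" if "a \<le> s" "s \<le> b" for s
        using \<psi>(2)[OF j] \<gamma>c(2)[OF that] by auto
      have pc: "\<gamma>' s \<in> fst c" "snd c (\<gamma>' s) = \<psi> j (snd c (\<gamma> s))" if "a \<le> s" "s \<le> b" for s
        using chart_pt[OF c r[OF that]] by (auto simp: \<gamma>'_def)
      have "((\<lambda>s. \<psi> j ((snd c \<circ> \<gamma>) s)) has_vector_derivative frechet_derivative (\<psi> j) (at (snd c (\<gamma> t))) D) (at t)"
        using has_vector_derivative_chain[OF D(1), of "\<psi> j"] Ck_on_SucD(1)[OF \<psi>(1)[OF j] \<gamma>c(2)[OF tab]] by simp
      then have d: "((snd c \<circ> \<gamma>') has_vector_derivative frechet_derivative (\<psi> j) (at (snd c (\<gamma> t))) D) (at t)"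
        by (rule has_vector_derivative_transform_within_open[of _ _ _ "{a<..<b}"]) (use t pc in auto)
      have "continuous_on {a..b} \<gamma>'"
        unfolding \<gamma>'_def by (rule piecewise_C1_on_continuous[OF piecewise_C1_on_chart_map[OF c p W \<gamma>W \<psi>(1)[OF j] \<psi>(2)[OF j]]]) (use t in auto)
      then have "continuous_on {a<..<b} \<gamma>'" by (rule continuous_on_subset) auto
      then have "isCont \<gamma>' t" using t by (auto simp: continuous_on_eq_continuous_at)
      from speed_chart[OF c pc(1)[OF tab] this d] show ?thesis
        using pc(2)[OF tab] unfolding \<gamma>'_def by simp
    qed
    then show ?thesis using D(2) by blast
  qed
  then show ?thesis using S(1) by blast
qed

lemma piecewise_C1_on_chart_line:
  assumes c: "c \<in> A" and seg: "\<And>t. 0 \<le> t \<Longrightarrow> t \<le> 1 \<Longrightarrow> x + t *\<^sub>R (y - x) \<in> chart_range c"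
  shows "piecewise_C1_on A 0 1 (\<lambda>t. chart_pt c (x + t *\<^sub>R (y - x)))"
    and "t \<in> {0<..<1} \<Longrightarrow> speed A g (\<lambda>t. chart_pt c (x + t *\<^sub>R (y - x))) t = metric_norm (g c) (x + t *\<^sub>R (y - x)) (y - x)"
proof -
  define X where "X = (\<lambda>t::real. x + t *\<^sub>R (y - x))"
  have X: "(X has_vector_derivative (y - x)) (at t within T)" for t T
    unfolding X_def by (auto intro!: derivative_eq_intros simp: has_vector_derivative_def)
  have "C1_curve_on A u v (\<lambda>t. chart_pt c (X t))" if "0 \<le> u" "v \<le> 1" for u v
    by (rule C1_chart_curve[OF c X]) (use seg that in \<open>auto simp: X_def\<close>)
  then show p: "piecewise_C1_on A 0 1 (\<lambda>t. chart_pt c (x + t *\<^sub>R (y - x)))"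
    unfolding piecewise_C1_on_def X_def by (intro exI[of _ "{}"]) simp
  assume t: "t \<in> {0<..<1}"
  have pc: "chart_pt c (X s) \<in> fst c" "snd c (chart_pt c (X s)) = X s" if "0 \<le> s" "s \<le> 1" for s
    using chart_pt[OF c seg[OF that]] by (auto simp: X_def)
  have d: "((snd c \<circ> (\<lambda>t. chart_pt c (X t))) has_vector_derivative (y - x)) (at t)"
    by (rule has_vector_derivative_transform_within_open[of X "y - x" t "{0<..<1}", OF X]) (use t pc in auto)
  have "continuous_on {0..1} (\<lambda>t. chart_pt c (X t))" using piecewise_C1_on_continuous[OF p] by (simp add: X_def)
  then have "continuous_on {0<..<1} (\<lambda>t. chart_pt c (X t))" by (rule continuous_on_subset) auto
  then have "isCont (\<lambda>t. chart_pt c (X t)) t" using t by (auto simp: continuous_on_eq_continuous_at)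
  from speed_chart[OF c pc(1) this d] show "speed A g (\<lambda>t. chart_pt c (x + t *\<^sub>R (y - x))) t = metric_norm (g c) (x + t *\<^sub>R (y - x)) (y - x)"
    using t pc(2)[of t] by (simp add: X_def)
qed

text \<open>At the end points and on \<open>S\<close>, where nothing is known, \<open>f\<close> is
  redefined as \<open>h\<close> without changing its integral.\<close>

lemma integral_mono_finite:
  fixes f h :: "real \<Rightarrow> real"
  assumes "f integrable_on {a..b}" "h integrable_on {a..b}" "finite S" "\<And>t. t \<in> {a<..<b} - S \<Longrightarrow> f t \<le> h t"
  shows "integral {a..b} f \<le> integral {a..b} h"
proof -
  define f' where "f' = (\<lambda>t. if t \<in> {a<..<b} - S then f t else h t)"
  have fi: "f' integrable_on {a..b}"
    by (rule integrable_spike_finite[of "S \<union> {a, b}" _ _ f]) (use assms in \<open>auto simp: f'_def\<close>)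
  have "integral {a..b} f = integral {a..b} f'"
    by (rule integral_spike[of "S \<union> {a, b}"]) (use assms(3) in \<open>auto simp: f'_def\<close>)
  also have "\<dots> \<le> integral {a..b} h"
    by (rule integral_le[OF fi assms(2)]) (use assms(4) in \<open>auto simp: f'_def\<close>)
  finally show ?thesis .
qed

lemma riem_dist_segment:
  assumes c: "c \<in> A" and seg: "\<And>t. 0 \<le> t \<Longrightarrow> t \<le> 1 \<Longrightarrow> x + t *\<^sub>R (y - x) \<in> chart_range c"
    and B: "\<And>t. 0 \<le> t \<Longrightarrow> t \<le> 1 \<Longrightarrow> metric_norm (g c) (x + t *\<^sub>R (y - x)) (y - x) \<le> B"
  shows "riem_dist A g (chart_pt c x) (chart_pt c y) \<le> B"
proof -
  note p = piecewise_C1_on_chart_line[OF c seg]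
  have "riem_dist A g (chart_pt c x) (chart_pt c y) \<le> integral {0..1} (speed A g (\<lambda>t. chart_pt c (x + t *\<^sub>R (y - x))))"
    using riem_dist_le_length[OF p(1)] by simp
  also have "\<dots> \<le> integral {0..1::real} (\<lambda>t. B)"
    by (rule integral_mono_finite[of _ _ _ _ "{}"]) (use piecewise_C1_on_speed_integrable[OF p(1)] p(2) B in auto)
  finally show ?thesis by simp
qed

section \<open>The axioms of a metric for the Riemannian distance\<close>

lemma piecewise_C1_on_reverse:
  assumes "piecewise_C1_on A a b \<gamma>" "a < b"
  shows "piecewise_C1_on A (- b) (- a) (\<lambda>t. \<gamma> (- t))" "integral {- b..- a} (speed A g (\<lambda>t. \<gamma> (- t))) = integral {a..b} (speed A g \<gamma>)"
proof -
  show "piecewise_C1_on A (- b) (- a) (\<lambda>t. \<gamma> (- t))"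
    using piecewise_C1_on_affine[OF assms(1), of "- 1" "- b" "- a" 0] by simp
  show "integral {- b..- a} (speed A g (\<lambda>t. \<gamma> (- t))) = integral {a..b} (speed A g \<gamma>)"
    using piecewise_C1_on_affine_length[OF assms(1) _ assms(2), of "- 1" "- b" "- a" 0] by simp
qed

lemma piecewise_C1_on_shift:
  assumes "piecewise_C1_on A a b \<gamma>" "a < b"
  shows "piecewise_C1_on A (a + k) (b + k) (\<lambda>t. \<gamma> (t - k))" "integral {a + k..b + k} (speed A g (\<lambda>t. \<gamma> (t - k))) = integral {a..b} (speed A g \<gamma>)"
proof -
  show "piecewise_C1_on A (a + k) (b + k) (\<lambda>t. \<gamma> (t - k))"
    using piecewise_C1_on_affine[OF assms(1), of 1 "a + k" "b + k" "- k"] by simp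
  have "{a + k..b + k} = (\<lambda>t. t + k) ` {a..b}" by simp
  then show "integral {a + k..b + k} (speed A g (\<lambda>t. \<gamma> (t - k))) = integral {a..b} (speed A g \<gamma>)"
    using piecewise_C1_on_affine_length[OF assms(1) _ assms(2), of 1 "a + k" "b + k" "- k"] by simp
qed

lemma speed_cong_interval:
  assumes "\<And>t. t \<in> {a<..<b} \<Longrightarrow> \<gamma> t = \<gamma>' t" "t \<in> {a<..<b}"
  shows "speed A g \<gamma> t = speed A g \<gamma>' t"
proof -
  have "vector_derivative (snd (chart_at A (\<gamma> t)) \<circ> \<gamma>) (at t) = vector_derivative (snd (chart_at A (\<gamma> t)) \<circ> \<gamma>') (at t)"
    by (rule vector_derivative_cong_eq) (use assms in \<open>auto intro!: eventually_nhds_in_open[THEN eventually_mono, of "{a<..<b}"]\<close>)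
  then show ?thesis unfolding speed_def using assms by simp
qed

lemma piecewise_C1_on_concat:
  assumes 1: "piecewise_C1_on A a b \<gamma>1" "a < b" and 2: "piecewise_C1_on A b d \<gamma>2" "b < d" and eq: "\<gamma>1 b = \<gamma>2 b"
  defines "\<gamma> \<equiv> \<lambda>t. if t \<le> b then \<gamma>1 t else \<gamma>2 t"
  shows "piecewise_C1_on A a d \<gamma>" "integral {a..d} (speed A g \<gamma>) = integral {a..b} (speed A g \<gamma>1) + integral {b..d} (speed A g \<gamma>2)"
proof -
  have p1: "piecewise_C1_on A a b \<gamma>" by (rule piecewise_C1_on_cong[OF 1(1)]) (simp add: \<gamma>_def)
  have p2: "piecewise_C1_on A b d \<gamma>" by (rule piecewise_C1_on_cong[OF 2(1)]) (use eq in \<open>auto simp: \<gamma>_def\<close>)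
  show p: "piecewise_C1_on A a d \<gamma>" by (rule piecewise_C1_on_join[OF p1 p2])
  have "integral {a..b} (speed A g \<gamma>) = integral {a..b} (speed A g \<gamma>1)"
    by (rule integral_spike[of "{a, b}"]) (auto intro!: speed_cong_interval[of a b] simp: \<gamma>_def)
  moreover have "integral {b..d} (speed A g \<gamma>) = integral {b..d} (speed A g \<gamma>2)"
    by (rule integral_spike[of "{b, d}"]) (auto intro!: speed_cong_interval[of b d] simp: \<gamma>_def)
  ultimately show "integral {a..d} (speed A g \<gamma>) = integral {a..b} (speed A g \<gamma>1) + integral {b..d} (speed A g \<gamma>2)"
    using Henstock_Kurzweil_Integration.integral_combine[of a b d "speed A g \<gamma>"] 1(2) 2(2) piecewise_C1_on_speed_integrable[OF p] by simp
qed

text \<open>The parameter interval is left free, so that reversal and concatenation act on the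
  relation directly.\<close>

definition joins :: "'a \<Rightarrow> 'a \<Rightarrow> real \<Rightarrow> bool" where
  "joins p q l \<longleftrightarrow> (\<exists>a b \<gamma>. a < b \<and> piecewise_C1_on A a b \<gamma> \<and> \<gamma> a = p \<and> \<gamma> b = q \<and> integral {a..b} (speed A g \<gamma>) = l)"

lemma joins_sym: "joins p q l \<Longrightarrow> joins q p l"
proof -
  assume "joins p q l"
  then obtain a b \<gamma> where h: "a < b" "piecewise_C1_on A a b \<gamma>" "\<gamma> a = p" "\<gamma> b = q" "integral {a..b} (speed A g \<gamma>) = l"
    unfolding joins_def by blast
  show ?thesis unfolding joins_def
    using piecewise_C1_on_reverse[OF h(2,1)] h by (intro exI[of _ "- b"] exI[of _ "- a"] exI[of _ "\<lambda>t. \<gamma> (- t)"]) simp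
qed

lemma joins_trans:
  assumes "joins p q l" "joins q r m" shows "joins p r (l + m)"
proof -
  obtain a b \<gamma> where h: "a < b" "piecewise_C1_on A a b \<gamma>" "\<gamma> a = p" "\<gamma> b = q" "integral {a..b} (speed A g \<gamma>) = l"
    using assms(1) unfolding joins_def by blast
  obtain a' b' \<gamma>' where h': "a' < b'" "piecewise_C1_on A a' b' \<gamma>'" "\<gamma>' a' = q" "\<gamma>' b' = r" "integral {a'..b'} (speed A g \<gamma>') = m"
    using assms(2) unfolding joins_def by blast
  define \<gamma>2 where "\<gamma>2 = (\<lambda>t. \<gamma>' (t - (b - a')))"
  have s: "piecewise_C1_on A b (b' + (b - a')) \<gamma>2" "integral {b..b' + (b - a')} (speed A g \<gamma>2) = m" "\<gamma>2 b = q" "\<gamma>2 (b' + (b - a')) = r" "b < b' + (b - a')"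
    using piecewise_C1_on_shift[OF h'(2,1), of "b - a'"] h' by (auto simp: \<gamma>2_def)
  have e: "\<gamma> b = \<gamma>2 b" using h s by simp
  show ?thesis unfolding joins_def
    using piecewise_C1_on_concat[OF h(2,1) s(1,5) e] h s
    by (intro exI[of _ a] exI[of _ "b' + (b - a')"] exI[of _ "\<lambda>t. if t \<le> b then \<gamma> t else \<gamma>2 t"]) auto
qed

lemma joins_nonneg: "joins p q l \<Longrightarrow> l \<ge> 0"
  unfolding joins_def using piecewise_C1_on_length_nonneg by blast

lemma joins_dist: "joins p q l \<Longrightarrow> riem_dist A g p q \<le> l"
  unfolding joins_def using riem_dist_le_length by blast

lemma chart_nbhd:
  assumes c: "c \<in> A" and x: "x \<in> chart_range c"
  shows "\<exists>r a b. 0 < r \<and> 0 < a \<and> 0 < b \<and> cball x r \<subseteq> chart_range c \<and>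
    (\<forall>y\<in>cball x r. \<forall>v. a * norm v \<le> metric_norm (g c) y v \<and> metric_norm (g c) y v \<le> b * norm v)"
proof -
  interpret local_metric "chart_range c" "g c" by (rule local_metric_chart[OF c])
  obtain r where r: "r > 0" "cball x r \<subseteq> chart_range c" using open_U x open_contains_cball by blast
  then show ?thesis using metric_norm_bounds[OF compact_cball r(2)] by blast
qed

lemma riem_dist_upper:
  assumes c: "c \<in> A" and r: "cball z r \<subseteq> chart_range c"
    and b: "\<And>y v. y \<in> cball z r \<Longrightarrow> metric_norm (g c) y v \<le> b * norm v"
    and xy: "x \<in> cball z r" "y \<in> cball z r"
  shows "riem_dist A g (chart_pt c x) (chart_pt c y) \<le> b * norm (y - x)"
  by (rule riem_dist_segment[OF c]) (use segment_in_cball[OF xy] r b in auto)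

text \<open>Being joined by a curve is an equivalence relation whose classes contain a chart ball
  around each of their points, so connectedness leaves a single class. It ensures that the infimum
  in \<open>riem_dist\<close> is taken over a nonempty set.\<close>

lemma joins_exists: "\<exists>l. joins p q l"
proof (rule connected_equivalence_relation[OF connected, where R="\<lambda>p q. \<exists>l. joins p q l"])
  show "\<exists>l. joins y x l" if "\<exists>l. joins x y l" for x y using that joins_sym by blast
  show "\<exists>l. joins x z l" if "\<exists>l. joins x y l" "\<exists>l. joins y z l" for x y z using that joins_trans by blast
  fix p :: 'a
  define c where "c = chart_at A p"
  have c: "c \<in> A" "p \<in> fst c" unfolding c_def by (rule chart_at)+
  then obtain r where r: "r > 0" "cball (snd c p) r \<subseteq> chart_range c" using chart_nbhd[OF c(1), of "snd c p"] by blast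
  define T where "T = chart_pt c ` ball (snd c p) r"
  have "open T" unfolding T_def by (rule open_chart_pt_image[OF c(1)]) (use r ball_subset_cball in auto)
  moreover have "p \<in> T" unfolding T_def using r c by (intro image_eqI[of _ _ "snd c p"]) auto
  moreover have "\<exists>l. joins p q l" if qT: "q \<in> T" for q
  proof -
    obtain y where y: "y \<in> ball (snd c p) r" "q = chart_pt c y" using qT unfolding T_def by blast
    have seg: "snd c p + t *\<^sub>R (y - snd c p) \<in> chart_range c" if "0 \<le> t" "t \<le> 1" for t
      using segment_in_cball[of "snd c p" "snd c p" r y t] r y that by auto
    show ?thesis unfolding joins_def
      using piecewise_C1_on_chart_line(1)[OF c(1) seg] c y
      by (intro exI[of _ "integral {0..1} (speed A g (\<lambda>t. chart_pt c (snd c p + t *\<^sub>R (y - snd c p))))"] exI[of _ 0] exI[of _ 1] exI[of _ "\<lambda>t. chart_pt c (snd c p + t *\<^sub>R (y - snd c p))"]) simp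
  qed
  ultimately show "\<exists>T. openin (top_of_set UNIV) T \<and> p \<in> T \<and> (\<forall>x\<in>T. \<exists>l. joins p x l)" by auto
qed auto

lemma riem_dist_lessD:
  assumes "riem_dist A g p q < r"
  shows "\<exists>\<gamma>. piecewise_C1_on A 0 1 \<gamma> \<and> \<gamma> 0 = p \<and> \<gamma> 1 = q \<and> integral {0..1} (speed A g \<gamma>) < r"
proof -
  obtain l a b \<gamma> where h: "a < b" "piecewise_C1_on A a b \<gamma>" "\<gamma> a = p" "\<gamma> b = q"
    using joins_exists[of p q] unfolding joins_def by blast
  have "piecewise_C1_on A 0 1 (\<lambda>t. \<gamma> ((b - a) * t + a))"
  proof (rule piecewise_C1_on_affine[OF h(2)])
    fix t :: real assume "0 \<le> t" "t \<le> 1"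
    then have "(b - a) * t \<le> b - a" "0 \<le> (b - a) * t" using h(1) by (auto intro: mult_left_le)
    then show "a \<le> (b - a) * t + a \<and> (b - a) * t + a \<le> b" by linarith
  qed (use h in simp)
  then have ne: "{curve_length A g \<gamma> | \<gamma>. piecewise_C1_curve A \<gamma> \<and> \<gamma> 0 = p \<and> \<gamma> 1 = q} \<noteq> {}"
    using h unfolding piecewise_C1_curve_iff by fastforce
  show ?thesis
    using cInf_lessD[OF ne assms[unfolded riem_dist_def]] unfolding piecewise_C1_curve_iff curve_length_def by blast
qed

lemma riem_dist_lessD_joins: "riem_dist A g p q < r \<Longrightarrow> \<exists>l<r. joins p q l"
  using riem_dist_lessD[of p q r] unfolding joins_def by (metis zero_less_one)

lemma riem_dist_nonneg: "riem_dist A g p q \<ge> 0"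
  using riem_dist_lessD_joins[of p q 0] joins_nonneg by fastforce

lemma riem_dist_sym: "riem_dist A g p q = riem_dist A g q p"
proof -
  have "riem_dist A g p q \<le> riem_dist A g q p" for p q
  proof (rule dense_ge)
    fix r assume "riem_dist A g q p < r"
    then obtain l where "l < r" "joins q p l" using riem_dist_lessD_joins by blast
    then show "riem_dist A g p q \<le> r" using joins_dist[OF joins_sym] by fastforce
  qed
  from this[of p q] this[of q p] show ?thesis by simp
qed

lemma riem_dist_triangle: "riem_dist A g p r \<le> riem_dist A g p q + riem_dist A g q r"
proof (rule field_le_epsilon)
  fix e :: real assume e: "e > 0"
  obtain l where l: "l < riem_dist A g p q + e / 2" "joins p q l" using riem_dist_lessD_joins[of p q "riem_dist A g p q + e / 2"] e by auto
  obtain m where m: "m < riem_dist A g q r + e / 2" "joins q r m" using riem_dist_lessD_joins[of q r "riem_dist A g q r + e / 2"] e by auto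
  have "riem_dist A g p r \<le> l + m" by (rule joins_dist[OF joins_trans[OF l(2) m(2)]])
  then show "riem_dist A g p r \<le> riem_dist A g p q + riem_dist A g q r + e" using l(1) m(1) by simp
qed

end

section \<open>Closed balls are compact\<close>

text \<open>The Hopf--Rinow theorem in Cohn-Vossen's form; the assumption \<open>len\<close> says that \<open>d\<close> is a length metric.\<close>

lemma (in Metric_space) length_space_mcball_compact:
  assumes comp: "mcomplete" and loc: "\<And>x. x \<in> M \<Longrightarrow> \<exists>r>0. compactin mtopology (mcball x r)"
    and len: "\<And>x y a e. x \<in> M \<Longrightarrow> y \<in> M \<Longrightarrow> 0 \<le> a \<Longrightarrow> a \<le> d x y \<Longrightarrow> 0 < e \<Longrightarrow> \<exists>z\<in>M. d x z \<le> a \<and> d z y < d x y - a + e"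
    and p: "p \<in> M"
  shows "compactin mtopology (mcball p R)"
proof (rule ccontr)
  assume neg: "\<not> compactin mtopology (mcball p R)"
  have down: "compactin mtopology (mcball p s)" if "s \<le> t" "compactin mtopology (mcball p t)" for s t
    by (rule closed_compactin[OF that(2) mcball_subset_concentric[OF that(1)] closedin_mcball])
  obtain r0 where r0: "r0 > 0" "compactin mtopology (mcball p r0)" using loc[OF p] by blast
  define S where "S = {s. compactin mtopology (mcball p s)}"
  have bdd: "bdd_above S" using down neg unfolding S_def by (intro bdd_aboveI[of _ R]) (metis linear mem_Collect_eq)
  define \<rho> where "\<rho> = Sup S"
  have \<rho>0: "\<rho> \<ge> r0" unfolding \<rho>_def by (rule cSup_upper[OF _ bdd]) (simp add: S_def r0)
  have less: "compactin mtopology (mcball p s)" if s: "s < \<rho>" for s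
  proof -
    have "S \<noteq> {}" using r0(2) unfolding S_def by blast
    then obtain t where "t \<in> S" "s < t" using s less_cSupE[of s S] unfolding \<rho>_def by blast
    then show ?thesis using down[of s t] by (simp add: S_def)
  qed
  have "mtotally_bounded (mcball p \<rho>)"
    unfolding mtotally_bounded_def
  proof (intro allI impI)
    fix \<epsilon> :: real assume \<epsilon>: "\<epsilon> > 0"
    \<comment> \<open>The ball of radius \<open>\<rho> - \<delta>\<close> is compact. Each point of
      the ball of radius \<open>\<rho>\<close> is within \<open>\<delta>\<close> plus
      \<open>\<epsilon> / 3\<close> of it, so an \<open>\<epsilon> / 3\<close> net of the smaller
      ball is an \<open>\<epsilon>\<close> net of the larger one.\<close>
    define \<delta> where "\<delta> = min (\<epsilon> / 3) (\<rho> / 2)"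
    have \<delta>: "0 < \<delta>" "\<delta> \<le> \<epsilon> / 3" "\<delta> < \<rho>" using \<epsilon> r0 \<rho>0 by (auto simp: \<delta>_def min_def)
    have "mtotally_bounded (mcball p (\<rho> - \<delta>))" by (rule compactin_imp_mtotally_bounded[OF less]) (use \<delta> in simp)
    then obtain K where K: "finite K" "K \<subseteq> mcball p (\<rho> - \<delta>)" "mcball p (\<rho> - \<delta>) \<subseteq> (\<Union>x\<in>K. mball x (\<epsilon> / 3))"
      unfolding mtotally_bounded_def using \<epsilon> by (meson divide_pos_pos zero_less_numeral)
    have "mcball p \<rho> \<subseteq> (\<Union>x\<in>K. mball x \<epsilon>)"
    proof
      fix y assume "y \<in> mcball p \<rho>"
      then have y: "y \<in> M" "d p y \<le> \<rho>" by auto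
      define a where "a = min (d p y) (\<rho> - \<delta>)"
      have a: "0 \<le> a" "a \<le> d p y" "a \<le> \<rho> - \<delta>" "d p y - a \<le> \<delta>" using \<delta> y by (auto simp: a_def min_def)
      obtain z where z: "z \<in> M" "d p z \<le> a" "d z y < d p y - a + \<epsilon> / 3" using len[OF p y(1) a(1,2), of "\<epsilon> / 3"] \<epsilon> by auto
      then have "z \<in> mcball p (\<rho> - \<delta>)" using a p by auto
      then obtain x where x: "x \<in> K" "z \<in> mball x (\<epsilon> / 3)" using K(3) by blast
      have "d x y \<le> d x z + d z y" using x z y by (auto intro: triangle)
      then have "d x y < \<epsilon>" using x(2) z(3) a \<delta> by simp
      then show "y \<in> (\<Union>x\<in>K. mball x \<epsilon>)" using x y by auto
    qed
    moreover have "K \<subseteq> mcball p \<rho>" using K(2) mcball_subset_concentric[of "\<rho> - \<delta>" \<rho> p] \<delta> by auto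
    ultimately show "\<exists>K. finite K \<and> K \<subseteq> mcball p \<rho> \<and> mcball p \<rho> \<subseteq> (\<Union>x\<in>K. mball x \<epsilon>)" using K(1) by blast
  qed
  then have "compactin mtopology (mtopology closure_of (mcball p \<rho>))"
    using mtotally_bounded_eq_compact_closure_of[OF comp] by blast
  then have C: "compactin mtopology (mcball p \<rho>)" by (simp add: closure_of_closedin)
  \<comment> \<open>Finitely many compact balls cover \<open>mcball p \<rho>\<close>. A Lebesgue
    number shows that their union contains a closed ball of radius beyond \<open>\<rho>\<close>,
    which contradicts the choice of \<open>\<rho>\<close> as a supremum.\<close>
  define \<C> where "\<C> = {mball x r | x r. x \<in> M \<and> r > 0 \<and> compactin mtopology (mcball x r)}"
  have cov: "mcball p \<rho> \<subseteq> \<Union>\<C>"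
  proof
    fix x assume "x \<in> mcball p \<rho>"
    then have x: "x \<in> M" by auto
    then obtain r where r: "r > 0" "compactin mtopology (mcball x r)" using loc by blast
    then show "x \<in> \<Union>\<C>" using x unfolding \<C>_def by (intro UnionI[of "mball x r"]) auto
  qed
  have op: "openin mtopology V" if "V \<in> \<C>" for V using that unfolding \<C>_def by auto
  obtain \<F> where F: "finite \<F>" "\<F> \<subseteq> \<C>" "mcball p \<rho> \<subseteq> \<Union>\<F>" using C cov op unfolding compactin_def by blast
  have "\<forall>V\<in>\<F>. \<exists>K. compactin mtopology K \<and> V \<subseteq> K" using F(2) mball_subset_mcball unfolding \<C>_def by blast
  then obtain k where k: "\<And>V. V \<in> \<F> \<Longrightarrow> compactin mtopology (k V) \<and> V \<subseteq> k V" by metis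
  define K where "K = (\<Union>V\<in>\<F>. k V)"
  have K: "compactin mtopology K" unfolding K_def by (rule compactin_Union) (use F k in auto)
  obtain \<delta> where \<delta>: "\<delta> > 0" "\<And>x. x \<in> mcball p \<rho> \<Longrightarrow> \<exists>V\<in>\<F>. mball x \<delta> \<subseteq> V"
    using lebesgue_number[OF C F(3)] op F(2) by blast
  have "mcball p (\<rho> + \<delta> / 2) \<subseteq> K"
  proof
    fix y assume "y \<in> mcball p (\<rho> + \<delta> / 2)"
    then have y: "y \<in> M" "d p y \<le> \<rho> + \<delta> / 2" by auto
    define a where "a = min (d p y) \<rho>"
    have a: "0 \<le> a" "a \<le> d p y" "a \<le> \<rho>" "d p y - a \<le> \<delta> / 2" using y r0 \<rho>0 \<delta>(1) by (auto simp: a_def min_def)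
    obtain z where z: "z \<in> M" "d p z \<le> a" "d z y < d p y - a + \<delta> / 2" using len[OF p y(1) a(1,2), of "\<delta> / 2"] \<delta>(1) by auto
    then have "z \<in> mcball p \<rho>" using a p by auto
    moreover have "y \<in> mball z \<delta>" using z y a by auto
    ultimately show "y \<in> K" using \<delta>(2) k unfolding K_def by blast
  qed
  then have "compactin mtopology (mcball p (\<rho> + \<delta> / 2))"
    by (rule closed_compactin[OF K _ closedin_mcball])
  then have "\<rho> + \<delta> / 2 \<le> \<rho>" unfolding \<rho>_def by (intro cSup_upper[OF _ bdd]) (simp add: S_def)
  then show False using \<delta>(1) by simp
qed

section \<open>Distance against chart coordinates, and the metric topology\<close>

context riemannian_manifold
begin

text \<open>The fundamental theorem of calculus for the coordinate representation, with the
  integrand set to 0 at the finitely many exceptional points. The lower bound \<open>l\<close> on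
  the metric turns Euclidean displacement into length.\<close>

lemma chart_displacement:
  assumes c: "c \<in> A" and p: "piecewise_C1_on A s t \<gamma>" and st: "s \<le> t"
    and im: "\<And>\<tau>. s \<le> \<tau> \<Longrightarrow> \<tau> \<le> t \<Longrightarrow> \<gamma> \<tau> \<in> fst c" and l: "l > 0"
    and lb: "\<And>\<tau> v. s \<le> \<tau> \<Longrightarrow> \<tau> \<le> t \<Longrightarrow> l * norm v \<le> metric_norm (g c) (snd c (\<gamma> \<tau>)) v"
  shows "l * norm (snd c (\<gamma> t) - snd c (\<gamma> s)) \<le> integral {s..t} (speed A g \<gamma>)"
proof (cases "s = t")
  case False
  then have st': "s < t" using st by simp
  obtain S where S: "finite S" "\<And>\<tau>. \<tau> \<in> {s<..<t} - S \<Longrightarrow> isCont \<gamma> \<tau> \<and>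
     (\<forall>c\<in>A. \<gamma> \<tau> \<in> fst c \<longrightarrow> (\<exists>D. ((snd c \<circ> \<gamma>) has_vector_derivative D) (at \<tau>) \<and> speed A g \<gamma> \<tau> = metric_norm (g c) (snd c (\<gamma> \<tau>)) D))"
    using piecewise_C1_on_derivative[OF p] by blast
  define f where "f = (\<lambda>\<tau>. if \<tau> \<in> {s<..<t} - S then vector_derivative (snd c \<circ> \<gamma>) (at \<tau>) else 0)"
  have f: "((snd c \<circ> \<gamma>) has_vector_derivative f \<tau>) (at \<tau>) \<and> speed A g \<gamma> \<tau> = metric_norm (g c) (snd c (\<gamma> \<tau>)) (f \<tau>)" if "\<tau> \<in> {s<..<t} - S" for \<tau>
    using S(2)[OF that] c im[of \<tau>] that vector_derivative_at[of "snd c \<circ> \<gamma>" _ \<tau>] unfolding f_def by fastforce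
  have "continuous_on {s..t} (snd c \<circ> \<gamma>)"
    by (rule continuous_on_compose[OF piecewise_C1_on_continuous[OF p st'] continuous_on_subset[OF continuous_on_chart[OF c]]]) (use im in auto)
  then have FI: "(f has_integral ((snd c \<circ> \<gamma>) t - (snd c \<circ> \<gamma>) s)) {s..t}"
    by (intro fundamental_theorem_of_calculus_interior_strong[OF S(1) st]) (use f in blast)
  have i: "(\<lambda>\<tau>. (1 / l) * speed A g \<gamma> \<tau>) integrable_on {s..t}"
    by (rule integrable_on_mult_right[OF piecewise_C1_on_speed_integrable[OF p]])
  have "norm (integral {s..t} f) \<le> integral {s..t} (\<lambda>\<tau>. (1 / l) * speed A g \<gamma> \<tau>)"
  proof (rule integral_norm_bound_integral[OF has_integral_integrable[OF FI] i])
    fix \<tau> assume \<tau>: "\<tau> \<in> {s..t}"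
    show "norm (f \<tau>) \<le> (1 / l) * speed A g \<gamma> \<tau>"
    proof (cases "\<tau> \<in> {s<..<t} - S")
      case True
      then have "l * norm (f \<tau>) \<le> speed A g \<gamma> \<tau>" using f[OF True] lb[of \<tau> "f \<tau>"] by auto
      then show ?thesis using l by (simp add: field_simps)
    next
      case False
      then have "f \<tau> = 0" unfolding f_def by auto
      then show ?thesis using speed_nonneg[of \<gamma> \<tau>] l by simp
    qed
  qed
  then have "norm (snd c (\<gamma> t) - snd c (\<gamma> s)) \<le> (1 / l) * integral {s..t} (speed A g \<gamma>)"
    using integral_unique[OF FI] by simp
  then show ?thesis using l by (simp add: field_simps)
qed simp

text \<open>A short curve cannot leave the chart ball. The truncated coordinate distance
  \<open>u\<close>, equal to \<open>r'\<close> away from \<open>p\<close>, grows at most at the rate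
  of the speed divided by \<open>l\<close>; as it is defined on the whole manifold, the curve need
  not be known to stay in the chart.\<close>

lemma curve_in_chart_ball:
  assumes c: "c \<in> A" and p: "p \<in> fst c" and r: "cball (snd c p) r \<subseteq> chart_range c" and l: "l > 0"
    and lb: "\<And>x v. x \<in> cball (snd c p) r \<Longrightarrow> l * norm v \<le> metric_norm (g c) x v"
    and r': "0 < r'" "r' < r" and pc: "piecewise_C1_on A a b \<gamma>" and ab: "a < b" and \<gamma>a: "\<gamma> a = p"
    and L: "integral {a..b} (speed A g \<gamma>) < l * r'"
  shows "\<gamma> b \<in> fst c \<and> l * norm (snd c (\<gamma> b) - snd c p) \<le> integral {a..b} (speed A g \<gamma>)"
proof -
  define x0 where "x0 = snd c p"
  define B where "B = chart_pt c ` ball x0 r"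
  define B' where "B' = chart_pt c ` cball x0 r'"
  define u where "u = (\<lambda>q. if q \<in> B' then norm (snd c q - x0) else r')"
  have inr: "cball x0 r \<subseteq> chart_range c" "ball x0 r \<subseteq> chart_range c" "cball x0 r' \<subseteq> chart_range c" "ball x0 r \<subseteq> cball x0 r"
    using r r' by (auto simp: x0_def subset_iff)
  have oB: "open B" unfolding B_def by (rule open_chart_pt_image[OF c open_ball inr(2)])
  have "compact B'" unfolding B'_def
    by (rule compact_continuous_image[OF continuous_on_subset[OF continuous_on_chart_pt[OF c] inr(3)] compact_cball])
  then have oB': "open (- B')" using compact_imp_closed by blast
  have Bu: "q \<in> fst c \<and> snd c q \<in> ball x0 r \<and> u q = min r' (norm (snd c q - x0))" if q: "q \<in> B" for q
  proof -
    obtain x where x: "x \<in> ball x0 r" "q = chart_pt c x" using q unfolding B_def by blast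
    then have q': "q \<in> fst c" "snd c q = x" using chart_pt[OF c, of x] inr by auto
    have "q \<in> B' \<longleftrightarrow> norm (snd c q - x0) \<le> r'"
    proof
      assume "q \<in> B'"
      then obtain y where "y \<in> cball x0 r'" "q = chart_pt c y" unfolding B'_def by blast
      then show "norm (snd c q - x0) \<le> r'" using chart_pt[OF c, of y] inr by (auto simp: dist_norm norm_minus_commute)
    next
      assume "norm (snd c q - x0) \<le> r'"
      then show "q \<in> B'" unfolding B'_def using x q' by (intro image_eqI[of _ _ x]) (auto simp: dist_norm norm_minus_commute)
    qed
    then show ?thesis using x q' unfolding u_def by auto
  qed
  define P where "P = (\<lambda>s t. a \<le> s \<longrightarrow> s \<le> t \<longrightarrow> t \<le> b \<longrightarrow> l * (u (\<gamma> t) - u (\<gamma> s)) \<le> integral {s..t} (speed A g \<gamma>))"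
  have cg: "continuous_on {a..b} \<gamma>" by (rule piecewise_C1_on_continuous[OF pc ab])
  have near: "\<exists>\<delta>>0. \<forall>\<tau>\<in>{a..b}. \<bar>\<tau> - x\<bar> < \<delta> \<longrightarrow> \<gamma> \<tau> \<in> V" if V: "open V" "\<gamma> x \<in> V" and x: "x \<in> {a..b}" for V x
  proof -
    have "continuous (at x within {a..b}) \<gamma>" using cg x continuous_on_eq_continuous_within by blast
    then have "\<forall>\<^sub>F \<tau> in at x within {a..b}. \<gamma> \<tau> \<in> V" using V unfolding continuous_within by (rule topological_tendstoD)
    then obtain d where d: "d > 0" "\<And>\<tau>. \<tau> \<in> {a..b} \<Longrightarrow> \<tau> \<noteq> x \<Longrightarrow> dist \<tau> x < d \<Longrightarrow> \<gamma> \<tau> \<in> V"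
      unfolding eventually_at by blast
    have "\<gamma> \<tau> \<in> V" if "\<tau> \<in> {a..b}" "\<bar>\<tau> - x\<bar> < d" for \<tau>
      using d(2)[of \<tau>] V(2) that by (cases "\<tau> = x") (auto simp: dist_real_def)
    then show ?thesis using d(1) by blast
  qed
  \<comment> \<open>Bisection: the claim is additive over adjacent intervals, so it suffices to have
    it on small intervals around each parameter, where the curve runs either inside \<open>B\<close>
    or outside \<open>B'\<close>.\<close>
  have "P a b"
  proof (rule Bolzano[of a b P])
    show "a \<le> b" using ab by simp
    fix s t v assume h: "P s t" "P t v" "s \<le> t" "t \<le> v"
    show "P s v" unfolding P_def
    proof (intro impI)
      assume h': "a \<le> s" "s \<le> v" "v \<le> b"
      have "integral {s..t} (speed A g \<gamma>) + integral {t..v} (speed A g \<gamma>) = integral {s..v} (speed A g \<gamma>)"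
        by (rule Henstock_Kurzweil_Integration.integral_combine[OF h(3,4) piecewise_C1_on_speed_integrable[OF piecewise_C1_on_subinterval[OF pc h'(1,3)]]])
      then show "l * (u (\<gamma> v) - u (\<gamma> s)) \<le> integral {s..v} (speed A g \<gamma>)"
        using h h' unfolding P_def by (simp add: algebra_simps)
    qed
  next
    fix x assume x: "a \<le> x" "x \<le> b"
    show "\<exists>d>0. \<forall>s t. s \<le> x \<and> x \<le> t \<and> t - s < d \<longrightarrow> P s t"
    proof (cases "\<gamma> x \<in> B")
      case True
      obtain d where d: "d > 0" "\<And>\<tau>. \<tau> \<in> {a..b} \<Longrightarrow> \<bar>\<tau> - x\<bar> < d \<Longrightarrow> \<gamma> \<tau> \<in> B" using near[OF oB True] x by auto
      have "P s t" if st: "s \<le> x" "x \<le> t" "t - s < d" for s t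
        unfolding P_def
      proof (intro impI)
        assume h: "a \<le> s" "s \<le> t" "t \<le> b"
        have \<gamma>B: "\<gamma> \<tau> \<in> B" if "s \<le> \<tau>" "\<tau> \<le> t" for \<tau> using d(2)[of \<tau>] that st h by auto
        have "u (\<gamma> t) - u (\<gamma> s) \<le> norm (snd c (\<gamma> t) - snd c (\<gamma> s))"
        proof -
          have "u (\<gamma> t) = min r' (norm (snd c (\<gamma> t) - x0))" "u (\<gamma> s) = min r' (norm (snd c (\<gamma> s) - x0))"
            using Bu[OF \<gamma>B[of t]] Bu[OF \<gamma>B[of s]] h by auto
          moreover have "norm (snd c (\<gamma> t) - x0) \<le> norm (snd c (\<gamma> t) - snd c (\<gamma> s)) + norm (snd c (\<gamma> s) - x0)"
            using norm_triangle_ineq[of "snd c (\<gamma> t) - snd c (\<gamma> s)" "snd c (\<gamma> s) - x0"] by simp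
          ultimately show ?thesis using norm_ge_zero[of "snd c (\<gamma> t) - snd c (\<gamma> s)"] by linarith
        qed
        then have "l * (u (\<gamma> t) - u (\<gamma> s)) \<le> l * norm (snd c (\<gamma> t) - snd c (\<gamma> s))" using l by simp
        also have "\<dots> \<le> integral {s..t} (speed A g \<gamma>)"
        proof (rule chart_displacement[OF c piecewise_C1_on_subinterval[OF pc h(1,3)] h(2) _ l])
          fix \<tau> v assume \<tau>: "s \<le> \<tau>" "\<tau> \<le> t"
          then show "\<gamma> \<tau> \<in> fst c" using Bu[OF \<gamma>B[OF \<tau>]] by simp
          have "snd c (\<gamma> \<tau>) \<in> cball (snd c p) r" using Bu[OF \<gamma>B[OF \<tau>]] by (simp add: x0_def)
          then show "l * norm v \<le> metric_norm (g c) (snd c (\<gamma> \<tau>)) v" by (rule lb)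
        qed
        finally show "l * (u (\<gamma> t) - u (\<gamma> s)) \<le> integral {s..t} (speed A g \<gamma>)" .
      qed
      then show ?thesis using d(1) by blast
    next
      case False
      have "B' \<subseteq> B" unfolding B_def B'_def using r' by (intro image_mono) auto
      then have xB': "\<gamma> x \<in> - B'" using False by blast
      obtain d where d: "d > 0" "\<And>\<tau>. \<tau> \<in> {a..b} \<Longrightarrow> \<bar>\<tau> - x\<bar> < d \<Longrightarrow> \<gamma> \<tau> \<in> - B'"
      proof -
        have "x \<in> {a..b}" using x by simp
        from near[OF oB' xB' this] show ?thesis using that by blast
      qed
      have "P s t" if st: "s \<le> x" "x \<le> t" "t - s < d" for s t
        unfolding P_def
      proof (intro impI)
        assume h: "a \<le> s" "s \<le> t" "t \<le> b"
        have "u (\<gamma> t) = r'" "u (\<gamma> s) = r'" using d(2)[of t] d(2)[of s] st h by (auto simp: u_def)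
        then show "l * (u (\<gamma> t) - u (\<gamma> s)) \<le> integral {s..t} (speed A g \<gamma>)" using piecewise_C1_on_length_nonneg by simp
      qed
      then show ?thesis using d(1) by blast
    qed
  qed
  then have "l * (u (\<gamma> b) - u p) \<le> integral {a..b} (speed A g \<gamma>)" using ab \<gamma>a unfolding P_def by simp
  moreover have "p \<in> B" unfolding B_def x0_def using r' c p by (intro image_eqI[of _ _ "snd c p"]) auto
  then have "u p = 0" using Bu[of p] r' by (simp add: x0_def)
  ultimately have ub: "l * u (\<gamma> b) \<le> integral {a..b} (speed A g \<gamma>)" by simp
  then have "l * u (\<gamma> b) < l * r'" using L by linarith
  then have "u (\<gamma> b) < r'" using l by simp
  then have bB': "\<gamma> b \<in> B'" unfolding u_def by (auto split: if_splits)
  moreover have "B' \<subseteq> B" unfolding B_def B'_def using r' by (intro image_mono) auto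
  ultimately have "\<gamma> b \<in> fst c" using Bu by blast
  then show ?thesis using ub bB' unfolding u_def x0_def by simp
qed

text \<open>The estimate for curves passes to the infimum. The bounds \<open>m\<close> are kept at
  most \<open>l * r'\<close>, so that the nearly optimal curves remain in the chart.\<close>

lemma riem_dist_lower:
  assumes c: "c \<in> A" and p: "p \<in> fst c" and r: "cball (snd c p) r \<subseteq> chart_range c" and l: "l > 0"
    and lb: "\<And>x v. x \<in> cball (snd c p) r \<Longrightarrow> l * norm v \<le> metric_norm (g c) x v"
    and r': "0 < r'" "r' < r" and d: "riem_dist A g p q < l * r'"
  shows "q \<in> fst c \<and> l * norm (snd c q - snd c p) \<le> riem_dist A g p q"
proof -
  have *: "q \<in> fst c \<and> l * norm (snd c q - snd c p) \<le> m" if m: "riem_dist A g p q < m" "m \<le> l * r'" for m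
  proof -
    obtain \<gamma> where \<gamma>: "piecewise_C1_on A 0 1 \<gamma>" "\<gamma> 0 = p" "\<gamma> 1 = q" "integral {0..1} (speed A g \<gamma>) < m"
      using riem_dist_lessD[OF m(1)] by blast
    have "integral {0..1} (speed A g \<gamma>) < l * r'" using \<gamma>(4) m(2) by simp
    from curve_in_chart_ball[OF c p r l lb r' \<gamma>(1) zero_less_one \<gamma>(2) this]
    show ?thesis using \<gamma> by auto
  qed
  have "l * norm (snd c q - snd c p) \<le> riem_dist A g p q"
  proof (rule dense_ge)
    fix m assume "riem_dist A g p q < m"
    then show "l * norm (snd c q - snd c p) \<le> m" using *[of "min m (l * r')"] d by auto
  qed
  then show ?thesis using *[of "l * r'"] d by simp
qed

lemma riem_dist_zero: "riem_dist A g p p = 0"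
proof -
  define c where "c = chart_at A p"
  have c: "c \<in> A" "p \<in> fst c" unfolding c_def by (rule chart_at)+
  then have "riem_dist A g (chart_pt c (snd c p)) (chart_pt c (snd c p)) \<le> 0"
    by (intro riem_dist_segment[OF c(1)]) (auto simp: metric_norm_def metric_ip_linear)
  then show ?thesis using riem_dist_nonneg[of p p] c by simp
qed

text \<open>The axiom still to be proved is definiteness: by \<open>riem_dist_lower\<close>,
  distance 0 forces equal coordinates in one chart.\<close>

sublocale dist: Metric_space UNIV "riem_dist A g"
proof
  show "0 \<le> riem_dist A g p q" for p q by (rule riem_dist_nonneg)
  show "riem_dist A g p q = riem_dist A g q p" for p q by (rule riem_dist_sym)
  show "riem_dist A g p r \<le> riem_dist A g p q + riem_dist A g q r" for p q r by (rule riem_dist_triangle)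
  show "riem_dist A g p q = 0 \<longleftrightarrow> p = q" for p q
  proof
    assume d: "riem_dist A g p q = 0"
    define c where "c = chart_at A p"
    have c: "c \<in> A" "p \<in> fst c" unfolding c_def by (rule chart_at)+
    obtain r a where r: "0 < r" "0 < a" "cball (snd c p) r \<subseteq> chart_range c"
      "\<And>y v. y \<in> cball (snd c p) r \<Longrightarrow> a * norm v \<le> metric_norm (g c) y v"
      using chart_nbhd[OF c(1), of "snd c p"] c by blast
    have "q \<in> fst c \<and> a * norm (snd c q - snd c p) \<le> riem_dist A g p q"
      by (rule riem_dist_lower[OF c r(3,2,4), of "r / 2"]) (use r d in auto)
    then have "q \<in> fst c" "snd c q = snd c p" using d r(2) by (auto simp: mult_le_0_iff)
    then show "p = q" using chart_inj[OF c(1)] c(2) by (metis inj_onD)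
  qed (simp add: riem_dist_zero)
qed

lemma riem_ball_nbhd:
  assumes "open U" "p \<in> U" shows "\<exists>r>0. \<forall>q. riem_dist A g p q < r \<longrightarrow> q \<in> U"
proof -
  define c where "c = chart_at A p"
  have c: "c \<in> A" "p \<in> fst c" unfolding c_def by (rule chart_at)+
  obtain r a where r: "0 < r" "0 < a" "cball (snd c p) r \<subseteq> chart_range c"
    "\<And>y v. y \<in> cball (snd c p) r \<Longrightarrow> a * norm v \<le> metric_norm (g c) y v"
    using chart_nbhd[OF c(1), of "snd c p"] c by blast
  have "open (snd c ` (U \<inter> fst c))" by (rule open_chart_image[OF c(1)]) (use assms open_domain[OF c(1)] in auto)
  then obtain s where s: "s > 0" "ball (snd c p) s \<subseteq> snd c ` (U \<inter> fst c)"
    using assms(2) c(2) open_contains_ball by (metis IntI image_eqI)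
  define t where "t = min (r / 2) s"
  have t: "0 < t" "t < r" "t \<le> s" using r s by (auto simp: t_def)
  have "q \<in> U" if q: "riem_dist A g p q < a * t" for q
  proof -
    have h: "q \<in> fst c" "a * norm (snd c q - snd c p) \<le> riem_dist A g p q"
      using riem_dist_lower[OF c r(3,2,4) t(1,2) q] by auto
    then have "a * norm (snd c q - snd c p) < a * t" using q by simp
    then have "norm (snd c q - snd c p) < s" using r(2) t by simp
    then have "snd c q \<in> snd c ` (U \<inter> fst c)" using s(2) by (auto simp: dist_norm norm_minus_commute)
    then show "q \<in> U" using h(1) chart_inj[OF c(1)] by (auto dest: inj_onD)
  qed
  then show ?thesis using r t by (intro exI[of _ "a * t"]) auto
qed

lemma riem_nbhd_ball:
  assumes e: "e > 0" shows "\<exists>V. open V \<and> p \<in> V \<and> (\<forall>q\<in>V. riem_dist A g p q < e)"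
proof -
  define c where "c = chart_at A p"
  have c: "c \<in> A" "p \<in> fst c" unfolding c_def by (rule chart_at)+
  obtain r b where r: "0 < r" "0 < b" "cball (snd c p) r \<subseteq> chart_range c"
    "\<And>y v. y \<in> cball (snd c p) r \<Longrightarrow> metric_norm (g c) y v \<le> b * norm v"
    using chart_nbhd[OF c(1), of "snd c p"] c by blast
  define s where "s = min r (e / b)"
  have s: "0 < s" "s \<le> r" "b * s \<le> e" using r e by (auto simp: s_def min_def field_simps)
  define V where "V = chart_pt c ` ball (snd c p) s"
  have "open V" unfolding V_def by (rule open_chart_pt_image[OF c(1)]) (use r(3) s in \<open>auto simp: subset_iff\<close>)
  moreover have "p \<in> V" unfolding V_def using s c by (intro image_eqI[of _ _ "snd c p"]) auto
  moreover have "riem_dist A g p q < e" if "q \<in> V" for q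
  proof -
    have "\<exists>y\<in>ball (snd c p) s. q = chart_pt c y" using that unfolding V_def by blast
    then obtain y where y: "y \<in> ball (snd c p) s" "q = chart_pt c y" by blast
    have "riem_dist A g (chart_pt c (snd c p)) (chart_pt c y) \<le> b * norm (y - snd c p)"
      by (rule riem_dist_upper[OF c(1) r(3,4)]) (use y s r in auto)
    also have "\<dots> < b * s" using y r by (simp add: dist_norm norm_minus_commute)
    finally show ?thesis using y c s by simp
  qed
  ultimately show ?thesis by blast
qed

text \<open>Makes compactness of closed metric balls a statement about the topology of the manifold,
  in which continuous functions attain their infimum on them.\<close>

lemma mtopology_eq: "dist.mtopology = euclidean"
proof (rule topology_eq[THEN iffD2], intro allI)
  fix S
  show "openin dist.mtopology S \<longleftrightarrow> openin euclidean S"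
  proof
    assume S: "openin dist.mtopology S"
    have "\<exists>V. open V \<and> p \<in> V \<and> V \<subseteq> S" if p: "p \<in> S" for p
    proof -
      obtain r where r: "r > 0" "dist.mball p r \<subseteq> S" using S p unfolding dist.openin_mtopology by blast
      obtain V where V: "open V" "p \<in> V" "\<And>q. q \<in> V \<Longrightarrow> riem_dist A g p q < r" using riem_nbhd_ball[OF r(1), of p] by metis
      have "V \<subseteq> S" using V(3) r(2) by (auto simp: subset_iff)
      then show ?thesis using V by blast
    qed
    then show "openin euclidean S" using open_subopen[of S] by auto
  next
    assume "openin euclidean S"
    then have "open S" by simp
    have "\<exists>r>0. dist.mball p r \<subseteq> S" if p: "p \<in> S" for p
    proof -
      obtain r where r: "r > 0" "\<forall>q. riem_dist A g p q < r \<longrightarrow> q \<in> S" using riem_ball_nbhd[OF \<open>open S\<close> p] by blast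
      have "dist.mball p r \<subseteq> S" using r(2) by (auto simp: subset_iff)
      then show ?thesis using r(1) by blast
    qed
    then show "openin dist.mtopology S" unfolding dist.openin_mtopology by simp
  qed
qed

lemma continuous_on_riem_dist: "continuous_on S (\<lambda>q. riem_dist A g p q)"
proof -
  have "isCont (\<lambda>q. riem_dist A g p q) q" for q
    unfolding continuous_at
  proof (rule tendstoI)
    fix e :: real assume "e > 0"
    then obtain V where V: "open V" "q \<in> V" "\<And>q'. q' \<in> V \<Longrightarrow> riem_dist A g q q' < e" using riem_nbhd_ball[of e q] by metis
    have "dist (riem_dist A g p q') (riem_dist A g p q) < e" if "q' \<in> V" for q'
      using V(3)[OF that] riem_dist_triangle[of p q' q] riem_dist_triangle[of p q q'] riem_dist_sym[of q q']
      by (simp add: dist_real_def)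
    then show "\<forall>\<^sub>F q' in at q. dist (riem_dist A g p q') (riem_dist A g p q) < e"
      using V(1,2) unfolding eventually_at_topological by blast
  qed
  then show ?thesis by (simp add: continuous_at_imp_continuous_on)
qed

text \<open>On a nearly shortest curve from \<open>p\<close> the distance from \<open>p\<close>
  takes the value \<open>a\<close> by the intermediate value theorem. This is the length space
  property that compactness of balls is derived from.\<close>

lemma almost_between:
  assumes a: "0 \<le> a" "a \<le> riem_dist A g p q" and e: "e > 0"
  shows "\<exists>z. riem_dist A g p z \<le> a \<and> riem_dist A g z q < riem_dist A g p q - a + e"
proof -
  obtain \<gamma> where \<gamma>: "piecewise_C1_on A 0 1 \<gamma>" "\<gamma> 0 = p" "\<gamma> 1 = q" "integral {0..1} (speed A g \<gamma>) < riem_dist A g p q + e"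
    using riem_dist_lessD[of p q "riem_dist A g p q + e"] e by auto
  have c: "continuous_on {0..1} (\<lambda>t. riem_dist A g p (\<gamma> t))"
    by (rule continuous_on_compose2[OF continuous_on_riem_dist[of UNIV] piecewise_C1_on_continuous[OF \<gamma>(1)]]) auto
  obtain t where t: "0 \<le> t" "t \<le> 1" "riem_dist A g p (\<gamma> t) = a"
    using IVT'[of "\<lambda>t. riem_dist A g p (\<gamma> t)" 0 a 1] c a \<gamma> riem_dist_zero by auto
  have le: "riem_dist A g (\<gamma> u) (\<gamma> v) \<le> integral {u..v} (speed A g \<gamma>)" if "0 \<le> u" "u \<le> v" "v \<le> 1" for u v
    using riem_dist_le_length[OF piecewise_C1_on_subinterval[OF \<gamma>(1) that(1,3)]] that riem_dist_zero by (cases "u = v") auto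
  have "a + riem_dist A g (\<gamma> t) q \<le> integral {0..t} (speed A g \<gamma>) + integral {t..1} (speed A g \<gamma>)"
    using le[of 0 t] le[of t 1] t \<gamma> by simp
  also have "\<dots> = integral {0..1} (speed A g \<gamma>)"
    by (rule Henstock_Kurzweil_Integration.integral_combine[OF t(1,2) piecewise_C1_on_speed_integrable[OF \<gamma>(1)]])
  finally show ?thesis using \<gamma>(4) t by (intro exI[of _ "\<gamma> t"]) auto
qed

lemma chart_ball_compact:
  "\<exists>r>0. compact (dist.mcball p r)"
proof -
  define c where "c = chart_at A p"
  have c: "c \<in> A" "p \<in> fst c" unfolding c_def by (rule chart_at)+
  obtain r a where r: "0 < r" "0 < a" "cball (snd c p) r \<subseteq> chart_range c"
    "\<And>y v. y \<in> cball (snd c p) r \<Longrightarrow> a * norm v \<le> metric_norm (g c) y v"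
    using chart_nbhd[OF c(1), of "snd c p"] c by blast
  have "compact (chart_pt c ` cball (snd c p) r)"
    by (rule compact_continuous_image[OF continuous_on_subset[OF continuous_on_chart_pt[OF c(1)] r(3)] compact_cball])
  moreover have "closed (dist.mcball p (a * r / 4))"
    using dist.closedin_mcball[of p "a * r / 4"] unfolding mtopology_eq by simp
  moreover have "dist.mcball p (a * r / 4) \<subseteq> chart_pt c ` cball (snd c p) r"
  proof
    fix q assume "q \<in> dist.mcball p (a * r / 4)"
    then have q: "riem_dist A g p q \<le> a * r / 4" by simp
    have "a * r > 0" using r by simp
    then have "riem_dist A g p q < a * (r / 2)" using q by simp
    then have h: "q \<in> fst c" "a * norm (snd c q - snd c p) \<le> riem_dist A g p q"
      using riem_dist_lower[OF c r(3,2,4), of "r / 2" q] r(1) by auto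
    then have "a * norm (snd c q - snd c p) \<le> a * r" using q \<open>a * r > 0\<close> by simp
    then have "snd c q \<in> cball (snd c p) r" using r(2) by (simp add: dist_norm norm_minus_commute)
    then show "q \<in> chart_pt c ` cball (snd c p) r" using h(1) c(1) by (intro image_eqI[of _ _ "snd c q"]) auto
  qed
  ultimately have "compact (dist.mcball p (a * r / 4))" by (metis compact_Int_closed inf.absorb_iff2)
  then show ?thesis using r by (intro exI[of _ "a * r / 4"]) auto
qed

lemma mcball_compact:
  assumes "dist.mcomplete" shows "compact (dist.mcball p R)"
proof -
  have "compactin dist.mtopology (dist.mcball p R)"
  proof (rule dist.length_space_mcball_compact[OF assms])
    show "\<exists>r>0. compactin dist.mtopology (dist.mcball x r)" for x
      using chart_ball_compact unfolding mtopology_eq by simp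
    show "\<exists>z\<in>UNIV. riem_dist A g x z \<le> a \<and> riem_dist A g z y < riem_dist A g x y - a + e"
      if "0 \<le> a" "a \<le> riem_dist A g x y" "0 < e" for x y a e using almost_between[OF that] by blast
  qed simp
  then show ?thesis unfolding mtopology_eq by simp
qed

text \<open>The error in \<open>almost_between\<close> disappears on minimizing the distance to
  \<open>q\<close> over the compact ball of radius \<open>a\<close> about \<open>p\<close>.\<close>

lemma between_exists:
  assumes comp: "dist.mcomplete" and a: "0 \<le> a" "a \<le> riem_dist A g p q"
  shows "\<exists>z. riem_dist A g p z = a \<and> riem_dist A g z q = riem_dist A g p q - a"
proof -
  have ne: "dist.mcball p a \<noteq> {}" using a dist.mcball_eq_empty by simp
  obtain z where z: "z \<in> dist.mcball p a" "\<And>y. y \<in> dist.mcball p a \<Longrightarrow> riem_dist A g q z \<le> riem_dist A g q y"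
    using continuous_attains_inf[OF mcball_compact[OF comp] ne continuous_on_riem_dist[of _ q]] by blast
  have "riem_dist A g z q \<le> riem_dist A g p q - a"
  proof (rule field_le_epsilon)
    fix e :: real assume "e > 0"
    from almost_between[OF a this] obtain y where y: "riem_dist A g p y \<le> a" "riem_dist A g y q < riem_dist A g p q - a + e" by blast
    then show "riem_dist A g z q \<le> riem_dist A g p q - a + e"
      using z(2)[of y] riem_dist_sym[of q] by auto
  qed
  moreover have "riem_dist A g p z \<le> a" using z(1) by simp
  ultimately have "riem_dist A g p z = a" "riem_dist A g z q = riem_dist A g p q - a"
    using riem_dist_triangle[of p q z] by auto
  then show ?thesis by blast
qed

text \<open>Testing the lengths of the image curves against the distances of their end points and applying the
  Cauchy-Schwarz inequality under the integral replaces Minkowski's integral inequality.\<close>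

lemma contraction:
  fixes \<psi> :: "'j \<Rightarrow> real ^ 'm \<Rightarrow> real ^ 'm"
  assumes c: "c \<in> A" and W: "W \<subseteq> chart_range c" and J: "finite J"
    and \<psi>: "\<And>j. j \<in> J \<Longrightarrow> Ck_on (Suc 0) (\<psi> j) W" "\<And>j. j \<in> J \<Longrightarrow> \<psi> j ` W \<subseteq> chart_range c"
    and B: "B \<ge> 0" "\<And>x v. x \<in> W \<Longrightarrow> (\<Sum>j\<in>J. (metric_norm (g c) (\<psi> j x) (frechet_derivative (\<psi> j) (at x) v))\<^sup>2) \<le> B\<^sup>2 * (metric_norm (g c) x v)\<^sup>2"
    and ball: "\<And>q. riem_dist A g y q < \<rho> \<Longrightarrow> q \<in> chart_pt c ` W" and yz: "riem_dist A g y z < \<rho>"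
  shows "(\<Sum>j\<in>J. (riem_dist A g (chart_pt c (\<psi> j (snd c y))) (chart_pt c (\<psi> j (snd c z))))\<^sup>2) \<le> B\<^sup>2 * (riem_dist A g y z)\<^sup>2"
proof -
  define D where "D = (\<lambda>j. riem_dist A g (chart_pt c (\<psi> j (snd c y))) (chart_pt c (\<psi> j (snd c z))))"
  define N where "N = sqrt (\<Sum>j\<in>J. (D j)\<^sup>2)"
  have N2: "N\<^sup>2 = (\<Sum>j\<in>J. (D j)\<^sup>2)" "N \<ge> 0" unfolding N_def by (simp_all add: sum_nonneg)
  have main: "N \<le> B * m" if m: "riem_dist A g y z < m" "m \<le> \<rho>" for m
  proof (cases "N = 0")
    case True
    have "0 \<le> m" using m riem_dist_nonneg[of y z] by linarith
    then show ?thesis using True B(1) by simp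
  next
    case False
    then have N: "N > 0" using N2(2) by simp
    obtain \<gamma> where \<gamma>: "piecewise_C1_on A 0 1 \<gamma>" "\<gamma> 0 = y" "\<gamma> 1 = z" "integral {0..1} (speed A g \<gamma>) < m"
      using riem_dist_lessD[OF m(1)] by blast
    \<comment> \<open>Points of a curve from \<open>y\<close> of length below \<open>\<rho>\<close>
      are within \<open>\<rho>\<close> of \<open>y\<close>, hence where the maps are
      defined.\<close>
    have \<gamma>W: "\<gamma> t \<in> chart_pt c ` W" if t: "0 \<le> t" "t \<le> 1" for t
    proof (rule ball)
      have "riem_dist A g y (\<gamma> t) \<le> integral {0..t} (speed A g \<gamma>)"
        using riem_dist_le_length[OF piecewise_C1_on_subinterval[OF \<gamma>(1), of 0 t]] t \<gamma>(2) riem_dist_zero by (cases "t = 0") auto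
      also have "\<dots> \<le> integral {0..t} (speed A g \<gamma>) + integral {t..1} (speed A g \<gamma>)" using piecewise_C1_on_length_nonneg by simp
      also have "\<dots> = integral {0..1} (speed A g \<gamma>)"
        by (rule Henstock_Kurzweil_Integration.integral_combine[OF t piecewise_C1_on_speed_integrable[OF \<gamma>(1)]])
      finally show "riem_dist A g y (\<gamma> t) < \<rho>" using \<gamma>(4) m(2) by simp
    qed
    define \<gamma>' where "\<gamma>' = (\<lambda>j t. chart_pt c (\<psi> j (snd c (\<gamma> t))))"
    have p': "piecewise_C1_on A 0 1 (\<gamma>' j)" if "j \<in> J" for j
      unfolding \<gamma>'_def by (rule piecewise_C1_on_chart_map[OF c \<gamma>(1) W \<gamma>W \<psi>(1)[OF that] \<psi>(2)[OF that]])
    obtain S where S: "finite S" "\<And>t. t \<in> {0<..<1} - S \<Longrightarrow> \<exists>D. speed A g \<gamma> t = metric_norm (g c) (snd c (\<gamma> t)) D \<and>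
      (\<forall>j\<in>J. speed A g (\<gamma>' j) t = metric_norm (g c) (\<psi> j (snd c (\<gamma> t))) (frechet_derivative (\<psi> j) (at (snd c (\<gamma> t))) D))"
      using piecewise_C1_on_chart_map_speed[OF c \<gamma>(1) W \<gamma>W \<psi>, of J "\<lambda>j. j"] unfolding \<gamma>'_def by blast
    have "N\<^sup>2 \<le> (\<Sum>j\<in>J. D j * integral {0..1} (speed A g (\<gamma>' j)))"
      unfolding N2(1)
    proof (rule sum_mono)
      fix j assume j: "j \<in> J"
      have "D j \<le> integral {0..1} (speed A g (\<gamma>' j))"
        using riem_dist_le_length[OF p'[OF j]] \<gamma> by (simp add: D_def \<gamma>'_def)
      then show "(D j)\<^sup>2 \<le> D j * integral {0..1} (speed A g (\<gamma>' j))"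
        unfolding power2_eq_square by (rule mult_left_mono) (simp add: D_def riem_dist_nonneg)
    qed
    also have "\<dots> = integral {0..1} (\<lambda>t. \<Sum>j\<in>J. D j * speed A g (\<gamma>' j) t)"
      by (subst integral_sum) (use J p' piecewise_C1_on_speed_integrable in \<open>auto intro!: integrable_on_mult_right\<close>)
    also have "\<dots> \<le> integral {0..1} (\<lambda>t. (N * B) * speed A g \<gamma> t)"
    proof (rule integral_mono_finite[OF _ _ S(1)])
      show "(\<lambda>t. \<Sum>j\<in>J. D j * speed A g (\<gamma>' j) t) integrable_on {0..1}"
        by (intro integrable_sum integrable_on_mult_right piecewise_C1_on_speed_integrable p' J)
      show "(\<lambda>t. (N * B) * speed A g \<gamma> t) integrable_on {0..1}"
        by (intro integrable_on_mult_right piecewise_C1_on_speed_integrable \<gamma>)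
      fix t assume t: "t \<in> {0<..<1} - S"
      obtain V where V: "speed A g \<gamma> t = metric_norm (g c) (snd c (\<gamma> t)) V"
        "\<And>j. j \<in> J \<Longrightarrow> speed A g (\<gamma>' j) t = metric_norm (g c) (\<psi> j (snd c (\<gamma> t))) (frechet_derivative (\<psi> j) (at (snd c (\<gamma> t))) V)"
        using S(2)[OF t] by blast
      have "\<exists>x\<in>W. \<gamma> t = chart_pt c x" using \<gamma>W[of t] t by auto
      then have xW: "snd c (\<gamma> t) \<in> W" using chart_pt[OF c] W by auto
      have "(\<Sum>j\<in>J. D j * speed A g (\<gamma>' j) t) \<le> L2_set D J * L2_set (\<lambda>j. speed A g (\<gamma>' j) t) J"
        by (rule order_trans[OF sum_mono L2_set_mult_ineq]) (simp add: abs_mult[symmetric])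
      also have "\<dots> \<le> N * (B * speed A g \<gamma> t)"
      proof (rule mult_mono)
        show "L2_set D J \<le> N" by (simp add: L2_set_def N_def)
        have "(\<Sum>j\<in>J. (speed A g (\<gamma>' j) t)\<^sup>2) \<le> (B * speed A g \<gamma> t)\<^sup>2"
          using B(2)[OF xW, of V] V by (simp add: power_mult_distrib)
        then show "L2_set (\<lambda>j. speed A g (\<gamma>' j) t) J \<le> B * speed A g \<gamma> t"
          unfolding L2_set_def using B(1) speed_nonneg by (intro real_le_lsqrt) (auto simp: sum_nonneg)
      qed (use N2 L2_set_nonneg in auto)
      finally show "(\<Sum>j\<in>J. D j * speed A g (\<gamma>' j) t) \<le> (N * B) * speed A g \<gamma> t" by (simp add: mult.assoc)
    qed
    also have "\<dots> = N * B * integral {0..1} (speed A g \<gamma>)" by simp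
    also have "\<dots> \<le> N * (B * m)" using \<gamma>(4) N B(1) by (simp add: mult.assoc mult_left_mono)
    finally show ?thesis using N by (simp add: power2_eq_square)
  qed
  have "N \<le> B * riem_dist A g y z"
  proof (rule field_le_epsilon)
    fix e :: real assume e: "e > 0"
    \<comment> \<open>Capped at \<open>\<rho>\<close> as \<open>main\<close> requires; the
      denominator is \<open>B + 1\<close> because \<open>B\<close> may be 0.\<close>
    define m where "m = min (\<rho>) (riem_dist A g y z + e / (B + 1))"
    have "riem_dist A g y z < m" "m \<le> \<rho>" using e B(1) yz by (auto simp: m_def)
    then have "N \<le> B * m" by (rule main)
    also have "\<dots> \<le> B * (riem_dist A g y z + e / (B + 1))" using B(1) by (intro mult_left_mono) (simp_all add: m_def)
    also have "\<dots> \<le> B * riem_dist A g y z + e"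
    proof -
      have "B * (e / (B + 1)) = (B / (B + 1)) * e" by simp
      also have "\<dots> \<le> 1 * e" using B(1) e by (intro mult_right_mono) (auto simp: field_simps)
      finally show ?thesis by (simp add: distrib_left)
    qed
    finally show "N \<le> B * riem_dist A g y z + e" .
  qed
  then have "N\<^sup>2 \<le> (B * riem_dist A g y z)\<^sup>2" using N2(2) by (intro power_mono)
  then show ?thesis using N2(1) unfolding D_def by (simp add: power_mult_distrib)
qed

end

section \<open>Second order paths\<close>

text \<open>Taylor's formula with Peano remainder. After subtraction of the quadratic part the
  derivative between 0 and \<open>s\<close> is at most e |s|, and the mean value inequality supplies
  the other factor |s|.\<close>

lemma second_order_taylor:
  fixes \<phi> :: "real \<Rightarrow> 'v::real_normed_vector"
  assumes r: "r > 0" and d1: "\<And>s. \<bar>s\<bar> < r \<Longrightarrow> (\<phi> has_vector_derivative \<phi>1 s) (at s)"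
    and d2: "(\<phi>1 has_vector_derivative w) (at 0)" and e: "e > 0"
  shows "\<exists>\<delta>>0. \<forall>s. \<bar>s\<bar> < \<delta> \<longrightarrow> norm (\<phi> s - \<phi> 0 - s *\<^sub>R \<phi>1 0 - (s\<^sup>2/2) *\<^sub>R w) \<le> e * s\<^sup>2"
proof -
  have "\<exists>\<delta>>0. \<forall>s. norm (s - 0) < \<delta> \<longrightarrow> norm (\<phi>1 s - \<phi>1 0 - (s - 0) *\<^sub>R w) \<le> e * norm (s - 0)"
    using d2 e unfolding has_vector_derivative_def has_derivative_at_alt by blast
  then obtain \<delta>0 where \<delta>0: "\<delta>0 > 0" "\<And>s. \<bar>s\<bar> < \<delta>0 \<Longrightarrow> norm (\<phi>1 s - \<phi>1 0 - s *\<^sub>R w) \<le> e * \<bar>s\<bar>"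
    by auto
  define \<delta> where "\<delta> = min r \<delta>0"
  have "norm (\<phi> s - \<phi> 0 - s *\<^sub>R \<phi>1 0 - (s\<^sup>2/2) *\<^sub>R w) \<le> e * s\<^sup>2" if s: "\<bar>s\<bar> < \<delta>" for s
  proof -
    define \<psi> where "\<psi> = (\<lambda>q. \<phi> q - q *\<^sub>R \<phi>1 0 - (q\<^sup>2/2) *\<^sub>R w)"
    have q: "\<bar>q\<bar> \<le> \<bar>s\<bar>" if "q \<in> closed_segment 0 s" for q
      using that by (auto simp: closed_segment_eq_real_ivl split: if_splits)
    have "norm (\<psi> s - \<psi> 0) \<le> (e * \<bar>s\<bar>) * norm (s - 0)"
    proof (rule differentiable_bound[OF convex_closed_segment[of 0 s]])
      fix q assume q': "q \<in> closed_segment 0 s"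
      then have qd: "\<bar>q\<bar> < r" "\<bar>q\<bar> < \<delta>0" using q[OF q'] s by (auto simp: \<delta>_def)
      have "(\<psi> has_vector_derivative \<phi>1 q - \<phi>1 0 - q *\<^sub>R w) (at q)"
      proof -
        have "((\<lambda>q. q *\<^sub>R \<phi>1 0) has_vector_derivative \<phi>1 0) (at q)" "((\<lambda>q. (q\<^sup>2/2) *\<^sub>R w) has_vector_derivative q *\<^sub>R w) (at q)"
          by (auto intro!: derivative_eq_intros simp: has_vector_derivative_def algebra_simps)
        then show ?thesis unfolding \<psi>_def by (intro has_vector_derivative_diff d1 qd)
      qed
      then show "(\<psi> has_derivative (\<lambda>h. h *\<^sub>R (\<phi>1 q - \<phi>1 0 - q *\<^sub>R w))) (at q within closed_segment 0 s)"
        unfolding has_vector_derivative_def by (rule has_derivative_at_withinI)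
      show "onorm (\<lambda>h. h *\<^sub>R (\<phi>1 q - \<phi>1 0 - q *\<^sub>R w)) \<le> e * \<bar>s\<bar>"
      proof (rule onorm_le)
        fix h :: real
        have "norm (\<phi>1 q - \<phi>1 0 - q *\<^sub>R w) \<le> e * \<bar>s\<bar>"
          using \<delta>0(2)[OF qd(2)] q[OF q'] e mult_left_mono[of "\<bar>q\<bar>" "\<bar>s\<bar>" e] by linarith
        then have "norm h * norm (\<phi>1 q - \<phi>1 0 - q *\<^sub>R w) \<le> norm h * (e * \<bar>s\<bar>)" by (rule mult_left_mono) simp
        then show "norm (h *\<^sub>R (\<phi>1 q - \<phi>1 0 - q *\<^sub>R w)) \<le> e * \<bar>s\<bar> * norm h" by (simp add: mult_ac)
      qed
    qed auto
    then show ?thesis by (simp add: \<psi>_def power2_eq_square algebra_simps)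
  qed
  then show ?thesis using r \<delta>0(1) by (intro exI[of _ \<delta>]) (auto simp: \<delta>_def)
qed

lemma Ck_on_nth: "open S \<Longrightarrow> Ck_on k f S \<Longrightarrow> Ck_on k (\<lambda>x. f x $ i) S"
  by (rule Ck_on_linear[OF _ bounded_linear_vec_nth])

lemma mixed_derivative_commute_vec:
  fixes h :: "'a::euclidean_space \<Rightarrow> real ^ 'n::finite"
  assumes S: "open S" and C: "Ck_on 2 h S" and x: "x \<in> S"
  shows "frechet_derivative (\<lambda>y. frechet_derivative h (at y) u) (at x) v
    = frechet_derivative (\<lambda>y. frechet_derivative h (at y) v) (at x) u"
proof -
  have C': "Ck_on (Suc (Suc 0)) h S" using C by (simp only: numeral_2_eq_2)
  have 1: "frechet_derivative (\<lambda>y. h y $ i) (at y) u = frechet_derivative h (at y) u $ i" if "y \<in> S" for y i u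
    using bounded_linear.has_derivative[OF bounded_linear_vec_nth[of i] Ck_on_SucD(1)[OF C' that]] by (metis frechet_derivative_at)
  have "frechet_derivative (\<lambda>y. frechet_derivative h (at y) u) (at x) v $ i
    = frechet_derivative (\<lambda>y. frechet_derivative (\<lambda>y. h y $ i) (at y) u) (at x) v" for u v i
  proof -
    have "((\<lambda>y. frechet_derivative h (at y) u $ i) has_derivative (\<lambda>v. frechet_derivative (\<lambda>y. frechet_derivative h (at y) u) (at x) v $ i)) (at x)"
      by (rule bounded_linear.has_derivative[OF bounded_linear_vec_nth[of i] Ck_on_SucD(1)[OF Ck_on_SucD(2)[OF C'] x]])
    then have "((\<lambda>y. frechet_derivative (\<lambda>y. h y $ i) (at y) u) has_derivative (\<lambda>v. frechet_derivative (\<lambda>y. frechet_derivative h (at y) u) (at x) v $ i)) (at x)"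
      by (rule has_derivative_transform_within_open[OF _ S x]) (simp add: 1)
    then show ?thesis by (metis frechet_derivative_at)
  qed
  then show ?thesis
    using mixed_derivative_commute[OF S Ck_on_nth[OF S C] x] by (simp add: vec_eq_iff)
qed

text \<open>The product rule for a differential applied to a moving vector. As \<open>Ck_on\<close>
  provides second derivatives only in fixed directions, the vector is expanded in the basis before
  differentiation.\<close>

lemma frechet_derivative_second:
  fixes h :: "'a::euclidean_space \<Rightarrow> 'b::real_normed_vector"
  assumes C: "Ck_on 2 h S" and X: "(X has_vector_derivative X') (at t)" and V: "(V has_vector_derivative V') (at t)" and XS: "X t \<in> S"
    and near: "\<forall>\<^sub>F s in nhds t. X s \<in> S"
  shows "((\<lambda>s. frechet_derivative h (at (X s)) (V s)) has_vector_derivative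
     frechet_derivative (\<lambda>y. frechet_derivative h (at y) (V t)) (at (X t)) X' + frechet_derivative h (at (X t)) V') (at t)"
proof -
  have C': "Ck_on (Suc (Suc 0)) h S" using C by (simp only: numeral_2_eq_2)
  have exp: "frechet_derivative h (at x) v = (\<Sum>i\<in>Basis. (v \<bullet> i) *\<^sub>R frechet_derivative h (at x) i)" if "x \<in> S" for x v
  proof -
    have l: "linear (frechet_derivative h (at x))" using Ck_on_SucD(1)[OF C' that] has_derivative_linear by blast
    have "frechet_derivative h (at x) v = frechet_derivative h (at x) (\<Sum>i\<in>Basis. (v \<bullet> i) *\<^sub>R i)" by (simp add: euclidean_representation)
    then show ?thesis by (simp add: linear_sum[OF l] linear_scale[OF l])
  qed
  have d2: "((\<lambda>y. frechet_derivative h (at y) v) has_derivative frechet_derivative (\<lambda>y. frechet_derivative h (at y) v) (at (X t))) (at (X t))" for v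
    by (rule Ck_on_SucD(1)[OF Ck_on_SucD(2)[OF C'] XS])
  have D: "((\<lambda>s. frechet_derivative h (at (X s)) v) has_vector_derivative frechet_derivative (\<lambda>y. frechet_derivative h (at y) v) (at (X t)) X') (at t)" for v
    using has_vector_derivative_chain[OF X d2] .
  have sum: "((\<lambda>s. \<Sum>i\<in>Basis. (V s \<bullet> i) *\<^sub>R frechet_derivative h (at (X s)) i) has_vector_derivative
     (\<Sum>i\<in>Basis. (V t \<bullet> i) *\<^sub>R frechet_derivative (\<lambda>y. frechet_derivative h (at y) i) (at (X t)) X' + (V' \<bullet> i) *\<^sub>R frechet_derivative h (at (X t)) i)) (at t)"
  proof (intro has_vector_derivative_sum has_vector_derivative_scaleR D)
    fix i :: 'a
    have "((\<lambda>s. V s \<bullet> i) has_vector_derivative V' \<bullet> i) (at t)"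
      using bounded_linear.has_vector_derivative[OF bounded_linear_inner_left V] .
    then show "((\<lambda>s. V s \<bullet> i) has_real_derivative V' \<bullet> i) (at t)" by (simp add: has_real_derivative_iff_has_vector_derivative)
  qed
  have "frechet_derivative (\<lambda>y. frechet_derivative h (at y) (V t)) (at (X t)) X' = (\<Sum>i\<in>Basis. (V t \<bullet> i) *\<^sub>R frechet_derivative (\<lambda>y. frechet_derivative h (at y) i) (at (X t)) X')"
  proof -
    have "((\<lambda>y. \<Sum>i\<in>Basis. (V t \<bullet> i) *\<^sub>R frechet_derivative h (at y) i) has_derivative
       (\<lambda>u. \<Sum>i\<in>Basis. (V t \<bullet> i) *\<^sub>R frechet_derivative (\<lambda>y. frechet_derivative h (at y) i) (at (X t)) u)) (at (X t))"
      by (intro has_derivative_sum has_derivative_scaleR_right d2)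
    from has_vector_derivative_chain[OF X this]
    have "((\<lambda>s. \<Sum>i\<in>Basis. (V t \<bullet> i) *\<^sub>R frechet_derivative h (at (X s)) i) has_vector_derivative
       (\<Sum>i\<in>Basis. (V t \<bullet> i) *\<^sub>R frechet_derivative (\<lambda>y. frechet_derivative h (at y) i) (at (X t)) X')) (at t)" .
    moreover have "((\<lambda>s. \<Sum>i\<in>Basis. (V t \<bullet> i) *\<^sub>R frechet_derivative h (at (X s)) i) has_vector_derivative
        frechet_derivative (\<lambda>y. frechet_derivative h (at y) (V t)) (at (X t)) X') (at t)"
    proof -
      obtain N where N: "open N" "t \<in> N" "\<And>s. s \<in> N \<Longrightarrow> X s \<in> S" using near unfolding eventually_nhds by blast
      show ?thesis by (rule has_vector_derivative_transform_within_open[OF D[of "V t"] N(1,2)]) (use exp N(3) in simp)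
    qed
    ultimately show ?thesis using vector_derivative_unique_at by blast
  qed
  moreover obtain N where N: "open N" "t \<in> N" "\<And>s. s \<in> N \<Longrightarrow> X s \<in> S" using near unfolding eventually_nhds by blast
  have "((\<lambda>s. frechet_derivative h (at (X s)) (V s)) has_vector_derivative
     (\<Sum>i\<in>Basis. (V t \<bullet> i) *\<^sub>R frechet_derivative (\<lambda>y. frechet_derivative h (at y) i) (at (X t)) X' + (V' \<bullet> i) *\<^sub>R frechet_derivative h (at (X t)) i)) (at t)"
    by (rule has_vector_derivative_transform_within_open[OF sum N(1,2)]) (use exp N(3) in simp)
  ultimately show ?thesis using exp[OF XS, of V'] by (simp add: sum.distrib)
qed

context local_metric
begin

text \<open>Agrees with the geodesic up to \<open>O(s\<^sup>3)\<close>, which suffices for second differences.\<close>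

definition gpath :: "real ^ 'm \<Rightarrow> real ^ 'm \<Rightarrow> real \<Rightarrow> real ^ 'm" where
  "gpath x e s = x + s *\<^sub>R e - (s\<^sup>2/2) *\<^sub>R Gam G x e e"

lemma gpath_deriv: "(gpath x e has_vector_derivative e - s *\<^sub>R Gam G x e e) (at s)"
  unfolding gpath_def[abs_def] by (auto intro!: derivative_eq_intros simp: has_vector_derivative_def algebra_simps)

lemma gpath_deriv2: "((\<lambda>s. e - s *\<^sub>R Gam G x e e) has_vector_derivative - Gam G x e e) (at s)"
  by (auto intro!: derivative_eq_intros simp: has_vector_derivative_def algebra_simps)

lemma gpath_0 [simp]: "gpath x e 0 = x" by (simp add: gpath_def)

lemma continuous_on_gpath: "continuous_on S (gpath x e)"
  unfolding gpath_def[abs_def] by (intro continuous_intros) simp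

lemma gpath_near:
  assumes "open S" "x \<in> S" shows "\<exists>r>0. \<forall>s. \<bar>s\<bar> < r \<longrightarrow> gpath x e s \<in> S"
proof -
  have "open (gpath x e -` S)" by (rule open_vimage[OF assms(1) continuous_on_gpath])
  moreover have "0 \<in> gpath x e -` S" using assms(2) by simp
  ultimately obtain r where "r > 0" "ball 0 r \<subseteq> gpath x e -` S" using open_contains_ball by blast
  then show ?thesis by (intro exI[of _ r]) (auto simp: dist_real_def subset_iff)
qed

text \<open>The acceleration of \<open>gpath\<close> at 0 is \<open>- Gam G x e e\<close>, so for a
  real function the quadratic coefficient is the covariant Hessian. The lemma is also applied to
  transition maps, hence the general target space.\<close>

lemma compose_gpath_taylor:
  fixes h :: "real ^ 'm \<Rightarrow> 'v::real_normed_vector"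
  assumes S: "open S" "x \<in> S" and C: "Ck_on 2 h S" and \<epsilon>: "\<epsilon> > 0"
  shows "\<exists>\<delta>>0. \<forall>s. \<bar>s\<bar> < \<delta> \<longrightarrow> gpath x e s \<in> S \<and> norm (h (gpath x e s) - h x - s *\<^sub>R frechet_derivative h (at x) e
     - (s\<^sup>2/2) *\<^sub>R (frechet_derivative (\<lambda>y. frechet_derivative h (at y) e) (at x) e - frechet_derivative h (at x) (Gam G x e e))) \<le> \<epsilon> * s\<^sup>2"
proof -
  have C': "Ck_on (Suc (Suc 0)) h S" using C by (simp only: numeral_2_eq_2)
  have C1: "Ck_on (Suc 0) h S" using C' by (rule Ck_on_Suc_imp)
  obtain r where r: "r > 0" "\<And>s. \<bar>s\<bar> < r \<Longrightarrow> gpath x e s \<in> S" using gpath_near[OF S] by blast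
  have d1: "((\<lambda>s. h (gpath x e s)) has_vector_derivative frechet_derivative h (at (gpath x e s)) (e - s *\<^sub>R Gam G x e e)) (at s)" if "\<bar>s\<bar> < r" for s
    by (rule has_vector_derivative_chain[OF gpath_deriv Ck_on_SucD(1)[OF C1 r(2)[OF that]]])
  have l: "linear (frechet_derivative h (at x))" using Ck_on_SucD(1)[OF C1 S(2)] has_derivative_linear by blast
  have ev: "\<forall>\<^sub>F s in nhds 0. gpath x e s \<in> S"
    unfolding eventually_nhds_metric using r by (auto simp: dist_real_def)
  have d2: "((\<lambda>s. frechet_derivative h (at (gpath x e s)) (e - s *\<^sub>R Gam G x e e)) has_vector_derivative
     frechet_derivative (\<lambda>y. frechet_derivative h (at y) e) (at x) e - frechet_derivative h (at x) (Gam G x e e)) (at 0)"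
    using frechet_derivative_second[OF C gpath_deriv[of x e 0] gpath_deriv2[of e x 0] _ ev] S(2) by (simp add: linear_neg[OF l])
  obtain \<delta> where \<delta>: "\<delta> > 0" "\<And>s. \<bar>s\<bar> < \<delta> \<Longrightarrow> norm (h (gpath x e s) - h (gpath x e 0) - s *\<^sub>R frechet_derivative h (at (gpath x e 0)) (e - 0 *\<^sub>R Gam G x e e)
     - (s\<^sup>2/2) *\<^sub>R (frechet_derivative (\<lambda>y. frechet_derivative h (at y) e) (at x) e - frechet_derivative h (at x) (Gam G x e e))) \<le> \<epsilon> * s\<^sup>2"
    using second_order_taylor[OF r(1) d1 d2 \<epsilon>] by blast
  show ?thesis using \<delta> r by (intro exI[of _ "min \<delta> r"]) auto
qed

section \<open>Gradient and Laplacian in an orthonormal frame\<close>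

lemma coord_grad_ip: "x \<in> U \<Longrightarrow> metric_ip G x v (coord_grad G h x) = v \<bullet> (\<chi> i. partial i h x)"
  unfolding metric_ip_def coord_grad_def by (simp add: inv_G)

lemma ip_coord_grad:
  assumes x: "x \<in> U" and d: "h differentiable (at x)"
  shows "metric_ip G x (coord_grad G h x) v = frechet_derivative h (at x) v"
proof -
  have l: "linear (frechet_derivative h (at x))" using d by (rule linear_frechet_derivative)
  have "frechet_derivative h (at x) v = frechet_derivative h (at x) (\<Sum>i\<in>UNIV. v $ i *\<^sub>R axis i 1)"
    by (simp add: basis_expansion[of v, unfolded scalar_mult_eq_scaleR])
  also have "\<dots> = v \<bullet> (\<chi> i. partial i h x)"
    by (simp add: linear_sum[OF l] linear_scale[OF l] inner_vec_def partial_def)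
  finally show ?thesis using coord_grad_ip[OF x] ip_sym[OF x] by metis
qed

lemma coord_grad_Ck:
  assumes C: "Ck_on (Suc k) h U" shows "Ck_on k (coord_grad G h) U"
proof (rule Ck_on_vec[OF open_U])
  fix i
  have "Ck_on k (\<lambda>x. \<Sum>j\<in>UNIV. matrix_inv (G x) $ i $ j * partial j h x) U"
    unfolding partial_def
    by (intro Ck_on_sum Ck_on_mult Ck_on_matrix_inv open_U G_entry_Ck det_G Ck_on_SucD(2)[OF C])
  then show "Ck_on k (\<lambda>x. coord_grad G h x $ i) U"
    by (simp add: coord_grad_def matrix_vector_mult_def)
qed

text \<open>Differentiating <grad h, b> = dh(b) along a line in direction \<open>b\<close>, with
  metric compatibility, identifies the Hessian in that direction; the trace is then taken over the
  frame.\<close>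

lemma laplacian_orthonormal:
  assumes x: "x \<in> U" and C: "Ck_on 2 h U" and e: "orthonormal x e"
  shows "coord_div G (coord_grad G h) x = (\<Sum>i\<in>UNIV. frechet_derivative (\<lambda>y. frechet_derivative h (at y) (e i)) (at x) (e i)
     - frechet_derivative h (at x) (Gam G x (e i) (e i)))"
proof -
  have C': "Ck_on (Suc (Suc 0)) h U" using C by (simp only: numeral_2_eq_2)
  have C1: "Ck_on (Suc 0) h U" using C' by (rule Ck_on_Suc_imp)
  define X where "X = coord_grad G h"
  have XC: "Ck_on (Suc 0) X U" unfolding X_def by (rule coord_grad_Ck[OF C'])
  have Xd: "(X has_derivative frechet_derivative X (at x)) (at x)" by (rule Ck_on_SucD(1)[OF XC x])
  have lin: "linear (cov_deriv G X x)"
  proof -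
    have l: "linear (frechet_derivative X (at x))" using Xd has_derivative_linear by blast
    show ?thesis by (rule linearI) (simp_all add: cov_deriv_Gam linear_add[OF l] linear_scale[OF l] Gam_algebra algebra_simps)
  qed
  have ip: "metric_ip G y (X y) v = frechet_derivative h (at y) v" if "y \<in> U" for y v
    unfolding X_def by (rule ip_coord_grad[OF that]) (use C1 that in simp)
  have key: "metric_ip G x (cov_deriv G X x b) b = frechet_derivative (\<lambda>y. frechet_derivative h (at y) b) (at x) b - frechet_derivative h (at x) (Gam G x b b)" for b
  proof -
    define Y where "Y = (\<lambda>s::real. x + s *\<^sub>R b)"
    have Y: "(Y has_vector_derivative b) (at 0)" "Y 0 = x" unfolding Y_def
      by (auto intro!: derivative_eq_intros simp: has_vector_derivative_def)
    have "((\<lambda>s. X (Y s)) has_vector_derivative frechet_derivative X (at x) b) (at 0)"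
      using has_vector_derivative_chain[OF Y(1), of X] Xd Y(2) by simp
    from metric_ip_has_derivative[OF Y(1) this has_vector_derivative_const[of b]]
    have 1: "((\<lambda>s. metric_ip G (Y s) (X (Y s)) b) has_real_derivative
       metric_ip G x (frechet_derivative X (at x) b + Gam G x b (X x)) b + metric_ip G x (X x) (Gam G x b b)) (at 0)"
      using Y(2) x by simp
    have "((\<lambda>s. frechet_derivative h (at (Y s)) b) has_vector_derivative frechet_derivative (\<lambda>y. frechet_derivative h (at y) b) (at x) b) (at 0)"
      using has_vector_derivative_chain[OF Y(1), of "\<lambda>y. frechet_derivative h (at y) b"] Ck_on_SucD(1)[OF Ck_on_SucD(2)[OF C'] x] Y(2) by simp
    moreover have "((\<lambda>s. frechet_derivative h (at (Y s)) b) has_vector_derivative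
       metric_ip G x (frechet_derivative X (at x) b + Gam G x b (X x)) b + metric_ip G x (X x) (Gam G x b b)) (at 0)"
    proof (rule has_vector_derivative_transform_within_open)
      show "((\<lambda>s. metric_ip G (Y s) (X (Y s)) b) has_vector_derivative
       metric_ip G x (frechet_derivative X (at x) b + Gam G x b (X x)) b + metric_ip G x (X x) (Gam G x b b)) (at 0)"
        using 1 by (simp add: has_real_derivative_iff_has_vector_derivative)
      have "continuous_on UNIV Y" unfolding Y_def by (intro continuous_intros)
      then show "open (Y -` U)" using open_U by (simp add: open_vimage)
      show "0 \<in> Y -` U" using Y(2) x by simp
    qed (use ip in auto)
    ultimately have "frechet_derivative (\<lambda>y. frechet_derivative h (at y) b) (at x) b = metric_ip G x (cov_deriv G X x b) b + metric_ip G x (X x) (Gam G x b b)"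
      using vector_derivative_unique_at unfolding cov_deriv_Gam by blast
    then show ?thesis using ip[OF x, of "Gam G x b b"] by simp
  qed
  show ?thesis unfolding coord_div_def X_def[symmetric] trace_orthonormal[OF x e lin] key ..
qed

lemma ip_cauchy_schwarz:
  assumes x: "x \<in> U" shows "\<bar>metric_ip G x u v\<bar> \<le> metric_norm G x u * metric_norm G x v"
proof (cases "v = 0")
  case False
  define a b where "a = metric_ip G x v v" and "b = metric_ip G x u v"
  have a: "a > 0" using ip_pos[OF x False] by (simp add: a_def)
  have "0 \<le> metric_ip G x (a *\<^sub>R u - b *\<^sub>R v) (a *\<^sub>R u - b *\<^sub>R v)" by (rule ip_nonneg[OF x])
  also have "\<dots> = a * (a * metric_ip G x u u - b\<^sup>2)"
    using ip_sym[OF x, of v u] by (simp add: metric_ip_linear a_def b_def power2_eq_square algebra_simps)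
  finally have "b\<^sup>2 \<le> metric_ip G x u u * a" using a by (simp add: zero_le_mult_iff mult.commute)
  then have "sqrt (b\<^sup>2) \<le> sqrt (metric_ip G x u u * a)" by (rule real_sqrt_le_mono)
  then show ?thesis by (simp add: metric_norm_def a_def b_def real_sqrt_mult)
qed (simp add: metric_ip_linear metric_norm_def)

end

section \<open>Second order paths under a change of chart\<close>

context riemannian_manifold
begin

text \<open>An isometry has trivial kernel, and equal dimensions then give surjectivity, the form in
  which it is used.\<close>

lemma chart_trans_injective:
  assumes "c \<in> A" "c' \<in> A" "p \<in> fst c" "p \<in> fst c'"
  shows "surj (frechet_derivative (chart_trans c c') (at (snd c p)))"
proof -
  interpret local_metric "chart_range c" "g c" by (rule local_metric_chart[OF assms(1)])
  define J where "J = frechet_derivative (chart_trans c c') (at (snd c p))"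
  have l: "linear J" unfolding J_def using chart_trans_has_derivative[OF assms] has_derivative_linear by blast
  have "v = 0" if "J v = 0" for v
  proof (rule ccontr)
    assume "v \<noteq> 0"
    then have "metric_ip (g c) (snd c p) v v > 0" using ip_pos[of "snd c p" v] assms by auto
    then show False using metric_ip_trans[OF assms, of v v] that by (simp add: J_def metric_ip_linear)
  qed
  then have "inj J" using l by (simp add: linear_injective_0)
  then show ?thesis using linear_injective_imp_surjective[OF l] unfolding J_def by blast
qed

text \<open>The transformation law of the Christoffel symbols, derived without expanding them. The
  defect \<open>S\<close> is symmetric in its two arguments, by torsion-freeness and commuting
  derivatives; paired with the metric it is skew in the last two places, by differentiating the
  isometry identity \<open>iso\<close>. A trilinear form with both symmetries vanishes.\<close>

lemma Gam_trans:
  assumes cc: "c \<in> A" "c' \<in> A" "p \<in> fst c" "p \<in> fst c'"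
  defines "T \<equiv> chart_trans c c'" and "x \<equiv> snd c p"
  shows "frechet_derivative (\<lambda>y. frechet_derivative T (at y) e) (at x) e - frechet_derivative T (at x) (Gam (g c) x e e)
     = - Gam (g c') (snd c' p) (frechet_derivative T (at x) e) (frechet_derivative T (at x) e)"
proof -
  interpret L: local_metric "chart_range c" "g c" by (rule local_metric_chart[OF cc(1)])
  interpret L': local_metric "chart_range c'" "g c'" by (rule local_metric_chart[OF cc(2)])
  define N where "N = snd c ` (fst c \<inter> fst c')"
  have oN: "open N" unfolding N_def by (rule open_chart_image[OF cc(1)]) (use open_Int[OF open_domain[OF cc(1)] open_domain[OF cc(2)]] in auto)
  have xN: "x \<in> N" using cc unfolding N_def x_def by blast
  have C2: "Ck_on 2 T N" unfolding T_def N_def by (rule chart_trans_Ck[OF cc(1,2)])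
  then have C': "Ck_on (Suc (Suc 0)) T N" by (simp only: numeral_2_eq_2)
  have C1: "Ck_on (Suc 0) T N" using C' by (rule Ck_on_Suc_imp)
  define J where "J = (\<lambda>y. frechet_derivative T (at y))"
  define H where "H = (\<lambda>u a. frechet_derivative (\<lambda>y. J y a) (at x) u)"
  have Tx: "T x = snd c' p" unfolding T_def x_def by (rule chart_trans_eq[OF cc(1,3)])
  have xU: "x \<in> chart_range c" "snd c' p \<in> chart_range c'" using cc by (auto simp: x_def)
  have iso: "metric_ip (g c') (T y) (J y a) (J y b) = metric_ip (g c) y a b" if y: "y \<in> N" for y a b
  proof -
    obtain q where q: "q \<in> fst c" "q \<in> fst c'" "y = snd c q" using y unfolding N_def by blast
    show ?thesis using metric_ip_trans[OF cc(1,2) q(1,2)] chart_trans_eq[OF cc(1) q(1), of c'] q(3) unfolding T_def J_def by simp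
  qed
  define S where "S = (\<lambda>u a. H u a + Gam (g c') (snd c' p) (J x u) (J x a) - J x (Gam (g c) x u a))"
  have HS: "H u a = H a u" for u a
    unfolding H_def J_def by (rule mixed_derivative_commute_vec[OF oN C2 xN])
  have Ssym: "S u a = S a u" for u a
    unfolding S_def using HS[of u a] L.Gam_sym[OF xU(1), of u a] L'.Gam_sym[OF xU(2), of "J x u" "J x a"] by simp
  have anti: "metric_ip (g c') (snd c' p) (S u a) (J x b) + metric_ip (g c') (snd c' p) (J x a) (S u b) = 0" for u a b
  proof -
    define Y where "Y = (\<lambda>s::real. x + s *\<^sub>R u)"
    have Y: "(Y has_vector_derivative u) (at 0)" "Y 0 = x" unfolding Y_def
      by (auto intro!: derivative_eq_intros simp: has_vector_derivative_def)
    have oY: "open (Y -` N)"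
    proof -
      have "continuous_on UNIV Y" unfolding Y_def by (intro continuous_intros)
      then show ?thesis using oN by (simp add: open_vimage)
    qed
    have JY: "((\<lambda>s. J (Y s) a) has_vector_derivative H u a) (at 0)" for a
      using has_vector_derivative_chain[OF Y(1), of "\<lambda>y. J y a"] Ck_on_SucD(1)[OF Ck_on_SucD(2)[OF C'] xN] Y(2)
      unfolding H_def J_def by simp
    have TY: "((\<lambda>s. T (Y s)) has_vector_derivative J x u) (at 0)"
      using has_vector_derivative_chain[OF Y(1), of T] Ck_on_SucD(1)[OF C1 xN] Y(2) unfolding J_def by simp
    have 1: "((\<lambda>s. metric_ip (g c') (T (Y s)) (J (Y s) a) (J (Y s) b)) has_real_derivative
       metric_ip (g c') (snd c' p) (H u a + Gam (g c') (snd c' p) (J x u) (J x a)) (J x b)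
        + metric_ip (g c') (snd c' p) (J x a) (H u b + Gam (g c') (snd c' p) (J x u) (J x b))) (at 0)"
      using L'.metric_ip_has_derivative[OF TY JY JY] Y(2) Tx xU by simp
    have 2: "((\<lambda>s. metric_ip (g c) (Y s) a b) has_real_derivative
       metric_ip (g c) x (Gam (g c) x u a) b + metric_ip (g c) x a (Gam (g c) x u b)) (at 0)"
      using L.metric_ip_has_derivative[OF Y(1) has_vector_derivative_const[of a] has_vector_derivative_const[of b]] Y(2) xU by simp
    have "((\<lambda>s. metric_ip (g c') (T (Y s)) (J (Y s) a) (J (Y s) b)) has_real_derivative
       metric_ip (g c) x (Gam (g c) x u a) b + metric_ip (g c) x a (Gam (g c) x u b)) (at 0)"
      by (rule has_field_derivative_transform_within_open[OF 2 oY]) (use Y(2) xN iso in auto)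
    from DERIV_unique[OF 1 this] show ?thesis
      unfolding S_def iso[OF xN, symmetric] Tx by (simp add: metric_ip_linear)
  qed
  have "metric_ip (g c') (snd c' p) (S u a) (J x b) = 0" for u a b
  proof -
    \<comment> \<open>Using the two symmetries alternately, three times each, returns the same form
      with the opposite sign.\<close>
    define t where "t = (\<lambda>u a b. metric_ip (g c') (snd c' p) (S u a) (J x b))"
    have sy: "t u a b = t a u b" for u a b unfolding t_def using Ssym[of u a] by simp
    have an: "t u a b = - t u b a" for u a b
      using anti[of u a b] L'.ip_sym[OF xU(2), of "J x a" "S u b"] unfolding t_def by simp
    have "t u a b = - t u b a" by (rule an)
    also have "\<dots> = - t b u a" by (simp add: sy[of u b a])
    also have "\<dots> = t b a u" using an[of b u a] by simp
    also have "\<dots> = t a b u" by (rule sy)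
    also have "\<dots> = - t a u b" by (rule an)
    also have "\<dots> = - t u a b" by (simp add: sy[of a u b])
    finally show ?thesis unfolding t_def by simp
  qed
  then have z: "metric_ip (g c') (snd c' p) (S e e) (J x b) = 0" for b by blast
  obtain b where "S e e = J x b"
    using chart_trans_injective[OF cc] unfolding surj_def J_def T_def x_def by metis
  then have "metric_ip (g c') (snd c' p) (S e e) (S e e) = 0" using z[of b] by simp
  then have "S e e = 0" using L'.ip_pos[OF xU(2), of "S e e"] by (cases "S e e = 0") auto
  then show ?thesis unfolding S_def H_def J_def by (simp add: algebra_simps eq_neg_iff_add_eq_0)
qed

definition cpath :: "('a, 'm) chart \<Rightarrow> 'a \<Rightarrow> real ^ 'm \<Rightarrow> real \<Rightarrow> 'a" where
  "cpath c p e s = chart_pt c (snd c p + s *\<^sub>R e - (s\<^sup>2/2) *\<^sub>R Gam (g c) (snd c p) e e)"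

text \<open>By \<open>compose_gpath_taylor\<close> for the transition map and by
  \<open>Gam_trans\<close>, the path written in \<open>c'\<close> has the same second order
  expansion as the path of the transformed vector there. This is what allows a different chart for
  each link.\<close>

lemma cpath_junction:
  assumes cc: "c \<in> A" "c' \<in> A" "p \<in> fst c" "p \<in> fst c'" and \<epsilon>: "\<epsilon> > 0"
  shows "\<exists>\<delta>>0. \<forall>s. \<bar>s\<bar> < \<delta> \<longrightarrow> riem_dist A g (cpath c p e s) (cpath c' p (frechet_derivative (chart_trans c c') (at (snd c p)) e) s) \<le> \<epsilon> * s\<^sup>2"
proof -
  interpret L: local_metric "chart_range c" "g c" by (rule local_metric_chart[OF cc(1)])
  interpret L': local_metric "chart_range c'" "g c'" by (rule local_metric_chart[OF cc(2)])
  define x where "x = snd c p" define x' where "x' = snd c' p"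
  define T where "T = chart_trans c c'"
  define J where "J = frechet_derivative T (at x)"
  define N where "N = snd c ` (fst c \<inter> fst c')"
  have oN: "open N" unfolding N_def by (rule open_chart_image[OF cc(1)]) (use open_Int[OF open_domain[OF cc(1)] open_domain[OF cc(2)]] in auto)
  have xN: "x \<in> N" using cc unfolding N_def x_def by blast
  have C2: "Ck_on 2 T N" unfolding T_def N_def by (rule chart_trans_Ck[OF cc(1,2)])
  have Tx: "T x = x'" unfolding T_def x_def x'_def by (rule chart_trans_eq[OF cc(1,3)])
  have xr: "x' \<in> chart_range c'" using cc by (auto simp: x'_def)
  obtain r a b where r: "0 < r" "0 < b" "cball x' r \<subseteq> chart_range c'"
    "\<And>y v. y \<in> cball x' r \<Longrightarrow> metric_norm (g c') y v \<le> b * norm v"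
    using chart_nbhd[OF cc(2) xr] by blast
  have "\<epsilon> / b > 0" using \<epsilon> r by simp
  then obtain \<delta>1 where \<delta>1: "\<delta>1 > 0" "\<And>s. \<bar>s\<bar> < \<delta>1 \<Longrightarrow> L.gpath x e s \<in> N \<and> norm (T (L.gpath x e s) - T x - s *\<^sub>R J e
     - (s\<^sup>2/2) *\<^sub>R (- Gam (g c') x' (J e) (J e))) \<le> \<epsilon> / b * s\<^sup>2"
    using L.compose_gpath_taylor[OF oN xN C2, of "\<epsilon> / b" e] Gam_trans[OF cc, of e] unfolding T_def x_def x'_def J_def by metis
  obtain \<delta>2 where \<delta>2: "\<delta>2 > 0" "\<And>s. \<bar>s\<bar> < \<delta>2 \<Longrightarrow> L'.gpath x' (J e) s \<in> ball x' r"
    using L'.gpath_near[of "ball x' r" x' "J e"] r by auto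
  have "open (N \<inter> T -` ball x' r)"
    by (rule continuous_open_preimage[OF Ck_on_imp_continuous_on[OF C2] oN open_ball])
  then obtain \<delta>3 where \<delta>3: "\<delta>3 > 0" "\<And>s. \<bar>s\<bar> < \<delta>3 \<Longrightarrow> L.gpath x e s \<in> N \<inter> T -` ball x' r"
    using L.gpath_near[of "N \<inter> T -` ball x' r" x e] xN Tx r by auto
  have "riem_dist A g (cpath c p e s) (cpath c' p (J e) s) \<le> \<epsilon> * s\<^sup>2" if s: "\<bar>s\<bar> < min \<delta>1 (min \<delta>2 \<delta>3)" for s
  proof -
    define y where "y = L.gpath x e s"
    define y' where "y' = L'.gpath x' (J e) s"
    have y: "y \<in> N" "T y \<in> ball x' r" using \<delta>3(2)[of s] s by (auto simp: y_def)
    obtain q where q: "q \<in> fst c" "q \<in> fst c'" "y = snd c q" using y(1) unfolding N_def by blast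
    have "cpath c p e s = chart_pt c y" by (simp add: cpath_def y_def L.gpath_def x_def)
    also have "\<dots> = chart_pt c' (T y)" using q chart_trans_eq[OF cc(1) q(1), of c'] cc by (simp add: T_def)
    finally have 1: "cpath c p e s = chart_pt c' (T y)" .
    have 2: "cpath c' p (J e) s = chart_pt c' y'" by (simp add: cpath_def y'_def L'.gpath_def x'_def)
    have "riem_dist A g (chart_pt c' (T y)) (chart_pt c' y') \<le> b * norm (y' - T y)"
      by (rule riem_dist_upper[OF cc(2) r(3,4)]) (use y \<delta>2(2)[of s] s in \<open>auto simp: y'_def less_imp_le\<close>)
    also have "norm (y' - T y) = norm (T (L.gpath x e s) - T x - s *\<^sub>R J e - (s\<^sup>2/2) *\<^sub>R (- Gam (g c') x' (J e) (J e)))"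
      by (simp add: y'_def y_def L'.gpath_def Tx norm_minus_commute algebra_simps)
    also have "b * \<dots> \<le> b * (\<epsilon> / b * s\<^sup>2)" using \<delta>1(2)[of s] s r(2) by (intro mult_left_mono) auto
    finally show ?thesis using r(2) unfolding 1 2 by simp
  qed
  then show ?thesis using \<delta>1(1) \<delta>2(1) \<delta>3(1) unfolding J_def T_def x_def
    by (intro exI[of _ "min \<delta>1 (min \<delta>2 \<delta>3)"]) auto
qed

text \<open>The path has the form x + s m(s) with \<open>m\<close> continuous, so the coordinate
  segment to its point at \<open>s\<close> has velocity s m(s), whose metric length along the
  segment is close to |s| times that of \<open>e\<close>.\<close>

lemma cpath_dist:
  assumes c: "c \<in> A" "p \<in> fst c" and \<epsilon>: "\<epsilon> > 0"
  shows "\<exists>\<delta>>0. \<forall>s. \<bar>s\<bar> < \<delta> \<longrightarrow> riem_dist A g p (cpath c p e s) \<le> (metric_norm (g c) (snd c p) e + \<epsilon>) * \<bar>s\<bar>"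
proof -
  interpret L: local_metric "chart_range c" "g c" by (rule local_metric_chart[OF c(1)])
  define x where "x = snd c p"
  have xU: "x \<in> chart_range c" using c by (auto simp: x_def)
  define m where "m = (\<lambda>s. e - (s/2) *\<^sub>R Gam (g c) x e e)"
  define S where "S = {q :: real \<times> real. x + fst q *\<^sub>R m (snd q) \<in> chart_range c}"
  have cm: "continuous_on T (\<lambda>q. x + fst q *\<^sub>R m (snd q))" for T :: "(real \<times> real) set"
    unfolding m_def by (intro continuous_intros) simp
  have oS: "open S" unfolding S_def using open_vimage[OF L.open_U cm[of UNIV]] by (simp add: vimage_def)
  have z: "(0, 0) \<in> S" using xU by (simp add: S_def)
  have "continuous_on S (\<lambda>q. metric_norm (g c) (x + fst q *\<^sub>R m (snd q)) (m (snd q)))"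
    by (intro L.continuous_on_metric_norm cm) (auto simp: S_def m_def intro!: continuous_intros)
  then have "isCont (\<lambda>q. metric_norm (g c) (x + fst q *\<^sub>R m (snd q)) (m (snd q))) (0, 0)"
    using oS z continuous_on_eq_continuous_at by blast
  then obtain d1 where d1: "d1 > 0" "\<And>q. dist q (0,0) < d1 \<Longrightarrow> dist (metric_norm (g c) (x + fst q *\<^sub>R m (snd q)) (m (snd q))) (metric_norm (g c) x e) < \<epsilon>"
    using \<epsilon> unfolding continuous_at_eps_delta by (auto simp: m_def)
  obtain d2 where d2: "d2 > 0" "ball (0,0) d2 \<subseteq> S" using oS z open_contains_ball by blast
  define \<delta> where "\<delta> = min d1 d2 / 2"
  have near: "dist (t * s, s) (0::real, 0::real) < min d1 d2" if "0 \<le> t" "t \<le> 1" "\<bar>s\<bar> < \<delta>" for t s :: real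
  proof -
    have "dist (t * s, s) (0::real, 0::real) \<le> \<bar>t * s\<bar> + \<bar>s\<bar>"
      using norm_Pair_le[of "t * s" s] by (simp add: dist_norm)
    also have "\<dots> \<le> \<bar>s\<bar> + \<bar>s\<bar>" using that by (simp add: abs_mult mult_left_le_one_le)
    finally show ?thesis using that by (simp add: \<delta>_def)
  qed
  have "riem_dist A g p (cpath c p e s) \<le> (metric_norm (g c) x e + \<epsilon>) * \<bar>s\<bar>" if s: "\<bar>s\<bar> < \<delta>" for s
  proof -
    define y where "y = x + s *\<^sub>R m s"
    have cy: "cpath c p e s = chart_pt c y" by (simp add: cpath_def y_def m_def x_def power2_eq_square algebra_simps)
    have "riem_dist A g (chart_pt c x) (chart_pt c y) \<le> (metric_norm (g c) x e + \<epsilon>) * \<bar>s\<bar>"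
    proof (rule riem_dist_segment[OF c(1)])
      fix t :: real assume t: "0 \<le> t" "t \<le> 1"
      have eq: "x + t *\<^sub>R (y - x) = x + (t * s) *\<^sub>R m s" "y - x = s *\<^sub>R m s" by (simp_all add: y_def)
      have "(t * s, s) \<in> S" using near[OF t s] d2(2) by (auto simp: dist_commute subset_iff)
      then show "x + t *\<^sub>R (y - x) \<in> chart_range c" unfolding eq by (simp add: S_def)
      have "metric_norm (g c) (x + (t * s) *\<^sub>R m s) (m s) \<le> metric_norm (g c) x e + \<epsilon>"
        using d1(2)[of "(t * s, s)"] near[OF t s] by (simp add: dist_real_def)
      then show "metric_norm (g c) (x + t *\<^sub>R (y - x)) (y - x) \<le> (metric_norm (g c) x e + \<epsilon>) * \<bar>s\<bar>"
        unfolding eq L.metric_norm_scaleR by (simp add: mult.commute mult_left_mono)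
    qed
    then show ?thesis unfolding cy using c by (simp add: x_def)
  qed
  then show ?thesis unfolding x_def using d1(1) d2(1) by (intro exI[of _ \<delta>]) (auto simp: \<delta>_def)
qed

end

section \<open>Variations in one chart\<close>

lemma uniform_radius:
  fixes P :: "'i::finite \<Rightarrow> real \<Rightarrow> bool"
  assumes "\<And>i. \<exists>\<delta>>0. \<forall>s. \<bar>s\<bar> < \<delta> \<longrightarrow> P i s"
  shows "\<exists>\<delta>>0. \<forall>i s. \<bar>s\<bar> < \<delta> \<longrightarrow> P i s"
proof -
  obtain \<delta> where \<delta>: "\<And>i. \<delta> i > 0 \<and> (\<forall>s. \<bar>s\<bar> < \<delta> i \<longrightarrow> P i s)" using assms by metis
  have "Min (range \<delta>) > 0" using \<delta> by (subst Min_gr_iff) auto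
  moreover have "P i s" if "\<bar>s\<bar> < Min (range \<delta>)" for i s
  proof -
    have "Min (range \<delta>) \<le> \<delta> i" by (rule Min_le) auto
    then show ?thesis using \<delta>[of i] that by auto
  qed
  ultimately show ?thesis by blast
qed

context local_metric
begin

text \<open>\<open>frame_field y e\<close> extends \<open>e\<close> from \<open>y\<close> with vanishing covariant derivative at \<open>y\<close>. The affine factor in
  \<open>var_field\<close> realizes the linear decay of the variation along a chain. Primes denote derivatives in \<open>x\<close>
  in the direction \<open>v\<close>.\<close>

definition frame_field :: "real ^ 'm \<Rightarrow> real ^ 'm \<Rightarrow> real ^ 'm \<Rightarrow> real ^ 'm" where
  "frame_field y e x = e - Gam G y (x - y) e"

definition var_field :: "real ^ 'm \<Rightarrow> real ^ 'm \<Rightarrow> real \<Rightarrow> real ^ 'm \<Rightarrow> real ^ 'm \<Rightarrow> real ^ 'm" where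
  "var_field y e \<alpha> l x = (\<alpha> + l \<bullet> (x - y)) *\<^sub>R frame_field y e x"

definition var_field' :: "real ^ 'm \<Rightarrow> real ^ 'm \<Rightarrow> real \<Rightarrow> real ^ 'm \<Rightarrow> real ^ 'm \<Rightarrow> real ^ 'm \<Rightarrow> real ^ 'm" where
  "var_field' y e \<alpha> l x v = (l \<bullet> v) *\<^sub>R frame_field y e x - (\<alpha> + l \<bullet> (x - y)) *\<^sub>R Gam G y v e"

definition var_acc' :: "real ^ 'm \<Rightarrow> real ^ 'm \<Rightarrow> real \<Rightarrow> real ^ 'm \<Rightarrow> real ^ 'm \<Rightarrow> real ^ 'm \<Rightarrow> real ^ 'm" where
  "var_acc' y e \<alpha> l x v = dGam G x v (var_field y e \<alpha> l x) (var_field y e \<alpha> l x)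
     + 2 *\<^sub>R Gam G x (var_field' y e \<alpha> l x v) (var_field y e \<alpha> l x)"

definition var_map :: "real ^ 'm \<Rightarrow> real ^ 'm \<Rightarrow> real \<Rightarrow> real ^ 'm \<Rightarrow> real \<Rightarrow> real ^ 'm \<Rightarrow> real ^ 'm" where
  "var_map y e \<alpha> l s x = x + s *\<^sub>R var_field y e \<alpha> l x
     - (s\<^sup>2/2) *\<^sub>R Gam G x (var_field y e \<alpha> l x) (var_field y e \<alpha> l x)"

definition var_map' :: "real ^ 'm \<Rightarrow> real ^ 'm \<Rightarrow> real \<Rightarrow> real ^ 'm \<Rightarrow> real \<Rightarrow> real ^ 'm \<Rightarrow> real ^ 'm \<Rightarrow> real ^ 'm" where
  "var_map' y e \<alpha> l s x v = v + s *\<^sub>R var_field' y e \<alpha> l x v - (s\<^sup>2/2) *\<^sub>R var_acc' y e \<alpha> l x v"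

lemma Gam_bounded_linear: "bounded_linear (\<lambda>v. Gam G y v e)"
  by (rule linear_conv_bounded_linear[THEN iffD1], rule linearI) (simp_all add: Gam_algebra)

lemma frame_field_has_derivative: "(frame_field y e has_derivative (\<lambda>v. - Gam G y v e)) (at x)"
proof -
  have "((\<lambda>x. e - Gam G y (x - y) e) has_derivative (\<lambda>v. 0 - Gam G y (v - 0) e)) (at x)"
    by (intro has_derivative_diff has_derivative_const bounded_linear.has_derivative[OF Gam_bounded_linear] has_derivative_ident)
  then show ?thesis unfolding frame_field_def[abs_def] by simp
qed

lemma var_field_has_derivative: "(var_field y e \<alpha> l has_derivative var_field' y e \<alpha> l x) (at x)"
proof -
  have w: "((\<lambda>x. \<alpha> + l \<bullet> (x - y)) has_derivative (\<lambda>v. l \<bullet> v)) (at x)"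
    by (auto intro!: derivative_eq_intros)
  show ?thesis unfolding var_field_def[abs_def] var_field'_def
    by (rule has_derivative_eq_rhs[OF has_derivative_scaleR[OF w frame_field_has_derivative]]) (auto simp: algebra_simps)
qed

text \<open>Identifies the differential of \<open>var_map\<close> with the curve \<open>T\<close> of
  the second variation: \<open>var_field'\<close> plays the part of \<open>V1\<close>, and
  \<open>var_acc'\<close>, the derivative of the quadratic term, that of \<open>V2\<close>.\<close>

lemma var_map_has_derivative:
  assumes x: "x \<in> U" shows "(var_map y e \<alpha> l s has_derivative var_map' y e \<alpha> l s x) (at x)"
proof -
  have "((\<lambda>x. Gam G x (var_field y e \<alpha> l x) (var_field y e \<alpha> l x)) has_derivative var_acc' y e \<alpha> l x) (at x)"
    unfolding Gam_def
    by (rule has_derivative_eq_rhs[OF trilin_has_derivative[OF chris_has_derivative[OF x] var_field_has_derivative var_field_has_derivative]])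
       (use Gam_sym[OF x, of "var_field y e \<alpha> l x"] in \<open>simp add: var_acc'_def dGam_def Gam_def[symmetric] scaleR_2 fun_eq_iff\<close>)
  then show ?thesis unfolding var_map_def[abs_def] var_map'_def[abs_def]
    by (intro has_derivative_diff has_derivative_add has_derivative_ident has_derivative_scaleR_right var_field_has_derivative)
qed

lemma continuous_on_frame_field: "continuous_on S X \<Longrightarrow> continuous_on S (\<lambda>p. frame_field y e (X p))"
  using continuous_on_compose2[OF continuous_at_imp_continuous_on[of UNIV "frame_field y e"]]
    has_derivative_continuous[OF frame_field_has_derivative] by blast

lemma continuous_on_var_field: "continuous_on S X \<Longrightarrow> continuous_on S (\<lambda>p. var_field y e \<alpha> l (X p))"
  unfolding var_field_def by (intro continuous_intros continuous_on_frame_field)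

lemma continuous_on_var_field':
  assumes "continuous_on S X" "continuous_on S V" shows "continuous_on S (\<lambda>p. var_field' y e \<alpha> l (X p) (V p))"
proof -
  have "continuous_on S (\<lambda>p. Gam G y (V p) e)"
    by (rule bounded_linear.continuous_on[OF Gam_bounded_linear assms(2)])
  then show ?thesis unfolding var_field'_def by (intro continuous_intros continuous_on_frame_field assms)
qed

lemma continuous_on_var_acc':
  assumes "continuous_on S X" "continuous_on S V" "X ` S \<subseteq> U"
  shows "continuous_on S (\<lambda>p. var_acc' y e \<alpha> l (X p) (V p))"
  unfolding var_acc'_def
  by (intro continuous_intros continuous_on_dGam continuous_on_Gam continuous_on_var_field continuous_on_var_field' assms)

lemma var_map_C1:
  assumes S: "open S" "S \<subseteq> U" shows "Ck_on (Suc 0) (var_map y e \<alpha> l s) S"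
proof (rule Ck_on_SucI[OF S(1)])
  show "(var_map y e \<alpha> l s has_derivative var_map' y e \<alpha> l s x) (at x)" if "x \<in> S" for x
    using var_map_has_derivative S(2) that by blast
  show "Ck_on 0 (\<lambda>x. var_map' y e \<alpha> l s x v) S" for v
    unfolding var_map'_def Ck_on.simps
    by (intro continuous_intros continuous_on_var_field' continuous_on_var_acc') (use S(2) in auto)
qed

lemma var_map_scaleR:
  assumes x: "x \<in> U" shows "var_map' y e \<alpha> l s x (c *\<^sub>R v) = c *\<^sub>R var_map' y e \<alpha> l s x v"
  using linear_scale[OF has_derivative_linear[OF var_map_has_derivative[OF x]]] .

text \<open>\<open>pull_second_difference\<close> is applied on \<open>K\<close> times the Euclidean
  unit sphere, \<open>pull2_zero\<close> evaluates its main term, and homogeneity of degree 2 in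
  \<open>v\<close> removes the normalization.\<close>

lemma var_map_second_difference:
  assumes K: "compact K" "K \<subseteq> U" and \<eta>: "\<eta> > 0"
  shows "\<exists>\<delta>>0. \<forall>s. \<bar>s\<bar> < \<delta> \<longrightarrow> (\<forall>x\<in>K. var_map y e \<alpha> l s x \<in> U \<and> (\<forall>v.
     metric_ip G (var_map y e \<alpha> l s x) (var_map' y e \<alpha> l s x v) (var_map' y e \<alpha> l s x v)
     + metric_ip G (var_map y e \<alpha> l (- s) x) (var_map' y e \<alpha> l (- s) x v) (var_map' y e \<alpha> l (- s) x v)
     \<le> 2 * metric_ip G x v v + s\<^sup>2 * (2 * (let w = \<alpha> + l \<bullet> (x - y); E = frame_field y e x; N = (l \<bullet> v) *\<^sub>R E + w *\<^sub>R (Gam G x v E - Gam G y v e)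
        in metric_ip G x N N + w\<^sup>2 * metric_ip G x (curvature G x E v E) v) + \<eta> * metric_ip G x v v)))"
proof -
  define Q where "Q = (\<lambda>x v. let w = \<alpha> + l \<bullet> (x - y); E = frame_field y e x; N = (l \<bullet> v) *\<^sub>R E + w *\<^sub>R (Gam G x v E - Gam G y v e)
        in metric_ip G x N N + w\<^sup>2 * metric_ip G x (curvature G x E v E) v)"
  define \<theta> where "\<theta> = (\<lambda>x v s. metric_ip G (var_map y e \<alpha> l s x) (var_map' y e \<alpha> l s x v) (var_map' y e \<alpha> l s x v))"
  obtain a b where ab: "0 < a" "\<And>x v. x \<in> K \<Longrightarrow> a * norm v \<le> metric_norm G x v" using metric_norm_bounds[OF K] by blast
  define S where "S = K \<times> sphere (0 :: real ^ 'm) 1"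
  have S: "compact S" unfolding S_def by (intro compact_Times K compact_sphere)
  have fU: "fst ` S \<subseteq> U" using K by (auto simp: S_def)
  have cf: "continuous_on S fst" "continuous_on S snd" by (intro continuous_intros)+
  have cA: "continuous_on S (\<lambda>p. Gam G (fst p) (var_field y e \<alpha> l (fst p)) (var_field y e \<alpha> l (fst p)))"
    by (intro continuous_on_Gam continuous_on_var_field cf fU)
  \<comment> \<open>Euclidean unit vectors have squared metric length at least
    \<open>a\<^sup>2\<close>, so an error of this size is absorbed by \<open>\<eta>\<close> times
    the metric.\<close>
  have "\<eta> * a\<^sup>2 > 0" using \<eta> ab by simp
  note cW = continuous_on_var_field[OF cf(1), of y e \<alpha> l] continuous_on_var_field'[OF cf, of y e \<alpha> l] continuous_on_var_acc'[OF cf fU, of y e \<alpha> l]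
  from pull_second_difference[OF S cf(1) cW(1) cA cf(2) cW(2,3) fU \<open>\<eta> * a\<^sup>2 > 0\<close>]
  obtain \<delta> where \<delta>: "\<delta> > 0" and est: "\<And>p s. p \<in> S \<Longrightarrow> \<bar>s\<bar> < \<delta> \<Longrightarrow> var_map y e \<alpha> l s (fst p) \<in> U \<and>
      \<bar>\<theta> (fst p) (snd p) s + \<theta> (fst p) (snd p) (- s) - 2 * \<theta> (fst p) (snd p) 0
       - s\<^sup>2 * pull2 (fst p) (var_field y e \<alpha> l (fst p)) (Gam G (fst p) (var_field y e \<alpha> l (fst p)) (var_field y e \<alpha> l (fst p))) (snd p)
          (var_field' y e \<alpha> l (fst p) (snd p)) (var_acc' y e \<alpha> l (fst p) (snd p)) 0\<bar> \<le> \<eta> * a\<^sup>2 * s\<^sup>2"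
    unfolding Let_def \<theta>_def var_map_def var_map'_def by blast
  have p2: "pull2 x (var_field y e \<alpha> l x) (Gam G x (var_field y e \<alpha> l x) (var_field y e \<alpha> l x)) v
          (var_field' y e \<alpha> l x v) (var_acc' y e \<alpha> l x v) 0 = 2 * Q x v" if x: "x \<in> U" for x v
  proof -
    have N: "var_field' y e \<alpha> l x v + Gam G x v (var_field y e \<alpha> l x)
      = (l \<bullet> v) *\<^sub>R frame_field y e x + (\<alpha> + l \<bullet> (x - y)) *\<^sub>R (Gam G x v (frame_field y e x) - Gam G y v e)"
      by (simp add: var_field'_def var_field_def Gam_algebra algebra_simps)
    have R: "curvature G x (var_field y e \<alpha> l x) v (var_field y e \<alpha> l x) = (\<alpha> + l \<bullet> (x - y))\<^sup>2 *\<^sub>R curvature G x (frame_field y e x) v (frame_field y e x)"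
      using curvature_scaleR[OF x, of "\<alpha> + l \<bullet> (x - y)" "frame_field y e x" 1 v "\<alpha> + l \<bullet> (x - y)" "frame_field y e x"]
      by (simp add: var_field_def power2_eq_square)
    show ?thesis unfolding var_acc'_def pull2_zero[OF x] N R Q_def Let_def by (simp add: metric_ip_linear)
  qed
  have \<theta>0: "\<theta> x v 0 = metric_ip G x v v" for x v by (simp add: \<theta>_def var_map_def var_map'_def)
  show ?thesis
  proof (intro exI[of _ \<delta>] conjI allI impI ballI)
    show "\<delta> > 0" by fact
    fix s x assume s: "\<bar>s\<bar> < \<delta>" and x: "x \<in> K"
    have xU: "x \<in> U" using x K by blast
    obtain w0 :: "real ^ 'm" where w0: "norm w0 = 1" using vector_choose_size[of 1] by auto
    show "var_map y e \<alpha> l s x \<in> U" using est[of "(x, w0)" s] w0 s x by (auto simp: S_def)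
    fix v
    define u where "u = (if v = 0 then w0 else (1 / norm v) *\<^sub>R v)"
    have u: "norm u = 1" "v = norm v *\<^sub>R u" unfolding u_def using w0 by auto
    have "(x, u) \<in> S" using x u by (simp add: S_def)
    from est[OF this s] have 1: "\<theta> x u s + \<theta> x u (- s) \<le> 2 * metric_ip G x u u + s\<^sup>2 * (2 * Q x u) + \<eta> * a\<^sup>2 * s\<^sup>2"
      using p2[OF xU] \<theta>0 by (simp add: abs_le_iff)
    have "a \<le> metric_norm G x u" using ab(2)[OF x, of u] u(1) by simp
    then have "a\<^sup>2 \<le> (metric_norm G x u)\<^sup>2" using ab(1) by (intro power_mono) auto
    then have "a\<^sup>2 \<le> metric_ip G x u u" using metric_norm_sq[OF xU] by simp
    then have "\<eta> * a\<^sup>2 * s\<^sup>2 \<le> \<eta> * metric_ip G x u u * s\<^sup>2" using \<eta> by (intro mult_right_mono mult_left_mono) auto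
    with 1 have 2: "\<theta> x u s + \<theta> x u (- s) \<le> 2 * metric_ip G x u u + s\<^sup>2 * (2 * Q x u + \<eta> * metric_ip G x u u)"
      by (simp add: algebra_simps)
    have h\<theta>: "\<theta> x (k *\<^sub>R u) q = k\<^sup>2 * \<theta> x u q" for k q
      unfolding \<theta>_def var_map_scaleR[OF xU] by (simp add: metric_ip_linear power2_eq_square)
    have hQ: "Q x (k *\<^sub>R u) = k\<^sup>2 * Q x u" for k
    proof -
      have C: "curvature G x (frame_field y e x) (k *\<^sub>R u) (frame_field y e x) = k *\<^sub>R curvature G x (frame_field y e x) u (frame_field y e x)"
        using curvature_scaleR[OF xU, of 1 _ k _ 1] by simp
      have N: "(l \<bullet> k *\<^sub>R u) *\<^sub>R frame_field y e x + (\<alpha> + l \<bullet> (x - y)) *\<^sub>R (Gam G x (k *\<^sub>R u) (frame_field y e x) - Gam G y (k *\<^sub>R u) e)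
        = k *\<^sub>R ((l \<bullet> u) *\<^sub>R frame_field y e x + (\<alpha> + l \<bullet> (x - y)) *\<^sub>R (Gam G x u (frame_field y e x) - Gam G y u e))"
        by (simp add: Gam_algebra algebra_simps)
      show ?thesis unfolding Q_def Let_def C N metric_ip_linear(5,6) by (simp add: power2_eq_square algebra_simps)
    qed
    have hI: "metric_ip G x (k *\<^sub>R u) (k *\<^sub>R u) = k\<^sup>2 * metric_ip G x u u" for k
      by (simp add: metric_ip_linear power2_eq_square)
    have "(norm v)\<^sup>2 * (\<theta> x u s + \<theta> x u (- s)) \<le> (norm v)\<^sup>2 * (2 * metric_ip G x u u + s\<^sup>2 * (2 * Q x u + \<eta> * metric_ip G x u u))"
      by (rule mult_left_mono[OF 2]) simp
    then have "\<theta> x (norm v *\<^sub>R u) s + \<theta> x (norm v *\<^sub>R u) (- s) \<le> 2 * metric_ip G x (norm v *\<^sub>R u) (norm v *\<^sub>R u) + s\<^sup>2 * (2 * Q x (norm v *\<^sub>R u) + \<eta> * metric_ip G x (norm v *\<^sub>R u) (norm v *\<^sub>R u))"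
      unfolding h\<theta> hQ hI by (simp add: algebra_simps)
    then show "metric_ip G (var_map y e \<alpha> l s x) (var_map' y e \<alpha> l s x v) (var_map' y e \<alpha> l s x v)
     + metric_ip G (var_map y e \<alpha> l (- s) x) (var_map' y e \<alpha> l (- s) x v) (var_map' y e \<alpha> l (- s) x v)
     \<le> 2 * metric_ip G x v v + s\<^sup>2 * (2 * (let w = \<alpha> + l \<bullet> (x - y); E = frame_field y e x; N = (l \<bullet> v) *\<^sub>R E + w *\<^sub>R (Gam G x v E - Gam G y v e)
        in metric_ip G x N N + w\<^sup>2 * metric_ip G x (curvature G x E v E) v) + \<eta> * metric_ip G x v v)"
      unfolding u(2)[symmetric] \<theta>_def Q_def .
  qed
qed

lemma frame_maps_bound:
  fixes e :: "'m \<Rightarrow> real ^ 'm"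
  assumes K: "compact K" "K \<subseteq> U" and \<eta>: "\<eta> > 0"
    and q: "\<And>x v. x \<in> K \<Longrightarrow> (let w = \<alpha> + l \<bullet> (x - y); E = (\<lambda>i. e i - Gam G y (x - y) (e i)); N = (\<lambda>i. (l \<bullet> v) *\<^sub>R E i + w *\<^sub>R (Gam G x v (E i) - Gam G y v (e i)))
      in (\<Sum>i\<in>UNIV. metric_ip G x (N i) (N i) + w\<^sup>2 * metric_ip G x (curvature G x (E i) v (E i)) v) \<le> q * metric_ip G x v v)"
  shows "\<exists>\<delta>>0. \<forall>s. \<bar>s\<bar> < \<delta> \<longrightarrow> (\<forall>x\<in>K. (\<forall>i. var_map y (e i) \<alpha> l s x \<in> U) \<and> (\<forall>v.
     (\<Sum>i\<in>UNIV. metric_ip G (var_map y (e i) \<alpha> l s x) (var_map' y (e i) \<alpha> l s x v) (var_map' y (e i) \<alpha> l s x v)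
     + metric_ip G (var_map y (e i) \<alpha> l (- s) x) (var_map' y (e i) \<alpha> l (- s) x v) (var_map' y (e i) \<alpha> l (- s) x v))
     \<le> (2 * real CARD('m) + 2 * s\<^sup>2 * (q + \<eta>)) * metric_ip G x v v))"
proof -
  define Q where "Q = (\<lambda>i x v. let w = \<alpha> + l \<bullet> (x - y); E = frame_field y (e i) x; N = (l \<bullet> v) *\<^sub>R E + w *\<^sub>R (Gam G x v E - Gam G y v (e i))
        in metric_ip G x N N + w\<^sup>2 * metric_ip G x (curvature G x E v E) v)"
  define m where "m = real CARD('m)"
  have m: "m > 0" by (simp add: m_def)
  \<comment> \<open>The share of each direction, chosen so that \<open>m\<close> shares add up to
    \<open>2 * \<eta>\<close>.\<close>
  define \<eta>' where "\<eta>' = 2 * \<eta> / m"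
  have \<eta>': "\<eta>' > 0" "m * \<eta>' = 2 * \<eta>" using \<eta> m by (auto simp: \<eta>'_def)
  define Pr where "Pr = (\<lambda>i s. \<forall>x\<in>K. var_map y (e i) \<alpha> l s x \<in> U \<and> (\<forall>v.
     metric_ip G (var_map y (e i) \<alpha> l s x) (var_map' y (e i) \<alpha> l s x v) (var_map' y (e i) \<alpha> l s x v)
     + metric_ip G (var_map y (e i) \<alpha> l (- s) x) (var_map' y (e i) \<alpha> l (- s) x v) (var_map' y (e i) \<alpha> l (- s) x v)
     \<le> 2 * metric_ip G x v v + s\<^sup>2 * (2 * Q i x v + \<eta>' * metric_ip G x v v)))"
  have "\<exists>\<delta>>0. \<forall>s. \<bar>s\<bar> < \<delta> \<longrightarrow> Pr i s" for i
    unfolding Pr_def Q_def by (rule var_map_second_difference[OF K \<eta>'(1)])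
  from uniform_radius[of Pr, OF this] obtain \<delta> where \<delta>0: "\<delta> > 0" "\<And>i s. \<bar>s\<bar> < \<delta> \<Longrightarrow> Pr i s" by blast
  have \<delta>: "\<delta> > 0" "\<And>i s x. \<bar>s\<bar> < \<delta> \<Longrightarrow> x \<in> K \<Longrightarrow> var_map y (e i) \<alpha> l s x \<in> U"
    "\<And>i s x v. \<bar>s\<bar> < \<delta> \<Longrightarrow> x \<in> K \<Longrightarrow> metric_ip G (var_map y (e i) \<alpha> l s x) (var_map' y (e i) \<alpha> l s x v) (var_map' y (e i) \<alpha> l s x v)
     + metric_ip G (var_map y (e i) \<alpha> l (- s) x) (var_map' y (e i) \<alpha> l (- s) x v) (var_map' y (e i) \<alpha> l (- s) x v)
     \<le> 2 * metric_ip G x v v + s\<^sup>2 * (2 * Q i x v + \<eta>' * metric_ip G x v v)"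
    using \<delta>0 unfolding Pr_def by blast+
  have "(\<Sum>i\<in>UNIV. metric_ip G (var_map y (e i) \<alpha> l s x) (var_map' y (e i) \<alpha> l s x v) (var_map' y (e i) \<alpha> l s x v)
     + metric_ip G (var_map y (e i) \<alpha> l (- s) x) (var_map' y (e i) \<alpha> l (- s) x v) (var_map' y (e i) \<alpha> l (- s) x v))
     \<le> (2 * real CARD('m) + 2 * s\<^sup>2 * (q + \<eta>)) * metric_ip G x v v" if s: "\<bar>s\<bar> < \<delta>" and x: "x \<in> K" for s x v
  proof -
    have Qs: "(\<Sum>i\<in>UNIV. Q i x v) \<le> q * metric_ip G x v v"
      using q[OF x, of v] unfolding Q_def Let_def frame_field_def .
    have "(\<Sum>i\<in>UNIV. metric_ip G (var_map y (e i) \<alpha> l s x) (var_map' y (e i) \<alpha> l s x v) (var_map' y (e i) \<alpha> l s x v)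
     + metric_ip G (var_map y (e i) \<alpha> l (- s) x) (var_map' y (e i) \<alpha> l (- s) x v) (var_map' y (e i) \<alpha> l (- s) x v))
     \<le> (\<Sum>i\<in>(UNIV::'m set). 2 * metric_ip G x v v + s\<^sup>2 * (2 * Q i x v + \<eta>' * metric_ip G x v v))"
      by (rule sum_mono) (rule \<delta>(3)[OF s x])
    also have "\<dots> = 2 * m * metric_ip G x v v + s\<^sup>2 * (2 * (\<Sum>i\<in>UNIV. Q i x v) + (m * \<eta>') * metric_ip G x v v)"
      by (simp add: sum.distrib sum_distrib_left[symmetric] sum_distrib_right[symmetric] m_def algebra_simps)
    also have "\<dots> \<le> 2 * m * metric_ip G x v v + s\<^sup>2 * (2 * (q * metric_ip G x v v) + (m * \<eta>') * metric_ip G x v v)"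
      using Qs by (intro add_left_mono mult_left_mono add_right_mono) auto
    also have "\<dots> = (2 * m + 2 * s\<^sup>2 * (q + \<eta>)) * metric_ip G x v v"
      unfolding \<eta>'(2) by (simp add: algebra_simps)
    finally show ?thesis unfolding m_def .
  qed
  then show ?thesis using \<delta>(1,2) by (intro exI[of _ \<delta>]) blast
qed

text \<open>Uniform continuity on the compact sphere bundle, with tolerance
  \<open>\<tau> * a\<close> because metric norms of Euclidean unit vectors are at least
  \<open>a\<close>.\<close>

lemma metric_norm_close:
  assumes x0: "x0 \<in> U" and \<tau>: "\<tau> > 0"
  shows "\<exists>r>0. cball x0 r \<subseteq> U \<and> (\<forall>x\<in>cball x0 r. \<forall>y\<in>cball x0 r. \<forall>v. metric_norm G x v \<le> (1 + \<tau>) * metric_norm G y v)"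
proof -
  obtain r0 where r0: "r0 > 0" "cball x0 r0 \<subseteq> U" using open_U x0 open_contains_cball by blast
  obtain a b where ab: "0 < a" "\<And>x v. x \<in> cball x0 r0 \<Longrightarrow> a * norm v \<le> metric_norm G x v"
    using metric_norm_bounds[OF compact_cball r0(2)] by blast
  define S where "S = cball x0 r0 \<times> sphere (0 :: real ^ 'm) 1"
  have "continuous_on S (\<lambda>p. metric_norm G (fst p) (snd p))"
    by (intro continuous_on_metric_norm continuous_intros) (use r0 S_def in auto)
  moreover have "compact S" unfolding S_def by (intro compact_Times compact_cball compact_sphere)
  ultimately have "uniformly_continuous_on S (\<lambda>p. metric_norm G (fst p) (snd p))" by (rule compact_uniformly_continuous)
  moreover have "\<tau> * a > 0" using \<tau> ab by simp
  ultimately obtain d where d: "d > 0" "\<And>p q. p \<in> S \<Longrightarrow> q \<in> S \<Longrightarrow> dist q p < d \<Longrightarrow> dist (metric_norm G (fst q) (snd q)) (metric_norm G (fst p) (snd p)) < \<tau> * a"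
    unfolding uniformly_continuous_on_def by metis
  define r where "r = min r0 (d / 3)"
  have r: "0 < r" "r \<le> r0" "2 * r < d" using r0 d by (auto simp: r_def min_def)
  have "metric_norm G x v \<le> (1 + \<tau>) * metric_norm G y v" if xy: "x \<in> cball x0 r" "y \<in> cball x0 r" for x y v
  proof (cases "v = 0")
    case False
    define u where "u = (1 / norm v) *\<^sub>R v"
    have u: "norm u = 1" "v = norm v *\<^sub>R u" using False by (auto simp: u_def)
    have xy0: "x \<in> cball x0 r0" "y \<in> cball x0 r0" using xy r by auto
    have "dist x y < d" using xy r(3) dist_triangle2[of x y x0] by (simp add: dist_commute)
    then have "dist (x, u) (y, u) < d" by (simp add: dist_Pair_Pair)
    then have "metric_norm G x u < metric_norm G y u + \<tau> * a"
      using d(2)[of "(y, u)" "(x, u)"] xy0 u(1) by (simp add: S_def dist_real_def abs_less_iff)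
    also have "\<dots> \<le> metric_norm G y u + \<tau> * metric_norm G y u" using ab(2)[OF xy0(2), of u] u(1) \<tau> by simp
    finally have "norm v * metric_norm G x u \<le> norm v * ((1 + \<tau>) * metric_norm G y u)"
      by (intro mult_left_mono) (simp_all add: algebra_simps)
    then have "metric_norm G x (norm v *\<^sub>R u) \<le> (1 + \<tau>) * metric_norm G y (norm v *\<^sub>R u)"
      unfolding metric_norm_scaleR by (simp add: mult_ac)
    then show ?thesis unfolding u(2)[symmetric] .
  qed (simp add: metric_norm_def metric_ip_linear)
  then show ?thesis using r r0(2) by (intro exI[of _ r]) auto
qed

lemma frame_field_base [simp]: "frame_field y e y = e"
  by (simp add: frame_field_def Gam_algebra)

text \<open>Each point moves along a \<open>gpath\<close> with its own initial vector. At the two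
  ends of a link these are the paths that occur in \<open>step_at\<close>, up to a change of
  chart.\<close>

lemma var_map_eq_gpath: "var_map y e \<alpha> l s x = gpath x ((\<alpha> + l \<bullet> (x - y)) *\<^sub>R frame_field y e x) s"
  by (simp add: var_map_def gpath_def var_field_def)

end

context riemannian_manifold
begin

section \<open>Second variation of the squared distance\<close>

text \<open>A tangent vector at \<open>p\<close> is represented by its coordinates in the chart \<open>chart_at A p\<close>.\<close>

definition tangent_ip :: "'a \<Rightarrow> real ^ 'm \<Rightarrow> real ^ 'm \<Rightarrow> real" where
  "tangent_ip p u v = metric_ip (g (chart_at A p)) (snd (chart_at A p) p) u v"

definition tpath :: "'a \<Rightarrow> real ^ 'm \<Rightarrow> real \<Rightarrow> 'a" where
  "tpath p e s = cpath (chart_at A p) p e s"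

definition gram_close :: "'a \<Rightarrow> ('m \<Rightarrow> real ^ 'm) \<Rightarrow> real \<Rightarrow> bool" where
  "gram_close p e k \<longleftrightarrow> (\<forall>i j. \<bar>tangent_ip p (e i) (e j) - (if i = j then 1 else 0)\<bar> \<le> k)"

text \<open>One link of the chain, with \<open>Q\<close> the second variation per unit length. A link of length \<open>h\<close> spoils the Gram
  matrix of the frame by at most \<open>C h\<^sup>2\<close>, hence \<open>N\<close> links of length \<open>L/N\<close> by \<open>O(1/N)\<close>: for large \<open>N\<close> the
  frame stays within the tolerance \<open>\<kappa>\<close> that each link requires.\<close>

definition step_at :: "real \<Rightarrow> real \<Rightarrow> real \<Rightarrow> real \<Rightarrow> 'a \<Rightarrow> 'a \<Rightarrow> bool" where
  "step_at \<Lambda> Q \<kappa> C y z \<longleftrightarrow> (\<forall>(e :: 'm \<Rightarrow> real ^ 'm) \<alpha> \<sigma>. gram_close y e \<kappa> \<longrightarrow> 0 \<le> \<alpha> \<longrightarrow> \<alpha> \<le> 1 \<longrightarrow> \<bar>\<sigma>\<bar> \<le> \<Lambda> * riem_dist A g y z \<longrightarrow>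
     (\<exists>f. (\<forall>i j. \<bar>tangent_ip z (f i) (f j) - tangent_ip y (e i) (e j)\<bar> \<le> C * (riem_dist A g y z)\<^sup>2) \<and>
       (\<forall>\<eta>>0. \<exists>\<delta>>0. \<forall>s. \<bar>s\<bar> < \<delta> \<longrightarrow>
          (\<Sum>i\<in>UNIV. (riem_dist A g (tpath y (\<alpha> *\<^sub>R e i) s) (tpath z ((\<alpha> + \<sigma>) *\<^sub>R f i) s))\<^sup>2
             + (riem_dist A g (tpath y (\<alpha> *\<^sub>R e i) (- s)) (tpath z ((\<alpha> + \<sigma>) *\<^sub>R f i) (- s)))\<^sup>2)
          \<le> (2 * real CARD('m) + 2 * s\<^sup>2 * Q) * (riem_dist A g y z)\<^sup>2 + \<eta> * s\<^sup>2)))"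

lemma cpath_gpath:
  assumes "c \<in> A" shows "cpath c p e s = chart_pt c (local_metric.gpath (g c) (snd c p) e s)"
  using local_metric.gpath_def[OF local_metric_chart[OF assms]] by (simp add: cpath_def)

lemma tpath_junction:
  assumes c: "c \<in> A" "p \<in> fst c" and \<epsilon>: "\<epsilon> > 0"
  shows "\<exists>\<delta>>0. \<forall>s. \<bar>s\<bar> < \<delta> \<longrightarrow> riem_dist A g (tpath p e s) (cpath c p (frechet_derivative (chart_trans (chart_at A p) c) (at (snd (chart_at A p) p)) e) s) \<le> \<epsilon> * s\<^sup>2"
  unfolding tpath_def by (rule cpath_junction[OF chart_at(1) c(1) chart_at(2) c(2) \<epsilon>])

lemma tpath_junction':
  assumes c: "c \<in> A" "p \<in> fst c" and \<epsilon>: "\<epsilon> > 0"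
  shows "\<exists>\<delta>>0. \<forall>s. \<bar>s\<bar> < \<delta> \<longrightarrow> riem_dist A g (cpath c p e s) (tpath p (frechet_derivative (chart_trans c (chart_at A p)) (at (snd c p)) e) s) \<le> \<epsilon> * s\<^sup>2"
  unfolding tpath_def by (rule cpath_junction[OF c(1) chart_at(1) c(2) chart_at(2) \<epsilon>])

text \<open>Changing the chart at both ends of a link alters a distance by at most 2 \<epsilon> s^2;
  for distances bounded by \<open>M\<close> the square then changes by a multiple of \<epsilon>
  s^2.\<close>

lemma square_perturb:
  fixes D D' M s \<epsilon> :: real
  assumes "0 \<le> D'" "D' \<le> D + 2 * \<epsilon> * s\<^sup>2" "0 \<le> D" "D \<le> M" "0 \<le> \<epsilon>" "\<epsilon> \<le> 1" "\<bar>s\<bar> \<le> 1"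
  shows "D'\<^sup>2 \<le> D\<^sup>2 + (4 * M + 4) * \<epsilon> * s\<^sup>2"
proof -
  have s2: "s\<^sup>2 \<le> 1" using assms(7) by (simp add: abs_square_le_1)
  have "D'\<^sup>2 \<le> (D + 2 * \<epsilon> * s\<^sup>2)\<^sup>2" using assms by (intro power_mono) auto
  also have "\<dots> = D\<^sup>2 + 4 * D * (\<epsilon> * s\<^sup>2) + 4 * (\<epsilon> * s\<^sup>2) * (\<epsilon> * s\<^sup>2)" by (simp add: power2_eq_square algebra_simps)
  also have "\<dots> \<le> D\<^sup>2 + 4 * M * (\<epsilon> * s\<^sup>2) + 4 * (\<epsilon> * s\<^sup>2) * 1"
  proof (intro add_mono mult_left_mono mult_right_mono order_refl)
    show "\<epsilon> * s\<^sup>2 \<le> 1" using mult_mono[OF assms(6) s2] assms(5) by simp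
  qed (use assms in auto)
  finally show ?thesis by (simp add: algebra_simps)
qed

text \<open>Everything takes place in one chart about \<open>y0\<close>. The frame at
  \<open>y\<close> is carried into this chart by \<open>J\<close>, extended to \<open>z\<close> as
  \<open>frame_field\<close>, and carried by \<open>J'\<close> into the chart that represents
  vectors at \<open>z\<close>. The bound of \<open>frame_maps_bound\<close> for the metrics pulled
  back by \<open>var_map\<close> passes to distances by \<open>contraction\<close>.\<close>

lemma step_local:
  fixes y0 :: 'a
  assumes Kr: "Kr \<ge> 0" and ric: "\<And>c x v. c \<in> A \<Longrightarrow> x \<in> chart_range c \<Longrightarrow> ricci (g c) x v v \<ge> - Kr * metric_ip (g c) x v v"
    and \<Lambda>: "\<Lambda> > 0" and \<epsilon>: "\<epsilon> > 0"
  shows "\<exists>\<rho> \<kappa> C. \<rho> > 0 \<and> \<kappa> > 0 \<and> C > 0 \<and> (\<forall>y z. riem_dist A g y0 y < \<rho> \<longrightarrow> riem_dist A g y0 z < \<rho> \<longrightarrow> y \<noteq> z \<longrightarrow>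
     step_at \<Lambda> (real CARD('m) * \<Lambda>\<^sup>2 + Kr + \<epsilon>) \<kappa> C y z)"
proof -
  define c where "c = chart_at A y0"
  have c: "c \<in> A" "y0 \<in> fst c" unfolding c_def by (rule chart_at)+
  interpret L: local_metric "chart_range c" "g c" by (rule local_metric_chart[OF c(1)])
  define x0 where "x0 = snd c y0"
  have x0: "x0 \<in> chart_range c" using c by (auto simp: x0_def)
  define G where "G = g c"
  define m where "m = real CARD('m)"
  have m: "m > 0" by (simp add: m_def)
  define q where "q = m * \<Lambda>\<^sup>2 + Kr + \<epsilon> / 2"
  obtain \<kappa>0 :: real where \<kappa>0: "\<kappa>0 > 0" "cball x0 \<kappa>0 \<subseteq> chart_range c" and est: "\<And>x y (e :: 'm \<Rightarrow> real ^ 'm) l (a::real) v.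
     x \<in> cball x0 \<kappa>0 \<Longrightarrow> y \<in> cball x0 \<kappa>0 \<Longrightarrow>
     (\<forall>i j. \<bar>metric_ip G y (e i) (e j) - (if i = j then 1 else 0)\<bar> \<le> \<kappa>0) \<Longrightarrow>
     (\<forall>u. \<bar>l \<bullet> u\<bar> \<le> (\<Lambda> + \<kappa>0) * metric_norm G y u) \<Longrightarrow> \<bar>a\<bar> \<le> 1 + \<kappa>0 \<Longrightarrow>
     (let E = (\<lambda>i. e i - Gam G y (x - y) (e i)); N = (\<lambda>i. (l \<bullet> v) *\<^sub>R E i + a *\<^sub>R (Gam G x v (E i) - Gam G y v (e i)))
      in (\<Sum>i\<in>UNIV. metric_ip G x (N i) (N i) + a\<^sup>2 * metric_ip G x (curvature G x (E i) v (E i)) v)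
         \<le> q * metric_ip G x v v)"
  proof -
    have "\<epsilon> / 2 > 0" using \<epsilon> by simp
    from L.frame_estimate[OF x0 Kr ric[OF c(1) x0] less_imp_le[OF \<Lambda>] this]
    show ?thesis using that unfolding G_def q_def m_def by blast
  qed
  obtain a b where ab: "0 < a" "0 < b" "\<And>x v. x \<in> cball x0 \<kappa>0 \<Longrightarrow> a * norm v \<le> metric_norm G x v"
    "\<And>x v. x \<in> cball x0 \<kappa>0 \<Longrightarrow> metric_norm G x v \<le> b * norm v"
    using L.metric_norm_bounds[OF compact_cball \<kappa>0(2)] unfolding G_def by blast
  define M where "M = sqrt 2 / a"
  have M: "M \<ge> 0" using ab by (simp add: M_def)
  obtain C0 where C0: "C0 > 0" "\<And>y z e f. y \<in> cball x0 \<kappa>0 \<Longrightarrow> z \<in> cball x0 \<kappa>0 \<Longrightarrow> norm e \<le> M \<Longrightarrow> norm f \<le> M \<Longrightarrow>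
    \<bar>metric_ip G z (e - Gam G y (z - y) e) (f - Gam G y (z - y) f) - metric_ip G y e f\<bar> \<le> C0 * (norm (z - y))\<^sup>2"
    using L.frame_drift[OF \<kappa>0(2) M] unfolding G_def by blast
  \<comment> \<open>So that \<Lambda> (1 + \<tau>) = \<Lambda> + \<kappa>0: replacing the Riemannian
    distance by the norm of the coordinate difference costs exactly the tolerance allowed in
    \<open>est\<close>.\<close>
  define \<tau> where "\<tau> = \<kappa>0 / \<Lambda>"
  have \<tau>: "\<tau> > 0" "\<Lambda> * \<tau> = \<kappa>0" using \<kappa>0 \<Lambda> by (auto simp: \<tau>_def)
  obtain r1 where r1: "r1 > 0" "\<And>x y v. x \<in> cball x0 r1 \<Longrightarrow> y \<in> cball x0 r1 \<Longrightarrow> metric_norm G x v \<le> (1 + \<tau>) * metric_norm G y v"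
    using L.metric_norm_close[OF x0 \<tau>(1)] unfolding G_def by blast
  \<comment> \<open>\<open>B0 * r\<close> bounds the change of the weight over the ball of radius
    \<open>r\<close>, which must not exceed \<kappa>0.\<close>
  define B0 where "B0 = (\<Lambda> + \<kappa>0) * b * 2"
  have B0: "B0 > 0" using \<Lambda> \<kappa>0 ab by (simp add: B0_def)
  define r where "r = min (\<kappa>0 / 2) (min r1 (\<kappa>0 / B0))"
  have r: "0 < r" "r \<le> \<kappa>0 / 2" "r \<le> r1" "B0 * r \<le> \<kappa>0" "r \<le> \<kappa>0"
  proof -
    have "r \<le> \<kappa>0 / B0" "r \<le> \<kappa>0 / 2" unfolding r_def by linarith+
    then show "B0 * r \<le> \<kappa>0" "r \<le> \<kappa>0 / 2" "r \<le> \<kappa>0" using B0 \<kappa>0(1) by (auto simp: pos_le_divide_eq mult.commute)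
    show "0 < r" "r \<le> r1" using \<kappa>0(1) r1(1) B0 unfolding r_def by auto
  qed
  have rb: "cball x0 r \<subseteq> cball x0 \<kappa>0" "cball x0 r \<subseteq> chart_range c" "ball x0 r \<subseteq> chart_range c" "ball x0 r \<subseteq> cball x0 r"
    using r \<kappa>0 by (auto simp: subset_iff)
  define V where "V = chart_pt c ` ball x0 r"
  have "open V" unfolding V_def by (rule open_chart_pt_image[OF c(1) open_ball rb(3)])
  moreover have "y0 \<in> V" unfolding V_def x0_def using r c by (intro image_eqI[of _ _ "snd c y0"]) auto
  ultimately obtain \<rho>3 where \<rho>3: "\<rho>3 > 0" "\<And>q. riem_dist A g y0 q < \<rho>3 \<Longrightarrow> q \<in> V" using riem_ball_nbhd[of V y0] by blast
  \<comment> \<open>The ball of radius \<open>2 * \<rho>\<close> about \<open>y\<close> must lie in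
    \<open>V\<close>, and a link, being shorter than \<open>2 * \<rho>\<close>, must be short enough
    for \<open>riem_dist_lower\<close>.\<close>
  define \<rho> where "\<rho> = min (\<rho>3 / 4) (a * \<kappa>0 / 16)"
  have \<rho>: "\<rho> > 0" "4 * \<rho> \<le> \<rho>3" "16 * \<rho> \<le> a * \<kappa>0"   proof -
    have "a * \<kappa>0 > 0" using ab(1) \<kappa>0(1) by simp
    then show "\<rho> > 0" "4 * \<rho> \<le> \<rho>3" "16 * \<rho> \<le> a * \<kappa>0" using \<rho>3(1) unfolding \<rho>_def by linarith+
  qed
  \<comment> \<open>At most 1, so that frame vectors have squared metric length at most 2, as the
    constant \<open>M\<close> presumes.\<close>
  define \<kappa> where "\<kappa> = min \<kappa>0 1"
  have \<kappa>: "\<kappa> > 0" "\<kappa> \<le> \<kappa>0" "\<kappa> \<le> 1" using \<kappa>0 by (auto simp: \<kappa>_def)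
  define C where "C = C0 / a\<^sup>2"
  have C: "C > 0" using C0 ab by (simp add: C_def)
  have inV: "p \<in> fst c \<and> snd c p \<in> ball x0 r" if pV: "p \<in> V" for p
  proof -
    have "\<exists>x\<in>ball x0 r. p = chart_pt c x" using pV unfolding V_def by blast
    then show ?thesis using chart_pt[OF c(1)] rb(3) by auto
  qed
  have main: "step_at \<Lambda> (m * \<Lambda>\<^sup>2 + Kr + \<epsilon>) \<kappa> C y z"
    if yz: "riem_dist A g y0 y < \<rho>" "riem_dist A g y0 z < \<rho>" "y \<noteq> z" for y z
    unfolding step_at_def
  proof (intro allI impI)
    fix e :: "'m \<Rightarrow> real ^ 'm" and \<alpha> \<sigma> :: real
    assume ge: "gram_close y e \<kappa>" and \<alpha>: "0 \<le> \<alpha>" "\<alpha> \<le> 1" and \<sigma>: "\<bar>\<sigma>\<bar> \<le> \<Lambda> * riem_dist A g y z"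
    define h where "h = riem_dist A g y z"
    have h: "0 < h" "h < 2 * \<rho>"
      using yz dist.mdist_pos_less[of y z] riem_dist_triangle[of y z y0] riem_dist_sym[of y y0] by (auto simp: h_def)
    have yV: "y \<in> V" "z \<in> V" using \<rho>3(2) yz \<rho> by auto
    define Y where "Y = snd c y" define Z where "Z = snd c z"
    have Yb: "y \<in> fst c" "z \<in> fst c" "Y \<in> ball x0 r" "Z \<in> ball x0 r" using inV yV by (auto simp: Y_def Z_def)
    then have Yc: "Y \<in> cball x0 r" "Z \<in> cball x0 r" by auto
    then have Yk: "Y \<in> cball x0 \<kappa>0" "Z \<in> cball x0 \<kappa>0" "Y \<in> chart_range c" "Z \<in> chart_range c" using rb by auto
    have YZ: "Y \<noteq> Z" using yz(3) chart_inj[OF c(1)] Yb(1,2) unfolding Y_def Z_def by (metis inj_onD)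
    have "a * norm (Z - Y) \<le> h"
    proof -
      have sub: "cball (snd c y) (\<kappa>0 / 2) \<subseteq> cball x0 \<kappa>0"
      proof
        fix w assume "w \<in> cball (snd c y) (\<kappa>0 / 2)"
        then show "w \<in> cball x0 \<kappa>0" using dist_triangle[of x0 w Y] Yc(1) r(2) by (auto simp: Y_def)
      qed
      have "riem_dist A g y z < a * (\<kappa>0 / 4)" using h \<rho> by (simp add: h_def)
      moreover have "cball (snd c y) (\<kappa>0 / 2) \<subseteq> chart_range c" using sub \<kappa>0 by blast
      ultimately show ?thesis
        using riem_dist_lower[OF c(1) Yb(1) _ ab(1), of "\<kappa>0 / 2" "\<kappa>0 / 4" z] ab(3) sub \<kappa>0(1)
        unfolding G_def Y_def Z_def h_def by (simp add: subset_iff)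
    qed
    then have nZY: "(norm (Z - Y))\<^sup>2 \<le> h\<^sup>2 / a\<^sup>2"
      using ab(1) power_mono[of "a * norm (Z - Y)" h 2] by (simp add: power_mult_distrib field_simps)
    define J where "J = frechet_derivative (chart_trans (chart_at A y) c) (at (snd (chart_at A y) y))"
    define J' where "J' = frechet_derivative (chart_trans c (chart_at A z)) (at Z)"
    have lJ: "linear J" unfolding J_def using chart_trans_has_derivative[OF chart_at(1) c(1) chart_at(2) Yb(1)] has_derivative_linear by blast
    have lJ': "linear J'" unfolding J'_def Z_def using chart_trans_has_derivative[OF c(1) chart_at(1) Yb(2) chart_at(2)] has_derivative_linear by blast
    define E where "E = (\<lambda>i. J (e i))"
    define F where "F = (\<lambda>i. L.frame_field Y (E i) Z)"
    define f where "f = (\<lambda>i. J' (F i))"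
    have gE: "metric_ip G Y (E i) (E j) = tangent_ip y (e i) (e j)" for i j
      unfolding G_def Y_def E_def J_def tangent_ip_def by (rule metric_ip_trans[OF chart_at(1) c(1) chart_at(2) Yb(1)])
    have gF: "tangent_ip z (f i) (f j) = metric_ip G Z (F i) (F j)" for i j
      unfolding G_def Z_def f_def J'_def tangent_ip_def by (rule metric_ip_trans[OF c(1) chart_at(1) Yb(2) chart_at(2)])
    have gE1: "\<bar>metric_ip G Y (E i) (E j) - (if i = j then 1 else 0)\<bar> \<le> \<kappa>" for i j
      using ge unfolding gE gram_close_def by blast
    have EM: "norm (E i) \<le> M" for i
    proof -
      have "metric_ip G Y (E i) (E i) \<le> 2" using gE1[of i i] \<kappa>(3) by (simp add: abs_le_iff)
      then have "metric_norm G Y (E i) \<le> sqrt 2" unfolding metric_norm_def by (rule real_sqrt_le_mono)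
      then have "a * norm (E i) \<le> sqrt 2" using ab(3)[OF Yk(1), of "E i"] by simp
      then show ?thesis using ab(1) by (simp add: M_def field_simps)
    qed
    have drift: "\<bar>tangent_ip z (f i) (f j) - tangent_ip y (e i) (e j)\<bar> \<le> C * h\<^sup>2" for i j
    proof -
      have "\<bar>metric_ip G Z (F i) (F j) - metric_ip G Y (E i) (E j)\<bar> \<le> C0 * (norm (Z - Y))\<^sup>2"
        using C0(2)[OF Yk(1,2) EM EM] unfolding F_def L.frame_field_def G_def .
      also have "\<dots> \<le> C0 * (h\<^sup>2 / a\<^sup>2)" using C0(1) nZY by (intro mult_left_mono) auto
      finally show ?thesis unfolding gF gE C_def by simp
    qed
    define n where "n = metric_norm G Y (Z - Y)"
    have n2: "metric_ip G Y (Z - Y) (Z - Y) = n\<^sup>2" unfolding n_def G_def by (rule L.metric_norm_sq[OF Yk(3), symmetric])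
    have n: "n > 0" using L.ip_pos[OF Yk(3), of "Z - Y"] YZ unfolding n_def metric_norm_def G_def by simp
    have hn: "h \<le> (1 + \<tau>) * n"
    proof -
      have "riem_dist A g (chart_pt c Y) (chart_pt c Z) \<le> (1 + \<tau>) * n"
      proof (rule riem_dist_segment[OF c(1)])
        fix t :: real assume t: "0 \<le> t" "t \<le> 1"
        have w: "Y + t *\<^sub>R (Z - Y) \<in> cball x0 r" by (rule segment_in_cball[OF Yc t])
        then show "Y + t *\<^sub>R (Z - Y) \<in> chart_range c" using rb by blast
        have "Y + t *\<^sub>R (Z - Y) \<in> cball x0 r1" "Y \<in> cball x0 r1" using w Yc(1) r(3) by auto
        from r1(2)[OF this] show "metric_norm (g c) (Y + t *\<^sub>R (Z - Y)) (Z - Y) \<le> (1 + \<tau>) * n"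
          unfolding n_def G_def .
      qed
      then show ?thesis using Yb c by (simp add: h_def Y_def Z_def)
    qed
    \<comment> \<open>A multiple of the metric dual of \<open>Z - Y\<close>, normalized so that the
      weight changes by exactly \<sigma> from \<open>Y\<close> to \<open>Z\<close>. Its norm
      |\<sigma>| / n is the least possible for such a form.\<close>
    define l where "l = (\<sigma> / n\<^sup>2) *\<^sub>R (G Y *v (Z - Y))"
    have lu: "l \<bullet> u = \<sigma> / n\<^sup>2 * metric_ip G Y u (Z - Y)" for u
      by (simp add: l_def metric_ip_def inner_commute)
    have lZ: "l \<bullet> (Z - Y) = \<sigma>" using n n2 by (simp add: lu)
    have lb: "\<bar>l \<bullet> u\<bar> \<le> (\<Lambda> + \<kappa>0) * metric_norm G Y u" for u
    proof -
      have nn: "metric_norm G Y u \<ge> 0" unfolding G_def by (rule L.metric_norm_nonneg[OF Yk(3)])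
      have "\<bar>l \<bullet> u\<bar> = \<bar>\<sigma>\<bar> / n\<^sup>2 * \<bar>metric_ip G Y u (Z - Y)\<bar>" unfolding lu by (simp add: abs_mult)
      also have "\<dots> \<le> \<bar>\<sigma>\<bar> / n\<^sup>2 * (metric_norm G Y u * n)"
        unfolding n_def G_def by (intro mult_left_mono L.ip_cauchy_schwarz[OF Yk(3)]) auto
      also have "\<dots> = (\<bar>\<sigma>\<bar> / n) * metric_norm G Y u" using n by (simp add: power2_eq_square)
      also have "\<dots> \<le> (\<Lambda> + \<kappa>0) * metric_norm G Y u"
      proof (rule mult_right_mono[OF _ nn])
        have "\<bar>\<sigma>\<bar> \<le> \<Lambda> * ((1 + \<tau>) * n)" using \<sigma> mult_left_mono[OF hn, of \<Lambda>] \<Lambda> unfolding h_def by linarith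
        also have "\<dots> = (\<Lambda> + \<kappa>0) * n" using \<tau>(2) by (simp add: algebra_simps)
        finally show "\<bar>\<sigma>\<bar> / n \<le> \<Lambda> + \<kappa>0" using n by (simp add: field_simps)
      qed
      finally show ?thesis .
    qed
    have wb: "\<bar>\<alpha> + l \<bullet> (x - Y)\<bar> \<le> 1 + \<kappa>0" if x: "x \<in> cball x0 r" for x
    proof -
      have "norm (x - Y) \<le> 2 * r" using x Yc(1) dist_triangle2[of x Y x0] by (simp add: dist_norm norm_minus_commute)
      then have "metric_norm G Y (x - Y) \<le> b * (2 * r)" using ab(4)[OF Yk(1), of "x - Y"] ab(2) mult_left_mono[of "norm (x - Y)" "2 * r" b] by linarith
      then have "(\<Lambda> + \<kappa>0) * metric_norm G Y (x - Y) \<le> (\<Lambda> + \<kappa>0) * (b * (2 * r))" using \<Lambda> \<kappa>0 by (intro mult_left_mono) auto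
      also have "\<dots> = B0 * r" by (simp add: B0_def)
      finally have "\<bar>l \<bullet> (x - Y)\<bar> \<le> \<kappa>0" using lb[of "x - Y"] r(4) by linarith
      then show ?thesis using \<alpha> by (simp add: abs_le_iff)
    qed
    have gE0: "\<forall>i j. \<bar>metric_ip G Y (E i) (E j) - (if i = j then 1 else 0)\<bar> \<le> \<kappa>0" using gE1 \<kappa>(2) order_trans by blast
    have "\<epsilon> / 2 > 0" using \<epsilon> by simp
    have qest: "let w = \<alpha> + l \<bullet> (x - Y); Ea = (\<lambda>i. E i - Gam (g c) Y (x - Y) (E i)); N = (\<lambda>i. (l \<bullet> v) *\<^sub>R Ea i + w *\<^sub>R (Gam (g c) x v (Ea i) - Gam (g c) Y v (E i)))
      in (\<Sum>i\<in>UNIV. metric_ip (g c) x (N i) (N i) + w\<^sup>2 * metric_ip (g c) x (curvature (g c) x (Ea i) v (Ea i)) v) \<le> q * metric_ip (g c) x v v"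
      if x: "x \<in> cball x0 r" for x v
    proof -
      have xk: "x \<in> cball x0 \<kappa>0" using x rb by blast
      show ?thesis using est[OF xk Yk(1) gE0 allI[OF lb] wb[OF x], of v] unfolding Let_def G_def .
    qed
    have "\<exists>\<delta>>0. \<forall>s. \<bar>s\<bar> < \<delta> \<longrightarrow> (\<forall>x\<in>cball x0 r. (\<forall>i. L.var_map Y (E i) \<alpha> l s x \<in> chart_range c) \<and> (\<forall>v.
     (\<Sum>i\<in>UNIV. metric_ip G (L.var_map Y (E i) \<alpha> l s x) (L.var_map' Y (E i) \<alpha> l s x v) (L.var_map' Y (E i) \<alpha> l s x v)
     + metric_ip G (L.var_map Y (E i) \<alpha> l (- s) x) (L.var_map' Y (E i) \<alpha> l (- s) x v) (L.var_map' Y (E i) \<alpha> l (- s) x v))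
     \<le> (2 * m + 2 * s\<^sup>2 * (q + \<epsilon> / 2)) * metric_ip G x v v))"
      unfolding G_def m_def by (rule L.frame_maps_bound[OF compact_cball rb(2) \<open>\<epsilon> / 2 > 0\<close> qest])
    then obtain \<delta>0 where \<delta>0: "\<delta>0 > 0" "\<And>s x i. \<bar>s\<bar> < \<delta>0 \<Longrightarrow> x \<in> cball x0 r \<Longrightarrow> L.var_map Y (E i) \<alpha> l s x \<in> chart_range c"
      "\<And>s x v. \<bar>s\<bar> < \<delta>0 \<Longrightarrow> x \<in> cball x0 r \<Longrightarrow>
     (\<Sum>i\<in>UNIV. metric_ip G (L.var_map Y (E i) \<alpha> l s x) (L.var_map' Y (E i) \<alpha> l s x v) (L.var_map' Y (E i) \<alpha> l s x v)
     + metric_ip G (L.var_map Y (E i) \<alpha> l (- s) x) (L.var_map' Y (E i) \<alpha> l (- s) x v) (L.var_map' Y (E i) \<alpha> l (- s) x v))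
     \<le> (2 * m + 2 * s\<^sup>2 * (q + \<epsilon> / 2)) * metric_ip G x v v"
      by blast
    define Q where "Q = m * \<Lambda>\<^sup>2 + Kr + \<epsilon>"
    have Qq: "q + \<epsilon> / 2 = Q" by (simp add: q_def Q_def)
    have Q0: "Q \<ge> 0" using m \<epsilon> Kr by (simp add: Q_def)
    define Dc where "Dc = (\<lambda>i s. riem_dist A g (cpath c y (\<alpha> *\<^sub>R E i) s) (cpath c z ((\<alpha> + \<sigma>) *\<^sub>R F i) s))"
    have contr: "(\<Sum>i\<in>UNIV. (Dc i s)\<^sup>2 + (Dc i (- s))\<^sup>2) \<le> (2 * m + 2 * s\<^sup>2 * Q) * h\<^sup>2" if s: "\<bar>s\<bar> < \<delta>0" for s
    proof -
      \<comment> \<open>Both signs of \<open>s\<close> enter the index set, because the second order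
        bound holds only for the sum over the two.\<close>
      define \<psi> where "\<psi> = (\<lambda>j :: 'm \<times> bool. L.var_map Y (E (fst j)) \<alpha> l (if snd j then s else - s))"
      define BB where "BB = sqrt (2 * m + 2 * s\<^sup>2 * Q)"
      have BB: "BB\<^sup>2 = 2 * m + 2 * s\<^sup>2 * Q" "BB \<ge> 0" unfolding BB_def using m Q0 by simp_all
      have sj: "\<bar>if snd j then s else - s\<bar> < \<delta>0" for j :: "'m \<times> bool" using s by simp
      have split: "(\<Sum>j\<in>UNIV. H (fst j) (snd j)) = (\<Sum>i\<in>UNIV. H i True + H i False)" for H :: "'m \<Rightarrow> bool \<Rightarrow> real"
        unfolding UNIV_Times_UNIV[symmetric] sum.cartesian_product' UNIV_bool by (simp add: add.commute)
      have "(\<Sum>j\<in>UNIV. (riem_dist A g (chart_pt c (\<psi> j (snd c y))) (chart_pt c (\<psi> j (snd c z))))\<^sup>2) \<le> BB\<^sup>2 * (riem_dist A g y z)\<^sup>2"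
      proof (rule contraction[where W="ball x0 r" and \<rho>="2 * \<rho>"])
        show "Ck_on (Suc 0) (\<psi> j) (ball x0 r)" for j unfolding \<psi>_def by (rule L.var_map_C1[OF open_ball rb(3)])
        show "\<psi> j ` ball x0 r \<subseteq> chart_range c" for j using \<delta>0(2)[OF sj] rb(4) unfolding \<psi>_def by blast
        fix x v assume x: "x \<in> ball x0 r"
        then have xc: "x \<in> cball x0 r" "x \<in> chart_range c" using rb by auto
        have fd: "frechet_derivative (\<psi> j) (at x) = L.var_map' Y (E (fst j)) \<alpha> l (if snd j then s else - s) x" for j
          unfolding \<psi>_def by (rule frechet_derivative_at[OF L.var_map_has_derivative[OF xc(2)], symmetric])
        have "(\<Sum>j\<in>UNIV. (metric_norm (g c) (\<psi> j x) (frechet_derivative (\<psi> j) (at x) v))\<^sup>2)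
          = (\<Sum>j\<in>UNIV. metric_ip G (\<psi> j x) (L.var_map' Y (E (fst j)) \<alpha> l (if snd j then s else - s) x v) (L.var_map' Y (E (fst j)) \<alpha> l (if snd j then s else - s) x v))"
        proof (rule sum.cong[OF refl])
          fix j
          have "\<psi> j x \<in> chart_range c" unfolding \<psi>_def by (rule \<delta>0(2)[OF sj xc(1)])
          from L.metric_norm_sq[OF this] show "(metric_norm (g c) (\<psi> j x) (frechet_derivative (\<psi> j) (at x) v))\<^sup>2
            = metric_ip G (\<psi> j x) (L.var_map' Y (E (fst j)) \<alpha> l (if snd j then s else - s) x v) (L.var_map' Y (E (fst j)) \<alpha> l (if snd j then s else - s) x v)"
            unfolding fd G_def .
        qed
        also have "\<dots> = (\<Sum>i\<in>UNIV. metric_ip G (L.var_map Y (E i) \<alpha> l s x) (L.var_map' Y (E i) \<alpha> l s x v) (L.var_map' Y (E i) \<alpha> l s x v)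
     + metric_ip G (L.var_map Y (E i) \<alpha> l (- s) x) (L.var_map' Y (E i) \<alpha> l (- s) x v) (L.var_map' Y (E i) \<alpha> l (- s) x v))"
          unfolding \<psi>_def using split[of "\<lambda>i b. metric_ip G (L.var_map Y (E i) \<alpha> l (if b then s else - s) x) (L.var_map' Y (E i) \<alpha> l (if b then s else - s) x v) (L.var_map' Y (E i) \<alpha> l (if b then s else - s) x v)"] by simp
        also have "\<dots> \<le> BB\<^sup>2 * (metric_norm (g c) x v)\<^sup>2"
          using \<delta>0(3)[OF s xc(1), of v] unfolding BB Qq L.metric_norm_sq[OF xc(2)] G_def .
        finally show "(\<Sum>j\<in>UNIV. (metric_norm (g c) (\<psi> j x) (frechet_derivative (\<psi> j) (at x) v))\<^sup>2) \<le> BB\<^sup>2 * (metric_norm (g c) x v)\<^sup>2" .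
      next
        fix p assume "riem_dist A g y p < 2 * \<rho>"
        then have "riem_dist A g y0 p < \<rho>3" using riem_dist_triangle[of y0 p y] yz(1) \<rho> by linarith
        then show "p \<in> chart_pt c ` ball x0 r" using \<rho>3(2) unfolding V_def by blast
      qed (use c rb BB h in \<open>auto simp: h_def\<close>)
      also have "(\<Sum>j\<in>UNIV. (riem_dist A g (chart_pt c (\<psi> j (snd c y))) (chart_pt c (\<psi> j (snd c z))))\<^sup>2) = (\<Sum>i\<in>UNIV. (Dc i s)\<^sup>2 + (Dc i (- s))\<^sup>2)"
      proof -
        have "\<psi> j (snd c y) = L.gpath Y (\<alpha> *\<^sub>R E (fst j)) (if snd j then s else - s)"
          "\<psi> j (snd c z) = L.gpath Z ((\<alpha> + \<sigma>) *\<^sub>R F (fst j)) (if snd j then s else - s)" for j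
          unfolding \<psi>_def L.var_map_eq_gpath Y_def[symmetric] Z_def[symmetric] by (simp_all add: lZ F_def)
        then have "(\<Sum>j\<in>UNIV. (riem_dist A g (chart_pt c (\<psi> j (snd c y))) (chart_pt c (\<psi> j (snd c z))))\<^sup>2)
          = (\<Sum>j\<in>UNIV. (Dc (fst j) (if snd j then s else - s))\<^sup>2)"
          unfolding Dc_def cpath_gpath[OF c(1)] Y_def[symmetric] Z_def[symmetric] by simp
        also have "\<dots> = (\<Sum>i\<in>UNIV. (Dc i s)\<^sup>2 + (Dc i (- s))\<^sup>2)" using split[of "\<lambda>i b. (Dc i (if b then s else - s))\<^sup>2"] by simp
        finally show ?thesis .
      qed
      finally show ?thesis unfolding BB h_def .
    qed
    have junc: "\<exists>\<delta>>0. \<forall>s. \<bar>s\<bar> < \<delta> \<longrightarrow> (\<Sum>i\<in>UNIV. (riem_dist A g (tpath y (\<alpha> *\<^sub>R e i) s) (tpath z ((\<alpha> + \<sigma>) *\<^sub>R f i) s))\<^sup>2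
             + (riem_dist A g (tpath y (\<alpha> *\<^sub>R e i) (- s)) (tpath z ((\<alpha> + \<sigma>) *\<^sub>R f i) (- s)))\<^sup>2)
          \<le> (2 * m + 2 * s\<^sup>2 * Q) * h\<^sup>2 + \<eta> * s\<^sup>2" if \<eta>: "\<eta> > 0" for \<eta>
    proof -
      define Dt where "Dt = (\<lambda>i s. riem_dist A g (tpath y (\<alpha> *\<^sub>R e i) s) (tpath z ((\<alpha> + \<sigma>) *\<^sub>R f i) s))"
      \<comment> \<open>A bound for the distances \<open>Dc\<close> that is valid for all |s| up to
        1, as \<open>square_perturb\<close> requires.\<close>
      define M1 where "M1 = sqrt ((2 * m + 2 * Q) * h\<^sup>2)"
      have M1: "M1 \<ge> 0" "M1\<^sup>2 = (2 * m + 2 * Q) * h\<^sup>2" unfolding M1_def using m Q0 by simp_all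
      \<comment> \<open>There are \<open>2 * m\<close> squares, each perturbed by at most (4 M1 + 4)
        \<epsilon>1 s^2.\<close>
      define \<epsilon>1 where "\<epsilon>1 = min 1 (\<eta> / (2 * m * (4 * M1 + 4)))"
      have \<epsilon>1: "0 < \<epsilon>1" "\<epsilon>1 \<le> 1" "2 * m * ((4 * M1 + 4) * \<epsilon>1) \<le> \<eta>"
      proof -
        have pos: "2 * m * (4 * M1 + 4) > 0" using m M1 by (simp add: add_nonneg_pos)
        then show "0 < \<epsilon>1" "\<epsilon>1 \<le> 1" using \<eta> by (auto simp: \<epsilon>1_def)
        have "\<epsilon>1 \<le> \<eta> / (2 * m * (4 * M1 + 4))" by (simp add: \<epsilon>1_def)
        then have "\<epsilon>1 * (2 * m * (4 * M1 + 4)) \<le> \<eta>" using pos by (simp add: pos_le_divide_eq)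
        then show "2 * m * ((4 * M1 + 4) * \<epsilon>1) \<le> \<eta>" by (simp add: algebra_simps)
      qed
      have JJ: "J (\<alpha> *\<^sub>R e i) = \<alpha> *\<^sub>R E i" "J' ((\<alpha> + \<sigma>) *\<^sub>R F i) = (\<alpha> + \<sigma>) *\<^sub>R f i" for i
        by (simp_all add: E_def f_def linear_scale[OF lJ] linear_scale[OF lJ'])
      have j1: "\<exists>\<delta>>0. \<forall>s. \<bar>s\<bar> < \<delta> \<longrightarrow> riem_dist A g (tpath y (\<alpha> *\<^sub>R e i) s) (cpath c y (\<alpha> *\<^sub>R E i) s) \<le> \<epsilon>1 * s\<^sup>2" for i
        using tpath_junction[OF c(1) Yb(1) \<epsilon>1(1), of "\<alpha> *\<^sub>R e i"] unfolding J_def[symmetric] JJ .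
      have j2: "\<exists>\<delta>>0. \<forall>s. \<bar>s\<bar> < \<delta> \<longrightarrow> riem_dist A g (cpath c z ((\<alpha> + \<sigma>) *\<^sub>R F i) s) (tpath z ((\<alpha> + \<sigma>) *\<^sub>R f i) s) \<le> \<epsilon>1 * s\<^sup>2" for i
        using tpath_junction'[OF c(1) Yb(2) \<epsilon>1(1), of "(\<alpha> + \<sigma>) *\<^sub>R F i"] unfolding Z_def[symmetric] J'_def[symmetric] JJ .
      obtain \<delta>1 where \<delta>1: "\<delta>1 > 0" "\<And>i s. \<bar>s\<bar> < \<delta>1 \<Longrightarrow> riem_dist A g (tpath y (\<alpha> *\<^sub>R e i) s) (cpath c y (\<alpha> *\<^sub>R E i) s) \<le> \<epsilon>1 * s\<^sup>2"
        using uniform_radius[of "\<lambda>i s. riem_dist A g (tpath y (\<alpha> *\<^sub>R e i) s) (cpath c y (\<alpha> *\<^sub>R E i) s) \<le> \<epsilon>1 * s\<^sup>2", OF j1] by blast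
      obtain \<delta>2 where \<delta>2: "\<delta>2 > 0" "\<And>i s. \<bar>s\<bar> < \<delta>2 \<Longrightarrow> riem_dist A g (cpath c z ((\<alpha> + \<sigma>) *\<^sub>R F i) s) (tpath z ((\<alpha> + \<sigma>) *\<^sub>R f i) s) \<le> \<epsilon>1 * s\<^sup>2"
        using uniform_radius[of "\<lambda>i s. riem_dist A g (cpath c z ((\<alpha> + \<sigma>) *\<^sub>R F i) s) (tpath z ((\<alpha> + \<sigma>) *\<^sub>R f i) s) \<le> \<epsilon>1 * s\<^sup>2", OF j2] by blast
      define \<delta> where "\<delta> = min (min \<delta>0 1) (min \<delta>1 \<delta>2)"
      have "(\<Sum>i\<in>UNIV. (Dt i s)\<^sup>2 + (Dt i (- s))\<^sup>2) \<le> (2 * m + 2 * s\<^sup>2 * Q) * h\<^sup>2 + \<eta> * s\<^sup>2" if s: "\<bar>s\<bar> < \<delta>" for s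
      proof -
        have s1: "\<bar>s\<bar> < \<delta>0" "\<bar>s\<bar> \<le> 1" "\<bar>s\<bar> < \<delta>1" "\<bar>s\<bar> < \<delta>2" using s by (auto simp: \<delta>_def)
        have s2: "s\<^sup>2 \<le> 1" using s1(2) by (simp add: abs_square_le_1)
        have DM: "Dc i s \<le> M1 \<and> Dc i (- s) \<le> M1" for i
        proof -
          have "(Dc i s)\<^sup>2 + (Dc i (- s))\<^sup>2 \<le> (\<Sum>i\<in>UNIV. (Dc i s)\<^sup>2 + (Dc i (- s))\<^sup>2)" by (rule member_le_sum) auto
          also have "\<dots> \<le> (2 * m + 2 * s\<^sup>2 * Q) * h\<^sup>2" by (rule contr[OF s1(1)])
          also have "\<dots> \<le> (2 * m + 2 * Q) * h\<^sup>2" using s2 Q0 by (intro mult_right_mono add_left_mono) (auto intro: mult_left_le_one_le)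
          finally have "(Dc i s)\<^sup>2 \<le> M1\<^sup>2" "(Dc i (- s))\<^sup>2 \<le> M1\<^sup>2" unfolding M1(2) by (smt (verit) zero_le_power2)+
          then show ?thesis using M1(1) by (meson power2_le_imp_le)
        qed
        have tri: "Dt i q \<le> Dc i q + 2 * \<epsilon>1 * q\<^sup>2" if "\<bar>q\<bar> < \<delta>1" "\<bar>q\<bar> < \<delta>2" for i q
          using riem_dist_triangle[of "tpath y (\<alpha> *\<^sub>R e i) q" "tpath z ((\<alpha> + \<sigma>) *\<^sub>R f i) q" "cpath c y (\<alpha> *\<^sub>R E i) q"]
            riem_dist_triangle[of "cpath c y (\<alpha> *\<^sub>R E i) q" "tpath z ((\<alpha> + \<sigma>) *\<^sub>R f i) q" "cpath c z ((\<alpha> + \<sigma>) *\<^sub>R F i) q"]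
            \<delta>1(2)[OF that(1), of i] \<delta>2(2)[OF that(2), of i] unfolding Dt_def Dc_def by linarith
        have "(Dt i s)\<^sup>2 + (Dt i (- s))\<^sup>2 \<le> ((Dc i s)\<^sup>2 + (Dc i (- s))\<^sup>2) + 2 * ((4 * M1 + 4) * \<epsilon>1 * s\<^sup>2)" for i
          using square_perturb[of "Dt i s" "Dc i s" \<epsilon>1 s M1] square_perturb[of "Dt i (- s)" "Dc i (- s)" \<epsilon>1 "- s" M1]
            tri[of s i] tri[of "- s" i] DM[of i] \<epsilon>1 s1 riem_dist_nonneg unfolding Dt_def Dc_def by simp
        then have "(\<Sum>i\<in>UNIV. (Dt i s)\<^sup>2 + (Dt i (- s))\<^sup>2) \<le> (\<Sum>i\<in>(UNIV::'m set). ((Dc i s)\<^sup>2 + (Dc i (- s))\<^sup>2) + 2 * ((4 * M1 + 4) * \<epsilon>1 * s\<^sup>2))"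
          by (intro sum_mono)
        also have "\<dots> = (\<Sum>i\<in>UNIV. (Dc i s)\<^sup>2 + (Dc i (- s))\<^sup>2) + (2 * m * ((4 * M1 + 4) * \<epsilon>1)) * s\<^sup>2"
          by (simp add: sum.distrib m_def)
        also have "\<dots> \<le> (2 * m + 2 * s\<^sup>2 * Q) * h\<^sup>2 + \<eta> * s\<^sup>2"
          using contr[OF s1(1)] \<epsilon>1(3) by (intro add_mono mult_right_mono) auto
        finally show ?thesis .
      qed
      then show ?thesis using \<delta>0(1) \<delta>1(1) \<delta>2(1) unfolding Dt_def by (intro exI[of _ \<delta>]) (auto simp: \<delta>_def)
    qed
    show "\<exists>f. (\<forall>i j. \<bar>tangent_ip z (f i) (f j) - tangent_ip y (e i) (e j)\<bar> \<le> C * (riem_dist A g y z)\<^sup>2) \<and>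
       (\<forall>\<eta>>0. \<exists>\<delta>>0. \<forall>s. \<bar>s\<bar> < \<delta> \<longrightarrow>
          (\<Sum>i\<in>UNIV. (riem_dist A g (tpath y (\<alpha> *\<^sub>R e i) s) (tpath z ((\<alpha> + \<sigma>) *\<^sub>R f i) s))\<^sup>2
             + (riem_dist A g (tpath y (\<alpha> *\<^sub>R e i) (- s)) (tpath z ((\<alpha> + \<sigma>) *\<^sub>R f i) (- s)))\<^sup>2)
          \<le> (2 * real CARD('m) + 2 * s\<^sup>2 * (m * \<Lambda>\<^sup>2 + Kr + \<epsilon>)) * (riem_dist A g y z)\<^sup>2 + \<eta> * s\<^sup>2)"
      using drift junc unfolding h_def Q_def m_def by (intro exI[of _ f]) simp
  qed
  show ?thesis
    by (intro exI[of _ \<rho>] exI[of _ \<kappa>] exI[of _ C]) (use \<rho> \<kappa> C main m_def in auto)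
qed

end

text \<open>Cauchy-Schwarz with weights \<open>k\<close> and 1; the difference of the two sides is
  \<open>(a - k * b)\<^sup>2 / k\<close>.\<close>

lemma square_sum_weighted:
  fixes a b k :: real
  assumes "k > 0" shows "(a + b)\<^sup>2 \<le> (1 + 1 / k) * a\<^sup>2 + (1 + k) * b\<^sup>2"
proof -
  have "0 \<le> (a - k * b)\<^sup>2 / k" using assms by simp
  also have "(a - k * b)\<^sup>2 / k = a\<^sup>2 / k - 2 * a * b + k * b\<^sup>2"
    using assms by (simp add: power2_eq_square field_simps)
  finally show ?thesis by (simp add: power2_eq_square algebra_simps)
qed

section \<open>From one link to the whole chain\<close>

context riemannian_manifold
begin

lemma step_at_mono:
  assumes "step_at \<Lambda> Q \<kappa> C y z" "\<kappa>' \<le> \<kappa>" "C \<le> C'"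
  shows "step_at \<Lambda> Q \<kappa>' C' y z"
  unfolding step_at_def
proof (intro allI impI)
  fix e :: "'m \<Rightarrow> real ^ 'm" and \<alpha> \<sigma> :: real
  assume h: "gram_close y e \<kappa>'" "0 \<le> \<alpha>" "\<alpha> \<le> 1" "\<bar>\<sigma>\<bar> \<le> \<Lambda> * riem_dist A g y z"
  have "gram_close y e \<kappa>" using h(1) assms(2) unfolding gram_close_def by (meson order_trans)
  then obtain f where f: "\<forall>i j. \<bar>tangent_ip z (f i) (f j) - tangent_ip y (e i) (e j)\<bar> \<le> C * (riem_dist A g y z)\<^sup>2"
      "\<forall>\<eta>>0. \<exists>\<delta>>0. \<forall>s. \<bar>s\<bar> < \<delta> \<longrightarrow>
          (\<Sum>i\<in>UNIV. (riem_dist A g (tpath y (\<alpha> *\<^sub>R e i) s) (tpath z ((\<alpha> + \<sigma>) *\<^sub>R f i) s))\<^sup>2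
             + (riem_dist A g (tpath y (\<alpha> *\<^sub>R e i) (- s)) (tpath z ((\<alpha> + \<sigma>) *\<^sub>R f i) (- s)))\<^sup>2)
          \<le> (2 * real CARD('m) + 2 * s\<^sup>2 * Q) * (riem_dist A g y z)\<^sup>2 + \<eta> * s\<^sup>2"
    using assms(1) h(2-4) unfolding step_at_def by blast
  have "C * (riem_dist A g y z)\<^sup>2 \<le> C' * (riem_dist A g y z)\<^sup>2" using assms(3) by (intro mult_right_mono) auto
  then have "\<forall>i j. \<bar>tangent_ip z (f i) (f j) - tangent_ip y (e i) (e j)\<bar> \<le> C' * (riem_dist A g y z)\<^sup>2" using f(1) order_trans by blast
  then show "\<exists>f. (\<forall>i j. \<bar>tangent_ip z (f i) (f j) - tangent_ip y (e i) (e j)\<bar> \<le> C' * (riem_dist A g y z)\<^sup>2) \<and>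
       (\<forall>\<eta>>0. \<exists>\<delta>>0. \<forall>s. \<bar>s\<bar> < \<delta> \<longrightarrow>
          (\<Sum>i\<in>UNIV. (riem_dist A g (tpath y (\<alpha> *\<^sub>R e i) s) (tpath z ((\<alpha> + \<sigma>) *\<^sub>R f i) s))\<^sup>2
             + (riem_dist A g (tpath y (\<alpha> *\<^sub>R e i) (- s)) (tpath z ((\<alpha> + \<sigma>) *\<^sub>R f i) (- s)))\<^sup>2)
          \<le> (2 * real CARD('m) + 2 * s\<^sup>2 * Q) * (riem_dist A g y z)\<^sup>2 + \<eta> * s\<^sup>2)"
    using f(2) by blast
qed

text \<open>A finite subcover of \<open>K\<close> by the balls of \<open>step_local\<close> yields
  extreme values of the constants, and a Lebesgue number puts both ends of any short link that
  starts in \<open>K\<close> into one of these balls.\<close>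

lemma step_uniform:
  assumes Kr: "Kr \<ge> 0" and ric: "\<And>c x v. c \<in> A \<Longrightarrow> x \<in> chart_range c \<Longrightarrow> ricci (g c) x v v \<ge> - Kr * metric_ip (g c) x v v"
    and \<Lambda>: "\<Lambda> > 0" and \<epsilon>: "\<epsilon> > 0" and K: "compact K"
  shows "\<exists>\<rho> \<kappa> C. \<rho> > 0 \<and> \<kappa> > 0 \<and> C > 0 \<and> (\<forall>y\<in>K. \<forall>z. riem_dist A g y z < \<rho> \<longrightarrow> y \<noteq> z \<longrightarrow>
     step_at \<Lambda> (real CARD('m) * \<Lambda>\<^sup>2 + Kr + \<epsilon>) \<kappa> C y z)"
proof (cases "K = {}")
  case True then show ?thesis by (intro exI[of _ 1]) auto
next
  case False
  define Q where "Q = real CARD('m) * \<Lambda>\<^sup>2 + Kr + \<epsilon>"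
  have "\<exists>t. 0 < fst t \<and> 0 < fst (snd t) \<and> 0 < snd (snd t) \<and> (\<forall>y z. riem_dist A g y0 y < fst t \<longrightarrow> riem_dist A g y0 z < fst t \<longrightarrow> y \<noteq> z \<longrightarrow>
     step_at \<Lambda> Q (fst (snd t)) (snd (snd t)) y z)" for y0
  proof -
    obtain \<rho> \<kappa> C where "\<rho> > 0 \<and> \<kappa> > 0 \<and> C > 0 \<and> (\<forall>y z. riem_dist A g y0 y < \<rho> \<longrightarrow> riem_dist A g y0 z < \<rho> \<longrightarrow> y \<noteq> z \<longrightarrow> step_at \<Lambda> Q \<kappa> C y z)"
      using step_local[OF Kr ric \<Lambda> \<epsilon>, of y0] unfolding Q_def by blast
    then show ?thesis by (intro exI[of _ "(\<rho>, \<kappa>, C)"]) simp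
  qed
  then obtain t where t: "\<And>y0. 0 < fst (t y0) \<and> 0 < fst (snd (t y0)) \<and> 0 < snd (snd (t y0)) \<and> (\<forall>y z. riem_dist A g y0 y < fst (t y0) \<longrightarrow> riem_dist A g y0 z < fst (t y0) \<longrightarrow> y \<noteq> z \<longrightarrow>
     step_at \<Lambda> Q (fst (snd (t y0))) (snd (snd (t y0))) y z)" by metis
  define \<rho> \<kappa> C where "\<rho> = (\<lambda>y. fst (t y))" and "\<kappa> = (\<lambda>y. fst (snd (t y)))" and "C = (\<lambda>y. snd (snd (t y)))"
  have pos: "0 < \<rho> y" "0 < \<kappa> y" "0 < C y" for y using t[of y] by (auto simp: \<rho>_def \<kappa>_def C_def)
  have st: "step_at \<Lambda> Q (\<kappa> y0) (C y0) y z" if "riem_dist A g y0 y < \<rho> y0" "riem_dist A g y0 z < \<rho> y0" "y \<noteq> z" for y0 y z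
    using t[of y0] that by (auto simp: \<rho>_def \<kappa>_def C_def)
  have op: "open (dist.mball y r)" for y r using dist.openin_mball[of y r] unfolding mtopology_eq by simp
  have "K \<subseteq> (\<Union>y\<in>K. dist.mball y (\<rho> y))" using pos(1) riem_dist_zero by auto
  then obtain Y where Y: "Y \<subseteq> K" "finite Y" "K \<subseteq> (\<Union>y\<in>Y. dist.mball y (\<rho> y))"
    using compactE_image[OF K, of K "\<lambda>y. dist.mball y (\<rho> y)"] op by metis
  have Yne: "Y \<noteq> {}" using Y(3) False by auto
  have "\<exists>\<epsilon>>0. \<forall>x\<in>K. \<exists>U\<in>(\<lambda>y. dist.mball y (\<rho> y)) ` Y. dist.mball x \<epsilon> \<subseteq> U"
    by (rule dist.lebesgue_number) (use K Y(3) op in \<open>auto simp: mtopology_eq\<close>)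
  then obtain r where r: "r > 0" "\<And>x. x \<in> K \<Longrightarrow> \<exists>y\<in>Y. dist.mball x r \<subseteq> dist.mball y (\<rho> y)" by auto
  define k where "k = Min (\<kappa> ` Y)" define D where "D = Max (C ` Y)"
  have k: "k > 0" unfolding k_def using Y Yne pos by (subst Min_gr_iff) auto
  have kle: "k \<le> \<kappa> y" "C y \<le> D" if "y \<in> Y" for y unfolding k_def D_def using Y(2) that by auto
  have D: "D > 0" using Yne kle(2) pos(3) by (meson all_not_in_conv less_le_trans)
  have "step_at \<Lambda> Q k D y z" if yz: "y \<in> K" "riem_dist A g y z < r" "y \<noteq> z" for y z
  proof -
    obtain y0 where y0: "y0 \<in> Y" "dist.mball y r \<subseteq> dist.mball y0 (\<rho> y0)" using r(2)[OF yz(1)] by blast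
    have "y \<in> dist.mball y r" "z \<in> dist.mball y r" using yz r(1) riem_dist_zero by auto
    then have "y \<in> dist.mball y0 (\<rho> y0)" "z \<in> dist.mball y0 (\<rho> y0)" using y0(2) by blast+
    then have "riem_dist A g y0 y < \<rho> y0" "riem_dist A g y0 z < \<rho> y0" by auto
    from step_at_mono[OF st[OF this yz(3)] kle[OF y0(1)]] show ?thesis .
  qed
  then show ?thesis using r(1) k D unfolding Q_def by blast
qed

lemma tpath_zero: "tpath p 0 s = p"
  unfolding tpath_def cpath_def using chart_at by (simp add: Gam_algebra)

text \<open>In the induction over the links, \<open>square_sum_weighted\<close> with \<open>k\<close> as weight makes the constants telescope:
  \<open>(1 + 1/k) k\<^sup>2 + (1 + k) = (k + 1)\<^sup>2\<close>.\<close>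

lemma chain_estimate:
  fixes e0 :: "'m \<Rightarrow> real ^ 'm"
  assumes comp: "dist.mcomplete" and Kr: "Kr \<ge> 0" and ric: "\<And>c x v. c \<in> A \<Longrightarrow> x \<in> chart_range c \<Longrightarrow> ricci (g c) x v v \<ge> - Kr * metric_ip (g c) x v v"
    and L: "L = riem_dist A g x p" "L > 0" and \<epsilon>: "\<epsilon> > 0" and e0: "gram_close x e0 0" and \<eta>: "\<eta> > 0"
  shows "\<exists>\<delta>>0. \<forall>s. \<bar>s\<bar> < \<delta> \<longrightarrow> (\<Sum>i\<in>UNIV. (riem_dist A g (tpath x (e0 i) s) p)\<^sup>2 + (riem_dist A g (tpath x (e0 i) (- s)) p)\<^sup>2)
     \<le> L\<^sup>2 * (2 * real CARD('m) + 2 * s\<^sup>2 * (real CARD('m) / L\<^sup>2 + Kr + \<epsilon>)) + \<eta> * s\<^sup>2"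
proof -
  define Q where "Q = real CARD('m) * (1 / L)\<^sup>2 + Kr + \<epsilon>"
  have K: "compact (dist.mcball x L)" by (rule mcball_compact[OF comp])
  have "1 / L > 0" using L by simp
  from step_uniform[OF Kr ric this \<epsilon> K]
  obtain \<rho> \<kappa> C where u: "\<rho> > 0" "\<kappa> > 0" "C > 0" "\<And>y z. y \<in> dist.mcball x L \<Longrightarrow> riem_dist A g y z < \<rho> \<Longrightarrow> y \<noteq> z \<Longrightarrow> step_at (1 / L) Q \<kappa> C y z"
    unfolding Q_def by blast
  \<comment> \<open>The first bound makes the links shorter than \<open>\<rho>\<close>; the second
    keeps the total drift C L^2 / N of the Gram matrix below \<kappa>.\<close>
  obtain N :: nat where N0: "real N > max (L / \<rho>) (C * L\<^sup>2 / \<kappa>)" using reals_Archimedean2 by blast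
  have "L / \<rho> > 0" using L u by simp
  then have N: "real N > 0" "L / \<rho> < real N" "C * L\<^sup>2 / \<kappa> < real N" using N0 by linarith+
  define h where "h = L / real N"
  have h: "h > 0" "h < \<rho>" "real N * h = L" using N L u by (auto simp: h_def field_simps)
  have hC: "real N * (C * h\<^sup>2) \<le> \<kappa>"
  proof -
    have "real N * (C * h\<^sup>2) = C * L\<^sup>2 / real N" using N(1) by (simp add: h_def power2_eq_square)
    also have "\<dots> \<le> \<kappa>" using N u by (simp add: field_simps)
    finally show ?thesis .
  qed
  define X where "X = (\<lambda>s::real. 2 * real CARD('m) + 2 * s\<^sup>2 * Q)"
  \<comment> \<open>The state after \<open>k\<close> links: a point of the chain at distance L - k h
    from \<open>p\<close>, a frame there with its accumulated drift, and a bound for the sum of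
    squares with the weight lowered to 1 - k/N. The clause for \<open>k = 0\<close> fixes the
    start.\<close>
  have claim: "\<exists>y f. riem_dist A g x y \<le> real k * h \<and> riem_dist A g y p = L - real k * h \<and> gram_close y f (real k * (C * h\<^sup>2)) \<and>
     (k = 0 \<longrightarrow> y = x \<and> f = e0) \<and>
     (\<forall>\<eta>>0. \<exists>\<delta>>0. \<forall>s. \<bar>s\<bar> < \<delta> \<longrightarrow> (\<Sum>i\<in>UNIV. (riem_dist A g (tpath x (e0 i) s) (tpath y ((1 - real k / real N) *\<^sub>R f i) s))\<^sup>2
        + (riem_dist A g (tpath x (e0 i) (- s)) (tpath y ((1 - real k / real N) *\<^sub>R f i) (- s)))\<^sup>2) \<le> (real k)\<^sup>2 * h\<^sup>2 * X s + \<eta> * s\<^sup>2)"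
    if "k \<le> N" for k
    using that
  proof (induction k)
    case 0
    have "gram_close x e0 0 \<and> (\<forall>\<eta>>0. \<exists>\<delta>>0. \<forall>s. \<bar>s\<bar> < \<delta> \<longrightarrow> (0::real) \<le> \<eta> * s\<^sup>2)"
      using e0 by (auto intro!: exI[of _ 1])
    then show ?case using L by (intro exI[of _ x] exI[of _ e0]) (simp add: riem_dist_zero)
  next
    case (Suc k)
    then obtain y f where y: "riem_dist A g x y \<le> real k * h" "riem_dist A g y p = L - real k * h" "gram_close y f (real k * (C * h\<^sup>2))"
      "k = 0 \<longrightarrow> y = x \<and> f = e0"
      and IH: "\<And>\<eta>. \<eta> > 0 \<Longrightarrow> \<exists>\<delta>>0. \<forall>s. \<bar>s\<bar> < \<delta> \<longrightarrow> (\<Sum>i\<in>UNIV. (riem_dist A g (tpath x (e0 i) s) (tpath y ((1 - real k / real N) *\<^sub>R f i) s))\<^sup>2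
        + (riem_dist A g (tpath x (e0 i) (- s)) (tpath y ((1 - real k / real N) *\<^sub>R f i) (- s)))\<^sup>2) \<le> (real k)\<^sup>2 * h\<^sup>2 * X s + \<eta> * s\<^sup>2"
      by auto
    have kN: "real k + 1 \<le> real N" using Suc.prems by simp
    have kh: "real k * h + h \<le> L"
    proof -
      have "(real k + 1) * h \<le> real N * h" using kN h(1) by (intro mult_right_mono) auto
      then show ?thesis using h(3) by (simp add: algebra_simps)
    qed
    obtain z where z: "riem_dist A g y z = h" "riem_dist A g z p = L - real k * h - h"
      using between_exists[OF comp, of h y p] y(2) h(1) kh by auto
    have yz: "y \<noteq> z" using z(1) h(1) riem_dist_zero by auto
    have yK: "y \<in> dist.mcball x L" using y(1) kh h(1) by simp
    have S: "step_at (1 / L) Q \<kappa> C y z" by (rule u(4)[OF yK _ yz]) (use z h in simp)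
    define \<alpha> where "\<alpha> = 1 - real k / real N"
    have \<alpha>: "0 \<le> \<alpha>" "\<alpha> \<le> 1" using kN N(1) by (auto simp: \<alpha>_def field_simps)
    have kC: "real k * (C * h\<^sup>2) \<le> \<kappa>"
    proof -
      have "real k * (C * h\<^sup>2) \<le> real N * (C * h\<^sup>2)" using kN u(3) by (intro mult_right_mono) auto
      then show ?thesis using hC by simp
    qed
    have gc: "gram_close y f \<kappa>" using y(3) kC unfolding gram_close_def by (meson order_trans)
    \<comment> \<open>The loss 1/N of weight per link equals h/L, exactly the slope that
      \<open>step_at\<close> admits for \<Lambda> = 1/L.\<close>
    have \<sigma>: "\<bar>- (1 / real N)\<bar> \<le> 1 / L * riem_dist A g y z" unfolding z(1) h_def using L N(1) by simp
    obtain f' where f': "\<forall>i j. \<bar>tangent_ip z (f' i) (f' j) - tangent_ip y (f i) (f j)\<bar> \<le> C * h\<^sup>2"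
      and f'2: "\<And>\<eta>. \<eta> > 0 \<Longrightarrow> \<exists>\<delta>>0. \<forall>s. \<bar>s\<bar> < \<delta> \<longrightarrow>
          (\<Sum>i\<in>UNIV. (riem_dist A g (tpath y (\<alpha> *\<^sub>R f i) s) (tpath z ((\<alpha> + - (1 / real N)) *\<^sub>R f' i) s))\<^sup>2
             + (riem_dist A g (tpath y (\<alpha> *\<^sub>R f i) (- s)) (tpath z ((\<alpha> + - (1 / real N)) *\<^sub>R f' i) (- s)))\<^sup>2)
          \<le> X s * h\<^sup>2 + \<eta> * s\<^sup>2"
      using S gc \<alpha> \<sigma> unfolding step_at_def z(1) X_def by blast
    have \<alpha>': "\<alpha> + - (1 / real N) = 1 - real (Suc k) / real N" using N(1) by (simp add: \<alpha>_def field_simps)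
    have g1: "gram_close z f' (real (Suc k) * (C * h\<^sup>2))"
      unfolding gram_close_def
    proof (intro allI)
      fix i j
      have "\<bar>tangent_ip y (f i) (f j) - (if i = j then 1 else 0)\<bar> \<le> real k * (C * h\<^sup>2)" using y(3) unfolding gram_close_def by blast
      moreover have "\<bar>tangent_ip z (f' i) (f' j) - tangent_ip y (f i) (f j)\<bar> \<le> C * h\<^sup>2" using f' by blast
      ultimately have "\<bar>tangent_ip z (f' i) (f' j) - (if i = j then 1 else 0)\<bar> \<le> real k * (C * h\<^sup>2) + C * h\<^sup>2" by linarith
      then show "\<bar>tangent_ip z (f' i) (f' j) - (if i = j then 1 else 0)\<bar> \<le> real (Suc k) * (C * h\<^sup>2)" by (simp add: algebra_simps)
    qed
    have d1: "riem_dist A g x z \<le> real (Suc k) * h"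
      using riem_dist_triangle[of x z y] y(1) z(1) by (simp add: algebra_simps)
    have d2: "riem_dist A g z p = L - real (Suc k) * h" using z(2) by (simp add: algebra_simps)
    have sums: "\<exists>\<delta>>0. \<forall>s. \<bar>s\<bar> < \<delta> \<longrightarrow> (\<Sum>i\<in>UNIV. (riem_dist A g (tpath x (e0 i) s) (tpath z ((1 - real (Suc k) / real N) *\<^sub>R f' i) s))\<^sup>2
        + (riem_dist A g (tpath x (e0 i) (- s)) (tpath z ((1 - real (Suc k) / real N) *\<^sub>R f' i) (- s)))\<^sup>2) \<le> (real (Suc k))\<^sup>2 * h\<^sup>2 * X s + \<eta> * s\<^sup>2"
      if \<eta>: "\<eta> > 0" for \<eta>
    proof (cases "k = 0")
      \<comment> \<open>Before the first link nothing has accumulated, and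
        \<open>square_sum_weighted\<close> has no positive weight to work with.\<close>
      case True
      then show ?thesis using f'2[OF \<eta>] y(4) unfolding \<alpha>' by (simp add: \<alpha>_def mult.commute)
    next
      case False
      define r where "r = real k"
      have r: "r > 0" using False by (simp add: r_def)
      define AA where "AA = (\<lambda>i s. riem_dist A g (tpath x (e0 i) s) (tpath y (\<alpha> *\<^sub>R f i) s))"
      define BB where "BB = (\<lambda>i s. riem_dist A g (tpath y (\<alpha> *\<^sub>R f i) s) (tpath z ((1 - real (Suc k) / real N) *\<^sub>R f' i) s))"
      define DD where "DD = (\<lambda>i s. riem_dist A g (tpath x (e0 i) s) (tpath z ((1 - real (Suc k) / real N) *\<^sub>R f' i) s))"
      define \<eta>1 \<eta>2 where "\<eta>1 = \<eta> / (2 * (1 + 1 / r))" and "\<eta>2 = \<eta> / (2 * (1 + r))"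
      have p: "1 + 1 / r > 0" "1 + r > 0" using r by (auto simp: add_pos_pos)
      have \<eta>12: "\<eta>1 > 0" "\<eta>2 > 0" "(1 + 1 / r) * \<eta>1 = \<eta> / 2" "(1 + r) * \<eta>2 = \<eta> / 2"
        using \<eta> p by (simp_all add: \<eta>1_def \<eta>2_def del: distrib_left_numeral)
      obtain \<delta>1 where \<delta>1: "\<delta>1 > 0" "\<And>s. \<bar>s\<bar> < \<delta>1 \<Longrightarrow> (\<Sum>i\<in>UNIV. (AA i s)\<^sup>2 + (AA i (- s))\<^sup>2) \<le> r\<^sup>2 * h\<^sup>2 * X s + \<eta>1 * s\<^sup>2"
        using IH[OF \<eta>12(1)] unfolding AA_def \<alpha>_def r_def by blast
      obtain \<delta>2 where \<delta>2: "\<delta>2 > 0" "\<And>s. \<bar>s\<bar> < \<delta>2 \<Longrightarrow> (\<Sum>i\<in>UNIV. (BB i s)\<^sup>2 + (BB i (- s))\<^sup>2) \<le> X s * h\<^sup>2 + \<eta>2 * s\<^sup>2"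
        using f'2[OF \<eta>12(2)] unfolding BB_def \<alpha>' by blast
      have DB: "(DD i s)\<^sup>2 \<le> (1 + 1 / r) * (AA i s)\<^sup>2 + (1 + r) * (BB i s)\<^sup>2" for i s
      proof -
        have "DD i s \<le> AA i s + BB i s" unfolding AA_def BB_def DD_def by (rule riem_dist_triangle)
        then have "(DD i s)\<^sup>2 \<le> (AA i s + BB i s)\<^sup>2" by (intro power_mono) (auto simp: DD_def riem_dist_nonneg)
        then show ?thesis using square_sum_weighted[OF r, of "AA i s" "BB i s"] by linarith
      qed
      have "(\<Sum>i\<in>UNIV. (DD i s)\<^sup>2 + (DD i (- s))\<^sup>2) \<le> (real (Suc k))\<^sup>2 * h\<^sup>2 * X s + \<eta> * s\<^sup>2" if s: "\<bar>s\<bar> < min \<delta>1 \<delta>2" for s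
      proof -
        have "(\<Sum>i\<in>UNIV. (DD i s)\<^sup>2 + (DD i (- s))\<^sup>2) \<le> (\<Sum>i\<in>(UNIV::'m set). (1 + 1 / r) * ((AA i s)\<^sup>2 + (AA i (- s))\<^sup>2) + (1 + r) * ((BB i s)\<^sup>2 + (BB i (- s))\<^sup>2))"
        proof (rule sum_mono)
          fix i :: 'm
          show "(DD i s)\<^sup>2 + (DD i (- s))\<^sup>2 \<le> (1 + 1 / r) * ((AA i s)\<^sup>2 + (AA i (- s))\<^sup>2) + (1 + r) * ((BB i s)\<^sup>2 + (BB i (- s))\<^sup>2)"
            using DB[of i s] DB[of i "- s"] unfolding distrib_left by linarith
        qed
        also have "\<dots> = (1 + 1 / r) * (\<Sum>i\<in>UNIV. (AA i s)\<^sup>2 + (AA i (- s))\<^sup>2) + (1 + r) * (\<Sum>i\<in>UNIV. (BB i s)\<^sup>2 + (BB i (- s))\<^sup>2)"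
          by (subst sum.distrib) (simp only: sum_distrib_left)
        also have "\<dots> \<le> (1 + 1 / r) * (r\<^sup>2 * h\<^sup>2 * X s + \<eta>1 * s\<^sup>2) + (1 + r) * (X s * h\<^sup>2 + \<eta>2 * s\<^sup>2)"
          using \<delta>1(2)[of s] \<delta>2(2)[of s] s p by (intro add_mono mult_left_mono) auto
        also have "\<dots> = ((1 + 1 / r) * r\<^sup>2 + (1 + r)) * (h\<^sup>2 * X s) + ((1 + 1 / r) * \<eta>1 + (1 + r) * \<eta>2) * s\<^sup>2"
          by (simp only: algebra_simps)
        also have "\<dots> = (real (Suc k))\<^sup>2 * h\<^sup>2 * X s + \<eta> * s\<^sup>2"
        proof -
          have "(1 + 1 / r) * r\<^sup>2 + (1 + r) = (real (Suc k))\<^sup>2"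
            using r by (simp add: r_def[symmetric] power2_eq_square field_simps)
          then show ?thesis unfolding \<eta>12(3,4) by simp
        qed
        finally show ?thesis .
      qed
      then show ?thesis using \<delta>1(1) \<delta>2(1) unfolding DD_def by (intro exI[of _ "min \<delta>1 \<delta>2"]) auto
    qed
    show ?case using g1 d1 d2 sums by (intro exI[of _ z] exI[of _ f']) blast
  qed
  \<comment> \<open>At \<open>k = N\<close> the weight is 0 and the far end, which is now
    \<open>p\<close>, does not move.\<close>
  obtain y f where y: "riem_dist A g y p = L - real N * h"
    and fin: "\<exists>\<delta>>0. \<forall>s. \<bar>s\<bar> < \<delta> \<longrightarrow> (\<Sum>i\<in>UNIV. (riem_dist A g (tpath x (e0 i) s) (tpath y ((1 - real N / real N) *\<^sub>R f i) s))\<^sup>2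
        + (riem_dist A g (tpath x (e0 i) (- s)) (tpath y ((1 - real N / real N) *\<^sub>R f i) (- s)))\<^sup>2) \<le> (real N)\<^sup>2 * h\<^sup>2 * X s + \<eta> * s\<^sup>2"
    using claim[of N] \<eta> by blast
  have yp: "y = p" using y h(3) dist.zero by simp
  have N1: "1 - real N / real N = 0" using N(1) by simp
  have hN: "(real N)\<^sup>2 * h\<^sup>2 = L\<^sup>2" using h(3) by (metis power_mult_distrib)
  have Qe: "Q = real CARD('m) / L\<^sup>2 + Kr + \<epsilon>" by (simp add: Q_def power_divide)
  show ?thesis using fin unfolding N1 yp scaleR_zero_left tpath_zero hN X_def Qe .
qed

text \<open>For positive \<open>L\<close> the factor L^2 cancels the denominator of dim / L^2 and
  leaves 2 dim. At \<open>L = 0\<close> the moved points are within 2 |s| of \<open>p\<close>, so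
  the squares sum to at most 8 dim s^2; the constant 8 covers both cases.\<close>

lemma dist_square_variation:
  fixes e0 :: "'m \<Rightarrow> real ^ 'm" and x p :: 'a
  assumes comp: "dist.mcomplete" and Kr: "Kr \<ge> 0" and ric: "\<And>c x v. c \<in> A \<Longrightarrow> x \<in> chart_range c \<Longrightarrow> ricci (g c) x v v \<ge> - Kr * metric_ip (g c) x v v"
    and e0: "gram_close x e0 0"
  defines "L \<equiv> riem_dist A g x p"
  shows "\<exists>\<delta>>0. \<forall>s. \<bar>s\<bar> < \<delta> \<longrightarrow> (\<Sum>i\<in>UNIV. (riem_dist A g (tpath x (e0 i) s) p)\<^sup>2 + (riem_dist A g (tpath x (e0 i) (- s)) p)\<^sup>2)
     \<le> 2 * real CARD('m) * L\<^sup>2 + s\<^sup>2 * (8 * real CARD('m) + 2 * L\<^sup>2 * (Kr + 1))"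
proof (cases "L = 0")
  case True
  then have xp: "x = p" unfolding L_def using dist.zero by simp
  have n1: "metric_norm (g (chart_at A x)) (snd (chart_at A x) x) (e0 i) = 1" for i
  proof -
    have "\<bar>tangent_ip x (e0 i) (e0 i) - 1\<bar> \<le> 0" using e0 unfolding gram_close_def by metis
    then show ?thesis by (simp add: metric_norm_def tangent_ip_def)
  qed
  have "\<exists>\<delta>>0. \<forall>s. \<bar>s\<bar> < \<delta> \<longrightarrow> riem_dist A g x (tpath x (e0 i) s) \<le> 2 * \<bar>s\<bar>" for i
    using cpath_dist[OF chart_at[of x] zero_less_one, of "e0 i"] unfolding n1 tpath_def by simp
  from uniform_radius[of "\<lambda>i s. riem_dist A g x (tpath x (e0 i) s) \<le> 2 * \<bar>s\<bar>", OF this]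
  obtain \<delta> where \<delta>: "\<delta> > 0" "\<And>i s. \<bar>s\<bar> < \<delta> \<Longrightarrow> riem_dist A g x (tpath x (e0 i) s) \<le> 2 * \<bar>s\<bar>" by blast
  have "(\<Sum>i\<in>UNIV. (riem_dist A g (tpath x (e0 i) s) p)\<^sup>2 + (riem_dist A g (tpath x (e0 i) (- s)) p)\<^sup>2) \<le> s\<^sup>2 * (8 * real CARD('m))" if s: "\<bar>s\<bar> < \<delta>" for s
  proof -
    have sq: "(riem_dist A g (tpath x (e0 i) q) p)\<^sup>2 \<le> 4 * s\<^sup>2" if "\<bar>q\<bar> = \<bar>s\<bar>" for i q
    proof -
      have "riem_dist A g (tpath x (e0 i) q) p \<le> 2 * \<bar>s\<bar>" using \<delta>(2)[of q i] that s riem_dist_sym xp by simp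
      then have "(riem_dist A g (tpath x (e0 i) q) p)\<^sup>2 \<le> (2 * \<bar>s\<bar>)\<^sup>2" by (rule power_mono) (rule riem_dist_nonneg)
      then show ?thesis by (simp add: power_mult_distrib)
    qed
    have "(\<Sum>i\<in>UNIV. (riem_dist A g (tpath x (e0 i) s) p)\<^sup>2 + (riem_dist A g (tpath x (e0 i) (- s)) p)\<^sup>2) \<le> (\<Sum>i\<in>(UNIV::'m set). 8 * s\<^sup>2)"
    proof (rule sum_mono)
      fix i :: 'm
      show "(riem_dist A g (tpath x (e0 i) s) p)\<^sup>2 + (riem_dist A g (tpath x (e0 i) (- s)) p)\<^sup>2 \<le> 8 * s\<^sup>2"
        using sq[of s i] sq[of "- s" i] by simp
    qed
    then show ?thesis by (simp add: mult_ac)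
  qed
  then show ?thesis using \<delta>(1) True by (intro exI[of _ \<delta>]) simp
next
  case False
  then have L0: "L > 0" unfolding L_def using riem_dist_nonneg[of x p] by simp
  then have "L\<^sup>2 > 0" by simp
  \<comment> \<open>The errors 1/2 and \<open>L\<^sup>2\<close> together produce the summand 1 in
    \<open>Kr + 1\<close>.\<close>
  have "(1 / 2 :: real) > 0" by simp
  from chain_estimate[OF comp Kr ric meta_eq_to_obj_eq[OF L_def] L0 this e0 \<open>L\<^sup>2 > 0\<close>]
  obtain \<delta> where \<delta>: "\<delta> > 0" "\<And>s. \<bar>s\<bar> < \<delta> \<Longrightarrow> (\<Sum>i\<in>UNIV. (riem_dist A g (tpath x (e0 i) s) p)\<^sup>2 + (riem_dist A g (tpath x (e0 i) (- s)) p)\<^sup>2)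
     \<le> L\<^sup>2 * (2 * real CARD('m) + 2 * s\<^sup>2 * (real CARD('m) / L\<^sup>2 + Kr + 1 / 2)) + L\<^sup>2 * s\<^sup>2" by blast
  have "L\<^sup>2 * (2 * real CARD('m) + 2 * s\<^sup>2 * (real CARD('m) / L\<^sup>2 + Kr + 1 / 2)) + L\<^sup>2 * s\<^sup>2
     \<le> 2 * real CARD('m) * L\<^sup>2 + s\<^sup>2 * (8 * real CARD('m) + 2 * L\<^sup>2 * (Kr + 1))" for s
  proof -
    have "L\<^sup>2 * (2 * real CARD('m) + 2 * s\<^sup>2 * (real CARD('m) / L\<^sup>2 + Kr + 1 / 2)) + L\<^sup>2 * s\<^sup>2
      = 2 * real CARD('m) * L\<^sup>2 + s\<^sup>2 * (2 * (L\<^sup>2 * (real CARD('m) / L\<^sup>2)) + 2 * L\<^sup>2 * (Kr + 1))"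
      by (simp add: algebra_simps)
    also have "L\<^sup>2 * (real CARD('m) / L\<^sup>2) = real CARD('m)" using L0 by simp
    also have "2 * real CARD('m) * L\<^sup>2 + s\<^sup>2 * (2 * real CARD('m) + 2 * L\<^sup>2 * (Kr + 1)) \<le> 2 * real CARD('m) * L\<^sup>2 + s\<^sup>2 * (8 * real CARD('m) + 2 * L\<^sup>2 * (Kr + 1))"
      by (intro add_left_mono mult_left_mono add_right_mono) auto
    finally show ?thesis .
  qed
  then show ?thesis using \<delta> order_trans by blast
qed

section \<open>Minimizers of the penalized function\<close>

lemma C2_fun_continuous:
  assumes "C2_fun A f" shows "continuous_on S f"
proof -
  have "isCont f p" for p
  proof -
    define c where "c = chart_at A p"
    have c: "c \<in> A" "p \<in> fst c" unfolding c_def by (rule chart_at)+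
    have "continuous_on (chart_range c) (coord_expr c f)"
      using assms c(1) Ck_on_imp_continuous_on unfolding C2_fun_def by blast
    then have "continuous_on (fst c) (\<lambda>q. coord_expr c f (snd c q))"
      by (rule continuous_on_compose2[OF _ continuous_on_chart[OF c(1)]]) auto
    then have "continuous_on (fst c) f"
      by (rule continuous_on_eq) (use c(1) in \<open>simp add: coord_expr_def chart_pt_def[symmetric]\<close>)
    then show ?thesis using continuous_on_eq_continuous_at[OF open_domain[OF c(1)]] c(2) by blast
  qed
  then show ?thesis by (simp add: continuous_at_imp_continuous_on)
qed

lemma tpath_taylor:
  fixes f :: "'a \<Rightarrow> real" and x :: 'a and e :: "real ^ 'm"
  assumes f: "C2_fun A f" and \<epsilon>: "\<epsilon> > 0"
  defines "c \<equiv> chart_at A x"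
  defines "h \<equiv> coord_expr c f" and "X \<equiv> snd c x"
  shows "\<exists>\<delta>>0. \<forall>s. \<bar>s\<bar> < \<delta> \<longrightarrow> \<bar>f (tpath x e s) - f x - s * frechet_derivative h (at X) e
     - (s\<^sup>2/2) * (frechet_derivative (\<lambda>y. frechet_derivative h (at y) e) (at X) e - frechet_derivative h (at X) (Gam (g c) X e e))\<bar> \<le> \<epsilon> * s\<^sup>2"
proof -
  have c: "c \<in> A" "x \<in> fst c" unfolding c_def by (rule chart_at)+
  interpret L: local_metric "chart_range c" "g c" by (rule local_metric_chart[OF c(1)])
  have X: "X \<in> chart_range c" using c by (auto simp: X_def)
  have C: "Ck_on 2 h (chart_range c)" using f c(1) unfolding C2_fun_def h_def by blast
  have fp: "f (tpath x e s) = h (L.gpath X e s)" for s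
    unfolding tpath_def c_def[symmetric] cpath_gpath[OF c(1)] h_def coord_expr_def X_def by (simp add: chart_pt_def)
  have fx: "f x = h X" unfolding h_def X_def coord_expr_def using c by (simp add: chart_pt_def[symmetric])
  show ?thesis unfolding fp fx using L.compose_gpath_taylor[OF L.open_U X C \<epsilon>, of e] by auto
qed

text \<open>Minimality, tested at \<open>s\<close> and \<open>- s\<close> along each frame vector,
  bounds the second difference of \<open>f\<close> from below by the negative of that of the
  penalty. Summed over the frame, the former is s^2 times the Laplacian up to small errors, and the
  latter is controlled by \<open>dist_square_variation\<close>.\<close>

lemma laplacian_at_minimum:
  assumes comp: "dist.mcomplete" and Kr: "Kr \<ge> 0" and ric: "\<And>c x v. c \<in> A \<Longrightarrow> x \<in> chart_range c \<Longrightarrow> ricci (g c) x v v \<ge> - Kr * metric_ip (g c) x v v"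
    and f: "C2_fun A f" and t: "t > 0"
    and min: "\<And>y. f x + (riem_dist A g x p)\<^sup>2 / (2 * t) \<le> f y + (riem_dist A g y p)\<^sup>2 / (2 * t)"
  shows "laplacian A g f x \<ge> - (8 * real CARD('m) + 2 * (riem_dist A g x p)\<^sup>2 * (Kr + 1)) / (2 * t)"
proof -
  define c where "c = chart_at A x"
  define h where "h = coord_expr c f"
  define X where "X = snd c x"
  define L where "L = riem_dist A g x p"
  define m where "m = real CARD('m)"
  have m: "m > 0" by (simp add: m_def)
  have c: "c \<in> A" "x \<in> fst c" unfolding c_def by (rule chart_at)+
  interpret L: local_metric "chart_range c" "g c" by (rule local_metric_chart[OF c(1)])
  have X: "X \<in> chart_range c" using c by (auto simp: X_def)
  have C: "Ck_on 2 h (chart_range c)" using f c(1) unfolding C2_fun_def h_def by blast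
  obtain e where e: "L.orthonormal X e" using L.orthonormal_exists[OF X] by blast
  have gc: "gram_close x e 0"
    using e unfolding gram_close_def L.orthonormal_def tangent_ip_def c_def[symmetric] X_def by simp
  define H where "H = (\<lambda>i. frechet_derivative (\<lambda>y. frechet_derivative h (at y) (e i)) (at X) (e i) - frechet_derivative h (at X) (Gam (g c) X (e i) (e i)))"
  have lap: "laplacian A g f x = (\<Sum>i\<in>UNIV. H i)"
    unfolding laplacian_def Let_def c_def[symmetric] h_def[symmetric] X_def[symmetric] H_def by (rule L.laplacian_orthonormal[OF X C e])
  define B where "B = 8 * m + 2 * L\<^sup>2 * (Kr + 1)"
  obtain \<delta>1 where \<delta>1: "\<delta>1 > 0" "\<And>s. \<bar>s\<bar> < \<delta>1 \<Longrightarrow> (\<Sum>i\<in>UNIV. (riem_dist A g (tpath x (e i) s) p)\<^sup>2 + (riem_dist A g (tpath x (e i) (- s)) p)\<^sup>2)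
     \<le> 2 * m * L\<^sup>2 + s\<^sup>2 * B"
    using dist_square_variation[OF comp Kr ric gc, of p] unfolding B_def L_def m_def by blast
  have "- B / (2 * t) \<le> laplacian A g f x"
  proof (rule field_le_epsilon)
    fix \<epsilon> :: real assume \<epsilon>: "\<epsilon> > 0"
    \<comment> \<open>Two Taylor errors in each of the \<open>m\<close> directions add up to
      \<epsilon> s^2.\<close>
    define \<epsilon>' where "\<epsilon>' = \<epsilon> / (2 * m)"
    have \<epsilon>': "\<epsilon>' > 0" using \<epsilon> m by (simp add: \<epsilon>'_def)
    have "\<exists>\<delta>>0. \<forall>s. \<bar>s\<bar> < \<delta> \<longrightarrow> \<bar>f (tpath x (e i) s) - f x - s * frechet_derivative h (at X) (e i) - (s\<^sup>2/2) * H i\<bar> \<le> \<epsilon>' * s\<^sup>2" for i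
      using tpath_taylor[OF f \<epsilon>', of x "e i"] unfolding H_def c_def h_def X_def .
    from uniform_radius[of "\<lambda>i s. \<bar>f (tpath x (e i) s) - f x - s * frechet_derivative h (at X) (e i) - (s\<^sup>2/2) * H i\<bar> \<le> \<epsilon>' * s\<^sup>2", OF this]
    obtain \<delta>2 where \<delta>2: "\<delta>2 > 0" "\<And>i s. \<bar>s\<bar> < \<delta>2 \<Longrightarrow> \<bar>f (tpath x (e i) s) - f x - s * frechet_derivative h (at X) (e i) - (s\<^sup>2/2) * H i\<bar> \<le> \<epsilon>' * s\<^sup>2" by blast
    define s where "s = min \<delta>1 \<delta>2 / 2"
    have s: "s > 0" "\<bar>s\<bar> < \<delta>1" "\<bar>s\<bar> < \<delta>2" "\<bar>- s\<bar> < \<delta>2" using \<delta>1(1) \<delta>2(1) by (auto simp: s_def)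
    have low: "f x - f (tpath x (e i) q) \<le> ((riem_dist A g (tpath x (e i) q) p)\<^sup>2 - L\<^sup>2) / (2 * t)" for i q
      using min[of "tpath x (e i) q"] by (simp add: L_def diff_divide_distrib)
    have each: "- (((riem_dist A g (tpath x (e i) s) p)\<^sup>2 + (riem_dist A g (tpath x (e i) (- s)) p)\<^sup>2 - 2 * L\<^sup>2) / (2 * t)) \<le> s\<^sup>2 * H i + 2 * \<epsilon>' * s\<^sup>2" for i
    proof -
      have "f (tpath x (e i) s) + f (tpath x (e i) (- s)) - 2 * f x \<le> s\<^sup>2 * H i + 2 * \<epsilon>' * s\<^sup>2"
        using \<delta>2(2)[OF s(3), of i] \<delta>2(2)[OF s(4), of i] by (simp add: abs_le_iff)
      moreover have "((riem_dist A g (tpath x (e i) s) p)\<^sup>2 + (riem_dist A g (tpath x (e i) (- s)) p)\<^sup>2 - 2 * L\<^sup>2) / (2 * t)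
        = ((riem_dist A g (tpath x (e i) s) p)\<^sup>2 - L\<^sup>2) / (2 * t) + ((riem_dist A g (tpath x (e i) (- s)) p)\<^sup>2 - L\<^sup>2) / (2 * t)"
        by (simp add: add_divide_distrib diff_divide_distrib)
      ultimately show ?thesis using low[of i s] low[of i "- s"] by linarith
    qed
    have "(\<Sum>i\<in>(UNIV::'m set). - (((riem_dist A g (tpath x (e i) s) p)\<^sup>2 + (riem_dist A g (tpath x (e i) (- s)) p)\<^sup>2 - 2 * L\<^sup>2) / (2 * t))) \<le> (\<Sum>i\<in>(UNIV::'m set). s\<^sup>2 * H i + 2 * \<epsilon>' * s\<^sup>2)"
      by (rule sum_mono) (rule each)
    also have "(\<Sum>i\<in>(UNIV::'m set). s\<^sup>2 * H i + 2 * \<epsilon>' * s\<^sup>2) = s\<^sup>2 * (laplacian A g f x + \<epsilon>)"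
    proof -
      have "m * (2 * \<epsilon>') = \<epsilon>" using m by (simp add: \<epsilon>'_def)
      have "(\<Sum>i\<in>(UNIV::'m set). s\<^sup>2 * H i + 2 * \<epsilon>' * s\<^sup>2) = s\<^sup>2 * (\<Sum>i\<in>UNIV. H i) + (m * (2 * \<epsilon>')) * s\<^sup>2"
        by (simp add: sum.distrib sum_distrib_left m_def)
      then show ?thesis unfolding \<open>m * (2 * \<epsilon>') = \<epsilon>\<close> lap by (simp add: algebra_simps)
    qed
    also have "(\<Sum>i\<in>(UNIV::'m set). - (((riem_dist A g (tpath x (e i) s) p)\<^sup>2 + (riem_dist A g (tpath x (e i) (- s)) p)\<^sup>2 - 2 * L\<^sup>2) / (2 * t)))
      = - (((\<Sum>i\<in>UNIV. (riem_dist A g (tpath x (e i) s) p)\<^sup>2 + (riem_dist A g (tpath x (e i) (- s)) p)\<^sup>2) - 2 * m * L\<^sup>2) / (2 * t))"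
      by (simp add: sum_negf sum_divide_distrib[symmetric] sum_subtractf m_def)
    finally have 1: "- (((\<Sum>i\<in>UNIV. (riem_dist A g (tpath x (e i) s) p)\<^sup>2 + (riem_dist A g (tpath x (e i) (- s)) p)\<^sup>2) - 2 * m * L\<^sup>2) / (2 * t)) \<le> s\<^sup>2 * (laplacian A g f x + \<epsilon>)" .
    have "((\<Sum>i\<in>UNIV. (riem_dist A g (tpath x (e i) s) p)\<^sup>2 + (riem_dist A g (tpath x (e i) (- s)) p)\<^sup>2) - 2 * m * L\<^sup>2) / (2 * t) \<le> s\<^sup>2 * B / (2 * t)"
      using \<delta>1(2)[OF s(2)] t by (intro divide_right_mono) auto
    with 1 have "s\<^sup>2 * (- B / (2 * t)) \<le> s\<^sup>2 * (laplacian A g f x + \<epsilon>)" by simp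
    then show "- B / (2 * t) \<le> laplacian A g f x + \<epsilon>" using s(1) by (simp only: mult_le_cancel_left_pos zero_less_power)
  qed
  then show ?thesis unfolding B_def L_def m_def .
qed

text \<open>Moving against the gradient for a short parameter \<open>s\<close> lowers
  \<open>f\<close> by about s n^2, with \<open>n\<close> its norm, while by the triangle inequality
  the penalty grows by at most about s L n / t. Comparison of the first order terms gives the
  bound.\<close>

lemma grad_at_minimum:
  assumes f: "C2_fun A f" and t: "t > 0"
    and min: "\<And>y. f x + (riem_dist A g x p)\<^sup>2 / (2 * t) \<le> f y + (riem_dist A g y p)\<^sup>2 / (2 * t)"
  shows "0 \<le> grad_norm A g f x" "grad_norm A g f x \<le> riem_dist A g x p / t"
proof -
  define c where "c = chart_at A x"
  define h where "h = coord_expr c f"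
  define X where "X = snd c x"
  define L where "L = riem_dist A g x p"
  have L0: "L \<ge> 0" by (simp add: L_def riem_dist_nonneg)
  have c: "c \<in> A" "x \<in> fst c" unfolding c_def by (rule chart_at)+
  interpret L: local_metric "chart_range c" "g c" by (rule local_metric_chart[OF c(1)])
  have X: "X \<in> chart_range c" using c by (auto simp: X_def)
  have C: "Ck_on 2 h (chart_range c)" using f c(1) unfolding C2_fun_def h_def by blast
  define v where "v = coord_grad (g c) h X"
  define n where "n = metric_norm (g c) X v"
  have gn: "grad_norm A g f x = n"
    unfolding grad_norm_def Let_def n_def v_def c_def h_def X_def ..
  have n: "n \<ge> 0" unfolding n_def by (rule L.metric_norm_nonneg[OF X])
  then show "0 \<le> grad_norm A g f x" by (simp add: gn)
  have "Ck_on (Suc (Suc 0)) h (chart_range c)" using C by (simp only: numeral_2_eq_2)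
  then have hd: "h differentiable (at X)" using X unfolding Ck_on.simps by blast
  have Dv: "frechet_derivative h (at X) (- v) = - n\<^sup>2"
    using L.ip_coord_grad[OF X hd, of "- v"] L.metric_norm_sq[OF X, of v] by (simp add: metric_ip_linear v_def n_def)
  have nv: "metric_norm (g c) X (- v) = n" unfolding n_def metric_norm_def by (simp add: metric_ip_linear)
  define H where "H = frechet_derivative (\<lambda>y. frechet_derivative h (at y) (- v)) (at X) (- v) - frechet_derivative h (at X) (Gam (g c) X (- v) (- v))"
  have key: "n\<^sup>2 \<le> L * (n + \<tau>) / t" if \<tau>: "\<tau> > 0" for \<tau>
  proof -
    obtain \<delta>1 where \<delta>1: "\<delta>1 > 0" "\<And>s. \<bar>s\<bar> < \<delta>1 \<Longrightarrow> \<bar>f (tpath x (- v) s) - f x - s * (- n\<^sup>2) - (s\<^sup>2/2) * H\<bar> \<le> 1 * s\<^sup>2"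
      using tpath_taylor[OF f zero_less_one, of x "- v"] Dv unfolding H_def c_def h_def X_def by metis
    obtain \<delta>2 where \<delta>2: "\<delta>2 > 0" "\<And>s. \<bar>s\<bar> < \<delta>2 \<Longrightarrow> riem_dist A g x (tpath x (- v) s) \<le> (n + \<tau>) * \<bar>s\<bar>"
      using cpath_dist[OF c \<tau>, of "- v"] nv unfolding X_def tpath_def c_def by metis
    \<comment> \<open>Collects the terms of order s^2: the Hessian, the Taylor remainder and the
      square in the penalty.\<close>
    define K where "K = \<bar>H\<bar> / 2 + 1 + (n + \<tau>)\<^sup>2 / (2 * t)"
    have K: "K > 0" unfolding K_def using t by (intro add_nonneg_pos add_pos_nonneg) auto
    have "n\<^sup>2 \<le> L * (n + \<tau>) / t + e" if e: "e > 0" for e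
    proof -
      define s where "s = min (min \<delta>1 \<delta>2 / 2) (e / K)"
      have s: "s > 0" "\<bar>s\<bar> < \<delta>1" "\<bar>s\<bar> < \<delta>2" "s * K \<le> e"
      proof -
        have eK: "e / K > 0" using e K by simp
        then show "s > 0" "\<bar>s\<bar> < \<delta>1" "\<bar>s\<bar> < \<delta>2" using \<delta>1(1) \<delta>2(1) unfolding s_def by linarith+
        have "s \<le> e / K" unfolding s_def by simp
        then show "s * K \<le> e" using K by (simp add: pos_le_divide_eq)
      qed
      define D where "D = riem_dist A g (tpath x (- v) s) p"
      have "D \<le> L + (n + \<tau>) * s"
        using riem_dist_triangle[of "tpath x (- v) s" p x] riem_dist_sym[of x "tpath x (- v) s"] \<delta>2(2)[OF s(3)] s(1) by (simp add: D_def L_def)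
      then have "D\<^sup>2 \<le> (L + (n + \<tau>) * s)\<^sup>2" by (intro power_mono) (simp_all add: D_def riem_dist_nonneg)
      then have D2: "(D\<^sup>2 - L\<^sup>2) / (2 * t) \<le> (2 * L * (n + \<tau>) * s + (n + \<tau>)\<^sup>2 * s\<^sup>2) / (2 * t)"
        using t by (intro divide_right_mono) (simp_all add: power2_eq_square algebra_simps)
      have up: "f (tpath x (- v) s) \<le> f x - s * n\<^sup>2 + (s\<^sup>2/2) * H + s\<^sup>2" using \<delta>1(2)[OF s(2)] by (simp add: abs_le_iff)
      have lo: "f x - f (tpath x (- v) s) \<le> (D\<^sup>2 - L\<^sup>2) / (2 * t)" using min[of "tpath x (- v) s"] by (simp add: D_def L_def diff_divide_distrib)
      have HH: "(s\<^sup>2/2) * H \<le> s\<^sup>2 * (\<bar>H\<bar> / 2)" using mult_left_mono[of H "\<bar>H\<bar>" "s\<^sup>2/2"] by simp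
      have "s * n\<^sup>2 \<le> (2 * L * (n + \<tau>) * s + (n + \<tau>)\<^sup>2 * s\<^sup>2) / (2 * t) + s\<^sup>2 * (\<bar>H\<bar> / 2) + s\<^sup>2"
        using up lo D2 HH by linarith
      also have "\<dots> = s * (L * (n + \<tau>) / t + s * K)"
        using t by (simp add: K_def power2_eq_square field_simps)
      finally have "n\<^sup>2 \<le> L * (n + \<tau>) / t + s * K" using s(1) by simp
      then show ?thesis using s(4) by linarith
    qed
    then show ?thesis by (rule field_le_epsilon)
  qed
  have "n\<^sup>2 \<le> L * n / t"
  proof (rule field_le_epsilon)
    fix e :: real assume e: "e > 0"
    \<comment> \<open>\<open>L\<close> may be 0, hence the denominator \<open>L + 1\<close>.\<close>
    define \<tau> where "\<tau> = e * t / (L + 1)"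
    have \<tau>: "\<tau> > 0" using e t L0 by (simp add: \<tau>_def)
    have "L * \<tau> / t = (L / (L + 1)) * e" using t by (simp add: \<tau>_def)
    also have "\<dots> \<le> 1 * e" using L0 e by (intro mult_right_mono) auto
    finally have "L * (n + \<tau>) / t \<le> L * n / t + e" by (simp add: distrib_left add_divide_distrib)
    then show "n\<^sup>2 \<le> L * n / t + e" using key[OF \<tau>] by linarith
  qed
  then have "n * n \<le> n * (L / t)" by (simp add: power2_eq_square mult_ac)
  then have "n \<le> L / t" 
  proof (cases "n = 0")
    case True then show ?thesis using L0 t by simp
  next
    case False
    then have "n > 0" using n by simp
    with \<open>n * n \<le> n * (L / t)\<close> show ?thesis by (rule mult_left_le_imp_le)
  qed
  then show "grad_norm A g f x \<le> riem_dist A g x p / t" by (simp add: gn L_def)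
qed

text \<open>Compactness of one closed ball suffices: beyond radius \<open>R\<close> the penalty
  alone exceeds the gap between \<open>f p\<close> and the infimum, so no point there can do better
  than \<open>p\<close>.\<close>

lemma penalized_minimum:
  fixes f :: "'a \<Rightarrow> real"
  assumes comp: "dist.mcomplete" and f: "C2_fun A f" and bd: "bdd_below (range f)" and t: "t > 0"
  defines "m0 \<equiv> INF y. f y"
  shows "\<exists>x. (\<forall>y. f x + (riem_dist A g x p)\<^sup>2 / (2 * t) \<le> f y + (riem_dist A g y p)\<^sup>2 / (2 * t)) \<and>
     f x \<le> f p \<and> (riem_dist A g x p)\<^sup>2 \<le> 2 * t * (f p - m0)"
proof -
  have m0: "m0 \<le> f y" for y unfolding m0_def by (rule cINF_lower[OF bd]) simp
  define F where "F = (\<lambda>y. f y + (riem_dist A g y p)\<^sup>2 / (2 * t))"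
  define R where "R = sqrt (2 * t * (f p - m0))"
  have R: "R \<ge> 0" "R\<^sup>2 = 2 * t * (f p - m0)" unfolding R_def using t m0[of p] by simp_all
  have cF: "continuous_on (dist.mcball p R) F"
    unfolding F_def riem_dist_sym[of _ p] by (intro continuous_intros C2_fun_continuous[OF f] continuous_on_riem_dist) (use t in auto)
  have ne: "dist.mcball p R \<noteq> {}" using R dist.mcball_eq_empty by simp
  obtain x where x: "x \<in> dist.mcball p R" "\<And>y. y \<in> dist.mcball p R \<Longrightarrow> F x \<le> F y"
    using continuous_attains_inf[OF mcball_compact[OF comp] ne cF] by blast
  have Fp: "F p = f p" by (simp add: F_def riem_dist_zero)
  have xp: "F x \<le> F p" by (rule x(2)) (use R riem_dist_zero in simp)
  have all: "F x \<le> F y" for y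
  proof (cases "y \<in> dist.mcball p R")
    case False
    then have "R < riem_dist A g y p" using riem_dist_sym[of y p] by simp
    then have "R\<^sup>2 < (riem_dist A g y p)\<^sup>2" using R(1) by (intro power_strict_mono) auto
    then have "(2 * t * (f p - m0)) / (2 * t) < (riem_dist A g y p)\<^sup>2 / (2 * t)" unfolding R(2)[symmetric] using t by (intro divide_strict_right_mono) auto
    then have "f p - m0 < (riem_dist A g y p)\<^sup>2 / (2 * t)" using t by simp
    then have "F p < F y" using m0[of y] Fp by (simp add: F_def)
    then show ?thesis using xp by simp
  qed (rule x(2))
  have 1: "f x + (riem_dist A g x p)\<^sup>2 / (2 * t) \<le> f p" using xp Fp by (simp add: F_def)
  have "(riem_dist A g x p)\<^sup>2 / (2 * t) \<ge> 0" using t by simp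
  then have fx: "f x \<le> f p" using 1 by linarith
  have "(riem_dist A g x p)\<^sup>2 / (2 * t) \<le> f p - m0" using 1 m0[of x] by linarith
  then have "(riem_dist A g x p)\<^sup>2 \<le> 2 * t * (f p - m0)" using t by (simp add: pos_divide_le_eq mult.commute)
  then show ?thesis using all fx unfolding F_def by blast
qed

lemma good_shadow:
  assumes comp: "dist.mcomplete" and Kr: "Kr \<ge> 0" and ric: "\<And>c x v. c \<in> A \<Longrightarrow> x \<in> chart_range c \<Longrightarrow> ricci (g c) x v v \<ge> - Kr * metric_ip (g c) x v v"
    and f: "C2_fun A f" and bd: "bdd_below (range f)" and p: "minimizing_seq f p"
  shows "admits_good_shadow A g f p"
proof -
  define m0 where "m0 = (INF y. f y)"
  have m0: "m0 \<le> f y" for y unfolding m0_def by (rule cINF_lower[OF bd]) simp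
  have pl: "(\<lambda>n. f (p n)) \<longlonglongrightarrow> m0" using p unfolding minimizing_seq_def m0_def .
  \<comment> \<open>The added 1 / Suc n keeps \<open>w\<close> positive where \<open>f (p n)\<close>
    already equals the infimum.\<close>
  define w where "w = (\<lambda>n. (f (p n) - m0) + 1 / real (Suc n))"
  have w: "w n > 0" for n unfolding w_def using m0[of "p n"] by (intro add_nonneg_pos) auto
  have w0: "w \<longlonglongrightarrow> 0"
  proof -
    have "(\<lambda>n. (f (p n) - m0) + inverse (real (Suc n))) \<longlonglongrightarrow> (m0 - m0) + 0"
      by (intro tendsto_intros pl LIMSEQ_inverse_real_of_nat)
    then show ?thesis by (simp add: w_def inverse_eq_divide)
  qed
  \<comment> \<open>Then \<open>t n\<close> tends to infinity, while its product with the gap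
    \<open>f (p n) - m0\<close> is at most \<open>sqrt (w n)\<close> and tends to 0.\<close>
  define t where "t = (\<lambda>n. 1 / sqrt (w n))"
  have t: "t n > 0" for n using w by (simp add: t_def)
  have ti: "1 / t n = sqrt (w n)" for n by (simp add: t_def)
  have sw: "(\<lambda>n. sqrt (w n)) \<longlonglongrightarrow> 0" using tendsto_real_sqrt[OF w0] by simp
  obtain q where q: "\<And>n y. f (q n) + (riem_dist A g (q n) (p n))\<^sup>2 / (2 * t n) \<le> f y + (riem_dist A g y (p n))\<^sup>2 / (2 * t n)"
    "\<And>n. f (q n) \<le> f (p n)" "\<And>n. (riem_dist A g (q n) (p n))\<^sup>2 \<le> 2 * t n * (f (p n) - m0)"
    proof -
    have "\<forall>n. \<exists>x. (\<forall>y. f x + (riem_dist A g x (p n))\<^sup>2 / (2 * t n) \<le> f y + (riem_dist A g y (p n))\<^sup>2 / (2 * t n)) \<and>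
      f x \<le> f (p n) \<and> (riem_dist A g x (p n))\<^sup>2 \<le> 2 * t n * (f (p n) - m0)"
      unfolding m0_def by (intro allI penalized_minimum[OF comp f bd t])
    from choice[OF this] show ?thesis using that by auto
  qed
  define L where "L = (\<lambda>n. riem_dist A g (q n) (p n))"
  have L0: "L n \<ge> 0" for n by (simp add: L_def riem_dist_nonneg)
  have L2: "(L n)\<^sup>2 \<le> 2 * sqrt (w n)" for n
  proof -
    have "(L n)\<^sup>2 \<le> 2 * t n * (f (p n) - m0)" using q(3) by (simp add: L_def)
    also have "\<dots> \<le> 2 * t n * w n" using t[of n] by (intro mult_left_mono) (auto simp: w_def)
    also have "2 * t n * w n = 2 * sqrt (w n)" using w[of n] real_div_sqrt[of "w n"] by (simp add: t_def)
    finally show ?thesis .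
  qed
  have Ll: "L \<longlonglongrightarrow> 0"
  proof -
    have sq: "(\<lambda>n. 2 * sqrt (w n)) \<longlonglongrightarrow> 0" using tendsto_mult_left[OF sw, of 2] by simp
    have "(\<lambda>n. (L n)\<^sup>2) \<longlonglongrightarrow> 0"
      by (rule tendsto_sandwich[OF _ _ tendsto_const sq]) (use L2 in auto)
    from tendsto_real_sqrt[OF this] show ?thesis using L0 by simp
  qed
  have 1: "minimizing_seq f q"
    unfolding minimizing_seq_def m0_def[symmetric]
    by (rule tendsto_sandwich[OF _ _ tendsto_const pl]) (use m0 q(2) in auto)
  have 2: "(\<lambda>n. riem_dist A g (p n) (q n)) \<longlonglongrightarrow> 0"
    using Ll unfolding L_def riem_dist_sym[of "q _"] .
  have 3: "(\<lambda>n. grad_norm A g f (q n)) \<longlonglongrightarrow> 0"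
  proof (rule tendsto_sandwich[OF _ _ tendsto_const])
    show "(\<lambda>n. L n * sqrt (w n)) \<longlonglongrightarrow> 0" using tendsto_mult[OF Ll sw] by simp
    have "grad_norm A g f (q n) \<le> L n * sqrt (w n)" for n
      using grad_at_minimum(2)[OF f t q(1), of n] ti[of n] unfolding L_def by (simp add: divide_inverse)
    then show "\<forall>\<^sub>F n in sequentially. grad_norm A g f (q n) \<le> L n * sqrt (w n)" by simp
    show "\<forall>\<^sub>F n in sequentially. 0 \<le> grad_norm A g f (q n)" using grad_at_minimum(1)[OF f t q(1)] by simp
  qed
  define b where "b = (\<lambda>n. - (8 * real CARD('m) + 2 * (L n)\<^sup>2 * (Kr + 1)) * sqrt (w n) / 2)"
  have bl: "b \<longlonglongrightarrow> 0"
  proof -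
    have "b \<longlonglongrightarrow> - (8 * real CARD('m) + 2 * 0\<^sup>2 * (Kr + 1)) * 0 / 2"
      unfolding b_def by (intro tendsto_intros Ll sw) simp
    then show ?thesis by simp
  qed
  have lb: "b n \<le> laplacian A g f (q n)" for n
  proof -
    have "- (8 * real CARD('m) + 2 * (L n)\<^sup>2 * (Kr + 1)) / (2 * t n) = b n"
      using ti[of n] by (simp add: b_def t_def)
    then show ?thesis using laplacian_at_minimum[OF comp Kr ric f t q(1), of n] unfolding L_def by simp
  qed
  have "(0::ereal) = liminf (\<lambda>n. ereal (b n))"
    using lim_imp_Liminf[OF sequentially_bot tendsto_ereal[OF bl]] by (simp add: zero_ereal_def)
  also have "\<dots> \<le> liminf (\<lambda>n. ereal (laplacian A g f (q n)))"
    by (rule Liminf_mono) (use lb in simp)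
  finally have 4: "liminf (\<lambda>n. ereal (laplacian A g f (q n))) \<ge> 0" .
  show ?thesis unfolding admits_good_shadow_def using 1 2 3 4 by blast
qed

end

theorem theorem1p3:
  fixes A :: "('a::{t2_space, second_countable_topology}, 'm::finite) chart set"
    and g :: "('a, 'm) chart \<Rightarrow> 'm coord_metric"
    and f :: "'a \<Rightarrow> real"
  assumes "complete_riemannian_manifold A g"
    and "ricci_bounded_below A g"
    and "C2_fun A f"
    and "bdd_below (range f)"
    and "bdd_above (range (hess_norm A g f))"
  shows "\<forall>p. minimizing_seq f p \<longrightarrow> admits_good_shadow A g f p"
proof -
  interpret riemannian_manifold A g
    using assms(1) unfolding complete_riemannian_manifold_def by blast
  have comp: "dist.mcomplete" using assms(1) unfolding complete_riemannian_manifold_def by blast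
  obtain K where K: "\<And>c x v. c \<in> A \<Longrightarrow> x \<in> chart_range c \<Longrightarrow> ricci (g c) x v v \<ge> K * metric_ip (g c) x v v"
    using assms(2) unfolding ricci_bounded_below_def by blast
  \<comment> \<open>A lower Ricci bound remains valid when decreased; the estimates above are stated
    for a nonnegative constant.\<close>
  define Kr where "Kr = max 0 (- K)"
  have "ricci (g c) x v v \<ge> - Kr * metric_ip (g c) x v v" if c: "c \<in> A" "x \<in> chart_range c" for c x v
  proof -
    interpret L: local_metric "chart_range c" "g c" by (rule local_metric_chart[OF c(1)])
    have "- Kr * metric_ip (g c) x v v \<le> K * metric_ip (g c) x v v"
      using L.ip_nonneg[OF c(2)] by (intro mult_right_mono) (auto simp: Kr_def)
    then show ?thesis using K[OF c, of v] by linarith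
  qed
  from good_shadow[OF comp _ this assms(3,4)] show ?thesis by (simp add: Kr_def)
qed

end
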